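(* Fix $p\in(0,1)$ and a connected graph $H$ with $v(H)$ vertices. Let $X_H$ denote the number of subgraphs of $G\sim\mathbb{G}(n,p)$ that are isomorphic to $H$. Then \[ \max_{x\in\mathbb{Z}}\Pr(X_H=x)=n^{1-v(H)+o(1)}, \] where $o(1)$ denotes a quantity tending to $0$ as $n\to\infty$ (with $p$ and $H$ fixed).
   Context: $\mathbb{G}(n,p)$ is the binomial random graph on a fixed set of $n$ vertices, where each of the $\binom{n}{2}$ possible edges is included independently with probability $p$. *)

theory Defs
  imports
    "HOL-Probability.Probability"
    "Graph_Theory.Pair_Digraph"
    "Graph_Theory.Digraph_Isomorphism"
begin

text \<open>
  A finite simple graph is a \<^locale>\<open>pair_graph\<close>: a finite, loop-free, symmetric digraph, in which
  an undirected edge between u and v is represented by the two arcs (u, v) and (v, u).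
\<close>

text \<open>The independent coin flips are indexed by undirected edges, so (u, v) and (v, u) share one.
  Singletons are not in the index set and get the default value \<^const>\<open>False\<close>: there are no loops.\<close>

definition binomial_random_graph :: "nat \<Rightarrow> real \<Rightarrow> nat pair_pre_digraph pmf" where
  "binomial_random_graph n p =
     map_pmf (\<lambda>f. \<lparr>pverts = {..<n}, parcs = {(u, v). f {u, v}}\<rparr>)
       (Pi_pmf {e. e \<subseteq> {..<n} \<and> card e = 2} False (\<lambda>_. bernoulli_pmf p))"

text \<open>Subgraphs are not necessarily induced or spanning, and they are counted as pairs of a vertex
  set and an arc set (not as embeddings of H). Every member of the set is symmetric if H is,
  so only undirected subgraphs are counted.\<close>

definition subgraph_count :: "'a pair_pre_digraph \<Rightarrow> 'b pair_pre_digraph \<Rightarrow> nat" where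
  "subgraph_count H G =
     card {H' :: 'b pair_pre_digraph.
       subgraph (with_proj H') (with_proj G) \<and> digraph_iso (with_proj H) (with_proj H')}"

lemma pair_graph_binomial_random_graph:
  assumes "G \<in> set_pmf (binomial_random_graph n p)"
  shows "pair_graph G" "pverts G = {..<n}"
proof -
  let ?E = "{e. e \<subseteq> {..<n} \<and> card e = 2}"
  have "finite ?E"
    by (rule finite_subset[of _ "Pow {..<n}"]) auto
  then have E: "set_pmf (Pi_pmf ?E False (\<lambda>_. bernoulli_pmf p)) \<subseteq> {f. \<forall>e. e \<notin> ?E \<longrightarrow> f e = False}"
    by (rule set_Pi_pmf_subset)
  from assms obtain f where G: "G = \<lparr>pverts = {..<n}, parcs = {(u, v). f {u, v}}\<rparr>"
    and "f \<in> set_pmf (Pi_pmf ?E False (\<lambda>_. bernoulli_pmf p))"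
    unfolding binomial_random_graph_def set_map_pmf by (rule imageE)
  then have f: "e \<in> ?E" if "f e" for e
    using subsetD[OF E, of f] that by (metis (no_types, lifting) mem_Collect_eq)
  have arc: "u < n \<and> v < n \<and> u \<noteq> v" if "f {u, v}" for u v
  proof -
    have "{u, v} \<in> ?E"
      using that by (rule f)
    then show ?thesis
      by (cases "u = v") simp_all
  qed
  have "{(u, v). f {u, v}} \<subseteq> {..<n} \<times> {..<n}"
    by (clarify, drule arc) simp
  then have fin: "finite {(u, v). f {u, v}}"
    by (rule finite_subset) simp
  have sym: "f {v, u}" if "f {u, v}" for u v
    using that by (simp add: insert_commute)
  show "pair_graph G"
  proof (unfold_locales, goal_cases)
    case (1 e)
    then show ?case using arc[of "fst e" "snd e"] by (simp add: G split_beta)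
  next
    case (2 e)
    then show ?case using arc[of "fst e" "snd e"] by (simp add: G split_beta)
  next
    case 3
    show ?case by (simp add: G)
  next
    case 4
    show ?case using fin by (simp add: G)
  next
    case (5 e)
    then show ?case using arc[of "fst e" "snd e"] by (simp add: G split_beta)
  next
    case 6
    show ?case by (simp add: symmetric_def G sym_def sym)
  qed
  show "pverts G = {..<n}"
    by (simp add: G)
qed

lemma finite_set_binomial_random_graph: "finite (set_pmf (binomial_random_graph n p))"
proof (rule finite_subset)
  show "set_pmf (binomial_random_graph n p)
      \<subseteq> (\<lambda>A. \<lparr>pverts = {..<n}, parcs = A\<rparr>) ` Pow ({..<n} \<times> {..<n})"
  proof
    fix G assume "G \<in> set_pmf (binomial_random_graph n p)"
    from pair_graph_binomial_random_graph[OF this]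
    interpret pair_graph G by simp
    have "parcs G \<subseteq> {..<n} \<times> {..<n}"
      using \<open>pverts G = {..<n}\<close> by (auto dest: in_arcsD1 in_arcsD2)
    moreover have "G = \<lparr>pverts = {..<n}, parcs = parcs G\<rparr>"
      using \<open>pverts G = {..<n}\<close> by simp
    ultimately show "G \<in> (\<lambda>A. \<lparr>pverts = {..<n}, parcs = A\<rparr>) ` Pow ({..<n} \<times> {..<n})"
      by blast
  qed
qed auto

text \<open>Hence the maximum over all integers is a genuine one (\<^const>\<open>Max\<close> of an infinite set is
  unspecified).\<close>

lemma finite_range_point_probs:
  "finite (range (\<lambda>x :: int.
     measure_pmf.prob (binomial_random_graph n p) {G. int (subgraph_count H G) = x}))"
proof (rule finite_subset)
  let ?M = "binomial_random_graph n p"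
  let ?P = "\<lambda>x. measure_pmf.prob ?M {G. int (subgraph_count H G) = x}"
  show "range ?P \<subseteq> insert 0 (?P ` (\<lambda>G. int (subgraph_count H G)) ` set_pmf ?M)"
  proof
    fix y assume "y \<in> range ?P"
    then obtain x where y: "y = ?P x" by blast
    show "y \<in> insert 0 (?P ` (\<lambda>G. int (subgraph_count H G)) ` set_pmf ?M)"
    proof (cases "x \<in> (\<lambda>G. int (subgraph_count H G)) ` set_pmf ?M")
      case True
      then show ?thesis unfolding y by blast
    next
      case False
      then have "?P x = 0"
        unfolding measure_pmf_zero_iff by blast
      then show ?thesis unfolding y by simp
    qed
  qed
  show "finite (insert 0 (?P ` (\<lambda>G. int (subgraph_count H G)) ` set_pmf ?M))"
    using finite_set_binomial_random_graph by blast
qed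

end

theory Submission
  imports Defs "HOL-Real_Asymp.Real_Asymp"
begin

text \<open>
  Write h for the number of vertices of H and Y for the number of embeddings of H, a constant multiple of
  the subgraph count. The lower bound is Chebyshev's inequality with Var Y = O(n^(2h-2)).

  For the upper bound, a smoothing inequality bounds point probabilities of Y by the concentration of Y
  on intervals of length about n^(h-2) and by the characteristic function at frequencies t
  between n^(-(h-2)+e) and n^(-e). Intervals of that length have probability O(1/n): Y is monotone and almost
  surely grows by at least their length with every added edge, so the sets with Y in such an interval are
  essentially an antichain, and the LYM inequality applies.

  The characteristic function is super-polynomially small. A connected H has an enumeration in which each of the
  first vertices is adjacent to an earlier one. Reserve m disjoint gadgets of r vertices each, playing the
  roles of the first r vertices of H, together with q vertex classes of size w for the next q roles.
  Repeated Cauchy-Schwarz (decoupling along the edges that join a role to its parent) leaves only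
  embeddings that use all these edges, so that conditionally Y becomes almost linear in the m independent
  edges joining the first two vertices of the gadgets, and its coefficients are independent across
  gadgets up to a small error. Hypercontractivity shows that every coefficient has the right order
  with positive probability, so the factors multiply to a tiny product. Varying r, q, m and w covers
  all frequencies.
\<close>

section \<open>Expectations over a random subset\<close>

text \<open>In Y every edge has a coefficient with a large deterministic main term, and at
  frequencies far above its reciprocal the phase modulo 2 pi is out of control. Decoupling removes
  that main term: the surviving coefficient of a gadget edge is a centred polynomial with standard
  deviation about w^(q/2) n^(h-r-q). The choice of w tunes this to at most about 1/|t|, where 1 -
  cos is comparable to a square and second and fourth moments suffice; m then has to be so large
  that m times the squared phase is a positive power of n.

  Embeddings that meet further gadgets spoil the independence. Relative to the others they number
  about m^(r-1)/n, so m stays below n^(1/(r-1)). For long trees m is therefore small and one class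
  (q = 1) cannot cover a unit interval of exponents of t, whereas two classes can. One class is used
  for r = 2, where m may be nearly n and the exponents just below h-2 have to be reached.

  The lowest frequencies are out of reach, as the characteristic function is near 1 at 0; the
  interval estimate takes their place. Losses of n^e at both ends are absorbed by the o(1).\<close>

locale bernoulli =
  fixes p :: real
  assumes p_pos: "0 < p" and p_less_1: "p < 1"
begin

text \<open>A weighted finite sum instead of an integral, so no integrability conditions arise;
  vector values let one definition serve probabilities and complex exponentials.\<close>

definition bexp :: "'a set \<Rightarrow> ('a set \<Rightarrow> 'b::real_vector) \<Rightarrow> 'b" where
  "bexp A F = (\<Sum>S\<in>Pow A. (p ^ card S * (1 - p) ^ card (A - S)) *\<^sub>R F S)"

lemma bexp_empty [simp]: "bexp {} F = F {}"
  by (simp add: bexp_def)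

lemma bexp_insert:
  assumes "finite A" "e \<notin> A"
  shows "bexp (insert e A) F = p *\<^sub>R bexp A (\<lambda>S. F (insert e S)) + (1 - p) *\<^sub>R bexp A F"
proof -
  have fin: "finite S" if "S \<in> Pow A" for S using that assms finite_subset by auto
  have inj: "inj_on (insert e) (Pow A)"
  proof (rule inj_onI)
    fix X Y assume "X \<in> Pow A" "Y \<in> Pow A" and eq: "insert e X = insert e Y"
    then have "e \<notin> X" "e \<notin> Y" using assms(2) by auto
    then show "X = Y" using eq by (simp add: insert_ident)
  qed
  have "bexp (insert e A) F
      = (\<Sum>S\<in>Pow A \<union> insert e ` Pow A. (p ^ card S * (1 - p) ^ card (insert e A - S)) *\<^sub>R F S)"
    by (simp add: bexp_def Pow_insert)
  also have "\<dots> = (\<Sum>S\<in>Pow A. (p ^ card S * (1 - p) ^ card (insert e A - S)) *\<^sub>R F S)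
      + (\<Sum>S\<in>Pow A. (p ^ card (insert e S) * (1 - p) ^ card (insert e A - insert e S)) *\<^sub>R F (insert e S))"
    using assms by (subst sum.union_disjoint) (auto simp: sum.reindex[OF inj])
  also have "(\<Sum>S\<in>Pow A. (p ^ card S * (1 - p) ^ card (insert e A - S)) *\<^sub>R F S) = (1 - p) *\<^sub>R bexp A F"
    unfolding bexp_def scaleR_sum_right
  proof (rule sum.cong)
    fix S assume S: "S \<in> Pow A"
    then have "insert e A - S = insert e (A - S)" using assms(2) by auto
    then have "card (insert e A - S) = Suc (card (A - S))" using assms by simp
    then show "(p ^ card S * (1 - p) ^ card (insert e A - S)) *\<^sub>R F S
        = (1 - p) *\<^sub>R (p ^ card S * (1 - p) ^ card (A - S)) *\<^sub>R F S" by (simp add: mult_ac)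
  qed simp
  also have "(\<Sum>S\<in>Pow A. (p ^ card (insert e S) * (1 - p) ^ card (insert e A - insert e S)) *\<^sub>R F (insert e S))
     = p *\<^sub>R bexp A (\<lambda>S. F (insert e S))"
    unfolding bexp_def scaleR_sum_right
  proof (rule sum.cong)
    fix S assume S: "S \<in> Pow A"
    then have "insert e A - insert e S = A - S" using assms(2) by auto
    moreover have "card (insert e S) = Suc (card S)"
      using S assms(2) fin[OF S] by (subst card_insert_disjoint) auto
    ultimately show "(p ^ card (insert e S) * (1 - p) ^ card (insert e A - insert e S)) *\<^sub>R F (insert e S)
        = p *\<^sub>R (p ^ card S * (1 - p) ^ card (A - S)) *\<^sub>R F (insert e S)"
      by (simp only: power_Suc scaleR_scaleR mult_ac)
  qed simp
  finally show ?thesis by simp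
qed

section \<open>Linearity, monotonicity and norm bounds\<close>

lemma bexp_cong: "(\<And>S. S \<subseteq> A \<Longrightarrow> F S = G S) \<Longrightarrow> bexp A F = bexp A G"
  unfolding bexp_def by (rule sum.cong) auto

lemma bexp_add: "bexp A (\<lambda>S. F S + G S) = bexp A F + bexp A G"
  by (simp add: bexp_def scaleR_add_right sum.distrib)

lemma bexp_diff: "bexp A (\<lambda>S. F S - G S) = bexp A F - bexp A G"
  by (simp add: bexp_def scaleR_diff_right sum_subtractf)

lemma bexp_scaleR: "bexp A (\<lambda>S. c *\<^sub>R F S) = c *\<^sub>R bexp A F"
  by (simp add: bexp_def scaleR_sum_right mult.commute)

lemma bexp_cmult: "bexp A (\<lambda>S. c * F S) = c * bexp A F" for c :: "'b::real_algebra"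
  by (simp add: bexp_def sum_distrib_left)

lemma bexp_multc: "bexp A (\<lambda>S. F S * c) = bexp A F * c" for c :: "'b::real_algebra"
  by (simp add: bexp_def sum_distrib_right)

lemma bexp_sum: "bexp A (\<lambda>S. \<Sum>i\<in>I. F i S) = (\<Sum>i\<in>I. bexp A (F i))"
  unfolding bexp_def scaleR_sum_right by (rule sum.swap)

lemma bexp_const [simp]: "finite A \<Longrightarrow> bexp A (\<lambda>_. c) = c"
  by (induction rule: finite_induct) (auto simp: bexp_insert scaleR_left_distrib[symmetric])

lemma bexp_weight_nonneg: "0 \<le> p ^ card S * (1 - p) ^ card (A - S)"
  using p_pos p_less_1 by simp

lemma bexp_mono:
  fixes F :: "'a set \<Rightarrow> real"
  shows "(\<And>S. S \<subseteq> A \<Longrightarrow> F S \<le> G S) \<Longrightarrow> bexp A F \<le> bexp A G"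
  unfolding bexp_def real_scaleR_def
  by (rule sum_mono) (rule mult_left_mono[OF _ bexp_weight_nonneg], simp)

lemma bexp_nonneg:
  fixes F :: "'a set \<Rightarrow> real"
  shows "(\<And>S. S \<subseteq> A \<Longrightarrow> 0 \<le> F S) \<Longrightarrow> 0 \<le> bexp A F"
  unfolding bexp_def real_scaleR_def
  by (rule sum_nonneg) (rule mult_nonneg_nonneg[OF bexp_weight_nonneg], simp)

lemma norm_bexp_le:
  fixes F :: "'a set \<Rightarrow> 'b::real_normed_vector"
  shows "norm (bexp A F) \<le> bexp A (\<lambda>S. norm (F S))"
  unfolding bexp_def by (rule order_trans[OF norm_sum])
    (auto intro!: sum_mono simp: bexp_weight_nonneg abs_mult p_pos p_less_1 less_imp_le)

lemma bexp_le_const: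
  fixes F :: "'a set \<Rightarrow> real"
  assumes "finite A" "\<And>S. S \<subseteq> A \<Longrightarrow> F S \<le> c"
  shows "bexp A F \<le> c"
  using bexp_mono[of A F "\<lambda>_. c"] assms by simp

section \<open>Conditioning and independence\<close>

lemma bexp_Un:
  assumes "finite A" "finite B" "A \<inter> B = {}"
  shows "bexp (A \<union> B) F = bexp A (\<lambda>S. bexp B (\<lambda>T. F (S \<union> T)))"
  using assms(1,3)
proof (induction arbitrary: F rule: finite_induct)
  case (insert e A)
  have "bexp (insert e A \<union> B) F = bexp (insert e (A \<union> B)) F" by simp
  also have "\<dots> = p *\<^sub>R bexp (A \<union> B) (\<lambda>S. F (insert e S)) + (1 - p) *\<^sub>R bexp (A \<union> B) F"
    using insert assms(2) by (intro bexp_insert) auto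
  also have "\<dots> = bexp (insert e A) (\<lambda>S. bexp B (\<lambda>T. F (S \<union> T)))"
    using insert by (simp add: bexp_insert)
  finally show ?case .
qed simp

text \<open>Dependence on the coordinates in \<open>A\<close> alone is expressed as invariance under
  intersection with \<open>A\<close>; the independence hypotheses below have the same form.\<close>

lemma bexp_restrict:
  assumes "finite B" "A \<subseteq> B" "\<And>S. S \<subseteq> B \<Longrightarrow> F S = F (S \<inter> A)"
  shows "bexp B F = bexp A F"
proof -
  have fin: "finite A" "finite (B - A)" using assms finite_subset by auto
  have "bexp B F = bexp (A \<union> (B - A)) F" using assms(2) by (simp add: Un_absorb1)
  also have "\<dots> = bexp A (\<lambda>S. bexp (B - A) (\<lambda>T. F (S \<union> T)))"
    using fin by (rule bexp_Un) auto
  also have "\<dots> = bexp A (\<lambda>S. bexp (B - A) (\<lambda>T. F S))"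
  proof (intro bexp_cong)
    fix S T assume ST: "S \<subseteq> A" "T \<subseteq> B - A"
    then have *: "(S \<union> T) \<inter> A = S" "S \<union> T \<subseteq> B" using assms(2) by auto
    show "F (S \<union> T) = F S" by (rule trans[OF assms(3)[OF *(2)]]) (simp only: *(1))
  qed
  finally show ?thesis using fin by simp
qed

lemma bexp_indep:
  fixes F G :: "'a set \<Rightarrow> 'b::real_algebra_1"
  assumes "finite C" "A \<subseteq> C" "B \<subseteq> C" "A \<inter> B = {}"
    and F: "\<And>S. S \<subseteq> C \<Longrightarrow> F S = F (S \<inter> A)" and G: "\<And>S. S \<subseteq> C \<Longrightarrow> G S = G (S \<inter> B)"
  shows "bexp C (\<lambda>S. F S * G S) = bexp C F * bexp C G"
proof -
  have fin: "finite A" "finite B" using assms(1-3) finite_subset by auto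
  have "bexp C (\<lambda>S. F S * G S) = bexp (A \<union> B) (\<lambda>S. F S * G S)"
  proof (rule bexp_restrict[OF assms(1)])
    show "A \<union> B \<subseteq> C" using assms by auto
    fix S assume S: "S \<subseteq> C"
    then have "S \<inter> (A \<union> B) \<subseteq> C" by auto
    moreover have "S \<inter> (A \<union> B) \<inter> A = S \<inter> A" "S \<inter> (A \<union> B) \<inter> B = S \<inter> B" by auto
    ultimately show "F S * G S = F (S \<inter> (A \<union> B)) * G (S \<inter> (A \<union> B))" using F G S by metis
  qed
  also have "\<dots> = bexp A (\<lambda>S. bexp B (\<lambda>T. F (S \<union> T) * G (S \<union> T)))"
    using fin assms(4) by (rule bexp_Un)
  also have "\<dots> = bexp A (\<lambda>S. bexp B (\<lambda>T. F S * G T))"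
  proof (intro bexp_cong)
    fix S T assume ST: "S \<subseteq> A" "T \<subseteq> B"
    then have "(S \<union> T) \<inter> A = S" "(S \<union> T) \<inter> B = T" "S \<union> T \<subseteq> C" using assms(2-4) by auto
    then show "F (S \<union> T) * G (S \<union> T) = F S * G T" using F G by metis
  qed
  also have "\<dots> = bexp A F * bexp B G" by (simp add: bexp_cmult bexp_multc)
  also have "bexp A F = bexp C F" by (rule bexp_restrict[OF assms(1,2), where F = F, symmetric]) (rule F)
  also have "bexp B G = bexp C G" by (rule bexp_restrict[OF assms(1,3), where F = G, symmetric]) (rule G)
  finally show ?thesis .
qed

lemma bexp_prod_indep:
  fixes F :: "'i \<Rightarrow> 'a set \<Rightarrow> real"
  assumes "finite I" "finite C" "\<And>i. i \<in> I \<Longrightarrow> A i \<subseteq> C"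
    and "\<And>i j. i \<in> I \<Longrightarrow> j \<in> I \<Longrightarrow> i \<noteq> j \<Longrightarrow> A i \<inter> A j = {}"
    and F: "\<And>i S. i \<in> I \<Longrightarrow> S \<subseteq> C \<Longrightarrow> F i S = F i (S \<inter> A i)"
  shows "bexp C (\<lambda>S. \<Prod>i\<in>I. F i S) = (\<Prod>i\<in>I. bexp C (F i))"
  using assms(1,3-5)
proof (induction rule: finite_induct)
  case (insert j I)
  have "bexp C (\<lambda>S. F j S * (\<Prod>i\<in>I. F i S)) = bexp C (F j) * bexp C (\<lambda>S. \<Prod>i\<in>I. F i S)"
  proof (rule bexp_indep[where A = "A j" and B = "\<Union>i\<in>I. A i"])
    fix S assume S: "S \<subseteq> C"
    show "(\<Prod>i\<in>I. F i S) = (\<Prod>i\<in>I. F i (S \<inter> (\<Union>i\<in>I. A i)))"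
    proof (rule prod.cong)
      fix i assume i: "i \<in> I"
      have e1: "S \<inter> (\<Union>i\<in>I. A i) \<inter> A i = S \<inter> A i" using i by auto
      have e2: "F i S = F i (S \<inter> A i)"
        by (rule insert.prems(3)) (use S i in auto)
      have e3: "F i (S \<inter> (\<Union>i\<in>I. A i)) = F i (S \<inter> (\<Union>i\<in>I. A i) \<inter> A i)"
        by (rule insert.prems(3)) (use S i in auto)
      show "F i S = F i (S \<inter> (\<Union>i\<in>I. A i))"
        by (rule trans[OF e2], rule sym, rule trans[OF e3], simp only: e1)
    qed simp
    show "F j S = F j (S \<inter> A j)" by (rule insert.prems(3)) (use S in auto)
  next
    have "A j \<inter> A i = {}" if "i \<in> I" for i
      using insert.prems(2)[of j i] insert.hyps(2) that by auto
    then show "A j \<inter> (\<Union>i\<in>I. A i) = {}" by auto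
    show "\<Union> (A ` I) \<subseteq> C" using insert.prems(1) by auto
    show "A j \<subseteq> C" using insert.prems(1) by auto
  qed (use assms(2) in auto)
  then show ?case using insert by simp
qed (use assms(2) in simp)

lemma bexp_subset_indicator:
  assumes "finite A" "T \<subseteq> A"
  shows "bexp A (\<lambda>S. of_bool (T \<subseteq> S)) = p ^ card T"
proof -
  have fin: "finite T" using assms finite_subset by auto
  have "bexp A (\<lambda>S. of_bool (T \<subseteq> S) :: real) = bexp T (\<lambda>S. of_bool (T \<subseteq> S))"
    using assms by (intro bexp_restrict) auto
  also have "\<dots> = (\<Sum>S\<in>Pow T. if S = T then p ^ card T else 0)"
    unfolding bexp_def by (rule sum.cong) auto
  also have "\<dots> = p ^ card T" using fin by simp
  finally show ?thesis .
qed

section \<open>Jensen and Markov inequalities\<close>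

lemma bexp_square_le:
  fixes F :: "'a set \<Rightarrow> real"
  assumes "finite A"
  shows "(bexp A F)\<^sup>2 \<le> bexp A (\<lambda>S. (F S)\<^sup>2)"
proof -
  define c where "c = bexp A F"
  have "0 \<le> bexp A (\<lambda>S. (F S - c)\<^sup>2)" by (rule bexp_nonneg) simp
  also have "\<dots> = bexp A (\<lambda>S. (F S)\<^sup>2 - (2 * c) * F S + c\<^sup>2)"
    by (rule bexp_cong) (simp add: power2_eq_square algebra_simps)
  also have "\<dots> = bexp A (\<lambda>S. (F S)\<^sup>2) - c\<^sup>2"
    using assms by (simp add: bexp_add bexp_diff bexp_cmult c_def power2_eq_square del: bexp_const) (simp add: bexp_const)
  finally show ?thesis by (simp add: c_def)
qed

text \<open>Jensen's inequality by iterated squaring; the repeated Cauchy-Schwarz step in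
  \<open>decoupling\<close> produces exactly the exponents 2^k.\<close>

lemma bexp_power_le:
  fixes F :: "'a set \<Rightarrow> real"
  assumes "finite A" "\<And>S. S \<subseteq> A \<Longrightarrow> 0 \<le> F S"
  shows "(bexp A F) ^ (2 ^ k) \<le> bexp A (\<lambda>S. F S ^ (2 ^ k))"
proof (induction k)
  case (Suc k)
  have "(bexp A F) ^ (2 ^ Suc k) = ((bexp A F) ^ (2 ^ k))\<^sup>2"
    by (simp add: power_mult[symmetric] mult.commute)
  also have "\<dots> \<le> (bexp A (\<lambda>S. F S ^ (2 ^ k)))\<^sup>2"
    using Suc bexp_nonneg[of A F, OF assms(2)] by (intro power_mono) auto
  also have "\<dots> \<le> bexp A (\<lambda>S. (F S ^ (2 ^ k))\<^sup>2)" by (rule bexp_square_le[OF assms(1)])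
  also have "\<dots> = bexp A (\<lambda>S. F S ^ (2 ^ Suc k))"
    by (simp add: power_mult[symmetric] mult.commute)
  finally show ?case .
qed simp

lemma bexp_markov:
  fixes F :: "'a set \<Rightarrow> real"
  assumes "finite A" "\<And>S. S \<subseteq> A \<Longrightarrow> 0 \<le> F S" "0 < c"
  shows "bexp A (\<lambda>S. of_bool (c \<le> F S)) \<le> bexp A F / c"
proof -
  have "bexp A (\<lambda>S. of_bool (c \<le> F S)) \<le> bexp A (\<lambda>S. (1 / c) * F S)"
    using assms by (intro bexp_mono) (auto simp: field_simps)
  then show ?thesis using bexp_cmult[of A "1 / c" F] by simp
qed

lemma norm_bexp_square_le:
  fixes F :: "'a set \<Rightarrow> complex"
  assumes "finite A"
  shows "(norm (bexp A F))\<^sup>2 \<le> bexp A (\<lambda>S. (norm (F S))\<^sup>2)"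
proof -
  have "(norm (bexp A F))\<^sup>2 \<le> (bexp A (\<lambda>S. norm (F S)))\<^sup>2"
    by (intro power_mono norm_bexp_le) simp
  also have "\<dots> \<le> bexp A (\<lambda>S. (norm (F S))\<^sup>2)" by (rule bexp_square_le[OF assms])
  finally show ?thesis .
qed

end

section \<open>Hypercontractivity and lower tails\<close>

text \<open>Polynomials of degree at most d in the indicators of the elements. Generating them from
  monomials gives closure properties by rule induction, without a normal form.\<close>

inductive pdeg :: "nat \<Rightarrow> ('a set \<Rightarrow> real) \<Rightarrow> bool" for d :: nat where
  pdeg_ind: "finite T \<Longrightarrow> card T \<le> d \<Longrightarrow> pdeg d (\<lambda>S. of_bool (T \<subseteq> S))"
| pdeg_add: "pdeg d f \<Longrightarrow> pdeg d g \<Longrightarrow> pdeg d (\<lambda>S. f S + g S)"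
| pdeg_cmult: "pdeg d f \<Longrightarrow> pdeg d (\<lambda>S. c * f S)"

section \<open>Algebra of polynomials of bounded degree\<close>

lemma pdeg_mono: "pdeg d f \<Longrightarrow> d \<le> e \<Longrightarrow> pdeg e f"
  by (induction rule: pdeg.induct) (auto intro: pdeg.intros)

lemma pdeg_const: "pdeg d (\<lambda>_. c)"
  using pdeg_cmult[OF pdeg_ind[of "{}" d], of c] by simp

lemma pdeg_diff: "pdeg d f \<Longrightarrow> pdeg d g \<Longrightarrow> pdeg d (\<lambda>S. f S - g S)"
  using pdeg_add[OF _ pdeg_cmult[of d g "-1"], of f] by simp

lemma pdeg_sum: "(\<And>i. i \<in> I \<Longrightarrow> pdeg d (f i)) \<Longrightarrow> pdeg d (\<lambda>S. \<Sum>i\<in>I. f i S)"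
  by (induction I rule: infinite_finite_induct) (auto intro: pdeg_const pdeg_add)

lemma pdeg_mult_ind:
  assumes "pdeg e g" "finite T" "card T \<le> d"
  shows "pdeg (d + e) (\<lambda>S. of_bool (T \<subseteq> S) * g S)"
  using assms(1)
proof (induction rule: pdeg.induct)
  case (pdeg_ind U)
  have "card (T \<union> U) \<le> d + e" using card_Un_le[of T U] pdeg_ind assms by linarith
  then have "pdeg (d + e) (\<lambda>S. of_bool (T \<union> U \<subseteq> S))"
    using pdeg_ind assms by (intro pdeg.pdeg_ind) auto
  then show ?case by (simp add: of_bool_conj)
next
  case (pdeg_add f g)
  then show ?case using pdeg.pdeg_add by (fastforce simp: distrib_left)
next
  case (pdeg_cmult f c)
  then show ?case using pdeg.pdeg_cmult[of "d + e" "\<lambda>S. of_bool (T \<subseteq> S) * f S" c] by (simp add: mult_ac)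
qed

lemma pdeg_mult: "pdeg d f \<Longrightarrow> pdeg e g \<Longrightarrow> pdeg (d + e) (\<lambda>S. f S * g S)"
proof (induction rule: pdeg.induct)
  case (pdeg_ind T)
  then show ?case using pdeg_mult_ind by blast
next
  case (pdeg_add f1 f2)
  then show ?case using pdeg.pdeg_add[of "d + e" "\<lambda>S. f1 S * g S" "\<lambda>S. f2 S * g S"] by (simp add: distrib_right)
next
  case (pdeg_cmult f c)
  then show ?case using pdeg.pdeg_cmult[of "d + e" "\<lambda>S. f S * g S" c] by (simp add: mult_ac)
qed

lemma pdeg_prod:
  "finite I \<Longrightarrow> (\<And>i. i \<in> I \<Longrightarrow> pdeg d (f i)) \<Longrightarrow> pdeg (card I * d) (\<lambda>S. \<Prod>i\<in>I. f i S)"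
  by (induction I rule: finite_induct) (auto intro: pdeg_const pdeg_mult)

lemma pdeg_delete: "pdeg d f \<Longrightarrow> pdeg d (\<lambda>S. f (S - {e}))"
proof (induction rule: pdeg.induct)
  case (pdeg_ind T)
  show ?case
  proof (cases "e \<in> T")
    case True
    then have "(\<lambda>S. of_bool (T \<subseteq> S - {e}) :: real) = (\<lambda>_. 0)" by (auto simp: fun_eq_iff)
    then show ?thesis by (simp only: pdeg_const)
  next
    case False
    then have "(\<lambda>S. of_bool (T \<subseteq> S - {e}) :: real) = (\<lambda>S. of_bool (T \<subseteq> S))"
      by (auto simp: fun_eq_iff)
    then show ?thesis using pdeg.pdeg_ind[OF pdeg_ind] by (simp only:)
  qed
qed (auto intro: pdeg.intros)

text \<open>The discrete derivative in direction \<open>e\<close> removes \<open>e\<close> from the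
  monomials that contain it and kills the others. The second conjunct covers d = 0, where d - 1
  truncates to 0 and the degree bound alone would miss that the derivative vanishes.\<close>

lemma pdeg_derivative:
  "pdeg d f \<Longrightarrow> pdeg (d - 1) (\<lambda>S. f (insert e S) - f (S - {e})) \<and> (d = 0 \<longrightarrow> (\<forall>S. f (insert e S) = f (S - {e})))"
proof (induction rule: pdeg.induct)
  case (pdeg_ind T)
  show ?case
  proof (cases "e \<in> T")
    case True
    then have "(\<lambda>S. of_bool (T \<subseteq> insert e S) - of_bool (T \<subseteq> S - {e}) :: real) = (\<lambda>S. of_bool (T - {e} \<subseteq> S))"
      by (auto simp: fun_eq_iff)
    moreover have "pdeg (d - 1) (\<lambda>S. of_bool (T - {e} \<subseteq> S))"
      using pdeg_ind True by (intro pdeg.pdeg_ind) auto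
    moreover have "d \<noteq> 0" using True pdeg_ind card_gt_0_iff[of T] by auto
    ultimately show ?thesis by simp
  next
    case False
    then have "(T \<subseteq> insert e S) = (T \<subseteq> S - {e})" for S by auto
    then show ?thesis by (simp add: pdeg_const)
  qed
next
  case (pdeg_add f g)
  then show ?case using pdeg.pdeg_add[of "d - 1" "\<lambda>S. f (insert e S) - f (S - {e})" "\<lambda>S. g (insert e S) - g (S - {e})"]
    by (simp add: algebra_simps)
next
  case (pdeg_cmult f c)
  then show ?case using pdeg.pdeg_cmult[of "d - 1" "\<lambda>S. f (insert e S) - f (S - {e})" c]
    by (simp add: algebra_simps)
qed

text \<open>\<open>g + (1 - p) * h\<close> and \<open>g - p * h\<close> are the values of a function
  with mean \<open>g\<close> and difference \<open>h\<close> over one biased bit. In its fourth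
  moment the term g^3 h cancels, and the term g h^3 is split by 2ab <= a^2 + b^2, whence 8 = 6 + 2
  and 3 = 2 + 1.\<close>

lemma fourth_moment_pointwise:
  fixes g h p :: real
  assumes "0 < p" "p < 1"
  shows "p * (g + (1 - p) * h) ^ 4 + (1 - p) * (g - p * h) ^ 4
      \<le> g ^ 4 + 8 * (p * (1 - p)) * (g\<^sup>2 * h\<^sup>2) + 3 * (p * (1 - p)) * h ^ 4"
proof -
  define q where "q = 1 - p"
  have p_eq: "p = 1 - q" by (simp add: q_def)
  have pq: "0 < p * q" using assms by (simp add: q_def)
  have "p * (g + q * h) ^ 4 + q * (g - p * h) ^ 4
      = g ^ 4 + 6 * (p * q) * (g\<^sup>2 * h\<^sup>2) + (p * q) * (4 * (q - p) * (g * h ^ 3)) + (p * q) * ((q ^ 3 + p ^ 3) * h ^ 4)"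
    unfolding p_eq by (simp add: power4_eq_xxxx power2_eq_square power3_eq_cube algebra_simps)
  moreover have "4 * (q - p) * (g * h ^ 3) \<le> 2 * (g\<^sup>2 * h\<^sup>2) + 2 * h ^ 4"
  proof -
    have *: "0 \<le> (h\<^sup>2) * (g - (q - p) * h)\<^sup>2" by simp
    have "(q - p)\<^sup>2 \<le> 1" using assms by (simp add: q_def abs_square_le_1 abs_le_iff)
    then have "(q - p)\<^sup>2 * h ^ 4 \<le> 1 * h ^ 4" by (rule mult_right_mono) simp
    with * show ?thesis by (simp add: power4_eq_xxxx power2_eq_square power3_eq_cube algebra_simps)
  qed
  then have "(p * q) * (4 * (q - p) * (g * h ^ 3)) \<le> (p * q) * (2 * (g\<^sup>2 * h\<^sup>2) + 2 * h ^ 4)"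
    using pq by (intro mult_left_mono) auto
  moreover have "(q ^ 3 + p ^ 3) * h ^ 4 \<le> 1 * h ^ 4"
  proof (rule mult_right_mono)
    have "q ^ 3 \<le> q ^ 1" "p ^ 3 \<le> p ^ 1" using power_decreasing[of 1 3 q] power_decreasing[of 1 3 p] assms by (auto simp: q_def)
    then show "q ^ 3 + p ^ 3 \<le> 1" by (simp add: q_def)
  qed simp
  then have "(p * q) * ((q ^ 3 + p ^ 3) * h ^ 4) \<le> (p * q) * (1 * h ^ 4)"
    using pq by (intro mult_left_mono) auto
  ultimately show ?thesis by (simp add: q_def algebra_simps)
qed

section \<open>Moments and tails of polynomials in independent bits\<close>

context bernoulli
begin

lemma bexp_Cauchy_Schwarz:
  fixes u v :: "'a set \<Rightarrow> real"
  shows "(bexp A (\<lambda>S. u S * v S))\<^sup>2 \<le> bexp A (\<lambda>S. (u S)\<^sup>2) * bexp A (\<lambda>S. (v S)\<^sup>2)"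
proof -
  define wt where "wt S = p ^ card S * (1 - p) ^ card (A - S)" for S
  have wt: "0 \<le> wt S" for S by (simp add: wt_def bexp_weight_nonneg)
  have "(\<Sum>S\<in>Pow A. (sqrt (wt S) * u S) * (sqrt (wt S) * v S))\<^sup>2
     \<le> (\<Sum>S\<in>Pow A. (sqrt (wt S) * u S)\<^sup>2) * (\<Sum>S\<in>Pow A. (sqrt (wt S) * v S)\<^sup>2)"
    by (rule Cauchy_Schwarz_ineq_sum)
  moreover have "(sqrt (wt S) * u S) * (sqrt (wt S) * v S) = wt S * (u S * v S)" for S
  proof -
    have "(sqrt (wt S) * u S) * (sqrt (wt S) * v S) = (sqrt (wt S))\<^sup>2 * (u S * v S)"
      by (simp only: power2_eq_square mult_ac)
    then show ?thesis using wt[of S] by simp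
  qed
  moreover have "(sqrt (wt S) * u S)\<^sup>2 = wt S * (u S)\<^sup>2" "(sqrt (wt S) * v S)\<^sup>2 = wt S * (v S)\<^sup>2" for S
    using wt[of S] by (auto simp: power_mult_distrib)
  ultimately show ?thesis by (simp only: bexp_def wt_def[symmetric] real_scaleR_def)
qed

text \<open>Both entries serve the inductive step of \<open>hypercontractivity\<close>: 16 gives
  sqrt hcK <= hcK / 4 for the mixed term, and 3 / (p (1 - p)) absorbs the term in h^4.\<close>

definition hcK :: real where "hcK = max 16 (3 / (p * (1 - p)))"

lemma hcK_bounds: "16 \<le> hcK" "3 \<le> hcK * (p * (1 - p))" "0 < hcK"
proof -
  show "16 \<le> hcK" by (simp add: hcK_def)
  then show "0 < hcK" by simp
  have "0 < p * (1 - p)" using p_pos p_less_1 by simp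
  moreover have "3 / (p * (1 - p)) \<le> hcK" by (simp add: hcK_def)
  ultimately show "3 \<le> hcK * (p * (1 - p))" by (simp only: pos_divide_le_eq)
qed

text \<open>Bonami's inequality for biased bits, by induction on the ground set: over the bit
  \<open>e\<close> the function has mean \<open>g\<close> of degree d and difference
  \<open>h\<close> of degree d - 1, so the terms with \<open>h\<close> have powers of
  \<open>hcK\<close> to spare.\<close>

theorem hypercontractivity:
  assumes "finite A" "pdeg d f"
  shows "bexp A (\<lambda>S. f S ^ 4) \<le> hcK ^ d * (bexp A (\<lambda>S. (f S)\<^sup>2))\<^sup>2"
  using assms
proof (induction A arbitrary: d f rule: finite_induct)
  case empty
  have "1 * (f {}) ^ 4 \<le> hcK ^ d * (f {}) ^ 4"
    using hcK_bounds by (intro mult_right_mono one_le_power) auto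
  then show ?case by (simp add: power4_eq_xxxx power2_eq_square mult_ac)
next
  case (insert e A)
  \<comment> \<open>Writing \<open>f (S - {e})\<close> for \<open>f S\<close> makes \<open>g\<close>
    and \<open>h\<close> polynomials on all sets; on subsets of \<open>A\<close> the two expressions
    agree.\<close>
  define h where "h = (\<lambda>S. f (insert e S) - f (S - {e}))"
  define g where "g = (\<lambda>S. f (S - {e}) + p * h S)"
  define v where "v = p * (1 - p)"
  have v: "0 < v" using p_pos p_less_1 by (simp add: v_def)
  have h: "pdeg (d - 1) h" "d = 0 \<Longrightarrow> h S = 0" for S
    using pdeg_derivative[OF insert.prems, of e] by (auto simp: h_def)
  have g: "pdeg d g" unfolding g_def
    by (intro pdeg_add pdeg_delete pdeg_cmult insert.prems pdeg_mono[OF h(1)]) simp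
  have f1: "f (insert e S) = g S + (1 - p) * h S" and f2: "f S = g S - p * h S" if "S \<subseteq> A" for S
  proof -
    have "S - {e} = S" using that insert.hyps by auto
    then show "f (insert e S) = g S + (1 - p) * h S" "f S = g S - p * h S"
      by (auto simp: g_def h_def algebra_simps)
  qed
  define a where "a = bexp A (\<lambda>S. (g S)\<^sup>2)"
  define b where "b = bexp A (\<lambda>S. (h S)\<^sup>2)"
  have ab: "0 \<le> a" "0 \<le> b" by (auto simp: a_def b_def intro: bexp_nonneg)
  have sq: "bexp (insert e A) (\<lambda>S. (f S)\<^sup>2) = a + v * b"
  proof -
    have "bexp (insert e A) (\<lambda>S. (f S)\<^sup>2)
       = bexp A (\<lambda>S. p * (f (insert e S))\<^sup>2 + (1 - p) * (f S)\<^sup>2)"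
      using insert.hyps by (simp add: bexp_insert bexp_add bexp_cmult)
    also have "\<dots> = bexp A (\<lambda>S. (g S)\<^sup>2 + v * (h S)\<^sup>2)"
      by (intro bexp_cong) (simp add: f1 f2 v_def power2_eq_square algebra_simps)
    finally show ?thesis by (simp add: bexp_add bexp_cmult a_def b_def)
  qed
  have "bexp (insert e A) (\<lambda>S. f S ^ 4) = bexp A (\<lambda>S. p * f (insert e S) ^ 4 + (1 - p) * f S ^ 4)"
    using insert.hyps by (simp add: bexp_insert bexp_add bexp_cmult)
  also have "\<dots> \<le> bexp A (\<lambda>S. g S ^ 4 + 8 * v * ((g S)\<^sup>2 * (h S)\<^sup>2) + 3 * v * h S ^ 4)"
    unfolding v_def by (intro bexp_mono) (simp only: f1 f2 fourth_moment_pointwise[OF p_pos p_less_1])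
  also have "\<dots> = bexp A (\<lambda>S. g S ^ 4) + 8 * v * bexp A (\<lambda>S. (g S)\<^sup>2 * (h S)\<^sup>2) + 3 * v * bexp A (\<lambda>S. h S ^ 4)"
    by (simp only: bexp_add bexp_cmult)
  finally have main: "bexp (insert e A) (\<lambda>S. f S ^ 4) \<le> \<dots>" .
  have g4: "bexp A (\<lambda>S. g S ^ 4) \<le> hcK ^ d * a\<^sup>2" using insert.IH[OF g] by (simp add: a_def)
  have h4: "bexp A (\<lambda>S. h S ^ 4) \<le> hcK ^ (d - 1) * b\<^sup>2" using insert.IH[OF h(1)] by (simp add: b_def)
  show ?case
  proof (cases d)
    case 0
    then have "h S = 0" for S using h(2) by simp
    then have "b = 0" "bexp A (\<lambda>S. (g S)\<^sup>2 * (h S)\<^sup>2) = 0" "bexp A (\<lambda>S. h S ^ 4) = 0"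
      using insert.hyps by (auto simp: b_def)
    then show ?thesis using main g4 sq by simp
  next
    case (Suc k)
    have Kk: "0 < hcK ^ k" using hcK_bounds by simp
    have "(bexp A (\<lambda>S. (g S)\<^sup>2 * (h S)\<^sup>2))\<^sup>2 \<le> bexp A (\<lambda>S. g S ^ 4) * bexp A (\<lambda>S. h S ^ 4)"
      using bexp_Cauchy_Schwarz[of A "\<lambda>S. (g S)\<^sup>2" "\<lambda>S. (h S)\<^sup>2"] by (simp add: power_mult[symmetric])
    also have "\<dots> \<le> (hcK ^ d * a\<^sup>2) * (hcK ^ k * b\<^sup>2)"
      using g4 h4 Suc hcK_bounds by (intro mult_mono) (auto intro: bexp_nonneg)
    also have "\<dots> = hcK * (hcK ^ k * (a * b))\<^sup>2"
      by (simp add: Suc power2_eq_square mult_ac)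
    also have "\<dots> \<le> (hcK / 4)\<^sup>2 * (hcK ^ k * (a * b))\<^sup>2"
    proof (rule mult_right_mono)
      have "16 * hcK \<le> hcK * hcK" using hcK_bounds by (intro mult_right_mono) auto
      then show "hcK \<le> (hcK / 4)\<^sup>2" by (simp add: power2_eq_square)
    qed simp
    also have "\<dots> = (hcK / 4 * (hcK ^ k * (a * b)))\<^sup>2" by (simp add: power_mult_distrib power_divide)
    finally have c: "bexp A (\<lambda>S. (g S)\<^sup>2 * (h S)\<^sup>2) \<le> hcK / 4 * (hcK ^ k * (a * b))"
      by (rule power2_le_imp_le) (use ab Kk hcK_bounds in auto)
    have "8 * v * bexp A (\<lambda>S. (g S)\<^sup>2 * (h S)\<^sup>2) \<le> 8 * v * (hcK / 4 * (hcK ^ k * (a * b)))"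
      using c v by (intro mult_left_mono) auto
    moreover have "3 * v * bexp A (\<lambda>S. h S ^ 4) \<le> (hcK * v) * v * (hcK ^ k * b\<^sup>2)"
      using h4 Suc v hcK_bounds Kk by (intro mult_mono) (auto simp: v_def intro: bexp_nonneg)
    ultimately have "bexp (insert e A) (\<lambda>S. f S ^ 4)
       \<le> hcK ^ d * a\<^sup>2 + 8 * v * (hcK / 4 * (hcK ^ k * (a * b))) + (hcK * v) * v * (hcK ^ k * b\<^sup>2)"
      using main g4 by linarith
    also have "\<dots> = hcK ^ d * (a + v * b)\<^sup>2"
      by (simp add: Suc power2_eq_square algebra_simps)
    finally show ?thesis by (simp add: sq)
  qed
qed

text \<open>The constant of \<open>moment_bound\<close>, whose induction passes from f to its
  square: the degree doubles, and \<open>hypercontractivity\<close> is applied once, raised to the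
  power 2^j.\<close>

fun hcM :: "nat \<Rightarrow> nat \<Rightarrow> real" where
  "hcM d 0 = 1"
| "hcM d (Suc j) = hcM (2 * d) j * (hcK ^ d) ^ (2 ^ j)"

lemma hcM_pos: "0 < hcM d j"
  by (induction d j rule: hcM.induct) (auto simp: hcK_bounds)

theorem moment_bound:
  assumes "finite A" "pdeg d f"
  shows "bexp A (\<lambda>S. f S ^ (2 ^ Suc j)) \<le> hcM d j * (bexp A (\<lambda>S. (f S)\<^sup>2)) ^ (2 ^ j)"
  using assms(2)
proof (induction j arbitrary: d f)
  case (Suc j)
  have "bexp A (\<lambda>S. f S ^ (2 ^ Suc (Suc j))) = bexp A (\<lambda>S. ((f S)\<^sup>2) ^ (2 ^ Suc j))"
    by (simp add: power_mult[symmetric])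
  also have "\<dots> \<le> hcM (2 * d) j * (bexp A (\<lambda>S. ((f S)\<^sup>2)\<^sup>2)) ^ (2 ^ j)"
    using pdeg_mult[OF Suc.prems Suc.prems] by (intro Suc.IH) (simp add: power2_eq_square mult_2)
  also have "\<dots> \<le> hcM (2 * d) j * (hcK ^ d * (bexp A (\<lambda>S. (f S)\<^sup>2))\<^sup>2) ^ (2 ^ j)"
    using hypercontractivity[OF assms(1) Suc.prems] hcM_pos[of "2 * d" j]
    by (intro mult_left_mono power_mono) (auto simp: power_mult[symmetric] intro: bexp_nonneg)
  also have "\<dots> = hcM d (Suc j) * (bexp A (\<lambda>S. (f S)\<^sup>2)) ^ (2 ^ Suc j)"
    by (simp add: power_mult_distrib power_mult[symmetric] mult_ac)
  finally show ?case .
qed simp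

text \<open>Markov's inequality for the moment of order 2^(j+1). When the second moment is smaller
  than c^2 by a fixed power of n, a large j yields any prescribed power of n.\<close>

lemma pdeg_tail:
  assumes "finite A" "pdeg d f" "0 < c"
  shows "bexp A (\<lambda>S. of_bool (c \<le> \<bar>f S\<bar>)) \<le> hcM d j * (bexp A (\<lambda>S. (f S)\<^sup>2) / c\<^sup>2) ^ (2 ^ j)"
proof -
  have "bexp A (\<lambda>S. of_bool (c \<le> \<bar>f S\<bar>) :: real) \<le> bexp A (\<lambda>S. of_bool (c ^ (2 ^ Suc j) \<le> \<bar>f S\<bar> ^ (2 ^ Suc j)))"
    using assms(3) by (intro bexp_mono) (auto intro: power_mono)
  also have "\<dots> \<le> bexp A (\<lambda>S. \<bar>f S\<bar> ^ (2 ^ Suc j)) / c ^ (2 ^ Suc j)"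
    using assms by (intro bexp_markov) auto
  also have "bexp A (\<lambda>S. \<bar>f S\<bar> ^ (2 ^ Suc j)) = bexp A (\<lambda>S. f S ^ (2 ^ Suc j))"
    by (simp add: power_mult)
  also have "\<dots> / c ^ (2 ^ Suc j) \<le> hcM d j * (bexp A (\<lambda>S. (f S)\<^sup>2)) ^ (2 ^ j) / c ^ (2 ^ Suc j)"
    using assms moment_bound[OF assms(1,2)] by (intro divide_right_mono) auto
  also have "\<dots> = hcM d j * (bexp A (\<lambda>S. (f S)\<^sup>2) / c\<^sup>2) ^ (2 ^ j)"
    by (simp add: power_divide power_mult[symmetric] mult.commute)
  finally show ?thesis .
qed

text \<open>Indicators of disjoint monomials are independent; every other pair has covariance at
  most 1.\<close>

lemma count_variance:
  fixes T :: "'c \<Rightarrow> 'a set"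
  assumes "finite A" "finite C" "\<And>c. c \<in> C \<Longrightarrow> T c \<subseteq> A"
  shows "bexp A (\<lambda>S. (\<Sum>c\<in>C. of_bool (T c \<subseteq> S) - p ^ card (T c))\<^sup>2)
     \<le> card {(c, c') \<in> C \<times> C. T c \<inter> T c' \<noteq> {}}"
proof -
  have fin: "finite (T c)" if "c \<in> C" for c using assms that finite_subset by blast
  have pc: "bexp A (\<lambda>S. (of_bool (T c \<subseteq> S) - p ^ card (T c)) * (of_bool (T c' \<subseteq> S) - p ^ card (T c')))
     \<le> of_bool (T c \<inter> T c' \<noteq> {})" if c: "c \<in> C" "c' \<in> C" for c c'
  proof -
    have "bexp A (\<lambda>S. (of_bool (T c \<subseteq> S) - p ^ card (T c)) * (of_bool (T c' \<subseteq> S) - p ^ card (T c')))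
      = bexp A (\<lambda>S. of_bool (T c \<union> T c' \<subseteq> S) - p ^ card (T c') * of_bool (T c \<subseteq> S)
          - p ^ card (T c) * of_bool (T c' \<subseteq> S) + p ^ card (T c) * p ^ card (T c'))"
      by (intro bexp_cong) (auto simp: algebra_simps)
    also have "\<dots> = p ^ card (T c \<union> T c') - p ^ card (T c) * p ^ card (T c')"
      using assms c by (simp only: bexp_add bexp_diff bexp_cmult bexp_subset_indicator Un_least bexp_const) (simp add: mult.commute)
    also have "\<dots> \<le> of_bool (T c \<inter> T c' \<noteq> {})"
    proof (cases "T c \<inter> T c' = {}")
      case True
      then show ?thesis using fin c by (simp add: card_Un_disjoint power_add)
    next
      case False
      have "p ^ card (T c \<union> T c') \<le> 1" using p_pos p_less_1 by (intro power_le_one) auto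
      moreover have "0 \<le> p ^ card (T c) * p ^ card (T c')" using p_pos by simp
      ultimately show ?thesis using False by simp
    qed
    finally show ?thesis .
  qed
  have "bexp A (\<lambda>S. (\<Sum>c\<in>C. of_bool (T c \<subseteq> S) - p ^ card (T c))\<^sup>2)
     = (\<Sum>c\<in>C. \<Sum>c'\<in>C. bexp A (\<lambda>S. (of_bool (T c \<subseteq> S) - p ^ card (T c)) * (of_bool (T c' \<subseteq> S) - p ^ card (T c'))))"
    by (simp only: power2_eq_square sum_product bexp_sum)
  also have "\<dots> \<le> (\<Sum>c\<in>C. \<Sum>c'\<in>C. of_bool (T c \<inter> T c' \<noteq> {}))"
    by (intro sum_mono pc)
  also have "\<dots> = (\<Sum>x\<in>C \<times> C. of_bool (T (fst x) \<inter> T (snd x) \<noteq> {}))"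
    by (simp add: sum.cartesian_product split_beta)
  also have "\<dots> = card {x \<in> C \<times> C. T (fst x) \<inter> T (snd x) \<noteq> {}}"
    using assms(2) by (simp add: sum.If_cases of_bool_def Int_def)
  also have "{x \<in> C \<times> C. T (fst x) \<inter> T (snd x) \<noteq> {}} = {(c, c') \<in> C \<times> C. T c \<inter> T c' \<noteq> {}}" by auto
  finally show ?thesis .
qed

text \<open>The expected count is at least p^d |C|, since every set has at most d elements, so a
  count below half of that is a deviation of the same order. \<open>\<theta>\<close> bounds the
  proportion of dependent pairs and thereby the relative variance.\<close>

lemma count_lower_tail:
  fixes T :: "'c \<Rightarrow> 'a set" and \<theta> :: real
  assumes "finite A" "finite C" "\<And>c. c \<in> C \<Longrightarrow> T c \<subseteq> A" "\<And>c. c \<in> C \<Longrightarrow> card (T c) \<le> d"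
    and "0 \<le> \<theta>" and D: "card {(c, c') \<in> C \<times> C. T c \<inter> T c' \<noteq> {}} \<le> \<theta> * (card C)\<^sup>2"
  shows "bexp A (\<lambda>S. of_bool (card {c \<in> C. T c \<subseteq> S} < p ^ d * card C / 2))
    \<le> hcM d j * (4 * \<theta> / (p ^ d)\<^sup>2) ^ (2 ^ j)"
proof (cases "C = {}")
  case True
  then show ?thesis using assms(1,5) hcM_pos[of d j] by (simp add: less_imp_le)
next
  case False
  define f where "f S = (\<Sum>c\<in>C. of_bool (T c \<subseteq> S) - p ^ card (T c))" for S
  define c0 where "c0 = p ^ d * card C / 2"
  have cC: "0 < card C" using False assms(2) by (simp add: card_gt_0_iff)
  have c0: "0 < c0" using p_pos cC by (simp add: c0_def)
  have fin: "finite (T c)" if "c \<in> C" for c using assms(1,3) that finite_subset by blast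
  have f: "pdeg d f"
    unfolding f_def by (intro pdeg_sum pdeg_diff pdeg_const pdeg_ind) (auto simp: fin assms(4))
  have "(\<Sum>c\<in>C. p ^ d) \<le> (\<Sum>c\<in>C. p ^ card (T c))"
    using p_pos p_less_1 assms(4) by (intro sum_mono power_decreasing) auto
  then have "card C * p ^ d \<le> (\<Sum>c\<in>C. p ^ card (T c))" by simp
  moreover have "f S = card {c \<in> C. T c \<subseteq> S} - (\<Sum>c\<in>C. p ^ card (T c))" for S
    using assms(2) by (simp add: f_def sum_subtractf of_bool_def sum.If_cases Int_def)
  ultimately have "c0 \<le> \<bar>f S\<bar>" if "card {c \<in> C. T c \<subseteq> S} < p ^ d * card C / 2" for S
    using that by (simp add: c0_def mult.commute)
  then have "bexp A (\<lambda>S. of_bool (card {c \<in> C. T c \<subseteq> S} < p ^ d * card C / 2) :: real) \<le> bexp A (\<lambda>S. of_bool (c0 \<le> \<bar>f S\<bar>))"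
    by (intro bexp_mono) auto
  also have "\<dots> \<le> hcM d j * (bexp A (\<lambda>S. (f S)\<^sup>2) / c0\<^sup>2) ^ (2 ^ j)"
    by (rule pdeg_tail[OF assms(1) f c0])
  also have "\<dots> \<le> hcM d j * ((\<theta> * (card C)\<^sup>2) / c0\<^sup>2) ^ (2 ^ j)"
    using order_trans[OF count_variance[of A C T, OF assms(1-3)] D] hcM_pos[of d j]
    by (intro mult_left_mono power_mono divide_right_mono divide_nonneg_nonneg bexp_nonneg) (auto simp: f_def)
  also have "\<theta> * (card C)\<^sup>2 / c0\<^sup>2 = 4 * \<theta> / (p ^ d)\<^sup>2"
    using cC by (simp add: c0_def power_mult_distrib power_divide field_simps)
  finally show ?thesis .
qed

end

section \<open>Decoupling and perturbed products\<close>

context bernoulli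
begin

lemma bexp_swap: "bexp A (\<lambda>S. bexp B (\<lambda>T. F S T)) = bexp B (\<lambda>T. bexp A (\<lambda>S. F S T))"
  unfolding bexp_def scaleR_sum_right by (subst sum.swap) (simp add: mult.commute)

lemma bexp_of_real: "bexp A (\<lambda>S. of_real (f S)) = (of_real (bexp A f) :: complex)"
  by (simp add: bexp_def scaleR_conv_of_real)

lemma bexp_cnj: "cnj (bexp A F) = bexp A (\<lambda>S. cnj (F S))"
  by (simp add: bexp_def)

text \<open>Cauchy-Schwarz in the coordinates outside one block, followed by expanding the square,
  replaces the block by two independent copies. The phase turns into a difference in which every
  monomial avoiding the block cancels. After all blocks only monomials meeting each of them survive,
  with a product of differences as factor.\<close>

lemma decoupling:
  fixes T :: "'c \<Rightarrow> 'a set" and a :: "'c \<Rightarrow> real" and B :: "'i \<Rightarrow> 'a set" and t :: real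
  assumes "finite I" "finite D" "finite C" "\<And>i. i \<in> I \<Longrightarrow> finite (B i)"
    and "\<And>i j. i \<in> I \<Longrightarrow> j \<in> I \<Longrightarrow> i \<noteq> j \<Longrightarrow> B i \<inter> B j = {}"
    and "\<And>i. i \<in> I \<Longrightarrow> B i \<inter> D = {}"
    and "\<And>c. c \<in> C \<Longrightarrow> T c \<subseteq> D \<union> \<Union> (B ` I)"
  shows "norm (bexp (D \<union> \<Union> (B ` I)) (\<lambda>S. cis (t * (\<Sum>c\<in>C. a c * of_bool (T c \<subseteq> S))))) ^ (2 ^ card I)
    \<le> bexp (\<Union> (B ` I)) (\<lambda>Y. bexp (\<Union> (B ` I)) (\<lambda>Y'. norm (bexp D (\<lambda>S. cis (t *
        (\<Sum>c\<in>C. a c * (\<Prod>i\<in>I. of_bool (T c \<inter> B i \<subseteq> Y) - of_bool (T c \<inter> B i \<subseteq> Y'))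
          * of_bool (T c \<inter> D \<subseteq> S)))))))"
  using assms(1,4-7)
proof (induction arbitrary: a T rule: finite_induct)
  case empty
  then have "(\<Sum>c\<in>C. a c * of_bool (T c \<subseteq> S)) = (\<Sum>c\<in>C. a c * of_bool (T c \<inter> D \<subseteq> S))" for S
    by (intro sum.cong) (auto simp: Int_absorb2)
  then show ?case by simp
next
  case (insert j I)
  define U where "U = \<Union> (B ` I)"
  define R where "R = D \<union> U"
  have finI: "finite (B j)" "finite U" "finite R" using insert assms(2) by (auto simp: U_def R_def)
  have BU: "B j \<inter> U = {}" using insert.prems(2)[of j] insert.hyps by (fastforce simp: U_def)
  have BD: "B j \<inter> D = {}" using insert.prems(3) by auto
  have BR: "R \<inter> B j = {}" using BU BD by (auto simp: R_def)
  define f where "f Y S = (\<Sum>c\<in>C. a c * of_bool (T c \<inter> B j \<subseteq> Y) * of_bool (T c - B j \<subseteq> S))" for Y S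
  \<comment> \<open>For fixed \<open>Y\<close> and \<open>Y'\<close> the difference on
    \<open>B j\<close> is absorbed into the coefficient and the block is deleted from
    \<open>T c\<close>; hence \<open>a\<close> and \<open>T\<close> are arbitrary in the
    induction.\<close>
  define a' where "a' Y Y' c = a c * (of_bool (T c \<inter> B j \<subseteq> Y) - of_bool (T c \<inter> B j \<subseteq> Y'))" for Y Y' c
  have f_diff: "f Y S - f Y' S = (\<Sum>c\<in>C. a' Y Y' c * of_bool (T c - B j \<subseteq> S))" for Y Y' S
    by (simp add: f_def a'_def sum_subtractf[symmetric] algebra_simps)
  have set_eq: "D \<union> \<Union> (B ` insert j I) = R \<union> B j" by (auto simp: R_def U_def)
  have "bexp (R \<union> B j) (\<lambda>S. cis (t * (\<Sum>c\<in>C. a c * of_bool (T c \<subseteq> S))))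
      = bexp R (\<lambda>S. bexp (B j) (\<lambda>Y. cis (t * (\<Sum>c\<in>C. a c * of_bool (T c \<subseteq> S \<union> Y)))))"
    using finI BR by (intro bexp_Un) auto
  also have "\<dots> = bexp R (\<lambda>S. bexp (B j) (\<lambda>Y. cis (t * f Y S)))"
  proof (intro bexp_cong)
    fix S Y assume SY: "S \<subseteq> R" "Y \<subseteq> B j"
    have "of_bool (T c \<subseteq> S \<union> Y) = (of_bool (T c \<inter> B j \<subseteq> Y) * of_bool (T c - B j \<subseteq> S) :: real)" for c
      using SY BR by (auto simp: of_bool_def)
    then show "cis (t * (\<Sum>c\<in>C. a c * of_bool (T c \<subseteq> S \<union> Y))) = cis (t * f Y S)"
      by (simp add: f_def mult.assoc)
  qed
  finally have e1: "bexp (R \<union> B j) (\<lambda>S. cis (t * (\<Sum>c\<in>C. a c * of_bool (T c \<subseteq> S))))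
      = bexp R (\<lambda>S. bexp (B j) (\<lambda>Y. cis (t * f Y S)))" .
  define N where "N = norm (bexp (R \<union> B j) (\<lambda>S. cis (t * (\<Sum>c\<in>C. a c * of_bool (T c \<subseteq> S)))))"
  define G where "G Y Y' = norm (bexp R (\<lambda>S. cis (t * (\<Sum>c\<in>C. a' Y Y' c * of_bool (T c - B j \<subseteq> S)))))" for Y Y'
  have "N\<^sup>2 \<le> bexp R (\<lambda>S. (norm (bexp (B j) (\<lambda>Y. cis (t * f Y S))))\<^sup>2)"
    unfolding N_def e1 by (rule norm_bexp_square_le[OF finI(3)])
  also have "\<dots> \<le> bexp (B j) (\<lambda>Y. bexp (B j) (\<lambda>Y'. G Y Y'))"
  proof -
    have "(of_real (bexp R (\<lambda>S. (norm (bexp (B j) (\<lambda>Y. cis (t * f Y S))))\<^sup>2)) :: complex)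
       = bexp R (\<lambda>S. bexp (B j) (\<lambda>Y. cis (t * f Y S)) * cnj (bexp (B j) (\<lambda>Y. cis (t * f Y S))))"
      by (simp only: bexp_of_real[symmetric] complex_norm_square)
    also have "\<dots> = bexp R (\<lambda>S. bexp (B j) (\<lambda>Y. bexp (B j) (\<lambda>Y'. cis (t * (f Y S - f Y' S)))))"
    proof -
      have "bexp (B j) F * cnj (bexp (B j) F) = bexp (B j) (\<lambda>Y. bexp (B j) (\<lambda>Y'. F Y * cnj (F Y')))"
        for F :: "'a set \<Rightarrow> complex"
      proof -
        have "bexp (B j) F * cnj (bexp (B j) F) = bexp (B j) (\<lambda>Y. F Y * bexp (B j) (\<lambda>Y'. cnj (F Y')))"
          by (simp only: bexp_multc bexp_cnj)
        then show ?thesis by (simp only: bexp_cmult)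
      qed
      then show ?thesis
        by (simp only: cis_cnj cis_mult diff_conv_add_uminus distrib_left mult_minus_right)
    qed
    also have "\<dots> = bexp (B j) (\<lambda>Y. bexp (B j) (\<lambda>Y'. bexp R (\<lambda>S. cis (t * (f Y S - f Y' S)))))"
      by (subst bexp_swap, subst bexp_swap[of R], rule refl)
    finally have e: "(of_real (bexp R (\<lambda>S. (norm (bexp (B j) (\<lambda>Y. cis (t * f Y S))))\<^sup>2)) :: complex) = \<dots>" .
    have "bexp R (\<lambda>S. (norm (bexp (B j) (\<lambda>Y. cis (t * f Y S))))\<^sup>2)
        \<le> norm (of_real (bexp R (\<lambda>S. (norm (bexp (B j) (\<lambda>Y. cis (t * f Y S))))\<^sup>2)) :: complex)"
      by (simp only: norm_of_real abs_ge_self)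
    also have "\<dots> \<le> bexp (B j) (\<lambda>Y. norm (bexp (B j) (\<lambda>Y'. bexp R (\<lambda>S. cis (t * (f Y S - f Y' S))))))"
      unfolding e by (rule norm_bexp_le)
    also have "\<dots> \<le> bexp (B j) (\<lambda>Y. bexp (B j) (\<lambda>Y'. norm (bexp R (\<lambda>S. cis (t * (f Y S - f Y' S))))))"
      by (intro bexp_mono norm_bexp_le)
    finally show ?thesis by (simp only: G_def f_diff)
  qed
  finally have N2: "N\<^sup>2 \<le> bexp (B j) (\<lambda>Y. bexp (B j) (\<lambda>Y'. G Y Y'))" .
  define H where "H Y Y' = norm (bexp D (\<lambda>S. cis (t *
      (\<Sum>c\<in>C. a c * (\<Prod>i\<in>insert j I. of_bool (T c \<inter> B i \<subseteq> Y) - of_bool (T c \<inter> B i \<subseteq> Y'))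
          * of_bool (T c \<inter> D \<subseteq> S)))))" for Y Y'
  have G: "G Y Y' ^ (2 ^ card I) \<le> bexp U (\<lambda>Z. bexp U (\<lambda>Z'. H (Y \<union> Z) (Y' \<union> Z')))"
    if Y: "Y \<subseteq> B j" "Y' \<subseteq> B j" for Y Y'
  proof -
    have "G Y Y' ^ (2 ^ card I) \<le> bexp U (\<lambda>Z. bexp U (\<lambda>Z'. norm (bexp D (\<lambda>S. cis (t *
        (\<Sum>c\<in>C. a' Y Y' c * (\<Prod>i\<in>I. of_bool ((T c - B j) \<inter> B i \<subseteq> Z) - of_bool ((T c - B j) \<inter> B i \<subseteq> Z'))
          * of_bool ((T c - B j) \<inter> D \<subseteq> S)))))))"
      unfolding G_def R_def U_def
    proof (rule insert.IH)
      fix c assume "c \<in> C"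
      then show "T c - B j \<subseteq> D \<union> \<Union> (B ` I)" using insert.prems(4)[of c] by auto
    qed (use insert.prems in auto)
    also have "\<dots> = bexp U (\<lambda>Z. bexp U (\<lambda>Z'. H (Y \<union> Z) (Y' \<union> Z')))"
    proof (intro bexp_cong)
      fix Z Z' assume Z: "Z \<subseteq> U" "Z' \<subseteq> U"
      have D: "(T c - B j) \<inter> D = T c \<inter> D" for c using BD by auto
      have pr: "(\<Prod>i\<in>I. of_bool ((T c - B j) \<inter> B i \<subseteq> Z) - of_bool ((T c - B j) \<inter> B i \<subseteq> Z') :: real)
         = (\<Prod>i\<in>I. of_bool (T c \<inter> B i \<subseteq> Y \<union> Z) - of_bool (T c \<inter> B i \<subseteq> Y' \<union> Z'))" for c
      proof (rule prod.cong)
        fix i assume i: "i \<in> I"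
        then have "B j \<inter> B i = {}" using insert.prems(2)[of j i] insert.hyps by auto
        then have "((T c - B j) \<inter> B i \<subseteq> Z) = (T c \<inter> B i \<subseteq> Y \<union> Z)"
          "((T c - B j) \<inter> B i \<subseteq> Z') = (T c \<inter> B i \<subseteq> Y' \<union> Z')" using Y by auto
        then show "of_bool ((T c - B j) \<inter> B i \<subseteq> Z) - of_bool ((T c - B j) \<inter> B i \<subseteq> Z')
          = (of_bool (T c \<inter> B i \<subseteq> Y \<union> Z) - of_bool (T c \<inter> B i \<subseteq> Y' \<union> Z') :: real)" by simp
      qed simp
      have "(T c \<inter> B j \<subseteq> Y \<union> Z) = (T c \<inter> B j \<subseteq> Y)" "(T c \<inter> B j \<subseteq> Y' \<union> Z') = (T c \<inter> B j \<subseteq> Y')" for c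
        using Z BU by auto
      then have "a' Y Y' c * (\<Prod>i\<in>I. of_bool ((T c - B j) \<inter> B i \<subseteq> Z) - of_bool ((T c - B j) \<inter> B i \<subseteq> Z'))
          = a c * (\<Prod>i\<in>insert j I. of_bool (T c \<inter> B i \<subseteq> Y \<union> Z) - of_bool (T c \<inter> B i \<subseteq> Y' \<union> Z'))" for c
        using insert.hyps by (simp add: a'_def pr mult.assoc)
      then show "norm (bexp D (\<lambda>S. cis (t *
        (\<Sum>c\<in>C. a' Y Y' c * (\<Prod>i\<in>I. of_bool ((T c - B j) \<inter> B i \<subseteq> Z) - of_bool ((T c - B j) \<inter> B i \<subseteq> Z'))
          * of_bool ((T c - B j) \<inter> D \<subseteq> S))))) = H (Y \<union> Z) (Y' \<union> Z')"
        by (simp only: H_def D)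
    qed
    finally show ?thesis .
  qed
  \<comment> \<open>Each block costs one squaring; the remaining power is moved inside the two
    expectations by Jensen's inequality before the induction hypothesis applies.\<close>
  have "N ^ (2 ^ card (insert j I)) = (N\<^sup>2) ^ (2 ^ card I)"
    using insert.hyps by (simp add: power_mult[symmetric])
  also have "\<dots> \<le> (bexp (B j) (\<lambda>Y. bexp (B j) (\<lambda>Y'. G Y Y'))) ^ (2 ^ card I)"
    using N2 by (intro power_mono) auto
  also have "\<dots> \<le> bexp (B j) (\<lambda>Y. (bexp (B j) (\<lambda>Y'. G Y Y')) ^ (2 ^ card I))"
    using finI by (intro bexp_power_le bexp_nonneg) (auto simp: G_def)
  also have "\<dots> \<le> bexp (B j) (\<lambda>Y. bexp (B j) (\<lambda>Y'. (G Y Y') ^ (2 ^ card I)))"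
    using finI by (intro bexp_mono bexp_power_le) (auto simp: G_def)
  also have "\<dots> \<le> bexp (B j) (\<lambda>Y. bexp (B j) (\<lambda>Y'. bexp U (\<lambda>Z. bexp U (\<lambda>Z'. H (Y \<union> Z) (Y' \<union> Z')))))"
    by (intro bexp_mono G)
  also have "\<dots> = bexp (B j) (\<lambda>Y. bexp U (\<lambda>Z. bexp (B j) (\<lambda>Y'. bexp U (\<lambda>Z'. H (Y \<union> Z) (Y' \<union> Z')))))"
    by (subst (2) bexp_swap) (rule refl)
  also have "\<dots> = bexp (B j \<union> U) (\<lambda>Y. bexp (B j \<union> U) (\<lambda>Y'. H Y Y'))"
    using finI BU by (simp only: bexp_Un)
  finally show ?case
    unfolding N_def H_def set_eq by (simp add: U_def)
qed

section \<open>Products of independent factors with sparse corrections\<close>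

lemma bexp_prod_elements:
  assumes "finite X"
  shows "bexp X (\<lambda>x. \<Prod>e\<in>x. \<omega> e) = (\<Prod>e\<in>X. complex_of_real (1 - p) + of_real p * \<omega> e)"
  using assms
proof (induction rule: finite_induct)
  case (insert e X)
  have "bexp X (\<lambda>S. \<Prod>e\<in>insert e S. \<omega> e) = bexp X (\<lambda>S. \<omega> e * (\<Prod>e\<in>S. \<omega> e))"
  proof (rule bexp_cong)
    fix S assume "S \<subseteq> X"
    then have "finite S" "e \<notin> S" using insert finite_subset by auto
    then show "(\<Prod>e\<in>insert e S. \<omega> e) = \<omega> e * (\<Prod>e\<in>S. \<omega> e)" by simp
  qed
  then have "bexp (insert e X) (\<lambda>x. \<Prod>e\<in>x. \<omega> e)
      = p *\<^sub>R (\<omega> e * bexp X (\<lambda>x. \<Prod>e\<in>x. \<omega> e)) + (1 - p) *\<^sub>R bexp X (\<lambda>x. \<Prod>e\<in>x. \<omega> e)"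
    unfolding bexp_insert[OF insert.hyps(1,2)] by (simp only: bexp_cmult)
  then show ?case using insert by (simp add: scaleR_conv_of_real algebra_simps)
qed simp

text \<open>Each nonlinear factor equals \<open>1 + (z j - 1) * of_bool (U j \<subseteq> x)\<close>; the correction only fixes the
  at most \<open>d\<close> coordinates in \<open>U j\<close> and so destroys at most \<open>d\<close> of the factors, each of which
  is at least 1/2.\<close>

lemma perturbed_product_bound:
  fixes \<omega> :: "'a \<Rightarrow> complex" and z :: "'j \<Rightarrow> complex"
  assumes "finite J" "finite X" "\<And>e. norm (\<omega> e) = 1" "\<And>j. norm (z j) = 1"
    and "\<And>j. j \<in> J \<Longrightarrow> finite (U j) \<and> card (U j) \<le> d"
  shows "norm (bexp X (\<lambda>x. (\<Prod>e\<in>x. \<omega> e) * (\<Prod>j\<in>J. if U j \<subseteq> x then z j else 1)))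
    \<le> (\<Prod>j\<in>J. 1 + 2 ^ d * norm (z j - 1)) * (\<Prod>e\<in>X. max (1/2) (norm (complex_of_real (1 - p) + of_real p * \<omega> e)))"
  using assms(1,2,5)
proof (induction arbitrary: X U rule: finite_induct)
  case empty
  then show ?case
    by (simp add: bexp_prod_elements prod_norm[symmetric]) (auto simp: prod_norm[symmetric] intro!: prod_mono)
next
  case (insert i J)
  define w where "w e = max (1/2) (norm (complex_of_real (1 - p) + of_real p * \<omega> e))" for e
  have w: "1/2 \<le> w e" "0 < w e" for e by (auto simp: w_def)
  define P where "P = (\<Prod>j\<in>J. 1 + 2 ^ d * norm (z j - 1))"
  have P: "0 \<le> P" unfolding P_def by (intro prod_nonneg) (auto intro: add_nonneg_nonneg)
  define F where "F x = (\<Prod>e\<in>x. \<omega> e) * (\<Prod>j\<in>J. if U j \<subseteq> x then z j else 1)" for x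
  have Ui: "finite (U i)" "card (U i) \<le> d" using insert.prems by auto
  have IH1: "norm (bexp X F) \<le> P * prod w X"
    using insert.IH[of X U] insert.prems by (simp add: F_def[abs_def] P_def w_def)
  have IH2: "norm (bexp X (\<lambda>x. of_bool (U i \<subseteq> x) * F x)) \<le> P * (2 ^ d * prod w X)"
  proof (cases "U i \<subseteq> X")
    case False
    have "bexp X (\<lambda>x. of_bool (U i \<subseteq> x) * F x) = bexp X (\<lambda>_. 0)"
      using False by (intro bexp_cong) auto
    also have "\<dots> = 0" using insert.prems by simp
    finally have "norm (bexp X (\<lambda>x. of_bool (U i \<subseteq> x) * F x)) = 0" by simp
    moreover have "0 \<le> P * (2 ^ d * prod w X)"
      by (intro mult_nonneg_nonneg prod_nonneg P zero_le_power) (auto intro: less_imp_le[OF w(2)])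
    ultimately show ?thesis by (simp only:)
  next
    case True
    define V where "V = X - U i"
    have fV: "finite V" using insert.prems by (simp add: V_def)
    have XV: "X = V \<union> U i" "V \<inter> U i = {}" using True by (auto simp: V_def)
    have "bexp X (\<lambda>x. of_bool (U i \<subseteq> x) * F x)
        = bexp V (\<lambda>x. bexp (U i) (\<lambda>y. of_bool (U i \<subseteq> x \<union> y) * F (x \<union> y)))"
      unfolding XV(1) using fV Ui XV by (intro bexp_Un) auto
    also have "\<dots> = bexp V (\<lambda>x. bexp (U i) (\<lambda>y. of_bool (U i \<subseteq> y)) *\<^sub>R F (x \<union> U i))"
    proof (rule bexp_cong)
      fix x assume x: "x \<subseteq> V"
      have "bexp (U i) (\<lambda>y. of_bool (U i \<subseteq> x \<union> y) * F (x \<union> y))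
         = bexp (U i) (\<lambda>y. of_bool (U i \<subseteq> y) * F (x \<union> U i))"
      proof (rule bexp_cong)
        fix y assume "y \<subseteq> U i"
        moreover have "(U i \<subseteq> x \<union> y) = (U i \<subseteq> y)" using x XV by auto
        ultimately show "of_bool (U i \<subseteq> x \<union> y) * F (x \<union> y) = of_bool (U i \<subseteq> y) * F (x \<union> U i)"
          by (cases "U i \<subseteq> y") (auto dest: subset_antisym)
      qed
      also have "\<dots> = bexp (U i) (\<lambda>y. of_bool (U i \<subseteq> y)) * F (x \<union> U i)" by (rule bexp_multc)
      also have "bexp (U i) (\<lambda>y. of_bool (U i \<subseteq> y)) = complex_of_real (bexp (U i) (\<lambda>y. of_bool (U i \<subseteq> y)))"
        by (subst bexp_of_real[symmetric], rule bexp_cong) (simp add: of_bool_def)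
      finally show "bexp (U i) (\<lambda>y. of_bool (U i \<subseteq> x \<union> y) * F (x \<union> y))
        = bexp (U i) (\<lambda>y. of_bool (U i \<subseteq> y)) *\<^sub>R F (x \<union> U i)" by (simp add: scaleR_conv_of_real)
    qed
    also have "\<dots> = p ^ card (U i) *\<^sub>R bexp V (\<lambda>x. F (x \<union> U i))"
      using Ui by (simp add: bexp_scaleR bexp_subset_indicator)
    also have "bexp V (\<lambda>x. F (x \<union> U i))
       = bexp V (\<lambda>x. (\<Prod>e\<in>U i. \<omega> e) * ((\<Prod>e\<in>x. \<omega> e) * (\<Prod>j\<in>J. if U j - U i \<subseteq> x then z j else 1)))"
    proof (rule bexp_cong)
      fix x assume x: "x \<subseteq> V"
      then have "(\<Prod>e\<in>x \<union> U i. \<omega> e) = (\<Prod>e\<in>x. \<omega> e) * (\<Prod>e\<in>U i. \<omega> e)"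
        using fV Ui XV finite_subset by (intro prod.union_disjoint) auto
      moreover have "(U j \<subseteq> x \<union> U i) = (U j - U i \<subseteq> x)" for j by auto
      ultimately show "F (x \<union> U i) = (\<Prod>e\<in>U i. \<omega> e) * ((\<Prod>e\<in>x. \<omega> e) * (\<Prod>j\<in>J. if U j - U i \<subseteq> x then z j else 1))"
        by (simp add: F_def)
    qed
    also have "\<dots> = (\<Prod>e\<in>U i. \<omega> e) * bexp V (\<lambda>x. (\<Prod>e\<in>x. \<omega> e) * (\<Prod>j\<in>J. if U j - U i \<subseteq> x then z j else 1))"
      by (rule bexp_cmult)
    also have "norm (p ^ card (U i) *\<^sub>R \<dots>)
       = p ^ card (U i) * norm (bexp V (\<lambda>x. (\<Prod>e\<in>x. \<omega> e) * (\<Prod>j\<in>J. if U j - U i \<subseteq> x then z j else 1)))"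
      using p_pos assms(3) by (simp add: norm_mult prod_norm[symmetric])
    also have "\<dots> \<le> 1 * norm (bexp V (\<lambda>x. (\<Prod>e\<in>x. \<omega> e) * (\<Prod>j\<in>J. if U j - U i \<subseteq> x then z j else 1)))"
      using p_pos p_less_1 by (intro mult_right_mono power_le_one) auto
    also have "\<dots> \<le> P * prod w V"
    proof -
      have "finite (U j - U i) \<and> card (U j - U i) \<le> d" if "j \<in> J" for j
        using insert.prems(2)[of j] that by (auto intro: order_trans[OF card_mono[of "U j" "U j - U i"]])
      then show ?thesis using insert.IH[of V "\<lambda>j. U j - U i"] fV by (simp add: P_def w_def)
    qed
    also have "prod w V \<le> 2 ^ d * prod w X"
    proof -
      have "(1/2) ^ card (U i) = (\<Prod>e\<in>U i. 1/2 :: real)" by simp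
      also have "\<dots> \<le> prod w (U i)" using w by (intro prod_mono) auto
      finally have "1 \<le> 2 ^ card (U i) * prod w (U i)" by (simp add: power_one_over field_simps)
      also have "\<dots> \<le> 2 ^ d * prod w (U i)"
        using Ui w by (intro mult_right_mono power_increasing prod_nonneg) (auto intro: less_imp_le)
      finally have "prod w V * 1 \<le> prod w V * (2 ^ d * prod w (U i))"
        using w by (intro mult_left_mono prod_nonneg) (auto intro: less_imp_le)
      moreover have "prod w X = prod w V * prod w (U i)"
        unfolding XV(1) using fV Ui XV by (intro prod.union_disjoint) auto
      ultimately show ?thesis by (simp add: mult_ac)
    qed
    finally show ?thesis using P by (simp add: mult_left_mono)
  qed
  have "bexp X (\<lambda>x. (\<Prod>e\<in>x. \<omega> e) * (\<Prod>j\<in>insert i J. if U j \<subseteq> x then z j else 1))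
     = bexp X (\<lambda>x. F x + (z i - 1) * (of_bool (U i \<subseteq> x) * F x))"
    using insert.hyps by (intro bexp_cong) (auto simp: F_def algebra_simps)
  also have "\<dots> = bexp X F + (z i - 1) * bexp X (\<lambda>x. of_bool (U i \<subseteq> x) * F x)"
    by (simp only: bexp_add bexp_cmult)
  also have "norm \<dots> \<le> P * prod w X + norm (z i - 1) * (P * (2 ^ d * prod w X))"
    by (intro order_trans[OF norm_triangle_ineq] add_mono IH1)
      (auto simp: norm_mult intro!: mult_left_mono IH2)
  also have "\<dots> = (1 + 2 ^ d * norm (z i - 1)) * P * prod w X" by (simp add: algebra_simps)
  finally show ?case using insert.hyps by (simp add: P_def w_def)
qed

text \<open>The squared modulus is 1 - 2 p (1 - p) (1 - cos \<theta>). The floor 1/2, which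
  \<open>perturbed_product_bound\<close> requires, is compatible with the bound because p (1 - p) (1
  - cos \<theta>) <= 1/2.\<close>

lemma bernoulli_factor_bound:
  "max (1/2) (norm (complex_of_real (1 - p) + of_real p * cis \<theta>)) \<le> exp (- (p * (1 - p) * (1 - cos \<theta>)))"
proof -
  define v where "v = p * (1 - p) * (1 - cos \<theta>)"
  have pq: "p * (1 - p) \<le> 1 / 4" using zero_le_power2[of "p - 1/2"] by (simp add: power2_eq_square algebra_simps)
  have "p * (1 - p) * (1 - cos \<theta>) \<le> (1/4) * 2"
    using pq p_pos p_less_1 cos_ge_minus_one[of \<theta>] by (intro mult_mono) auto
  then have v: "v \<le> 1/2" by (simp add: v_def)
  have "1/2 \<le> 1 + (- v)" using v by simp
  also have "\<dots> \<le> exp (- v)" by (rule exp_ge_add_one_self)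
  finally have 1: "1/2 \<le> exp (- v)" .
  have "(norm (complex_of_real (1 - p) + of_real p * cis \<theta>))\<^sup>2 = (1 - p + p * cos \<theta>)\<^sup>2 + (p * sin \<theta>)\<^sup>2"
    by (simp add: cmod_power2)
  also have "\<dots> = (1 - p)\<^sup>2 + 2 * p * (1 - p) * cos \<theta> + p\<^sup>2 * ((sin \<theta>)\<^sup>2 + (cos \<theta>)\<^sup>2)"
    by algebra
  also have "\<dots> = 1 + (- 2 * v)" by (simp only: sin_cos_squared_add) (simp add: v_def power2_eq_square algebra_simps)
  also have "\<dots> \<le> exp (- 2 * v)" by (rule exp_ge_add_one_self)
  also have "\<dots> = (exp (- v))\<^sup>2" by (simp add: exp_double[symmetric])
  finally have "norm (complex_of_real (1 - p) + of_real p * cis \<theta>) \<le> exp (- v)"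
    by (rule power2_le_imp_le) simp
  with 1 show ?thesis by (simp add: v_def)
qed

lemma norm_cis_minus_1_square: "(norm (cis x - 1))\<^sup>2 = 2 * (1 - cos x)"
proof -
  have "(norm (cis x - 1))\<^sup>2 = (cos x - 1)\<^sup>2 + (sin x)\<^sup>2" by (simp add: cmod_power2)
  also have "\<dots> = ((sin x)\<^sup>2 + (cos x)\<^sup>2) + 1 - 2 * cos x"
    by (simp only: power2_eq_square) (simp add: algebra_simps)
  finally show ?thesis by (simp only: sin_cos_squared_add) simp
qed

lemma norm_cis_minus_1_le: "norm (cis x - 1) \<le> \<bar>x\<bar>"
proof (rule power2_le_imp_le)
  have "cos x = 1 - 2 * (sin (x / 2))\<^sup>2" using cos_double_sin[of "x / 2"] by simp
  then have "(norm (cis x - 1))\<^sup>2 = 4 * (sin (x / 2))\<^sup>2" by (simp add: norm_cis_minus_1_square)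
  also have "\<dots> \<le> 4 * \<bar>x / 2\<bar>\<^sup>2"
    using abs_sin_x_le_abs_x[of "x / 2"] by (intro mult_left_mono) (auto simp: abs_le_square_iff[symmetric])
  finally show "(norm (cis x - 1))\<^sup>2 \<le> \<bar>x\<bar>\<^sup>2" by (simp add: power_divide)
qed simp

end

section \<open>Oscillation and anticoncentration\<close>

context bernoulli
begin

text \<open>The constant part of the polynomial is a fixed phase, the linear part yields a product
  of independent factors, and each term of higher degree perturbs that product by a factor of at
  most 1 + 2^d |t b|. The bound is useful when the nonlinear coefficients are small in
  total.\<close>

lemma oscillation_bound:
  fixes U :: "'c \<Rightarrow> 'a set" and b :: "'c \<Rightarrow> real" and t :: real
  assumes "finite X" "finite C" "\<And>c. c \<in> C \<Longrightarrow> U c \<subseteq> X" "\<And>c. c \<in> C \<Longrightarrow> card (U c) \<le> d"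
  shows "norm (bexp X (\<lambda>x. cis (t * (\<Sum>c\<in>C. b c * of_bool (U c \<subseteq> x)))))
    \<le> exp (2 ^ d * (\<bar>t\<bar> * (\<Sum>c | c \<in> C \<and> 2 \<le> card (U c). \<bar>b c\<bar>))
         - p * (1 - p) * (\<Sum>e\<in>X. 1 - cos (t * (\<Sum>c | c \<in> C \<and> U c = {e}. b c))))"
proof -
  define C0 C1 C2 where "C0 = {c \<in> C. U c = {}}" and "C1 = {c \<in> C. card (U c) = 1}"
    and "C2 = {c \<in> C. 2 \<le> card (U c)}"
  have fU: "finite (U c)" if "c \<in> C" for c using assms(1,3) that finite_subset by blast
  have "U c = {} \<or> card (U c) = 1 \<or> 2 \<le> card (U c)" if "c \<in> C" for c
    using fU[OF that] card_gt_0_iff[of "U c"] by linarith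
  then have CC: "C = (C0 \<union> C1) \<union> C2"
    unfolding C0_def C1_def C2_def by blast
  have disj: "C0 \<inter> C1 = {}" "(C0 \<union> C1) \<inter> C2 = {}" by (auto simp: C0_def C1_def C2_def)
  have fin: "finite C0" "finite C1" "finite C2" using assms(2) by (auto simp: C0_def C1_def C2_def)
  define ce where "ce e = (\<Sum>c | c \<in> C \<and> U c = {e}. b c)" for e
  have C1_sum: "(\<Sum>c\<in>C1. b c * of_bool (U c \<subseteq> x)) = (\<Sum>e\<in>x. ce e)" if x: "x \<subseteq> X" for x
  proof -
    have fx: "finite x" using x assms(1) finite_subset by auto
    have "(\<Sum>e\<in>x. ce e) = (\<Sum>e\<in>x. \<Sum>c | c \<in> C1 \<and> U c = {e}. b c)"
      unfolding ce_def by (intro sum.cong) (auto simp: C1_def)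
    also have "\<dots> = (\<Sum>e\<in>x. \<Sum>c\<in>C1. if U c = {e} then b c else 0)"
      using fin by (simp add: sum.inter_filter)
    also have "\<dots> = (\<Sum>c\<in>C1. \<Sum>e\<in>x. if U c = {e} then b c else 0)" by (rule sum.swap)
    also have "\<dots> = (\<Sum>c\<in>C1. b c * of_bool (U c \<subseteq> x))"
    proof (rule sum.cong)
      fix c assume "c \<in> C1"
      then obtain e where e: "U c = {e}" by (auto simp: C1_def card_1_singleton_iff)
      then show "(\<Sum>e\<in>x. if U c = {e} then b c else 0) = b c * of_bool (U c \<subseteq> x)"
        using fx by (auto simp: sum.delta)
    qed simp
    finally show ?thesis ..
  qed
  have split: "sum f C = sum f C0 + sum f C1 + sum f C2" for f :: "'c \<Rightarrow> real"
  proof -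
    have "sum f C = sum f ((C0 \<union> C1) \<union> C2)" using CC by simp
    then show ?thesis using disj fin by (simp add: sum.union_disjoint)
  qed
  define s0 where "s0 = (\<Sum>c\<in>C0. b c)"
  have cis_sum: "cis (\<Sum>i\<in>I. f i) = (\<Prod>i\<in>I. cis (f i))" for f :: "'i \<Rightarrow> real" and I
    by (induction I rule: infinite_finite_induct) (auto simp: cis_mult[symmetric])
  have "bexp X (\<lambda>x. cis (t * (\<Sum>c\<in>C. b c * of_bool (U c \<subseteq> x))))
     = bexp X (\<lambda>x. cis (t * s0) * ((\<Prod>e\<in>x. cis (t * ce e)) * (\<Prod>c\<in>C2. if U c \<subseteq> x then cis (t * b c) else 1)))"
  proof (rule bexp_cong)
    fix x assume x: "x \<subseteq> X"
    have "(\<Sum>c\<in>C. b c * of_bool (U c \<subseteq> x))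
      = (\<Sum>c\<in>C0. b c * of_bool (U c \<subseteq> x)) + (\<Sum>c\<in>C1. b c * of_bool (U c \<subseteq> x)) + (\<Sum>c\<in>C2. b c * of_bool (U c \<subseteq> x))"
      by (rule split)
    also have "(\<Sum>c\<in>C0. b c * of_bool (U c \<subseteq> x)) = s0" by (simp add: s0_def C0_def)
    finally have e: "(\<Sum>c\<in>C. b c * of_bool (U c \<subseteq> x))
       = s0 + (\<Sum>e\<in>x. ce e) + (\<Sum>c\<in>C2. b c * of_bool (U c \<subseteq> x))" by (simp only: C1_sum[OF x])
    have "cis (t * (\<Sum>c\<in>C. b c * of_bool (U c \<subseteq> x)))
      = cis (t * s0) * ((\<Prod>e\<in>x. cis (t * ce e)) * (\<Prod>c\<in>C2. cis (t * (b c * of_bool (U c \<subseteq> x)))))"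
      unfolding e by (simp add: distrib_left cis_mult[symmetric] sum_distrib_left cis_sum mult_ac)
    also have "(\<Prod>c\<in>C2. cis (t * (b c * of_bool (U c \<subseteq> x)))) = (\<Prod>c\<in>C2. if U c \<subseteq> x then cis (t * b c) else 1)"
      by (intro prod.cong) auto
    finally show "cis (t * (\<Sum>c\<in>C. b c * of_bool (U c \<subseteq> x)))
      = cis (t * s0) * ((\<Prod>e\<in>x. cis (t * ce e)) * (\<Prod>c\<in>C2. if U c \<subseteq> x then cis (t * b c) else 1))" .
  qed
  then have "norm (bexp X (\<lambda>x. cis (t * (\<Sum>c\<in>C. b c * of_bool (U c \<subseteq> x)))))
    = norm (bexp X (\<lambda>x. (\<Prod>e\<in>x. cis (t * ce e)) * (\<Prod>c\<in>C2. if U c \<subseteq> x then cis (t * b c) else 1)))"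
    by (simp only: bexp_cmult norm_mult norm_cis mult_1)
  also have "\<dots> \<le> (\<Prod>c\<in>C2. 1 + 2 ^ d * norm (cis (t * b c) - 1))
      * (\<Prod>e\<in>X. max (1/2) (norm (complex_of_real (1 - p) + of_real p * cis (t * ce e))))"
    using assms fin fU by (intro perturbed_product_bound) (auto simp: C2_def)
  also have "\<dots> \<le> (\<Prod>c\<in>C2. exp (2 ^ d * (\<bar>t\<bar> * \<bar>b c\<bar>))) * (\<Prod>e\<in>X. exp (- (p * (1 - p) * (1 - cos (t * ce e)))))"
  proof (intro mult_mono prod_mono conjI bernoulli_factor_bound prod_nonneg)
    fix c assume "c \<in> C2"
    have "1 + 2 ^ d * norm (cis (t * b c) - 1) \<le> 1 + 2 ^ d * (\<bar>t\<bar> * \<bar>b c\<bar>)"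
      using norm_cis_minus_1_le[of "t * b c"] by (simp add: abs_mult)
    also have "\<dots> \<le> exp (2 ^ d * (\<bar>t\<bar> * \<bar>b c\<bar>))" by (rule exp_ge_add_one_self)
    finally show "1 + 2 ^ d * norm (cis (t * b c) - 1) \<le> exp (2 ^ d * (\<bar>t\<bar> * \<bar>b c\<bar>))" .
  qed (auto intro: add_nonneg_nonneg)
  also have "\<dots> = exp (2 ^ d * (\<bar>t\<bar> * (\<Sum>c\<in>C2. \<bar>b c\<bar>))) * exp (- (p * (1 - p) * (\<Sum>e\<in>X. 1 - cos (t * ce e))))"
    using fin assms(1) by (simp add: exp_sum[symmetric] sum_distrib_left sum_negf)
  finally show ?thesis by (simp add: C2_def ce_def exp_add[symmetric])
qed

end

text \<open>Induction by deleting a point: the members of the family that avoid x form an antichain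
  in A - {x}, and averaging over x recovers the weights, since (N + 1 - k) C(N + 1, k) = (N + 1)
  C(N, k). The averaging fails only for the member A itself, which is then the whole
  antichain.\<close>

lemma LYM_inequality:
  fixes \<A> :: "'a set set"
  assumes "finite A" "\<A> \<subseteq> Pow A" "\<And>S S'. S \<in> \<A> \<Longrightarrow> S' \<in> \<A> \<Longrightarrow> S \<subseteq> S' \<Longrightarrow> S = S'"
  shows "(\<Sum>S\<in>\<A>. 1 / real (card A choose card S)) \<le> 1"
  using assms
proof (induction "card A" arbitrary: A \<A>)
  case 0
  then have "\<A> \<subseteq> {{}}" by auto
  then have "\<A> = {} \<or> \<A> = {{}}" by auto
  then show ?case using 0 by auto
next
  case (Suc N)
  show ?case
  proof (cases "A \<in> \<A>")
    case True
    then have "\<A> = {A}" using Suc.prems by blast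
    then show ?thesis by simp
  next
    case False
    have fin: "finite \<A>" using Suc.prems(1,2) finite_subset by blast
    have N: "card A = Suc N" "finite A" using Suc by auto
    have step: "1 / real (card A choose card S) = (\<Sum>x\<in>A. if x \<in> S then 0 else 1 / real (N choose card S)) / Suc N"
      if S: "S \<in> \<A>" for S
    proof -
      have SA: "S \<subseteq> A" "S \<noteq> A" using S Suc.prems False by auto
      then have lt: "card S < Suc N" using psubset_card_mono[of A S] N by auto
      have cd: "card (A - S) = Suc N - card S" using SA N by (simp add: card_Diff_subset finite_subset)
      have "(\<Sum>x\<in>A. if x \<in> S then 0 else 1 / real (N choose card S)) = (\<Sum>x\<in>A - S. 1 / real (N choose card S))"
        using N by (intro sum.mono_neutral_cong_right) auto
      also have "\<dots> = (Suc N - card S) / (N choose card S)" by (simp add: cd)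
      finally have e: "(\<Sum>x\<in>A. if x \<in> S then 0 else 1 / real (N choose card S)) = (Suc N - card S) / (N choose card S)" .
      have "(Suc N - card S) * (Suc N choose card S) = Suc N * (N choose card S)"
        using binomial_absorb_comp[of "Suc N" "card S"] by simp
      then have "real (Suc N - card S) * (Suc N choose card S) = real (Suc N) * (N choose card S)"
        by (metis of_nat_mult)
      moreover have "0 < real (Suc N choose card S)" "0 < real (N choose card S)" using lt by auto
      moreover have "1 / x = k / y / n" if "k * x = n * y" "0 < x" "0 < y" "0 < n" for k x n y :: real
        using that by (simp add: field_simps)
      ultimately show ?thesis unfolding e N by (metis of_nat_0_less_iff zero_less_Suc)
    qed
    have "(\<Sum>S\<in>\<A>. 1 / real (card A choose card S))
       = (\<Sum>S\<in>\<A>. (\<Sum>x\<in>A. if x \<in> S then 0 else 1 / real (N choose card S)) / Suc N)"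
      by (intro sum.cong step) auto
    also have "\<dots> = (\<Sum>S\<in>\<A>. \<Sum>x\<in>A. if x \<in> S then 0 else 1 / real (N choose card S)) / Suc N"
      by (simp only: sum_divide_distrib)
    also have "(\<Sum>S\<in>\<A>. \<Sum>x\<in>A. if x \<in> S then 0 else 1 / real (N choose card S))
       = (\<Sum>x\<in>A. \<Sum>S\<in>\<A>. if x \<in> S then 0 else 1 / real (N choose card S))" by (rule sum.swap)
    also have "\<dots> \<le> (\<Sum>x\<in>A. 1)"
    proof (rule sum_mono)
      fix x assume x: "x \<in> A"
      have "(\<Sum>S\<in>\<A>. if x \<in> S then 0 else 1 / real (N choose card S))
         = (\<Sum>S | S \<in> \<A> \<and> x \<notin> S. 1 / real (N choose card S))"
        using fin by (subst sum.inter_filter) (auto intro: sum.cong)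
      also have "\<dots> = (\<Sum>S\<in>{S \<in> \<A>. x \<notin> S}. 1 / real (card (A - {x}) choose card S))"
        using x N by simp
      also have "\<dots> \<le> 1"
        using x N Suc.prems by (intro Suc.hyps(1)) auto
      finally show "(\<Sum>S\<in>\<A>. if x \<in> S then 0 else 1 / real (N choose card S)) \<le> 1" .
    qed
    also have "\<dots> = Suc N" using N by simp
    finally show ?thesis by (simp add: divide_right_mono)
  qed
qed

section \<open>Antichains and the largest binomial probability\<close>

context bernoulli
begin

text \<open>The weight of a set of size k is the binomial point probability of k divided by C(N, k),
  hence at most \<open>\<beta>\<close> times the weight in the LYM inequality.\<close>

lemma antichain_probability:
  assumes "finite A" "\<A> \<subseteq> Pow A" "\<And>S S'. S \<in> \<A> \<Longrightarrow> S' \<in> \<A> \<Longrightarrow> S \<subseteq> S' \<Longrightarrow> S = S'"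
    and \<beta>: "\<And>k. k \<le> card A \<Longrightarrow> (card A choose k) * p ^ k * (1 - p) ^ (card A - k) \<le> \<beta>"
  shows "bexp A (\<lambda>S. of_bool (S \<in> \<A>)) \<le> \<beta>"
proof -
  have fin: "finite \<A>" using assms(1,2) finite_subset by blast
  have "0 \<le> \<beta>" using order_trans[OF _ \<beta>[of 0]] p_less_1 by simp
  have "bexp A (\<lambda>S. of_bool (S \<in> \<A>) :: real) = (\<Sum>S\<in>\<A>. p ^ card S * (1 - p) ^ card (A - S))"
    unfolding bexp_def using assms(1,2) by (intro sum.mono_neutral_cong_right) auto
  also have "\<dots> \<le> (\<Sum>S\<in>\<A>. \<beta> * (1 / real (card A choose card S)))"
  proof (rule sum_mono)
    fix S assume "S \<in> \<A>"
    then have S: "S \<subseteq> A" using assms(2) by auto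
    then have k: "card S \<le> card A" using assms(1) by (simp add: card_mono)
    have "card (A - S) = card A - card S" using S assms(1) by (simp add: card_Diff_subset finite_subset)
    moreover have "0 < real (card A choose card S)" using k by simp
    ultimately show "p ^ card S * (1 - p) ^ card (A - S) \<le> \<beta> * (1 / real (card A choose card S))"
      using \<beta>[OF k] by (simp add: field_simps)
  qed
  also have "\<dots> = \<beta> * (\<Sum>S\<in>\<A>. 1 / real (card A choose card S))" by (rule sum_distrib_left[symmetric])
  also have "\<dots> \<le> \<beta> * 1" using LYM_inequality[OF assms(1-3)] \<open>0 \<le> \<beta>\<close> by (intro mult_left_mono) auto
  finally show ?thesis by simp
qed

text \<open>The sets \<open>S\<close> with \<open>f S\<close> in a short interval, from which every further element
  increases \<open>f\<close> beyond the interval, form an antichain.\<close>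

lemma monotone_small_ball:
  fixes f :: "'a set \<Rightarrow> real"
  assumes "finite A" and mono: "\<And>S S'. S \<subseteq> S' \<Longrightarrow> S' \<subseteq> A \<Longrightarrow> f S \<le> f S'"
    and \<beta>: "\<And>k. k \<le> card A \<Longrightarrow> (card A choose k) * p ^ k * (1 - p) ^ (card A - k) \<le> \<beta>"
  shows "bexp A (\<lambda>S. of_bool (y \<le> f S \<and> f S < y + l)) \<le> \<beta> + bexp A (\<lambda>S. of_bool (\<exists>e\<in>A - S. f (insert e S) < f S + l))"
proof -
  define \<A> where "\<A> = {S \<in> Pow A. y \<le> f S \<and> f S < y + l \<and> (\<forall>e\<in>A - S. f S + l \<le> f (insert e S))}"
  have anti: "S = S'" if "S \<in> \<A>" "S' \<in> \<A>" and sub: "S \<subseteq> S'" for S S'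
  proof (rule ccontr)
    assume "S \<noteq> S'"
    then obtain e where e: "e \<in> S'" "e \<notin> S" using sub by (metis subsetI subset_antisym)
    have "S' \<subseteq> A" using that by (auto simp: \<A>_def)
    then have "f (insert e S) \<le> f S'" using e that by (intro mono) auto
    moreover have "f S + l \<le> f (insert e S)" using that e \<open>S' \<subseteq> A\<close> by (auto simp: \<A>_def)
    ultimately show False using that by (auto simp: \<A>_def)
  qed
  have "bexp A (\<lambda>S. of_bool (y \<le> f S \<and> f S < y + l))
     \<le> bexp A (\<lambda>S. of_bool (S \<in> \<A>) + of_bool (\<exists>e\<in>A - S. f (insert e S) < f S + l) :: real)"
    by (intro bexp_mono) (auto simp: \<A>_def not_less)
  also have "\<dots> = bexp A (\<lambda>S. of_bool (S \<in> \<A>)) + bexp A (\<lambda>S. of_bool (\<exists>e\<in>A - S. f (insert e S) < f S + l))"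
    by (rule bexp_add)
  also have "bexp A (\<lambda>S. of_bool (S \<in> \<A>)) \<le> \<beta>"
    by (rule antichain_probability[OF assms(1) _ anti \<beta>]) (auto simp: \<A>_def)
  finally show ?thesis by simp
qed

text \<open>Starting from its maximum, the binomial distribution decays so slowly that about
  \<open>sqrt N\<close> consecutive values are within a factor 2 of the maximum.\<close>

lemma binomial_point_bound:
  assumes "1 \<le> N" "k \<le> N"
  shows "(N choose k) * p ^ k * (1 - p) ^ (N - k) \<le> 2 * sqrt 2 / sqrt (p * (1 - p)) / sqrt N"
proof -
  define q where "q = 1 - p"
  have q: "0 < q" "q < 1" "p + q = 1" using p_pos p_less_1 by (auto simp: q_def)
  define b where "b k = (if k \<le> N then real (N choose k) * p ^ k * q ^ (N - k) else 0)" for k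
  have b0: "0 \<le> b k" for k using p_pos q by (simp add: b_def)
  have bpos: "0 < b k" if "k \<le> N" for k using p_pos q that by (simp add: b_def)
  have rec: "b (Suc k) * (real (Suc k) * q) = b k * (real (N - k) * p)" for k
  proof (cases "k < N")
    case True
    have "Suc k * (N choose Suc k) = (N - k) * (N choose k)"
      using binomial_absorption[of k N] binomial_absorb_comp[of N k] by simp
    then have c: "real (Suc k) * real (N choose Suc k) = real (N - k) * real (N choose k)" by (metis of_nat_mult)
    have "N - k = Suc (N - Suc k)" using True by simp
    then have qk: "q ^ (N - k) = q * q ^ (N - Suc k)" by simp
    have "b (Suc k) * (real (Suc k) * q) = (real (Suc k) * real (N choose Suc k)) * p ^ Suc k * (q * q ^ (N - Suc k))"
      using True by (simp add: b_def)
    also have "\<dots> = b k * (real (N - k) * p)"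
      unfolding c using True by (simp add: b_def qk)
    finally show ?thesis .
  next
    case False
    then show ?thesis by (simp add: b_def)
  qed
  have sum1: "(\<Sum>k\<le>N. b k) = 1"
    using binomial_ring[of p q N] q by (simp add: b_def mult.assoc)
  obtain m where m: "m \<le> N" "\<And>k. k \<le> N \<Longrightarrow> b k \<le> b m"
  proof -
    have "Max (b ` {..N}) \<in> b ` {..N}" by (intro Max_in) auto
    then obtain m where "Max (b ` {..N}) = b m" "m \<in> {..N}" by (rule imageE)
    then show ?thesis using that[of m] Max_ge[of "b ` {..N}"] by (metis atMost_iff finite_atMost finite_imageI imageI)
  qed
  then have bm: "b k \<le> b m" for k using b0[of m] by (cases "k \<le> N") (auto simp: b_def)
  have bmpos: "0 < b m" using m bpos by simp
  \<comment> \<open>Comparing the mode \<open>m\<close> with its two neighbours locates it within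
    distance 1 of N p.\<close>
  have lower: "real N * p \<le> real m + q"
  proof -
    have "b m * (real (N - m) * p) \<le> b m * (real (Suc m) * q)"
      unfolding rec[symmetric] using bm q by (intro mult_right_mono) auto
    then have "real (N - m) * p \<le> real (Suc m) * q" using bmpos by simp
    then have "real N * p - m * p \<le> m * q + q" using m by (simp add: of_nat_diff algebra_simps)
    moreover have "m * p + m * q = m" using q by (simp add: distrib_left[symmetric])
    ultimately show ?thesis by linarith
  qed
  have upper: "real m \<le> real N * p + p"
  proof (cases m)
    case 0
    then show ?thesis using p_pos by simp
  next
    case (Suc j)
    have "b m * (real m * q) \<le> b m * (real (N - j) * p)"
      using rec[of j] bm[of j] p_pos by (simp add: Suc mult_right_mono)
    then have "real m * q \<le> real (N - j) * p" using bmpos by simp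
    then have "m * q \<le> real N * p - m * p + p" using m Suc by (simp add: of_nat_diff algebra_simps)
    moreover have "m * p + m * q = m" using q by (simp add: distrib_left[symmetric])
    ultimately show ?thesis by linarith
  qed
  define v where "v = real N * p * q"
  have v: "0 < v" using assms p_pos q by (simp add: v_def)
  \<comment> \<open>Each ratio of consecutive terms beyond the mode is at least 1 - (i + 1) / v. The
    induction closes because i^2 + (i + 1) <= (i + 1)^2.\<close>
  have slow: "b m * (1 - (real i)\<^sup>2 / v) \<le> b (m + i)" if "(real i)\<^sup>2 \<le> v" for i
    using that
  proof (induction i)
    case (Suc i)
    have iv: "(real i)\<^sup>2 \<le> v" "real (Suc i) \<le> v"
    proof -
      have "(real i)\<^sup>2 \<le> (real (Suc i))\<^sup>2" by (intro power_mono) auto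
      then show "(real i)\<^sup>2 \<le> v" using Suc.prems by (rule order_trans)
      have "real (Suc i) ^ 1 \<le> (real (Suc i))\<^sup>2" by (rule power_increasing) auto
      also have "\<dots> \<le> v" by (rule Suc.prems)
      finally show "real (Suc i) \<le> v" by simp
    qed
    define D where "D = real (Suc (m + i)) * q"
    have D: "0 < D" "v \<le> D"
    proof -
      show "0 < D" using q by (simp add: D_def)
      have "real N * p \<le> real (Suc (m + i))" using lower q by simp
      then show "v \<le> D" unfolding v_def D_def using q by (intro mult_right_mono) auto
    qed
    have "D - (real N - real (m + i)) * p = real (m + i) * (p + q) + q - real N * p"
      by (simp add: D_def algebra_simps)
    also have "\<dots> \<le> real (Suc i)" using upper q by simp
    finally have D1: "D - real (Suc i) \<le> (real N - real (m + i)) * p" by simp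
    have "D * (1 - s / v) \<le> D - s" if "0 \<le> s" for s
    proof -
      have "s / v * v \<le> s / v * D" using D v that by (intro mult_left_mono) auto
      moreover have "s / v * v = s" using v by simp
      moreover have "D * (1 - s / v) = D - s / v * D" by (simp add: right_diff_distrib)
      ultimately show ?thesis by linarith
    qed
    then have D2: "D * (1 - real (Suc i) / v) \<le> D - real (Suc i)" by simp
    have r: "D * (1 - real (Suc i) / v) \<le> real (N - (m + i)) * p"
    proof -
      have "(real N - real (m + i)) * p \<le> real (N - (m + i)) * p"
        using p_pos by (intro mult_right_mono) auto
      with D1 D2 show ?thesis by linarith
    qed
    have "b m * (1 - (real (Suc i))\<^sup>2 / v) \<le> b m * ((1 - (real i)\<^sup>2 / v) * (1 - real (Suc i) / v))"
    proof (rule mult_left_mono)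
      have "(1 - (real i)\<^sup>2 / v) * (1 - real (Suc i) / v) = 1 - (real i)\<^sup>2 / v - real (Suc i) / v + (real i)\<^sup>2 / v * (real (Suc i) / v)"
      proof -
        have "(1 - x) * (1 - y) = 1 - x - y + x * y" for x y :: real by (simp add: algebra_simps)
        then show ?thesis .
      qed
      moreover have "0 \<le> (real i)\<^sup>2 / v * (real (Suc i) / v)" using v by simp
      moreover have "(real i)\<^sup>2 / v + real (Suc i) / v \<le> (real (Suc i))\<^sup>2 / v"
        using v by (simp add: add_divide_distrib[symmetric] divide_right_mono power2_eq_square algebra_simps)
      ultimately show "1 - (real (Suc i))\<^sup>2 / v \<le> (1 - (real i)\<^sup>2 / v) * (1 - real (Suc i) / v)" by linarith
    qed (rule b0)
    also have "\<dots> = (b m * (1 - (real i)\<^sup>2 / v)) * (1 - real (Suc i) / v)" by simp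
    also have "\<dots> \<le> b (m + i) * (1 - real (Suc i) / v)"
      using Suc.IH[OF iv(1)] iv(2) v by (intro mult_right_mono) auto
    also have "\<dots> \<le> b (m + Suc i)"
    proof -
      have "b (m + i) * (1 - real (Suc i) / v) * D \<le> b (m + i) * (real (N - (m + i)) * p)"
        using mult_left_mono[OF r b0[of "m + i"]] by (simp add: mult_ac)
      also have "\<dots> = b (m + Suc i) * D" using rec[of "m + i"] by (simp add: D_def)
      finally show ?thesis using D by simp
    qed
    finally show ?case .
  qed simp
  \<comment> \<open>Up to this index i^2 / v is at most 1/2, so M + 1 values are at least half of
    the maximum, while all values sum to 1.\<close>
  define M where "M = nat \<lfloor>sqrt (v / 2)\<rfloor>"
  have M: "real M \<le> sqrt (v / 2)" "sqrt (v / 2) \<le> real (Suc M)" 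
  proof -
    have "real (nat \<lfloor>x\<rfloor>) \<le> x \<and> x \<le> real (Suc (nat \<lfloor>x\<rfloor>))" if "0 \<le> x" for x :: real
    proof -
      have "real (nat \<lfloor>x\<rfloor>) = of_int \<lfloor>x\<rfloor>" using that by simp
      then show ?thesis using real_of_int_floor_add_one_ge[of x] of_int_floor_le[of x] by linarith
    qed
    then show "real M \<le> sqrt (v / 2)" "sqrt (v / 2) \<le> real (Suc M)"
      unfolding M_def using v by (metis divide_nonneg_pos less_imp_le real_sqrt_ge_zero zero_less_numeral)+
  qed
  have half: "b m / 2 \<le> b (m + i)" if "i \<le> M" for i
  proof -
    have "real i \<le> sqrt (v / 2)" using that M by linarith
    then have "(real i)\<^sup>2 \<le> (sqrt (v / 2))\<^sup>2" by (intro power_mono) auto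
    then have i: "(real i)\<^sup>2 \<le> v / 2" using v by simp
    then have "1/2 \<le> 1 - (real i)\<^sup>2 / v" using v by (simp add: field_simps)
    then have "b m * (1/2) \<le> b m * (1 - (real i)\<^sup>2 / v)" by (intro mult_left_mono b0)
    also have "\<dots> \<le> b (m + i)" using i v by (intro slow) auto
    finally show ?thesis by simp
  qed
  have "real (Suc M) * (b m / 2) = (\<Sum>i\<le>M. b m / 2)" by simp
  also have "\<dots> \<le> (\<Sum>i\<le>M. b (m + i))" using half by (intro sum_mono) auto
  also have "\<dots> = (\<Sum>j\<in>(\<lambda>i. m + i) ` {..M}. b j)" by (subst sum.reindex) auto
  also have "\<dots> \<le> (\<Sum>j\<in>{..N} \<union> (\<lambda>i. m + i) ` {..M}. b j)" by (intro sum_mono2) (auto simp: b0)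
  also have "\<dots> = (\<Sum>j\<le>N. b j)" by (intro sum.mono_neutral_right) (auto simp: b_def)
  finally have "real (Suc M) * (b m / 2) \<le> 1" by (simp only: sum1)
  moreover have "sqrt (v / 2) * (b m / 2) \<le> real (Suc M) * (b m / 2)" using M b0 by (intro mult_right_mono) auto
  ultimately have "sqrt (v / 2) * (b m / 2) \<le> 1" by linarith
  then have "b m \<le> 2 / sqrt (v / 2)" using v by (simp add: field_simps)
  also have "\<dots> = 2 * sqrt 2 / sqrt (p * q) / sqrt N"
    by (simp add: v_def real_sqrt_divide real_sqrt_mult)
  finally show ?thesis using bm[of k] assms by (simp add: b_def q_def)
qed

end

section \<open>Counting embeddings of a pattern\<close>

definition all_edges :: "nat \<Rightarrow> nat set set" where
  "all_edges n = {e. e \<subseteq> {..<n} \<and> card e = 2}"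

text \<open>Pattern vertices are the numbers below h, so an enumeration of the vertices of H turns
  the roles of the construction into initial segments.\<close>

definition embs :: "nat \<Rightarrow> nat \<Rightarrow> (nat \<Rightarrow> nat) set" where
  "embs h n = {\<psi> \<in> {..<h} \<rightarrow>\<^sub>E {..<n}. inj_on \<psi> {..<h}}"

definition image_edges :: "nat set set \<Rightarrow> (nat \<Rightarrow> nat) \<Rightarrow> nat set set" where
  "image_edges E \<psi> = (\<lambda>e. \<psi> ` e) ` E"

definition emb_count :: "nat \<Rightarrow> nat set set \<Rightarrow> nat \<Rightarrow> nat set set \<Rightarrow> nat" where
  "emb_count h E n S = card {\<psi> \<in> embs h n. image_edges E \<psi> \<subseteq> S}"

lemma finite_all_edges [simp]: "finite (all_edges n)"
  by (rule finite_subset[of _ "Pow {..<n}"]) (auto simp: all_edges_def)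

lemma card_all_edges: "card (all_edges n) = n * (n - 1) div 2"
  by (simp add: all_edges_def n_subsets choose_two)

lemma finite_embs [simp]: "finite (embs h n)"
  unfolding embs_def by (rule finite_subset[of _ "{..<h} \<rightarrow>\<^sub>E {..<n}"]) (auto intro: finite_PiE)

text \<open>Choose for each vertex of \<open>A\<close> the role mapped onto it; the other h - |A|
  values are free. The multiplied form avoids a division by 0 and holds trivially when
  \<open>A\<close> has more than h elements.\<close>

lemma embs_covering_card:
  assumes "finite A"
  shows "real (card {\<psi> \<in> embs h n. A \<subseteq> \<psi> ` {..<h}}) * real n ^ card A \<le> real h ^ h * real n ^ h"
proof (cases "card A \<le> h")
  case False
  have "\<not> A \<subseteq> \<psi> ` {..<h}" for \<psi> :: "nat \<Rightarrow> nat"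
  proof
    assume "A \<subseteq> \<psi> ` {..<h}"
    then have "card A \<le> card (\<psi> ` {..<h})" by (intro card_mono) auto
    also have "\<dots> \<le> h" using card_image_le[of "{..<h}" \<psi>] by simp
    finally show False using False by simp
  qed
  then show ?thesis by simp
next
  case True
  define F where "F \<sigma> = {\<psi> \<in> {..<h} \<rightarrow>\<^sub>E {..<n}. \<forall>a\<in>A. \<psi> (\<sigma> a) = a}" for \<sigma> :: "nat \<Rightarrow> nat"
  define \<Sigma> where "\<Sigma> = {\<sigma> \<in> A \<rightarrow>\<^sub>E {..<h}. inj_on \<sigma> A}"
  have fin: "finite \<Sigma>" unfolding \<Sigma>_def using assms by (intro finite_subset[OF _ finite_PiE[of A "\<lambda>_. {..<h}"]]) auto
  have finF: "finite (F \<sigma>)" for \<sigma>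
    unfolding F_def by (intro finite_subset[OF _ finite_PiE[of "{..<h}" "\<lambda>_. {..<n}"]]) auto
  have "{\<psi> \<in> embs h n. A \<subseteq> \<psi> ` {..<h}} \<subseteq> (\<Union>\<sigma>\<in>\<Sigma>. F \<sigma>)"
  proof clarify
    fix \<psi> assume \<psi>: "\<psi> \<in> embs h n" "A \<subseteq> \<psi> ` {..<h}"
    then have "\<forall>a\<in>A. \<exists>i. i < h \<and> \<psi> i = a" by auto
    then obtain \<sigma> where \<sigma>: "\<And>a. a \<in> A \<Longrightarrow> \<sigma> a < h \<and> \<psi> (\<sigma> a) = a" by metis
    then have "restrict \<sigma> A \<in> \<Sigma>" by (auto simp: \<Sigma>_def inj_on_def) metis
    moreover have "\<psi> \<in> F (restrict \<sigma> A)" using \<sigma> \<psi> by (auto simp: F_def embs_def)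
    ultimately show "\<psi> \<in> (\<Union>\<sigma>\<in>\<Sigma>. F \<sigma>)" by blast
  qed
  then have "card {\<psi> \<in> embs h n. A \<subseteq> \<psi> ` {..<h}} \<le> card (\<Union>\<sigma>\<in>\<Sigma>. F \<sigma>)"
    using fin finF by (intro card_mono) auto
  also have "\<dots> \<le> (\<Sum>\<sigma>\<in>\<Sigma>. card (F \<sigma>))" using fin by (rule card_UN_le)
  also have "\<dots> \<le> (\<Sum>\<sigma>\<in>\<Sigma>. n ^ (h - card A))"
  proof (rule sum_mono)
    fix \<sigma> assume \<sigma>: "\<sigma> \<in> \<Sigma>"
    then have inj: "inj_on \<sigma> A" and img: "\<sigma> ` A \<subseteq> {..<h}" by (auto simp: \<Sigma>_def)
    define G where "G i = (if i \<in> \<sigma> ` A then {the_inv_into A \<sigma> i} else {..<n})" for i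
    have "F \<sigma> \<subseteq> Pi\<^sub>E {..<h} G"
    proof
      fix \<psi> assume \<psi>: "\<psi> \<in> F \<sigma>"
      show "\<psi> \<in> Pi\<^sub>E {..<h} G"
      proof (rule PiE_I)
        fix i assume "i \<in> {..<h}"
        then show "\<psi> i \<in> G i" using \<psi> inj by (auto simp: F_def G_def the_inv_into_f_f)
      qed (use \<psi> in \<open>auto simp: F_def\<close>)
    qed
    then have "card (F \<sigma>) \<le> card (Pi\<^sub>E {..<h} G)" by (intro card_mono finite_PiE) (auto simp: G_def)
    also have "\<dots> = (\<Prod>i\<in>{..<h}. card (G i))" by (simp add: card_PiE)
    also have "\<dots> = (\<Prod>i\<in>{..<h} - \<sigma> ` A. n)"
      by (intro prod.mono_neutral_cong_right) (auto simp: G_def)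
    also have "\<dots> = n ^ (h - card A)"
      using inj img assms by (simp add: card_Diff_subset card_image)
    finally show "card (F \<sigma>) \<le> n ^ (h - card A)" .
  qed
  also have "\<dots> = card \<Sigma> * n ^ (h - card A)" by simp
  also have "card \<Sigma> \<le> card (A \<rightarrow>\<^sub>E {..<h})"
    unfolding \<Sigma>_def using assms by (intro card_mono finite_PiE) auto
  also have "card (A \<rightarrow>\<^sub>E {..<h}) = h ^ card A" using assms by (simp add: card_PiE)
  also have "h ^ card A \<le> h ^ h"
    using True by (cases "h = 0") (auto intro: power_increasing)
  finally have "card {\<psi> \<in> embs h n. A \<subseteq> \<psi> ` {..<h}} * n ^ card A \<le> h ^ h * n ^ (h - card A) * n ^ card A"
    by (simp add: mult_right_mono)
  also have "\<dots> = h ^ h * n ^ h" using True by (simp add: mult.assoc power_add[symmetric])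
  finally have "real (card {\<psi> \<in> embs h n. A \<subseteq> \<psi> ` {..<h}} * n ^ card A) \<le> real (h ^ h * n ^ h)"
    by (simp only: of_nat_le_iff)
  then show ?thesis by simp
qed

lemma embs_covering_bound:
  assumes "finite A" "0 < n"
  shows "real (card {\<psi> \<in> embs h n. A \<subseteq> \<psi> ` {..<h}}) \<le> real h ^ h * real n ^ h / real n ^ card A"
  using embs_covering_card[OF assms(1), of h n] assms(2) by (simp add: pos_le_divide_eq)

text \<open>A union bound over the common witness \<open>v\<close>. All second-moment counts below
  have this shape, the witness being an edge, a vertex or a choice of class vertices.\<close>

lemma card_pairs_sharing:
  fixes P :: "'c \<Rightarrow> 'v \<Rightarrow> bool" and b :: "'v \<Rightarrow> real"
  assumes "finite C" "finite V" "\<And>v. v \<in> V \<Longrightarrow> card {c \<in> C. P c v} \<le> b v"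
    and "\<And>c c'. c \<in> C \<Longrightarrow> c' \<in> C \<Longrightarrow> Q c c' \<Longrightarrow> \<exists>v\<in>V. P c v \<and> P c' v"
  shows "real (card {(c, c') \<in> C \<times> C. Q c c'}) \<le> (\<Sum>v\<in>V. (b v)\<^sup>2)"
proof -
  have "{(c, c') \<in> C \<times> C. Q c c'} \<subseteq> (\<Union>v\<in>V. {c \<in> C. P c v} \<times> {c \<in> C. P c v})"
    using assms(4) by blast
  then have "card {(c, c') \<in> C \<times> C. Q c c'} \<le> card (\<Union>v\<in>V. {c \<in> C. P c v} \<times> {c \<in> C. P c v})"
    using assms by (intro card_mono) auto
  also have "\<dots> \<le> (\<Sum>v\<in>V. card ({c \<in> C. P c v} \<times> {c \<in> C. P c v}))" using assms(2) by (rule card_UN_le)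
  finally have "real (card {(c, c') \<in> C \<times> C. Q c c'}) \<le> real (\<Sum>v\<in>V. card ({c \<in> C. P c v} \<times> {c \<in> C. P c v}))"
    by (simp only: of_nat_le_iff)
  also have "\<dots> = (\<Sum>v\<in>V. (real (card {c \<in> C. P c v}))\<^sup>2)"
    by (simp add: card_cartesian_product power2_eq_square)
  also have "\<dots> \<le> (\<Sum>v\<in>V. (b v)\<^sup>2)" using assms(3) by (intro sum_mono power_mono) auto
  finally show ?thesis .
qed

section \<open>Variance and interval concentration of the embedding count\<close>

locale pattern = bernoulli +
  fixes h :: nat and E :: "nat set set"
  assumes h_ge_2: "2 \<le> h" and edge_E: "\<And>e. e \<in> E \<Longrightarrow> e \<subseteq> {..<h} \<and> card e = 2"
    and E_nonempty: "E \<noteq> {}"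
begin

abbreviation "T \<equiv> image_edges E"

lemma finite_E: "finite E"
  by (rule finite_subset[of _ "Pow {..<h}"]) (use edge_E in auto)

lemma finite_T [simp]: "finite (T \<psi>)"
  by (simp add: image_edges_def finite_E)

lemma card_T_le: "card (T \<psi>) \<le> card E"
  unfolding image_edges_def by (rule card_image_le[OF finite_E])

lemma T_subset_all_edges: "\<psi> \<in> embs h n \<Longrightarrow> T \<psi> \<subseteq> all_edges n"
proof
  fix e assume \<psi>: "\<psi> \<in> embs h n" and "e \<in> T \<psi>"
  then obtain d where d: "d \<in> E" "e = \<psi> ` d" by (auto simp: image_edges_def)
  then have "d \<subseteq> {..<h}" "card d = 2" using edge_E by auto
  moreover from this have "card (\<psi> ` d) = 2"
    using \<psi> by (subst card_image) (auto simp: embs_def intro: inj_on_subset)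
  ultimately show "e \<in> all_edges n" using \<psi> d by (auto simp: all_edges_def embs_def)
qed

lemma T_edge_in_image: "e \<in> T \<psi> \<Longrightarrow> e \<subseteq> \<psi> ` {..<h}"
  using edge_E by (fastforce simp: image_edges_def)

lemma emb_count_eq_sum: "real (emb_count h E n S) = (\<Sum>\<psi>\<in>embs h n. of_bool (T \<psi> \<subseteq> S))"
  by (simp add: emb_count_def of_bool_def sum.If_cases Int_def)

lemma emb_count_mono: "S \<subseteq> S' \<Longrightarrow> emb_count h E n S \<le> emb_count h E n S'"
  unfolding emb_count_def by (rule card_mono) auto

lemma emb_count_le: "emb_count h E n S \<le> n ^ h"
proof -
  have "emb_count h E n S \<le> card ({..<h} \<rightarrow>\<^sub>E {..<n})"
    unfolding emb_count_def by (intro card_mono finite_PiE) (auto simp: embs_def)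
  then show ?thesis by (simp add: card_PiE)
qed

text \<open>Correlated embeddings share an edge; there are at most n^2 edges, and each lies in the
  image of O(n^(h-2)) embeddings.\<close>

lemma emb_count_variance:
  assumes "0 < n"
  shows "bexp (all_edges n) (\<lambda>S. (real (emb_count h E n S) - (\<Sum>\<psi>\<in>embs h n. p ^ card (T \<psi>)))\<^sup>2)
    \<le> real h ^ (2 * h) * real n ^ (2 * h - 2)"
proof -
  have "bexp (all_edges n) (\<lambda>S. (real (emb_count h E n S) - (\<Sum>\<psi>\<in>embs h n. p ^ card (T \<psi>)))\<^sup>2)
      = bexp (all_edges n) (\<lambda>S. (\<Sum>\<psi>\<in>embs h n. of_bool (T \<psi> \<subseteq> S) - p ^ card (T \<psi>))\<^sup>2)"
    by (simp add: emb_count_eq_sum sum_subtractf)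
  also have "\<dots> \<le> card {(\<psi>, \<psi>') \<in> embs h n \<times> embs h n. T \<psi> \<inter> T \<psi>' \<noteq> {}}"
    using T_subset_all_edges by (intro count_variance) auto
  also have "\<dots> \<le> (\<Sum>e\<in>all_edges n. (real h ^ h * real n ^ h / real n ^ 2)\<^sup>2)"
  proof (rule card_pairs_sharing[where P = "\<lambda>\<psi> e. e \<subseteq> \<psi> ` {..<h}"])
    fix e assume "e \<in> all_edges n"
    then have "card e = 2" by (simp add: all_edges_def)
    moreover from this have "finite e" using card.infinite by fastforce
    ultimately show "real (card {\<psi> \<in> embs h n. e \<subseteq> \<psi> ` {..<h}}) \<le> real h ^ h * real n ^ h / real n ^ 2"
      using embs_covering_bound[of e n h] assms by simp
  next
    fix \<psi> \<psi>' assume "\<psi> \<in> embs h n" "T \<psi> \<inter> T \<psi>' \<noteq> {}"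
    then obtain e where "e \<in> T \<psi>" "e \<in> T \<psi>'" by auto
    then show "\<exists>e\<in>all_edges n. e \<subseteq> \<psi> ` {..<h} \<and> e \<subseteq> \<psi>' ` {..<h}"
      using T_subset_all_edges[OF \<open>\<psi> \<in> embs h n\<close>] by (intro bexI[of _ e] conjI T_edge_in_image) auto
  qed simp_all
  also have "\<dots> = card (all_edges n) * (real h ^ h * real n ^ (h - 2))\<^sup>2"
  proof -
    have "real n ^ h = real n ^ (h - 2) * real n ^ 2" by (metis h_ge_2 le_add_diff_inverse2 power_add)
    then show ?thesis using assms by simp
  qed
  also have "\<dots> \<le> real n ^ 2 * (real h ^ h * real n ^ (h - 2))\<^sup>2"
  proof (rule mult_right_mono)
    have "card (all_edges n) \<le> n * n" unfolding card_all_edges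
      by (metis diff_le_self div_le_dividend le_trans mult_le_mono2)
    then show "real (card (all_edges n)) \<le> (real n)\<^sup>2" by (metis of_nat_le_iff of_nat_mult power2_eq_square)
  qed simp
  also have "\<dots> = real h ^ (2 * h) * (real n ^ 2 * real n ^ (2 * (h - 2)))"
    by (simp add: power_mult_distrib power_mult[symmetric] mult_ac)
  also have "real n ^ 2 * real n ^ (2 * (h - 2)) = real n ^ (2 * h - 2)"
  proof -
    have "2 * h - 2 = 2 + 2 * (h - 2)" using h_ge_2 by simp
    then show ?thesis by (simp only: power_add)
  qed
  finally show ?thesis .
qed

lemma emb_count_insert:
  assumes "e \<notin> S"
  shows "emb_count h E n (insert e S) = emb_count h E n S + card {\<psi> \<in> {\<psi> \<in> embs h n. e \<in> T \<psi>}. T \<psi> - {e} \<subseteq> S}"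
proof -
  have "{\<psi> \<in> embs h n. T \<psi> \<subseteq> insert e S}
     = {\<psi> \<in> embs h n. T \<psi> \<subseteq> S} \<union> {\<psi> \<in> {\<psi> \<in> embs h n. e \<in> T \<psi>}. T \<psi> - {e} \<subseteq> S}"
    using assms by auto
  then show ?thesis unfolding emb_count_def
    using assms by (simp only:) (subst card_Un_disjoint, auto)
qed

text \<open>A fixed pattern edge is mapped onto \<open>e\<close>, and every other role chooses from
  a block of n div h vertices of its own, so all choices are injective. After the ends of
  \<open>e\<close> are removed a block has more than n/h - 3 vertices, which is at least n/(2h)
  because 6h <= n.\<close>

lemma embs_through_edge_card:
  assumes "e \<in> all_edges n" "6 * h \<le> n"
  shows "(real n / (2 * h)) ^ (h - 2) \<le> card {\<psi> \<in> embs h n. e \<in> T \<psi>}"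
proof -
  obtain d where d: "d \<in> E" using E_nonempty by auto
  then obtain i j where ij: "d = {i, j}" "i \<noteq> j" "i < h" "j < h"
    using edge_E[OF d] by (auto simp: card_2_iff)
  obtain a b where ab: "e = {a, b}" "a \<noteq> b" "a < n" "b < n"
    using assms by (auto simp: all_edges_def card_2_iff)
  define k where "k = n div h"
  have kh: "k * h \<le> n" by (simp add: k_def)
  define G where "G l = (if l = i then {a} else if l = j then {b} else {k * l..<k * Suc l} - {a, b})" for l
  have block: "k * Suc l \<le> n" if "l < h" for l
    using mult_le_mono2[of "Suc l" h k] that kh by linarith
  have Gsub: "Pi\<^sub>E {..<h} G \<subseteq> {\<psi> \<in> embs h n. e \<in> T \<psi>}"
  proof
    fix \<psi> assume \<psi>: "\<psi> \<in> Pi\<^sub>E {..<h} G"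
    then have mem: "\<psi> l \<in> G l" if "l < h" for l using that by auto
    have "\<psi> i = a" "\<psi> j = b" using mem[of i] mem[of j] ij by (auto simp: G_def split: if_splits)
    then have "e \<in> T \<psi>" unfolding image_edges_def using d ij ab by (intro image_eqI[of _ _ d]) auto
    moreover have "\<psi> l < n" if "l < h" for l
      using mem[OF that] block[OF that] ab by (auto simp: G_def split: if_splits)
    moreover have "inj_on \<psi> {..<h}"
    proof (rule inj_onI)
      fix l l' assume l: "l \<in> {..<h}" "l' \<in> {..<h}" "\<psi> l = \<psi> l'"
      have lt: "k * Suc x \<le> k * y" if "x < y" for x y using that by (intro mult_le_mono) auto
      show "l = l'"
        using mem[of l] mem[of l'] l ij ab lt[of l l'] lt[of l' l]
        by (cases l l' rule: linorder_cases) (auto simp: G_def split: if_splits)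
    qed
    ultimately show "\<psi> \<in> {\<psi> \<in> embs h n. e \<in> T \<psi>}" using \<psi> by (auto simp: embs_def PiE_iff)
  qed
  have "real n / h < k + 1"
  proof -
    have "n = k * h + n mod h" "n mod h < h" using h_ge_2 by (auto simp: k_def)
    then have "n < (k + 1) * h" by simp
    then have "real n < real ((k + 1) * h)" by (simp only: of_nat_less_iff)
    then show ?thesis using h_ge_2 by (simp add: pos_divide_less_eq algebra_simps)
  qed
  then have "real n / (2 * h) \<le> real k - 2"
    using assms(2) h_ge_2 by (simp add: field_simps)
  moreover have "real k - 2 \<le> card ({k * l..<k * Suc l} - {a, b})" for l
  proof -
    have "card {k * l..<k * Suc l} - card {a, b} \<le> card ({k * l..<k * Suc l} - {a, b})"
      by (rule diff_card_le_card_Diff) simp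
    then show ?thesis using ab by simp
  qed
  ultimately have Gc: "real n / (2 * h) \<le> card ({k * l..<k * Suc l} - {a, b})" for l
    by (meson order_trans)
  have "(real n / (2 * h)) ^ (h - 2) = (\<Prod>l\<in>{..<h} - {i, j}. real n / (2 * h))"
    using ij by (simp add: card_Diff_subset numeral_2_eq_2)
  also have "\<dots> \<le> (\<Prod>l\<in>{..<h} - {i, j}. real (card (G l)))"
    using Gc by (intro prod_mono) (auto simp: G_def)
  also have "\<dots> = (\<Prod>l\<in>{..<h}. real (card (G l)))"
    by (intro prod.mono_neutral_left) (auto simp: G_def)
  also have "\<dots> = card (Pi\<^sub>E {..<h} G)" by (simp add: card_PiE)
  also have "\<dots> \<le> card {\<psi> \<in> embs h n. e \<in> T \<psi>}"
    using Gsub by (intro of_nat_mono card_mono) auto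
  finally show ?thesis .
qed

text \<open>Half of a lower bound for the expected number of embeddings created by a new edge:
  \<open>embs_through_edge_card\<close> times the least probability of the remaining edges.\<close>

definition ball_width :: "nat \<Rightarrow> real" where
  "ball_width n = p ^ card E * (real n / (2 * h)) ^ (h - 2) / 2"

text \<open>Two embeddings through \<open>e\<close> are dependent only if they share another edge,
  hence a third vertex, so the proportion of dependent pairs is O(1/n). Level j = 2 of the tail
  bound turns this into n^(-4), which survives a union bound over n^2 edges.\<close>

lemma small_increment_probability:
  assumes "e \<in> all_edges n" "6 * h \<le> n"
  shows "bexp (all_edges n) (\<lambda>S. of_bool (card {\<psi> \<in> {\<psi> \<in> embs h n. e \<in> T \<psi>}. T \<psi> - {e} \<subseteq> S} < ball_width n))
    \<le> hcM (card E) 2 * (4 * (real h ^ (2 * h) * (2 * real h) ^ (2 * h)) / (p ^ card E)\<^sup>2) ^ 4 / real n ^ 4"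
proof -
  define C where "C = {\<psi> \<in> embs h n. e \<in> T \<psi>}"
  define \<theta> where "\<theta> = real h ^ (2 * h) * (2 * real h) ^ (2 * h) / real n"
  have n: "0 < n" using assms h_ge_2 by simp
  have C: "(real n / (2 * h)) ^ (h - 2) \<le> card C"
    unfolding C_def by (rule embs_through_edge_card[OF assms])
  have e: "finite e" "card e = 2" using assms finite_subset by (auto simp: all_edges_def)
  have "real (card {(\<psi>, \<psi>') \<in> C \<times> C. (T \<psi> - {e}) \<inter> (T \<psi>' - {e}) \<noteq> {}})
    \<le> (\<Sum>v\<in>{..<n} - e. (real h ^ h * real n ^ h / real n ^ 3)\<^sup>2)"
  proof (rule card_pairs_sharing[where P = "\<lambda>\<psi> v. insert v e \<subseteq> \<psi> ` {..<h}"])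
    fix v assume "v \<in> {..<n} - e"
    then have "card (insert v e) = 3" using e by simp
    then have "real (card {\<psi> \<in> embs h n. insert v e \<subseteq> \<psi> ` {..<h}}) \<le> real h ^ h * real n ^ h / real n ^ 3"
      using embs_covering_bound[of "insert v e" n h] n e by simp
    moreover have "card {\<psi> \<in> C. insert v e \<subseteq> \<psi> ` {..<h}} \<le> card {\<psi> \<in> embs h n. insert v e \<subseteq> \<psi> ` {..<h}}"
      by (rule card_mono) (auto simp: C_def)
    ultimately show "real (card {\<psi> \<in> C. insert v e \<subseteq> \<psi> ` {..<h}}) \<le> real h ^ h * real n ^ h / real n ^ 3"
      by linarith
  next
    fix \<psi> \<psi>' assume \<psi>: "\<psi> \<in> C" "\<psi>' \<in> C" "(T \<psi> - {e}) \<inter> (T \<psi>' - {e}) \<noteq> {}"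
    then obtain e' where e': "e' \<in> T \<psi>" "e' \<in> T \<psi>'" "e' \<noteq> e" by auto
    then have "e' \<in> all_edges n" using \<psi> T_subset_all_edges by (auto simp: C_def)
    then have c: "card e' = 2" "finite e'" "e' \<subseteq> {..<n}" using finite_subset by (auto simp: all_edges_def)
    then have "\<not> e' \<subseteq> e" using e e'(3) card_subset_eq[of e e'] by auto
    then obtain v where "v \<in> e'" "v \<notin> e" by auto
    then show "\<exists>v\<in>{..<n} - e. insert v e \<subseteq> \<psi> ` {..<h} \<and> insert v e \<subseteq> \<psi>' ` {..<h}"
      using e' c T_edge_in_image[of e' \<psi>] T_edge_in_image[of e' \<psi>'] \<psi> T_edge_in_image[of e] by (auto simp: C_def)
  qed (auto simp: C_def)
  also have "\<dots> \<le> real n * (real h ^ h * real n ^ h / real n ^ 3)\<^sup>2"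
  proof -
    have "card ({..<n} - e) \<le> n" using card_mono[of "{..<n}" "{..<n} - e"] by simp
    then show ?thesis by (simp add: mult_right_mono)
  qed
  also have "\<dots> = real h ^ (2 * h) * (real n ^ (h - 2))\<^sup>2 / real n"
  proof -
    have "real n ^ h = real n ^ (h - 2) * real n ^ 2" by (metis h_ge_2 le_add_diff_inverse2 power_add)
    then show ?thesis using n
      by (simp add: power_mult_distrib power_divide power_mult[symmetric] field_simps power2_eq_square power3_eq_cube mult.commute)
        (simp add: mult_2_right power_add)
  qed
  also have "\<dots> \<le> \<theta> * (real (card C))\<^sup>2"
  proof -
    have "(real n ^ (h - 2))\<^sup>2 = (2 * real h) ^ (2 * (h - 2)) * ((real n / (2 * h)) ^ (h - 2))\<^sup>2"
    proof -
      define x where "x = real n / (2 * h)"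
      have "real n = 2 * real h * x" using h_ge_2 by (simp add: x_def)
      then show ?thesis unfolding x_def[symmetric]
        by (simp only: power_mult_distrib power_mult[symmetric] mult.commute[of 2])
    qed
    also have "\<dots> \<le> (2 * real h) ^ (2 * h) * (real (card C))\<^sup>2"
      using h_ge_2 C by (intro mult_mono power_mono power_increasing) auto
    finally have "real h ^ (2 * h) * (real n ^ (h - 2))\<^sup>2 / real n
      \<le> real h ^ (2 * h) * ((2 * real h) ^ (2 * h) * (real (card C))\<^sup>2) / real n"
      by (intro divide_right_mono mult_left_mono) auto
    then show ?thesis by (simp add: \<theta>_def mult_ac)
  qed
  finally have D: "real (card {(\<psi>, \<psi>') \<in> C \<times> C. (T \<psi> - {e}) \<inter> (T \<psi>' - {e}) \<noteq> {}}) \<le> \<theta> * (real (card C))\<^sup>2" .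
  have cE: "card (T \<psi> - {e}) \<le> card E" for \<psi>
    using card_T_le[of \<psi>] card_mono[of "T \<psi>" "T \<psi> - {e}"] by auto
  have sub: "T \<psi> - {e} \<subseteq> all_edges n" if "\<psi> \<in> C" for \<psi>
    using that T_subset_all_edges by (auto simp: C_def)
  have tail: "bexp (all_edges n) (\<lambda>S. of_bool (card {\<psi> \<in> C. T \<psi> - {e} \<subseteq> S} < p ^ card E * card C / 2))
    \<le> hcM (card E) 2 * (4 * \<theta> / (p ^ card E)\<^sup>2) ^ (2 ^ 2)"
  proof (rule count_lower_tail[where T = "\<lambda>\<psi>. T \<psi> - {e}" and C = C])
    show "real (card {(c, c') \<in> C \<times> C. (T c - {e}) \<inter> (T c' - {e}) \<noteq> {}}) \<le> \<theta> * real ((card C)\<^sup>2)"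
      using D by simp
    show "finite C" by (simp add: C_def)
    show "0 \<le> \<theta>" by (simp add: \<theta>_def)
  qed (use cE sub in simp_all)
  have "ball_width n \<le> p ^ card E * card C / 2"
    unfolding ball_width_def using C p_pos by (intro divide_right_mono mult_left_mono) auto
  then have "bexp (all_edges n) (\<lambda>S. of_bool (card {\<psi> \<in> C. T \<psi> - {e} \<subseteq> S} < ball_width n) :: real)
     \<le> bexp (all_edges n) (\<lambda>S. of_bool (card {\<psi> \<in> C. T \<psi> - {e} \<subseteq> S} < p ^ card E * card C / 2))"
    by (intro bexp_mono) auto
  also note tail
  also have "hcM (card E) 2 * (4 * \<theta> / (p ^ card E)\<^sup>2) ^ (2 ^ 2)
      = hcM (card E) 2 * ((4 * (real h ^ (2 * h) * (2 * real h) ^ (2 * h)) / (p ^ card E)\<^sup>2) / real n) ^ 4"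
    by (simp add: \<theta>_def mult.commute[of "real n"])
  also have "\<dots> = hcM (card E) 2 * (4 * (real h ^ (2 * h) * (2 * real h) ^ (2 * h)) / (p ^ card E)\<^sup>2) ^ 4 / real n ^ 4"
    by (simp only: power_divide[of _ "real n"] times_divide_eq_right)
  finally show ?thesis by (simp only: C_def)
qed

text \<open>With about n^2 / 2 edges the largest binomial probability is O(1/n). The sets from which
  some new edge creates too few embeddings contribute n^2 n^(-4).\<close>

theorem emb_count_small_ball:
  obtains K where "0 < K" "\<And>n y. 6 * h \<le> n \<Longrightarrow>
    bexp (all_edges n) (\<lambda>S. of_bool (y \<le> real (emb_count h E n S) \<and> real (emb_count h E n S) < y + ball_width n)) \<le> K / real n"
proof
  define K1 where "K1 = 2 * sqrt 2 / sqrt (p * (1 - p))"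
  define K2 where "K2 = hcM (card E) 2 * (4 * (real h ^ (2 * h) * (2 * real h) ^ (2 * h)) / (p ^ card E)\<^sup>2) ^ 4"
  have K: "0 < K1" "0 < K2" using p_pos p_less_1 h_ge_2 hcM_pos[of "card E" 2] by (auto simp: K1_def K2_def)
  then show "0 < 2 * K1 + K2" by simp
  fix n y assume n: "6 * h \<le> n"
  define N where "N = card (all_edges n)"
  have n2: "2 \<le> n" using n h_ge_2 by simp
  have "even (n * (n - 1))" by (cases n) auto
  then have "2 * N = n * (n - 1)" by (simp only: N_def card_all_edges dvd_mult_div_cancel)
  then have "2 * real N = real n * (real n - 1)" using n2 by (metis One_nat_def Suc_leD of_nat_1 of_nat_diff of_nat_mult of_nat_numeral numeral_2_eq_2)
  moreover have "real n * (real n / 2) \<le> real n * (real n - 1)" "real n * (real n - 1) \<le> real n * real n"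
    using n2 by (auto intro!: mult_left_mono)
  ultimately have N: "(real n / 2)\<^sup>2 \<le> real N" "real N \<le> real n ^ 2"
    by (auto simp: power2_eq_square)
  then have N1: "1 \<le> N" using n2 by (cases N) auto
  have sqN: "real n / 2 \<le> sqrt N" using N(1) by (rule real_le_rsqrt)
  have beta: "(N choose k) * p ^ k * (1 - p) ^ (N - k) \<le> 2 * K1 / n" if "k \<le> N" for k
  proof -
    have "(N choose k) * p ^ k * (1 - p) ^ (N - k) \<le> K1 / sqrt N"
      unfolding K1_def by (rule binomial_point_bound[OF N1 that])
    also have "\<dots> \<le> K1 / (n / 2)" using sqN K n2 N1 by (intro divide_left_mono mult_pos_pos) auto
    finally show ?thesis by (simp add: mult.commute)
  qed
  have "bexp (all_edges n) (\<lambda>S. of_bool (y \<le> real (emb_count h E n S) \<and> real (emb_count h E n S) < y + ball_width n))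
    \<le> 2 * K1 / n + bexp (all_edges n) (\<lambda>S. of_bool (\<exists>e\<in>all_edges n - S. real (emb_count h E n (insert e S)) < real (emb_count h E n S) + ball_width n))"
    using beta by (intro monotone_small_ball) (auto simp: N_def emb_count_mono)
  also have "bexp (all_edges n) (\<lambda>S. of_bool (\<exists>e\<in>all_edges n - S. real (emb_count h E n (insert e S)) < real (emb_count h E n S) + ball_width n))
     \<le> bexp (all_edges n) (\<lambda>S. \<Sum>e\<in>all_edges n. of_bool (card {\<psi> \<in> {\<psi> \<in> embs h n. e \<in> T \<psi>}. T \<psi> - {e} \<subseteq> S} < ball_width n) :: real)"
  proof (rule bexp_mono)
    fix S
    show "of_bool (\<exists>e\<in>all_edges n - S. real (emb_count h E n (insert e S)) < real (emb_count h E n S) + ball_width n)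
      \<le> (\<Sum>e\<in>all_edges n. of_bool (card {\<psi> \<in> {\<psi> \<in> embs h n. e \<in> T \<psi>}. T \<psi> - {e} \<subseteq> S} < ball_width n) :: real)"
    proof (cases "\<exists>e\<in>all_edges n - S. real (emb_count h E n (insert e S)) < real (emb_count h E n S) + ball_width n")
      case True
      then obtain e where e: "e \<in> all_edges n" "e \<notin> S"
        "real (emb_count h E n (insert e S)) < real (emb_count h E n S) + ball_width n" by auto
      then have "1 \<le> (of_bool (card {\<psi> \<in> {\<psi> \<in> embs h n. e \<in> T \<psi>}. T \<psi> - {e} \<subseteq> S} < ball_width n) :: real)"
        using emb_count_insert[OF e(2), of n] by simp
      also have "\<dots> \<le> (\<Sum>e\<in>all_edges n. of_bool (card {\<psi> \<in> {\<psi> \<in> embs h n. e \<in> T \<psi>}. T \<psi> - {e} \<subseteq> S} < ball_width n))"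
        using e by (intro member_le_sum) auto
      finally show ?thesis using True by simp
    qed (auto intro: sum_nonneg)
  qed
  also have "\<dots> = (\<Sum>e\<in>all_edges n. bexp (all_edges n) (\<lambda>S. of_bool (card {\<psi> \<in> {\<psi> \<in> embs h n. e \<in> T \<psi>}. T \<psi> - {e} \<subseteq> S} < ball_width n)))"
    by (rule bexp_sum)
  also have "\<dots> \<le> (\<Sum>e\<in>all_edges n. K2 / real n ^ 4)"
    unfolding K2_def by (intro sum_mono small_increment_probability n)
  also have "\<dots> = real N * (K2 / real n ^ 4)" by (simp add: N_def)
  also have "\<dots> \<le> real n ^ 2 * (K2 / real n ^ 4)" using N K by (intro mult_right_mono) auto
  also have "\<dots> = K2 / real n ^ 2" using n2 by (simp add: power4_eq_xxxx power2_eq_square)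
  also have "\<dots> \<le> K2 / real n" using n2 K by (intro divide_left_mono) (auto simp: power2_eq_square)
  finally show "bexp (all_edges n) (\<lambda>S. of_bool (y \<le> real (emb_count h E n S) \<and> real (emb_count h E n S) < y + ball_width n))
    \<le> (2 * K1 + K2) / real n" by (simp add: add_divide_distrib)
qed

end

section \<open>Smoothing of point probabilities\<close>

text \<open>The subtracted term makes the induction telescope.\<close>

lemma sum_inverse_squares_le: "(\<Sum>m\<le>L. 1 / (real (max 1 m))\<^sup>2) \<le> 3 - 1 / real (max 1 L)"
proof (induction L)
  case (Suc L)
  show ?case
  proof (cases "L = 0")
    case False
    have "(\<Sum>m\<le>Suc L. 1 / (real (max 1 m))\<^sup>2) \<le> 3 - 1 / real L + 1 / (real (Suc L))\<^sup>2"
      using Suc False by (simp add: max_def)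
    moreover have "1 / (real (Suc L))\<^sup>2 \<le> 1 / (real L * real (Suc L))"
      using False by (intro divide_left_mono) (auto simp: power2_eq_square)
    moreover have "1 / (real L * real (Suc L)) = 1 / real L - 1 / real (Suc L)" using False by (simp add: field_simps)
    ultimately show ?thesis by (simp only: max_def) simp
  qed simp
qed simp

text \<open>In the geometric sum the numerator is at most 2, and concavity of the sine gives |z - 1|
  >= 2 |\<theta>| / pi. The constant 2 pi, instead of pi, cancels against the frequency 2 pi /
  N.\<close>

lemma cis_arithmetic_sum_bound:
  fixes \<theta> :: real and s :: int
  assumes "0 < \<bar>\<theta>\<bar>" "\<bar>\<theta>\<bar> \<le> pi"
  shows "norm (\<Sum>j\<in>{s..<s + int L}. cis (\<theta> * real_of_int j)) \<le> 2 * pi / \<bar>\<theta>\<bar>"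
proof -
  define z where "z = cis \<theta>"
  have "1 - cos \<theta> \<ge> 2 * \<theta>\<^sup>2 / pi\<^sup>2"
  proof -
    have conc: "2 / pi * y \<le> sin y" if "0 \<le> y" "y \<le> pi / 2" for y
    proof -
      have "convex_on {0..pi/2} (\<lambda>x. - sin x)"
      proof (rule f''_ge0_imp_convex[where f' = "\<lambda>x. - cos x" and f'' = sin])
        fix x :: real assume "x \<in> {0..pi/2}"
        then show "0 \<le> sin x" by (intro sin_ge_zero) auto
      qed (auto intro!: derivative_eq_intros)
      then have "- sin ((1 - 2 / pi * y) *\<^sub>R 0 + (2 / pi * y) *\<^sub>R (pi / 2)) \<le> (1 - 2 / pi * y) * (- sin 0) + (2 / pi * y) * (- sin (pi / 2))"
        using that by (intro convex_onD) (auto simp: field_simps)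
      then show ?thesis by simp
    qed
    have "2 / pi * (\<bar>\<theta>\<bar> / 2) \<le> sin (\<bar>\<theta>\<bar> / 2)" using assms by (intro conc) auto
    then have "(\<bar>\<theta>\<bar> / pi)\<^sup>2 \<le> (sin (\<bar>\<theta>\<bar> / 2))\<^sup>2" by (intro power_mono) auto
    moreover have "cos \<theta> = 1 - 2 * (sin (\<bar>\<theta>\<bar> / 2))\<^sup>2" using cos_double_sin[of "\<bar>\<theta>\<bar> / 2"] by simp
    ultimately show ?thesis by (simp add: power_divide)
  qed
  then have "(2 * \<bar>\<theta>\<bar> / pi)\<^sup>2 \<le> (norm (z - 1))\<^sup>2"
  proof -
    assume a: "1 - cos \<theta> \<ge> 2 * \<theta>\<^sup>2 / pi\<^sup>2"
    have "(norm (z - 1))\<^sup>2 = (cos \<theta> - 1)\<^sup>2 + (sin \<theta>)\<^sup>2" by (simp add: cmod_power2 z_def)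
    also have "\<dots> = ((sin \<theta>)\<^sup>2 + (cos \<theta>)\<^sup>2) + 1 - 2 * cos \<theta>"
      by (simp only: power2_eq_square) (simp add: algebra_simps)
    finally have "(norm (z - 1))\<^sup>2 = 2 * (1 - cos \<theta>)" by simp
    then show ?thesis using a by (simp add: power_divide power_mult_distrib)
  qed
  then have z1: "2 * \<bar>\<theta>\<bar> / pi \<le> norm (z - 1)" by (rule power2_le_imp_le) simp
  moreover have "0 < 2 * \<bar>\<theta>\<bar> / pi" using assms by simp
  ultimately have nz: "0 < norm (z - 1)" by linarith
  have "{s..<s + int L} = (\<lambda>i. s + int i) ` {..<L}"
    by (auto simp: image_iff intro!: bexI[of _ "nat (_ - s)"])
  moreover have "cis (\<theta> * real_of_int (s + int i)) = cis (\<theta> * real_of_int s) * z ^ i" for i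
    unfolding z_def Complex.DeMoivre cis_mult by (simp add: algebra_simps)
  ultimately have "(\<Sum>j\<in>{s..<s + int L}. cis (\<theta> * real_of_int j)) = (\<Sum>i<L. cis (\<theta> * real_of_int s) * z ^ i)"
    by (simp add: sum.reindex inj_on_def)
  also have "\<dots> = cis (\<theta> * real_of_int s) * ((z ^ L - 1) / (z - 1))"
    using nz by (simp add: sum_distrib_left[symmetric] geometric_sum)
  finally have "norm (\<Sum>j\<in>{s..<s + int L}. cis (\<theta> * real_of_int j)) = norm (z ^ L - 1) / norm (z - 1)"
    by (simp add: norm_mult norm_divide)
  also have "\<dots> \<le> 2 / norm (z - 1)"
  proof (rule divide_right_mono)
    have "norm (z ^ L - 1) \<le> norm (z ^ L) + norm (1 :: complex)" by (rule norm_triangle_ineq4)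
    then show "norm (z ^ L - 1) \<le> 2" by (simp add: norm_power z_def)
  qed simp
  also have "\<dots> \<le> 2 / (2 * \<bar>\<theta>\<bar> / pi)" using z1 assms nz by (intro divide_left_mono) auto
  also have "\<dots> = pi / \<bar>\<theta>\<bar>" by simp
  also have "\<dots> \<le> 2 * pi / \<bar>\<theta>\<bar>" using assms by (intro divide_right_mono) auto
  finally show ?thesis .
qed

text \<open>The Fourier coefficients of a product of two Dirichlet kernels are numbers of
  representations as a difference.\<close>

lemma sum_differences:
  fixes I J :: "int set" and \<Phi> :: "int \<Rightarrow> complex"
  assumes "finite I" "finite J" "finite K" "\<And>i j. i \<in> I \<Longrightarrow> j \<in> J \<Longrightarrow> j - i \<in> K"
  shows "(\<Sum>i\<in>I. \<Sum>j\<in>J. \<Phi> (j - i)) = (\<Sum>k\<in>K. of_nat (card {(i, j) \<in> I \<times> J. j - i = k}) * \<Phi> k)"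
proof -
  have "(\<Sum>i\<in>I. \<Sum>j\<in>J. \<Phi> (j - i)) = (\<Sum>x\<in>I \<times> J. \<Phi> (snd x - fst x))"
    by (simp add: sum.cartesian_product split_beta)
  also have "\<dots> = (\<Sum>k\<in>K. \<Sum>x | x \<in> I \<times> J \<and> snd x - fst x = k. \<Phi> (snd x - fst x))"
    using assms by (intro sum.group[symmetric]) auto
  also have "\<dots> = (\<Sum>k\<in>K. \<Sum>x | x \<in> I \<times> J \<and> snd x - fst x = k. \<Phi> k)"
    by (intro sum.cong) auto
  also have "\<dots> = (\<Sum>k\<in>K. of_nat (card {(i, j) \<in> I \<times> J. j - i = k}) * \<Phi> k)"
    by (intro sum.cong) (auto simp: split_beta intro!: arg_cong[where f = card])
  finally show ?thesis .
qed

lemma card_differences_le: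
  fixes I J :: "int set"
  assumes "finite I"
  shows "card {(i, j) \<in> I \<times> J. j - i = k} \<le> card I"
proof (rule card_inj_on_le[where f = fst])
  show "inj_on fst {(i, j) \<in> I \<times> J. j - i = k}" by (auto simp: inj_on_def)
qed (use assms in auto)

lemma card_differences_ge:
  fixes I I' J :: "int set"
  assumes "finite I" "finite J" "I' \<subseteq> I" "\<And>i. i \<in> I' \<Longrightarrow> i + k \<in> J"
  shows "card I' \<le> card {(i, j) \<in> I \<times> J. j - i = k}"
proof (rule card_inj_on_le[where f = "\<lambda>i. (i, i + k)"])
  show "finite {(i, j) \<in> I \<times> J. j - i = k}"
    by (rule finite_subset[of _ "I \<times> J"]) (use assms in auto)
qed (use assms in \<open>auto simp: inj_on_def\<close>)

text \<open>A Fejer kernel of length \<open>b\<close> majorises the indicator of a point.  On the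
  frequencies up to \<open>a\<close> it is almost equal to \<open>1 / b\<close> times a trapezoid kernel, which is a product
  of two Dirichlet kernels and hence concentrated on an interval of length \<open>N / a\<close>.\<close>

lemma (in bernoulli) point_probability_smoothing:
  fixes X :: "'a set \<Rightarrow> nat" and \<beta> \<delta> :: real
  assumes A: "finite A" and X: "\<And>S. S \<subseteq> A \<Longrightarrow> X S \<le> M" and x: "x \<le> M" and N: "2 * M \<le> N" "0 < N"
    and ab: "1 \<le> a" "2 * a \<le> b"
    and \<beta>: "\<And>y. bexp A (\<lambda>S. of_bool (y \<le> real (X S) \<and> real (X S) < y + real N / real a)) \<le> \<beta>"
    and \<delta>: "0 \<le> \<delta>" "\<And>k. a < k \<Longrightarrow> k < b \<Longrightarrow> norm (bexp A (\<lambda>S. cis (2 * pi * real k / real N * real (X S)))) \<le> \<delta>"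
  shows "bexp A (\<lambda>S. of_bool (X S = x)) \<le> 18 * (real a / real b) * \<beta> + 3 * (real a / real b)\<^sup>2 + 2 * \<delta>"
proof -
  \<comment> \<open>Since N is at least twice the range of \<open>X\<close>, all phases
    \<open>\<omega> * D S\<close> lie in [-pi, pi], where the estimate of exponential sums is
    valid.\<close>
  define \<omega> where "\<omega> = 2 * pi / real N"
  define D where "D S = real (X S) - real x" for S
  define \<Phi> where "\<Phi> k = bexp A (\<lambda>S. cis (\<omega> * D S * real_of_int k))" for k :: int
  have b0: "0 < b" and a0: "0 < a" using ab by auto
  have \<Phi>_norm: "norm (\<Phi> k) = norm (bexp A (\<lambda>S. cis (2 * pi * real (nat \<bar>k\<bar>) / real N * real (X S))))" for k
  proof -
    have *: "norm (\<Phi> k) = norm (bexp A (\<lambda>S. cis (2 * pi * real_of_int k / real N * real (X S))))" for k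
    proof -
      have "\<Phi> k = bexp A (\<lambda>S. cis (- (\<omega> * real x * real_of_int k)) * cis (2 * pi * real_of_int k / real N * real (X S)))"
        unfolding \<Phi>_def D_def \<omega>_def cis_mult
        by (intro bexp_cong arg_cong[where f = cis]) (simp add: diff_divide_distrib algebra_simps)
      then show ?thesis by (simp only: bexp_cmult norm_mult norm_cis mult_1)
    qed
    show ?thesis
    proof (cases "0 \<le> k")
      case True
      then show ?thesis using *[of k] by simp
    next
      case False
      have "cnj (\<Phi> k) = \<Phi> (- k)" unfolding \<Phi>_def bexp_cnj by (simp add: cis_cnj)
      then have "norm (\<Phi> k) = norm (\<Phi> (- k))" by (metis complex_mod_cnj)
      then show ?thesis using *[of "- k"] False by simp
    qed
  qed
  have \<Phi>_le1: "norm (\<Phi> k) \<le> 1" for k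
    unfolding \<Phi>_def by (rule order_trans[OF norm_bexp_le]) (use A in simp)
  have \<Phi>_le: "norm (\<Phi> k) \<le> \<delta>" if "int a < \<bar>k\<bar>" "\<bar>k\<bar> < int b" for k
    unfolding \<Phi>_norm using that by (intro \<delta>(2)) auto
  \<comment> \<open>\<open>I1\<close> with itself gives the Fejer triangle. \<open>I2\<close> with
    \<open>J2\<close> gives a trapezoid that equals a for |k| <= a and vanishes for |k| >= 2a, so
    that 2a <= b puts its support into \<open>K\<close>.\<close>
  define I1 where "I1 = {0..<int b}"
  define I2 J2 where "I2 = {0..<int a}" and "J2 = {- int a..<2 * int a}"
  define K where "K = {- int b<..<int b}"
  define c1 where "c1 k = card {(i, j) \<in> I1 \<times> I1. j - i = k}" for k
  define c2 where "c2 k = card {(i, j) \<in> I2 \<times> J2. j - i = k}" for k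
  have s1: "(\<Sum>i\<in>I1. \<Sum>j\<in>I1. \<Phi> (j - i)) = (\<Sum>k\<in>K. of_nat (c1 k) * \<Phi> k)"
    unfolding c1_def by (rule sum_differences) (auto simp: I1_def K_def)
  have s2: "(\<Sum>i\<in>I2. \<Sum>j\<in>J2. \<Phi> (j - i)) = (\<Sum>k\<in>K. of_nat (c2 k) * \<Phi> k)"
    unfolding c2_def by (rule sum_differences) (use ab in \<open>auto simp: I2_def J2_def K_def\<close>)
  have c1_le: "c1 k \<le> b" for k unfolding c1_def by (rule order_trans[OF card_differences_le]) (auto simp: I1_def)
  have c2_le: "c2 k \<le> a" for k unfolding c2_def by (rule order_trans[OF card_differences_le]) (auto simp: I2_def)
  have c1_ge: "real b - real a \<le> real (c1 k)" if "\<bar>k\<bar> \<le> int a" for k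
  proof -
    have "card {max 0 (- k)..<min (int b) (int b - k)} \<le> c1 k"
      unfolding c1_def by (rule card_differences_ge) (auto simp: I1_def)
    moreover have "real b - real a \<le> card {max 0 (- k)..<min (int b) (int b - k)}"
      using that ab by (auto simp: max_def min_def)
    ultimately show ?thesis by linarith
  qed
  have c2_ge: "real a \<le> real (c2 k)" if "\<bar>k\<bar> \<le> int a" for k
  proof -
    have "card {0..<int a} \<le> c2 k"
      unfolding c2_def by (rule card_differences_ge) (use that in \<open>auto simp: I2_def J2_def\<close>)
    then show ?thesis by simp
  qed
  \<comment> \<open>Difference of the normalised kernels. For |k| <= a both are near 1 / b and
    differ by at most a / b^2. For larger |k| the crude bound 1 / b suffices, because
    \<open>\<Phi>\<close> is at most \<open>\<delta>\<close> there and there are fewer than 2b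
    frequencies.\<close>
  define w where "w k = real (c1 k) / (real b)\<^sup>2 - real (c2 k) / (real a * real b)" for k
  have w_small: "\<bar>w k\<bar> \<le> real a / (real b)\<^sup>2" if "\<bar>k\<bar> \<le> int a" for k
  proof -
    have "real (c2 k) = real a" using c2_ge[OF that] c2_le[of k] by simp
    then have "w k = (real (c1 k) - real b) / (real b)\<^sup>2"
      using a0 b0 by (simp add: w_def field_simps power2_eq_square)
    moreover have "\<bar>real (c1 k) - real b\<bar> \<le> real a" using c1_ge[OF that] c1_le[of k] by simp
    ultimately show ?thesis by (simp add: divide_right_mono)
  qed
  have w_large: "\<bar>w k\<bar> \<le> 1 / real b" for k
  proof -
    have "real (c1 k) / (real b)\<^sup>2 \<le> real b / (real b)\<^sup>2" using c1_le[of k] by (intro divide_right_mono) auto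
    moreover have "real (c2 k) / (real a * real b) \<le> real a / (real a * real b)"
      using c2_le[of k] by (intro divide_right_mono) auto
    moreover have "0 \<le> real (c1 k) / (real b)\<^sup>2" "0 \<le> real (c2 k) / (real a * real b)" by auto
    moreover have "real b / (real b)\<^sup>2 = 1 / real b" "real a / (real a * real b) = 1 / real b"
      using a0 by (auto simp: power2_eq_square)
    ultimately show ?thesis unfolding w_def abs_le_iff by linarith
  qed
  have diff: "norm (\<Sum>k\<in>K. of_real (w k) * \<Phi> k) \<le> 3 * (real a / real b)\<^sup>2 + 2 * \<delta>"
  proof -
    have "norm (\<Sum>k\<in>K. of_real (w k) * \<Phi> k) \<le> (\<Sum>k\<in>K. (if \<bar>k\<bar> \<le> int a then real a / (real b)\<^sup>2 else 0) + \<delta> / real b)"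
    proof (rule sum_norm_le)
      fix k assume k: "k \<in> K"
      show "norm (of_real (w k) * \<Phi> k) \<le> (if \<bar>k\<bar> \<le> int a then real a / (real b)\<^sup>2 else 0) + \<delta> / real b"
      proof (cases "\<bar>k\<bar> \<le> int a")
        case True
        have "\<bar>w k\<bar> * norm (\<Phi> k) \<le> real a / (real b)\<^sup>2 * 1"
          using w_small[OF True] \<Phi>_le1[of k] by (intro mult_mono) auto
        moreover have "0 \<le> \<delta> / real b" using \<delta>(1) by simp
        ultimately show ?thesis using True by (simp add: norm_mult)
      next
        case False
        have "\<bar>w k\<bar> * norm (\<Phi> k) \<le> 1 / real b * \<delta>"
          using w_large[of k] \<Phi>_le[of k] False k by (intro mult_mono) (auto simp: K_def)
        then show ?thesis using False by (simp add: norm_mult)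
      qed
    qed
    also have "\<dots> = (\<Sum>k\<in>K. if \<bar>k\<bar> \<le> int a then real a / (real b)\<^sup>2 else 0) + card K * (\<delta> / real b)"
      by (simp add: sum.distrib)
    also have "(\<Sum>k\<in>K. if \<bar>k\<bar> \<le> int a then real a / (real b)\<^sup>2 else 0) = (\<Sum>k\<in>{- int a..int a}. real a / (real b)\<^sup>2)"
      using ab by (intro sum.mono_neutral_cong_right) (auto simp: K_def)
    also have "\<dots> = (2 * real a + 1) * (real a / (real b)\<^sup>2)" by simp
    also have "\<dots> \<le> (3 * real a) * (real a / (real b)\<^sup>2)" using ab by (intro mult_right_mono) auto
    also have "\<dots> = 3 * (real a / real b)\<^sup>2" by (simp add: power_divide power2_eq_square)
    also have "card K * (\<delta> / real b) \<le> (2 * real b) * (\<delta> / real b)"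
      using \<delta>(1) b0 by (intro mult_right_mono) (auto simp: K_def)
    also have "\<dots> = 2 * \<delta>" using b0 by simp
    finally show ?thesis by simp
  qed
  define G1 G2 where "G1 S = (\<Sum>i\<in>I2. cis (\<omega> * D S * real_of_int i))" and "G2 S = (\<Sum>j\<in>J2. cis (\<omega> * D S * real_of_int j))" for S
  have S2: "(\<Sum>i\<in>I2. \<Sum>j\<in>J2. \<Phi> (j - i)) = bexp A (\<lambda>S. cnj (G1 S) * G2 S)"
    unfolding \<Phi>_def G1_def G2_def
    by (simp add: bexp_sum[symmetric] sum_product cis_cnj cis_mult right_diff_distrib)
  have S1: "complex_of_real (bexp A (\<lambda>S. (norm (\<Sum>i\<in>I1. cis (\<omega> * D S * real_of_int i)))\<^sup>2)) = (\<Sum>i\<in>I1. \<Sum>j\<in>I1. \<Phi> (j - i))"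
  proof -
    have "complex_of_real ((norm z)\<^sup>2) = cnj z * z" for z by (simp only: complex_norm_square mult.commute)
    then show ?thesis unfolding \<Phi>_def bexp_of_real[symmetric]
      by (simp add: bexp_sum[symmetric] sum_product cis_cnj cis_mult right_diff_distrib)
  qed
  \<comment> \<open>At X S = x all b exponentials equal 1, so the Fejer kernel divided by b^2 is 1
    there, and it is nonnegative elsewhere.\<close>
  have "bexp A (\<lambda>S. of_bool (X S = x)) \<le> bexp A (\<lambda>S. 1 / (real b)\<^sup>2 * (norm (\<Sum>i\<in>I1. cis (\<omega> * D S * real_of_int i)))\<^sup>2)"
    using b0 by (intro bexp_mono) (auto simp: D_def I1_def)
  also have "\<dots> = 1 / (real b)\<^sup>2 * bexp A (\<lambda>S. (norm (\<Sum>i\<in>I1. cis (\<omega> * D S * real_of_int i)))\<^sup>2)"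
    by (rule bexp_cmult)
  also have "\<dots> \<le> norm (complex_of_real (1 / (real b)\<^sup>2 * bexp A (\<lambda>S. (norm (\<Sum>i\<in>I1. cis (\<omega> * D S * real_of_int i)))\<^sup>2)))"
    by (simp only: norm_of_real abs_ge_self)
  also have "\<dots> = norm ((\<Sum>k\<in>K. of_real (w k) * \<Phi> k) + of_real (1 / (real a * real b)) * bexp A (\<lambda>S. cnj (G1 S) * G2 S))"
    unfolding of_real_mult S1 s1 S2[symmetric] s2
    by (simp add: sum_distrib_left sum.distrib[symmetric] w_def algebra_simps)
  also have "\<dots> \<le> (3 * (real a / real b)\<^sup>2 + 2 * \<delta>) + 1 / (real a * real b) * bexp A (\<lambda>S. norm (G1 S) * norm (G2 S))"
  proof (intro order_trans[OF norm_triangle_ineq] add_mono diff)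
    have "norm (bexp A (\<lambda>S. cnj (G1 S) * G2 S)) \<le> bexp A (\<lambda>S. norm (G1 S) * norm (G2 S))"
      by (rule order_trans[OF norm_bexp_le]) (simp add: norm_mult)
    then show "norm (of_real (1 / (real a * real b)) * bexp A (\<lambda>S. cnj (G1 S) * G2 S))
        \<le> 1 / (real a * real b) * bexp A (\<lambda>S. norm (G1 S) * norm (G2 S))"
      unfolding norm_mult norm_of_real by (intro mult_mono) auto
  qed
  also have "bexp A (\<lambda>S. norm (G1 S) * norm (G2 S)) \<le> 18 * (real a)\<^sup>2 * \<beta>"
  proof -
    \<comment> \<open>\<open>\<mu> S\<close> is the index of the interval of length N / a that
      contains \<open>D S\<close>. \<open>r m\<close> is the distance of interval m from 0 in this
      unit, raised to 1 near 0, where the trivial bound 3 a^2 is used; m and - m - 1 are mirror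
      images.\<close>
    define \<mu> where "\<mu> S = \<lfloor>D S * real a / real N\<rfloor>" for S
    define r where "r m = real_of_int (max 1 (if 0 \<le> m then m else - m - 1))" for m :: int
    have r1: "1 \<le> r m" for m by (simp add: r_def)
    have NN: "0 < real N" using N by simp
    have pt: "norm (G1 S) * norm (G2 S) \<le> 3 * (real a)\<^sup>2 * (1 / (r (\<mu> S))\<^sup>2)" if S: "S \<subseteq> A" for S
    proof (cases "r (\<mu> S) = 1")
      case True
      have "norm (G1 S) \<le> real a" unfolding G1_def
        by (rule order_trans[OF norm_sum]) (simp add: I2_def)
      moreover have "norm (G2 S) \<le> 3 * real a" unfolding G2_def
        by (rule order_trans[OF norm_sum]) (simp add: J2_def)
      ultimately have "norm (G1 S) * norm (G2 S) \<le> real a * (3 * real a)" by (intro mult_mono) auto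
      then show ?thesis using True by (simp add: power2_eq_square)
    next
      case False
      have rD: "r (\<mu> S) * real N / real a \<le> \<bar>D S\<bar>"
      proof (cases "0 \<le> \<mu> S")
        case True
        then have "r (\<mu> S) = real_of_int (\<mu> S)" using False by (auto simp: r_def max_def split: if_splits)
        also have "\<dots> \<le> D S * real a / real N" unfolding \<mu>_def by (rule of_int_floor_le)
        finally have "r (\<mu> S) * real N / real a \<le> D S" using NN a0 by (simp add: field_simps)
        then show ?thesis by linarith
      next
        case neg: False
        then have "r (\<mu> S) = - real_of_int (\<mu> S) - 1" using False by (auto simp: r_def max_def split: if_splits)
        moreover have "D S * real a / real N < real_of_int (\<mu> S) + 1" unfolding \<mu>_def by linarith
        ultimately have "r (\<mu> S) \<le> - D S * real a / real N" by simp
        then have "r (\<mu> S) * real N / real a \<le> - D S" using NN a0 by (simp add: field_simps)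
        then show ?thesis by linarith
      qed
      have "0 < r (\<mu> S) * real N / real a" using r1[of "\<mu> S"] NN a0 by simp
      then have D0: "0 < \<bar>D S\<bar>" using rD by linarith
      have "\<bar>D S\<bar> \<le> real M" using X[OF S] x by (simp add: D_def abs_le_iff)
      then have "\<bar>\<omega> * D S\<bar> \<le> \<omega> * (real N / 2)"
        using N unfolding abs_mult \<omega>_def by (intro mult_mono) auto
      then have \<theta>: "0 < \<bar>\<omega> * D S\<bar>" "\<bar>\<omega> * D S\<bar> \<le> pi" using D0 NN by (auto simp: \<omega>_def)
      have J2': "J2 = {- int a..<- int a + int (3 * a)}" and I2': "I2 = {0..<0 + int a}" by (auto simp: J2_def I2_def)
      have "2 * pi / \<bar>\<omega> * D S\<bar> = real N / \<bar>D S\<bar>" using NN by (simp add: \<omega>_def abs_mult)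
      also have "\<dots> \<le> real N / (r (\<mu> S) * real N / real a)"
        by (rule divide_left_mono[OF rD]) (use mult_pos_pos[OF D0 \<open>0 < r (\<mu> S) * real N / real a\<close>] in simp_all)
      also have "\<dots> = real a / r (\<mu> S)" using NN by simp
      finally have B: "2 * pi / \<bar>\<omega> * D S\<bar> \<le> real a / r (\<mu> S)" .
      have "norm (G1 S) \<le> real a / r (\<mu> S)"
        unfolding G1_def I2' using cis_arithmetic_sum_bound[OF \<theta>] B by (rule order_trans)
      moreover have "norm (G2 S) \<le> real a / r (\<mu> S)"
        unfolding G2_def J2' using cis_arithmetic_sum_bound[OF \<theta>] B by (rule order_trans)
      ultimately have "norm (G1 S) * norm (G2 S) \<le> (real a / r (\<mu> S)) * (real a / r (\<mu> S))"
        using r1[of "\<mu> S"] by (intro mult_mono) auto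
      also have "\<dots> = 1 * (real a)\<^sup>2 * (1 / (r (\<mu> S))\<^sup>2)" by (simp add: power2_eq_square)
      also have "\<dots> \<le> 3 * (real a)\<^sup>2 * (1 / (r (\<mu> S))\<^sup>2)" by (intro mult_right_mono) auto
      finally show ?thesis .
    qed
    define MM where "MM = {- int a - 1..int a}"
    have \<mu>_MM: "\<mu> S \<in> MM" if S: "S \<subseteq> A" for S
    proof -
      have "\<bar>D S\<bar> \<le> real M" using X[OF S] x by (simp add: D_def abs_le_iff)
      then have "\<bar>D S\<bar> \<le> real N" using N by linarith
      then have "D S \<le> real N" "- real N \<le> D S" by linarith+
      then have "D S * real a \<le> real N * real a" "(- real N) * real a \<le> D S * real a"
        by (intro mult_right_mono; simp)+
      then have "D S * real a / real N \<le> real a" "- real a \<le> D S * real a / real N"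
        using NN by (auto simp: field_simps)
      then show ?thesis unfolding \<mu>_def MM_def atLeastAtMost_iff by linarith
    qed
    have P: "bexp A (\<lambda>S. of_bool (\<mu> S = m)) \<le> \<beta>" for m
    proof -
      define y where "y = real x + real_of_int m * (real N / real a)"
      have "bexp A (\<lambda>S. of_bool (\<mu> S = m)) = bexp A (\<lambda>S. of_bool (y \<le> real (X S) \<and> real (X S) < y + real N / real a) :: real)"
      proof (intro bexp_cong arg_cong[where f = of_bool])
        fix S
        have "\<mu> S = m \<longleftrightarrow> real_of_int m \<le> D S * real a / real N \<and> D S * real a / real N < real_of_int m + 1"
          unfolding \<mu>_def by linarith
        also have "\<dots> \<longleftrightarrow> real_of_int m * (real N / real a) \<le> D S \<and> D S < real_of_int m * (real N / real a) + real N / real a"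
          using NN a0 by (simp add: field_simps)
        finally show "(\<mu> S = m) = (y \<le> real (X S) \<and> real (X S) < y + real N / real a)"
          by (simp add: y_def D_def algebra_simps)
      qed
      also have "\<dots> \<le> \<beta>" by (rule \<beta>)
      finally show ?thesis .
    qed
    have \<beta>0: "0 \<le> \<beta>" using P[of 0] bexp_nonneg[of A "\<lambda>S. of_bool (\<mu> S = 0)"] by simp
    have "bexp A (\<lambda>S. norm (G1 S) * norm (G2 S)) \<le> bexp A (\<lambda>S. \<Sum>m\<in>MM. 3 * (real a)\<^sup>2 * (1 / (r m)\<^sup>2) * of_bool (\<mu> S = m))"
    proof (rule bexp_mono)
      fix S assume S: "S \<subseteq> A"
      have "(\<Sum>m\<in>MM. 3 * (real a)\<^sup>2 * (1 / (r m)\<^sup>2) * of_bool (\<mu> S = m)) = 3 * (real a)\<^sup>2 * (1 / (r (\<mu> S))\<^sup>2)"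
        using \<mu>_MM[OF S] by (subst sum.remove[of _ "\<mu> S"]) (auto simp: MM_def intro!: sum.neutral)
      then show "norm (G1 S) * norm (G2 S) \<le> (\<Sum>m\<in>MM. 3 * (real a)\<^sup>2 * (1 / (r m)\<^sup>2) * of_bool (\<mu> S = m))"
        using pt[OF S] by simp
    qed
    also have "\<dots> = (\<Sum>m\<in>MM. 3 * (real a)\<^sup>2 * (1 / (r m)\<^sup>2) * bexp A (\<lambda>S. of_bool (\<mu> S = m)))"
      by (simp only: bexp_sum bexp_cmult)
    also have "\<dots> \<le> (\<Sum>m\<in>MM. 3 * (real a)\<^sup>2 * (1 / (r m)\<^sup>2) * \<beta>)"
      by (intro sum_mono mult_left_mono P) auto
    also have "\<dots> = 3 * (real a)\<^sup>2 * \<beta> * (\<Sum>m\<in>MM. 1 / (r m)\<^sup>2)"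
      by (simp add: sum_distrib_left mult_ac)
    also have "(\<Sum>m\<in>MM. 1 / (r m)\<^sup>2) \<le> 6"
    proof -
      have MM_eq: "MM = int ` {..a} \<union> (\<lambda>i. - int i - 1) ` {..a}"
      proof (rule set_eqI)
        fix m
        show "(m \<in> MM) = (m \<in> int ` {..a} \<union> (\<lambda>i. - int i - 1) ` {..a})"
        proof (cases "0 \<le> m")
          case True
          then show ?thesis by (auto simp: MM_def image_iff intro!: bexI[of _ "nat m"])
        next
          case False
          then show ?thesis by (auto simp: MM_def image_iff intro!: bexI[of _ "nat (- m - 1)"])
        qed
      qed
      have "(\<Sum>m\<in>MM. 1 / (r m)\<^sup>2) = (\<Sum>m\<in>int ` {..a}. 1 / (r m)\<^sup>2) + (\<Sum>m\<in>(\<lambda>i. - int i - 1) ` {..a}. 1 / (r m)\<^sup>2)"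
        unfolding MM_eq by (rule sum.union_disjoint) auto
      also have "\<dots> = (\<Sum>i\<le>a. 1 / (real (max 1 i))\<^sup>2) + (\<Sum>i\<le>a. 1 / (real (max 1 i))\<^sup>2)"
        by (simp add: sum.reindex inj_on_def r_def of_int_max of_nat_max)
      also have "\<dots> \<le> 3 + 3"
        using sum_inverse_squares_le[of a] by (intro add_mono) (auto elim!: order_trans)
      finally show ?thesis by simp
    qed
    finally show ?thesis using \<beta>0 by (simp add: mult_left_mono)
  qed
  finally show ?thesis
    using a0 b0 by (simp add: divide_right_mono power2_eq_square field_simps)
qed

section \<open>Gadgets\<close>

text \<open>The first r + q roles carry a tree with root 0 and parent function \<open>\<pi>\<close>.
  As \<open>parent_gadget\<close> puts all parents among the first r roles, every tree edge starts
  inside a gadget. \<open>room\<close> keeps half of the vertices free for the remaining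
  roles.\<close>

locale gadgets = pattern +
  fixes r q :: nat and \<pi> :: "nat \<Rightarrow> nat" and n m w :: nat
  assumes r_ge_2: "2 \<le> r" and q_ge_1: "1 \<le> q" and rq: "r + q \<le> h"
    and parent_less: "\<And>i. 1 \<le> i \<Longrightarrow> i < r + q \<Longrightarrow> \<pi> i < i"
    and parent_gadget: "\<And>i. 1 \<le> i \<Longrightarrow> i < r + q \<Longrightarrow> \<pi> i < r"
    and parent_edge: "\<And>i. 1 \<le> i \<Longrightarrow> i < r + q \<Longrightarrow> {i, \<pi> i} \<in> E"
    and m_pos: "1 \<le> m" and w_pos: "1 \<le> w" and room: "2 * (m * r + q * w) \<le> n" and n_large: "4 * h \<le> n"
begin

text \<open>Gadget \<open>g < m\<close> consists of the vertices \<open>gad g i\<close> with \<open>i < r\<close>.  The candidates for the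
  image of pattern vertex \<open>i\<close> are a gadget vertex for \<open>i < r\<close>, a class of \<open>w\<close> vertices shared by
  all gadgets for \<open>r \<le> i < r + q\<close>, and a linear-sized set for the remaining \<open>i\<close>.\<close>

definition gad :: "nat \<Rightarrow> nat \<Rightarrow> nat" where "gad g i = g * r + i"

text \<open>At most h classes of this size fit into the half of the vertices left free by
  \<open>room\<close>.\<close>

definition fl :: nat where "fl = n div (2 * h)"

text \<open>Start of a class in the layout: gadgets, then the q classes of size \<open>w\<close>,
  then the linear-sized classes. Of interest for r <= i only.\<close>

definition lo :: "nat \<Rightarrow> nat" where
  "lo i = (if i < r + q then m * r + (i - r) * w else m * r + q * w + (i - (r + q)) * fl)"

definition len :: "nat \<Rightarrow> nat" where
  "len i = (if i < r then 1 else if i < r + q then w else fl)"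

definition cand :: "nat \<Rightarrow> nat \<Rightarrow> nat set" where
  "cand g i = (if i < r then {gad g i} else {lo i..<lo i + len i})"

lemma card_cand: "card (cand g i) = len i"
  by (simp add: cand_def len_def)

lemma finite_cand [simp]: "finite (cand g i)"
  by (simp add: cand_def)

lemma gad_less: "g < m \<Longrightarrow> i < r \<Longrightarrow> gad g i < m * r"
  unfolding gad_def using mult_le_mono1[of "Suc g" m r] by simp

lemma gad_inj: "i < r \<Longrightarrow> j < r \<Longrightarrow> gad g i = gad g' j \<longleftrightarrow> g = g' \<and> i = j"
  unfolding gad_def by (metis add_diff_cancel_left' div_mult_self3 div_less mod_less mod_mult_self3 mult.commute add.commute add_0 not_less_zero)

lemma gad_surj: "v < m * r \<Longrightarrow> \<exists>g<m. \<exists>i<r. v = gad g i"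
  using r_ge_2 by (intro exI[of _ "v div r"] conjI exI[of _ "v mod r"]) (auto simp: gad_def less_mult_imp_div_less)

lemma lo_mono: "r \<le> i \<Longrightarrow> i < j \<Longrightarrow> lo i + len i \<le> lo j"
proof -
  assume ij: "r \<le> i" "i < j"
  consider "j < r + q" | "i < r + q" "r + q \<le> j" | "r + q \<le> i" using ij by linarith
  then show ?thesis
  proof cases
    case 1
    have "Suc (i - r) \<le> j - r" using ij 1 by linarith
    then have "Suc (i - r) * w \<le> (j - r) * w" by (rule mult_le_mono1)
    then show ?thesis using 1 ij by (simp add: lo_def len_def)
  next
    case 2
    then have "Suc (i - r) \<le> q" using ij by linarith
    then have "Suc (i - r) * w \<le> q * w" by (rule mult_le_mono1)
    then show ?thesis using 2 ij by (simp add: lo_def len_def)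
  next
    case 3
    then have "Suc (i - (r + q)) \<le> j - (r + q)" using ij by linarith
    then have "Suc (i - (r + q)) * fl \<le> (j - (r + q)) * fl" by (rule mult_le_mono1)
    then show ?thesis using 3 ij by (simp add: lo_def len_def)
  qed
qed

lemma lo_ge: "r \<le> i \<Longrightarrow> m * r \<le> lo i"
  by (simp add: lo_def)

lemma lo_len_le: "r \<le> i \<Longrightarrow> i < h \<Longrightarrow> lo i + len i \<le> n"
proof -
  assume i: "r \<le> i" "i < h"
  have 1: "lo i + len i \<le> lo h" using lo_mono[OF i] .
  have 2: "lo h = m * r + q * w + (h - (r + q)) * fl" using rq by (simp add: lo_def)
  have 3: "(h - (r + q)) * fl \<le> h * fl" by simp
  have "2 * (h * fl) \<le> n" unfolding fl_def by (metis div_times_less_eq_dividend mult.assoc mult.commute)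
  moreover have "x + y \<le> z" if "2 * x \<le> z" "2 * y \<le> z" for x y z :: nat using that by linarith
  ultimately have "m * r + q * w + h * fl \<le> n" using room by blast
  then show ?thesis using 1 2 3 by linarith
qed

lemma cand_subset:
  assumes "g < m" "i < h"
  shows "cand g i \<subseteq> {..<n}"
proof (cases "i < r")
  case True
  have "m * r \<le> n" using room by (simp add: algebra_simps)
  then show ?thesis using gad_less[OF assms(1) True] True by (simp add: cand_def)
next
  case False
  then show ?thesis using lo_len_le[of i] assms(2) by (auto simp: cand_def)
qed

lemma cand_disjoint:
  assumes "g < m" "g' < m" "i \<noteq> j"
  shows "cand g i \<inter> cand g' j = {}"
proof -
  have "cand g i \<inter> cand g' j = {}" if "i < j" "g < m" for g g' i j
    using that gad_inj[of i j g g'] gad_less[of g i] lo_ge[of j] lo_mono[of i j]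
    by (auto simp: cand_def)
  then show ?thesis using assms by (metis Int_commute linorder_neqE_nat)
qed

section \<open>Edge blocks of the tree roles\<close>

definition xe :: "nat \<Rightarrow> nat set" where "xe g = {gad g 0, gad g 1}"

text \<open>The edges that may realise the tree edge between role i and its parent when the parent
  sits in gadget g: one edge for i < r, a star of \<open>w\<close> edges for a class role.\<close>

definition gblock :: "nat \<Rightarrow> nat \<Rightarrow> nat set set" where
  "gblock g i = (\<lambda>u. {gad g (\<pi> i), u}) ` cand g i"

definition block :: "nat \<Rightarrow> nat set set" where
  "block i = (\<Union>g<m. gblock g i)"

lemma parent_1: "\<pi> (Suc 0) = 0"
  using parent_less[of 1] r_ge_2 by simp

lemma gblock_1: "gblock g (Suc 0) = {xe g}"
  using r_ge_2 by (auto simp: gblock_def cand_def xe_def parent_1 insert_commute)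

lemma finite_gblock [simp]: "finite (gblock g i)" by (simp add: gblock_def)

lemma finite_block [simp]: "finite (block i)" by (simp add: block_def)

lemma gad_in_cand: "i < r \<Longrightarrow> gad g i \<in> cand g i"
  by (simp add: cand_def)

text \<open>Candidate sets of different roles are disjoint, so the ends of a common edge determine
  the roles, and the parent end determines the gadget. Matching the ends crosswise would give i =
  \<pi> j < j = \<pi> i < i.\<close>

lemma gblock_disjoint:
  assumes "g < m" "g' < m" "1 \<le> i" "i < r + q" "1 \<le> j" "j < r + q" "(g, i) \<noteq> (g', j)"
  shows "gblock g i \<inter> gblock g' j = {}"
proof (rule ccontr)
  assume "gblock g i \<inter> gblock g' j \<noteq> {}"
  then obtain u u' where u: "u \<in> cand g i" "u' \<in> cand g' j" and eq: "{gad g (\<pi> i), u} = {gad g' (\<pi> j), u'}"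
    by (auto simp: gblock_def)
  have \<pi>: "\<pi> i < i" "\<pi> j < j" "\<pi> i < r" "\<pi> j < r"
    using assms parent_less parent_gadget by auto
  from eq consider "u = u'" "gad g (\<pi> i) = gad g' (\<pi> j)" | "u = gad g' (\<pi> j)" "u' = gad g (\<pi> i)"
    by (auto simp: doubleton_eq_iff)
  then show False
  proof cases
    case 1
    then have "i = j" using cand_disjoint[OF assms(1,2), of i j] u by auto
    then show False using 1(2) gad_inj[of "\<pi> i" "\<pi> j"] \<pi> assms(7) by auto
  next
    case 2
    have "i = \<pi> j" using cand_disjoint[OF assms(1,2), of i "\<pi> j"] u 2 gad_in_cand[OF \<pi>(4), of g'] by auto
    moreover have "j = \<pi> i" using cand_disjoint[OF assms(2,1), of j "\<pi> i"] u 2 gad_in_cand[OF \<pi>(3), of g] by auto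
    ultimately show False using \<pi> by simp
  qed
qed

lemma block_disjoint:
  "1 \<le> i \<Longrightarrow> i < r + q \<Longrightarrow> 1 \<le> j \<Longrightarrow> j < r + q \<Longrightarrow> i \<noteq> j \<Longrightarrow> block i \<inter> block j = {}"
  using gblock_disjoint[of _ _ i j] by (fastforce simp: block_def)

lemma gblock_subset:
  assumes "g < m" "1 \<le> i" "i < r + q"
  shows "gblock g i \<subseteq> all_edges n"
proof
  fix e assume "e \<in> gblock g i"
  then obtain u where u: "u \<in> cand g i" "e = {gad g (\<pi> i), u}" by (auto simp: gblock_def)
  have \<pi>: "\<pi> i < i" "\<pi> i < r" using assms parent_less parent_gadget by auto
  have "gad g (\<pi> i) \<in> cand g (\<pi> i)" using \<pi> by (simp add: gad_in_cand)
  then have "gad g (\<pi> i) \<noteq> u" using cand_disjoint[OF assms(1,1), of i "\<pi> i"] u \<pi> by auto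
  moreover have "u < n" "gad g (\<pi> i) < n"
    using cand_subset[OF assms(1), of i] cand_subset[OF assms(1), of "\<pi> i"] u \<pi> assms rq gad_in_cand[OF \<pi>(2)] by auto
  ultimately show "e \<in> all_edges n" by (simp add: u all_edges_def)
qed

text \<open>The index set starts at 2 because the block of role 1 is kept as the set
  \<open>Xs\<close> of linear variables. The blocks in \<open>BB\<close> are decoupled; the edges in
  \<open>ZZ\<close> are exposed and then held fixed.\<close>

definition Ib :: "nat set" where "Ib = {2..<r + q}"
definition BB :: "nat set set" where "BB = \<Union> (block ` Ib)"
definition Xs :: "nat set set" where "Xs = block 1"
definition ZZ :: "nat set set" where "ZZ = all_edges n - BB - Xs"

lemma Xs_eq: "Xs = xe ` {..<m}"
  by (auto simp: Xs_def block_def gblock_1)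

lemma xe_inj: "inj_on xe {..<m}"
proof (rule inj_onI)
  fix g g' assume "xe g = xe g'"
  then have "gad g 0 = gad g' 0 \<or> gad g 0 = gad g' 1" by (auto simp: xe_def doubleton_eq_iff)
  then show "g = g'" using r_ge_2 gad_inj[of 0 0 g g'] gad_inj[of 0 1 g g'] by auto
qed

lemma finite_sets [simp]: "finite Ib" "finite BB" "finite Xs" "finite ZZ"
  by (auto simp: Ib_def BB_def Xs_def ZZ_def)

lemma edges_split: "all_edges n = (ZZ \<union> Xs) \<union> \<Union> (block ` Ib)"
proof -
  have "block i \<subseteq> all_edges n" if "1 \<le> i" "i < r + q" for i
    using gblock_subset that by (auto simp: block_def)
  then have "Xs \<subseteq> all_edges n" "BB \<subseteq> all_edges n"
    using r_ge_2 unfolding Xs_def BB_def Ib_def by (simp, intro UN_least, simp)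
  then show ?thesis by (auto simp: ZZ_def BB_def)
qed

lemma block_Xs_disjoint: "i \<in> Ib \<Longrightarrow> block i \<inter> Xs = {}"
  unfolding Xs_def Ib_def by (rule block_disjoint) (use r_ge_2 in auto)

lemma block_ZZ_disjoint: "i \<in> Ib \<Longrightarrow> block i \<inter> ZZ = {}"
  by (auto simp: ZZ_def BB_def)

lemma Xs_ZZ_disjoint: "ZZ \<inter> Xs = {}" by (auto simp: ZZ_def)

section \<open>Embeddings that survive the decoupling\<close>

definition touching :: "(nat \<Rightarrow> nat) set" where
  "touching = {\<psi> \<in> embs h n. \<forall>i\<in>Ib. T \<psi> \<inter> block i \<noteq> {}}"

lemma finite_touching [simp]: "finite touching" by (simp add: touching_def)

lemma touch_gblock:
  assumes "T \<psi> \<inter> block i \<noteq> {}"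
  obtains g u where "g < m" "u \<in> cand g i" "u \<in> \<psi> ` {..<h}" "gad g (\<pi> i) \<in> \<psi> ` {..<h}" "{gad g (\<pi> i), u} \<in> T \<psi>"
proof -
  from assms obtain e g u where e: "e \<in> T \<psi>" "g < m" "u \<in> cand g i" "e = {gad g (\<pi> i), u}"
    by (auto simp: block_def gblock_def)
  then show ?thesis using that[of g u] T_edge_in_image[OF e(1)] by auto
qed

lemma touching_class_vertex:
  assumes "\<psi> \<in> touching" "r \<le> i" "i < r + q"
  shows "\<exists>u\<in>{lo i..<lo i + w}. u \<in> \<psi> ` {..<h}"
proof -
  have "i \<in> Ib" using assms r_ge_2 by (simp add: Ib_def)
  then have "T \<psi> \<inter> block i \<noteq> {}" using assms by (auto simp: touching_def)
  then obtain g u where "u \<in> cand g i" "u \<in> \<psi> ` {..<h}" by (rule touch_gblock)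
  then show ?thesis using assms by (auto simp: cand_def len_def)
qed

definition gverts :: "(nat \<Rightarrow> nat) \<Rightarrow> nat \<Rightarrow> nat set" where
  "gverts \<psi> g = {i. i < r \<and> gad g i \<in> \<psi> ` {..<h}}"

text \<open>The edges of the forest induced by the tree on the hit positions of one gadget, each
  named by its child end.\<close>

definition gtree :: "(nat \<Rightarrow> nat) \<Rightarrow> nat \<Rightarrow> nat set" where
  "gtree \<psi> g = {i \<in> gverts \<psi> g. 1 \<le> i \<and> \<pi> i \<in> gverts \<psi> g}"

text \<open>The smallest hit position has no hit parent, as parents are smaller: a nonempty forest
  has fewer edges than vertices.\<close>

lemma gtree_less: "gverts \<psi> g \<noteq> {} \<Longrightarrow> card (gtree \<psi> g) + 1 \<le> card (gverts \<psi> g)"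
proof -
  assume ne: "gverts \<psi> g \<noteq> {}"
  have fin: "finite (gverts \<psi> g)" by (simp add: gverts_def)
  define i where "i = Min (gverts \<psi> g)"
  have i: "i \<in> gverts \<psi> g" using fin ne by (simp add: i_def)
  have "i \<notin> gtree \<psi> g"
  proof
    assume "i \<in> gtree \<psi> g"
    then have "\<pi> i \<in> gverts \<psi> g" "1 \<le> i" "i < r" by (auto simp: gtree_def gverts_def)
    moreover from this have "\<pi> i < i" using parent_less by simp
    moreover have "i \<le> \<pi> i" unfolding i_def using \<open>\<pi> i \<in> gverts \<psi> g\<close> fin by (intro Min_le) (auto simp: i_def)
    ultimately show False by linarith
  qed
  then have "gtree \<psi> g \<subset> gverts \<psi> g" using i by (auto simp: gtree_def)
  from psubset_card_mono[OF fin this] show ?thesis by linarith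
qed

lemma gadget_vertices_card:
  "card (\<psi> ` {..<h} \<inter> {..<m * r}) = (\<Sum>g<m. card (gverts \<psi> g))"
proof -
  have "\<psi> ` {..<h} \<inter> {..<m * r} = (\<Union>g<m. gad g ` gverts \<psi> g)"
  proof (rule set_eqI)
    fix v
    show "v \<in> \<psi> ` {..<h} \<inter> {..<m * r} \<longleftrightarrow> v \<in> (\<Union>g<m. gad g ` gverts \<psi> g)"
    proof
      assume v: "v \<in> \<psi> ` {..<h} \<inter> {..<m * r}"
      then obtain g i where "g < m" "i < r" "v = gad g i" using gad_surj[of v] by blast
      then show "v \<in> (\<Union>g<m. gad g ` gverts \<psi> g)" using v unfolding gverts_def by blast
    next
      assume "v \<in> (\<Union>g<m. gad g ` gverts \<psi> g)"
      then obtain g i where "g < m" "i < r" "v = gad g i" "v \<in> \<psi> ` {..<h}" unfolding gverts_def by blast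
      then show "v \<in> \<psi> ` {..<h} \<inter> {..<m * r}" using gad_less[of g i] by simp
    qed
  qed
  moreover have "card (\<Union>g<m. gad g ` gverts \<psi> g) = (\<Sum>g<m. card (gad g ` gverts \<psi> g))"
  proof (rule card_UN_disjoint)
    show "\<forall>i\<in>{..<m}. \<forall>j\<in>{..<m}. i \<noteq> j \<longrightarrow> gad i ` gverts \<psi> i \<inter> gad j ` gverts \<psi> j = {}"
    proof (intro ballI impI equals0I)
      fix g g' v assume gg: "g \<noteq> g'" and "v \<in> gad g ` gverts \<psi> g \<inter> gad g' ` gverts \<psi> g'"
      then obtain i j where "v = gad g i" "v = gad g' j" "i < r" "j < r" unfolding gverts_def by blast
      then show False using gad_inj[of i j g g'] gg by simp
    qed
  qed (auto simp: gverts_def)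
  moreover have "card (gad g ` gverts \<psi> g) = card (gverts \<psi> g)" for g
    by (rule card_image) (auto simp: inj_on_def gverts_def gad_inj)
  ultimately show ?thesis by simp
qed

text \<open>Every gadget that is hit adds one vertex beyond its tree edges, which forces additional
  vertices on embeddings that spread over several gadgets.\<close>

lemma gadget_vertices_lower:
  assumes "G \<subseteq> {..<m}" "\<And>g. g \<in> G \<Longrightarrow> gverts \<psi> g \<noteq> {}"
  shows "(\<Sum>g<m. card (gtree \<psi> g)) + card G \<le> card (\<psi> ` {..<h} \<inter> {..<m * r})"
proof -
  have "card G = (\<Sum>g<m. if g \<in> G then 1 else 0)"
  proof -
    have "(\<Sum>g<m. if g \<in> G then 1 else 0) = card ({..<m} \<inter> G)" by (simp add: sum.If_cases)
    then show ?thesis using assms(1) by (simp add: Int_absorb1)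
  qed
  then have "(\<Sum>g<m. card (gtree \<psi> g)) + card G = (\<Sum>g<m. card (gtree \<psi> g) + (if g \<in> G then 1 else 0))"
    by (simp only: sum.distrib)
  also have "\<dots> \<le> (\<Sum>g<m. card (gverts \<psi> g))"
  proof (rule sum_mono)
    fix g
    have "card (gtree \<psi> g) \<le> card (gverts \<psi> g)"
      by (rule card_mono) (auto simp: gtree_def gverts_def)
    then show "card (gtree \<psi> g) + (if g \<in> G then 1 else 0) \<le> card (gverts \<psi> g)"
      using gtree_less[of \<psi> g] assms(2)[of g] by auto
  qed
  finally show ?thesis by (simp only: gadget_vertices_card)
qed

lemma xe_gtree:
  assumes "xe g \<in> T \<psi>"
  shows "Suc 0 \<in> gtree \<psi> g"
  using T_edge_in_image[OF assms] r_ge_2 by (auto simp: gtree_def gverts_def xe_def parent_1)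

text \<open>An edge in the block of a role below r has both ends in one gadget, at the positions
  \<open>i\<close> and \<open>\<pi> i\<close>.\<close>

lemma touching_gtree:
  assumes "\<psi> \<in> touching" "xe g \<in> T \<psi>" "g < m" "1 \<le> i" "i < r"
  shows "\<exists>g'<m. i \<in> gtree \<psi> g'"
proof (cases "i = 1")
  case True
  then show ?thesis using xe_gtree[OF assms(2)] assms(3) by (intro exI[of _ g]) simp
next
  case False
  then have "i \<in> Ib" using assms by (simp add: Ib_def)
  then have "T \<psi> \<inter> block i \<noteq> {}" using assms by (auto simp: touching_def)
  then obtain g' u where "g' < m" "u \<in> cand g' i" "u \<in> \<psi> ` {..<h}" "gad g' (\<pi> i) \<in> \<psi> ` {..<h}" by (rule touch_gblock)
  then show ?thesis using assms parent_gadget[of i]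
    by (intro exI[of _ g']) (auto simp: gtree_def gverts_def cand_def)
qed

text \<open>Each of the r - 1 non-root gadget roles is realised in some gadget, and a second edge of
  the form \<open>xe g'\<close> realises role 1 once more.\<close>

lemma touching_gtree_sum:
  assumes "\<psi> \<in> touching" "xe g \<in> T \<psi>" "g < m"
  shows "r - 1 \<le> (\<Sum>g<m. card (gtree \<psi> g))"
    and "g' < m \<Longrightarrow> g' \<noteq> g \<Longrightarrow> xe g' \<in> T \<psi> \<Longrightarrow> r \<le> (\<Sum>g<m. card (gtree \<psi> g))"
proof -
  have fin: "finite (gtree \<psi> g)" for g by (simp add: gtree_def gverts_def)
  have "{1..<r} \<subseteq> (\<Union>g<m. gtree \<psi> g)" using touching_gtree[OF assms] by fastforce
  then have "card {1..<r} \<le> card (\<Union>g<m. gtree \<psi> g)" using fin by (intro card_mono) auto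
  also have "\<dots> \<le> (\<Sum>g<m. card (gtree \<psi> g))" by (rule card_UN_le) simp
  finally show "r - 1 \<le> (\<Sum>g<m. card (gtree \<psi> g))" by simp
  assume g': "g' < m" "g' \<noteq> g" "xe g' \<in> T \<psi>"
  \<comment> \<open>With role 1 deleted from gadget g the roles are still covered, thanks to g'; the
    deleted one is the surplus.\<close>
  define X where "X g'' = (if g'' = g then gtree \<psi> g - {Suc 0} else gtree \<psi> g'')" for g''
  have "{1..<r} \<subseteq> (\<Union>g<m. X g)"
  proof
    fix i assume i: "i \<in> {1..<r}"
    show "i \<in> (\<Union>g<m. X g)"
    proof (cases "i = 1")
      case True
      then show ?thesis using xe_gtree[OF g'(3)] g' by (auto simp: X_def)
    next
      case False
      then show ?thesis using touching_gtree[OF assms, of i] i by (auto simp: X_def)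
    qed
  qed
  then have "card {1..<r} \<le> card (\<Union>g<m. X g)" using fin by (intro card_mono) (auto simp: X_def)
  also have "\<dots> \<le> (\<Sum>g<m. card (X g))" by (rule card_UN_le) simp
  also have "\<dots> = card (X g) + (\<Sum>g\<in>{..<m} - {g}. card (X g))"
    using assms by (intro sum.remove) auto
  also have "(\<Sum>g\<in>{..<m} - {g}. card (X g)) = (\<Sum>g\<in>{..<m} - {g}. card (gtree \<psi> g))"
    by (intro sum.cong) (auto simp: X_def)
  finally have "r - 1 \<le> card (X g) + (\<Sum>g\<in>{..<m} - {g}. card (gtree \<psi> g))" by simp
  moreover have "card (X g) + 1 = card (gtree \<psi> g)"
    using xe_gtree[OF assms(2)] fin[of g] card_Suc_Diff1[of "gtree \<psi> g" "Suc 0"] by (simp add: X_def)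
  moreover have "(\<Sum>g<m. card (gtree \<psi> g)) = card (gtree \<psi> g) + (\<Sum>g\<in>{..<m} - {g}. card (gtree \<psi> g))"
    using assms by (intro sum.remove) auto
  ultimately show "r \<le> (\<Sum>g<m. card (gtree \<psi> g))" using r_ge_2 by linarith
qed

text \<open>The embeddings whose terms are linear in the edge \<open>xe g\<close>.\<close>

definition at_gadget :: "nat \<Rightarrow> (nat \<Rightarrow> nat) set" where
  "at_gadget g = {\<psi> \<in> touching. T \<psi> \<inter> Xs = {xe g}}"

text \<open>These terms depend on the decoupled edges of gadget g only, so their sums are
  independent for different gadgets.\<close>

definition pure :: "nat \<Rightarrow> (nat \<Rightarrow> nat) set" where
  "pure g = {\<psi> \<in> at_gadget g. \<forall>g'<m. g' \<noteq> g \<longrightarrow> gverts \<psi> g' = {}}"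

definition mixed :: "nat \<Rightarrow> (nat \<Rightarrow> nat) set" where
  "mixed g = at_gadget g - pure g"

definition nonlinear :: "(nat \<Rightarrow> nat) set" where
  "nonlinear = {\<psi> \<in> touching. 2 \<le> card (T \<psi> \<inter> Xs)}"

lemma finite_parts [simp]: "finite (at_gadget g)" "finite (pure g)" "finite (mixed g)" "finite nonlinear"
  by (auto simp: at_gadget_def pure_def mixed_def nonlinear_def)

lemma pure_contains_gadget:
  assumes "\<psi> \<in> pure g" "g < m"
  shows "gad g ` {..<r} \<subseteq> \<psi> ` {..<h}"
proof -
  have \<psi>: "\<psi> \<in> touching" "xe g \<in> T \<psi>" using assms by (auto simp: pure_def at_gadget_def)
  have "i \<in> gverts \<psi> g" if "i < r" for i
  proof (cases "i = 0")
    case True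
    then show ?thesis using xe_gtree[OF \<psi>(2)] by (auto simp: gtree_def parent_1)
  next
    case False
    then obtain g' where g': "g' < m" "i \<in> gtree \<psi> g'" using touching_gtree[OF \<psi> assms(2), of i] \<open>i < r\<close> by auto
    then have "g' = g" using assms by (auto simp: pure_def gtree_def)
    then show ?thesis using g' by (simp add: gtree_def)
  qed
  then show ?thesis by (auto simp: gverts_def)
qed

text \<open>A forest with at least r - 1 edges that is spread over two gadgets has at least r + 1
  vertices, one more than a pure embedding covers.\<close>

lemma mixed_gadget_vertices:
  assumes "\<psi> \<in> mixed g" "g < m"
  shows "r + 1 \<le> card (\<psi> ` {..<h} \<inter> {..<m * r})"
proof -
  have \<psi>: "\<psi> \<in> touching" "xe g \<in> T \<psi>" using assms by (auto simp: mixed_def at_gadget_def)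
  obtain g' where g': "g' < m" "g' \<noteq> g" "gverts \<psi> g' \<noteq> {}" using assms by (auto simp: mixed_def pure_def)
  have "(\<Sum>g<m. card (gtree \<psi> g)) + card {g, g'} \<le> card (\<psi> ` {..<h} \<inter> {..<m * r})"
    by (rule gadget_vertices_lower) (use g' assms xe_gtree[OF \<psi>(2)] in \<open>auto simp: gtree_def\<close>)
  then show ?thesis using touching_gtree_sum(1)[OF \<psi> assms(2)] g' r_ge_2 by simp
qed

text \<open>Two edges in \<open>Xs\<close> give at least r tree edges, spread over at least two
  gadgets.\<close>

lemma nonlinear_gadget_vertices:
  assumes "\<psi> \<in> nonlinear"
  obtains g g' where "g < m" "g' < m" "g \<noteq> g'" "xe g \<in> T \<psi>" "xe g' \<in> T \<psi>" "r + 2 \<le> card (\<psi> ` {..<h} \<inter> {..<m * r})"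
proof -
  have \<psi>: "\<psi> \<in> touching" "2 \<le> card (T \<psi> \<inter> Xs)" using assms by (auto simp: nonlinear_def)
  then obtain e e' where e: "e \<in> T \<psi> \<inter> Xs" "e' \<in> T \<psi> \<inter> Xs" "e \<noteq> e'"
    by (metis card_le_Suc0_iff_eq finite_Int finite_T not_less_eq_eq numeral_2_eq_2)
  then obtain g g' where g: "g < m" "g' < m" "e = xe g" "e' = xe g'" by (auto simp: Xs_eq)
  then have ne: "g' \<noteq> g" using e by auto
  have "(\<Sum>g<m. card (gtree \<psi> g)) + card {g, g'} \<le> card (\<psi> ` {..<h} \<inter> {..<m * r})"
    by (rule gadget_vertices_lower) (use g e xe_gtree[of g \<psi>] xe_gtree[of g' \<psi>] in \<open>auto simp: gtree_def\<close>)
  then have "r + 2 \<le> card (\<psi> ` {..<h} \<inter> {..<m * r})"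
    using touching_gtree_sum(2)[OF \<psi>(1), of g g'] e g ne by simp
  then show ?thesis using that[of g g'] g e ne by auto
qed

text \<open>One vertex from each of the q shared classes; the image of every surviving embedding
  contains such a choice.\<close>

definition classes :: "(nat \<Rightarrow> nat) set" where
  "classes = (PiE {r..<r + q} (\<lambda>i. {lo i..<lo i + w}))"

lemma finite_classes [simp]: "finite classes"
  unfolding classes_def by (intro finite_PiE) auto

lemma card_classes: "card classes = w ^ q"
  by (simp add: classes_def card_PiE)

definition cverts :: "(nat \<Rightarrow> nat) \<Rightarrow> nat set" where "cverts u = u ` {r..<r + q}"

lemma card_cverts: "u \<in> classes \<Longrightarrow> card (cverts u) = q"
proof -
  assume u: "u \<in> classes"
  have "inj_on u {r..<r + q}"
  proof (rule inj_onI)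
    fix i j assume ij: "i \<in> {r..<r + q}" "j \<in> {r..<r + q}" "u i = u j"
    have mem: "lo i \<le> u i" "u i < lo i + w" "lo j \<le> u j" "u j < lo j + w"
      using PiE_mem[OF u[unfolded classes_def] ij(1)] PiE_mem[OF u[unfolded classes_def] ij(2)] by auto
    have "len i = w" "len j = w" using ij by (auto simp: len_def)
    then show "i = j" using lo_mono[of i j] lo_mono[of j i] mem ij
      by (cases i j rule: linorder_cases) auto
  qed
  then show ?thesis by (simp add: cverts_def card_image)
qed

lemma cverts_ge: "u \<in> classes \<Longrightarrow> v \<in> cverts u \<Longrightarrow> m * r \<le> v"
  using lo_ge by (fastforce simp: cverts_def classes_def dest: PiE_mem)

lemma card_cverts_Un:
  assumes "u \<in> classes" "A \<subseteq> {..<m * r}"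
  shows "card (A \<union> cverts u) = card A + q"
proof -
  have "finite A" using assms finite_subset by auto
  moreover have "A \<inter> cverts u = {}" using assms cverts_ge by fastforce
  ultimately show ?thesis using card_cverts[OF assms(1)] by (simp add: card_Un_disjoint cverts_def)
qed

lemma touching_classes:
  assumes "\<psi> \<in> touching"
  shows "\<exists>u\<in>classes. cverts u \<subseteq> \<psi> ` {..<h}"
proof -
  have "\<forall>i\<in>{r..<r + q}. \<exists>u. u \<in> {lo i..<lo i + w} \<and> u \<in> \<psi> ` {..<h}"
    using touching_class_vertex[OF assms] by fastforce
  then obtain u where u: "\<And>i. i \<in> {r..<r + q} \<Longrightarrow> u i \<in> {lo i..<lo i + w} \<and> u i \<in> \<psi> ` {..<h}" by metis
  then have "restrict u {r..<r + q} \<in> classes" by (auto simp: classes_def)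
  moreover have "cverts (restrict u {r..<r + q}) \<subseteq> \<psi> ` {..<h}" using u by (auto simp: cverts_def)
  ultimately show ?thesis by blast
qed

text \<open>n^(h - (r + q)), the order of the number of ways to place the roles outside the gadget
  and the classes.\<close>

definition NS :: real where "NS = real n ^ h / real n ^ (r + q)"

section \<open>Counting pure, mixed and nonlinear embeddings\<close>

lemma n_pos: "0 < n" using n_large h_ge_2 by simp

lemma count_covering_family:
  assumes "finite \<A>" "\<And>A. A \<in> \<A> \<Longrightarrow> finite A \<and> card A = k" "\<And>\<psi>. \<psi> \<in> \<Psi> \<Longrightarrow> \<psi> \<in> embs h n \<and> (\<exists>A\<in>\<A>. A \<subseteq> \<psi> ` {..<h})"
  shows "real (card \<Psi>) \<le> real (card \<A>) * (real h ^ h * real n ^ h / real n ^ k)"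
proof -
  have "\<Psi> \<subseteq> (\<Union>A\<in>\<A>. {\<psi> \<in> embs h n. A \<subseteq> \<psi> ` {..<h}})" using assms(3) by auto
  then have "card \<Psi> \<le> card (\<Union>A\<in>\<A>. {\<psi> \<in> embs h n. A \<subseteq> \<psi> ` {..<h}})" using assms(1) by (intro card_mono) auto
  also have "\<dots> \<le> (\<Sum>A\<in>\<A>. card {\<psi> \<in> embs h n. A \<subseteq> \<psi> ` {..<h}})" using assms(1) by (rule card_UN_le)
  finally have "real (card \<Psi>) \<le> (\<Sum>A\<in>\<A>. real (card {\<psi> \<in> embs h n. A \<subseteq> \<psi> ` {..<h}}))"
    by (simp only: of_nat_sum[symmetric] of_nat_le_iff)
  also have "\<dots> \<le> (\<Sum>A\<in>\<A>. real h ^ h * real n ^ h / real n ^ k)"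
    using assms(2) embs_covering_bound[OF _ n_pos, of _ h] by (intro sum_mono) metis
  finally show ?thesis by simp
qed

lemma pure_count:
  assumes "g < m" "u \<in> classes"
  shows "real (card {\<psi> \<in> pure g. cverts u \<subseteq> \<psi> ` {..<h}}) \<le> real h ^ h * NS"
proof -
  have sub: "gad g ` {..<r} \<subseteq> {..<m * r}" using gad_less[OF assms(1)] by auto
  have "card (gad g ` {..<r}) = r" by (subst card_image) (auto simp: inj_on_def gad_def)
  then have c: "card (gad g ` {..<r} \<union> cverts u) = r + q" using card_cverts_Un[OF assms(2) sub] by simp
  have "real (card {\<psi> \<in> pure g. cverts u \<subseteq> \<psi> ` {..<h}}) \<le> real (card {gad g ` {..<r} \<union> cverts u}) * (real h ^ h * real n ^ h / real n ^ (r + q))"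
    by (rule count_covering_family)
      (use c pure_contains_gadget[OF _ assms(1)] in \<open>auto simp: cverts_def pure_def at_gadget_def touching_def\<close>)
  then show ?thesis by (simp add: NS_def)
qed

lemma card_sets_containing:
  assumes "finite V" "D \<subseteq> V" "card D \<le> k"
  shows "card {A. A \<subseteq> V \<and> card A = k \<and> D \<subseteq> A} \<le> card V ^ (k - card D)"
proof -
  have finD: "finite D" using assms finite_subset by auto
  have "card {A. A \<subseteq> V \<and> card A = k \<and> D \<subseteq> A} \<le> card {B. B \<subseteq> V \<and> card B = k - card D}"
  proof (rule card_inj_on_le[where f = "\<lambda>A. A - D"])
    show "inj_on (\<lambda>A. A - D) {A. A \<subseteq> V \<and> card A = k \<and> D \<subseteq> A}" by (auto simp: inj_on_def)
    show "(\<lambda>A. A - D) ` {A. A \<subseteq> V \<and> card A = k \<and> D \<subseteq> A} \<subseteq> {B. B \<subseteq> V \<and> card B = k - card D}"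
      using finD by (auto simp: card_Diff_subset)
    show "finite {B. B \<subseteq> V \<and> card B = k - card D}"
      by (rule finite_subset[of _ "Pow V"]) (use assms(1) in auto)
  qed
  also have "\<dots> = card V choose (k - card D)" using assms(1) by (rule n_subsets)
  also have "\<dots> \<le> card V ^ (k - card D)"
    by (cases "k - card D \<le> card V") (auto simp: binomial_le_pow binomial_eq_0)
  finally show ?thesis .
qed

lemma card_xe: "card (xe g) = 2"
  using r_ge_2 gad_inj[of 0 1 g g] by (simp add: xe_def)

lemma xe_subset: "g < m \<Longrightarrow> xe g \<subseteq> {..<m * r}"
  using gad_less[of g 0] gad_less[of g 1] r_ge_2 by (auto simp: xe_def)

text \<open>Of the r + 1 covered gadget vertices two are the ends of \<open>xe g\<close> and the
  others have at most m r choices each; one more fixed vertex than in \<open>pure_count\<close>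
  saves a factor n.\<close>

lemma mixed_count:
  assumes "g < m" "u \<in> classes"
  shows "real (card {\<psi> \<in> mixed g. cverts u \<subseteq> \<psi> ` {..<h}}) \<le> real h ^ h * NS * real (m * r) ^ (r - 1) / real n"
proof -
  define \<A>0 where "\<A>0 = {A. A \<subseteq> {..<m * r} \<and> card A = r + 1 \<and> xe g \<subseteq> A}"
  define \<A> where "\<A> = (\<lambda>A. A \<union> cverts u) ` \<A>0"
  have fin0: "finite \<A>0" by (rule finite_subset[of _ "Pow {..<m * r}"]) (auto simp: \<A>0_def)
  have c0: "card \<A>0 \<le> (m * r) ^ (r - 1)"
    using card_sets_containing[of "{..<m * r}" "xe g" "r + 1"] xe_subset[OF assms(1)] r_ge_2
    by (simp add: \<A>0_def card_xe)
  have cA: "card \<A> \<le> (m * r) ^ (r - 1)"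
    using c0 card_image_le[OF fin0, of "\<lambda>A. A \<union> cverts u"] by (simp add: \<A>_def)
  have "real (card {\<psi> \<in> mixed g. cverts u \<subseteq> \<psi> ` {..<h}}) \<le> real (card \<A>) * (real h ^ h * real n ^ h / real n ^ (r + q + 1))"
  proof (rule count_covering_family)
    fix A assume "A \<in> \<A>"
    then obtain A0 where A0: "A0 \<in> \<A>0" "A = A0 \<union> cverts u" by (auto simp: \<A>_def)
    then have "card A = r + 1 + q" using card_cverts_Un[OF assms(2), of A0] by (simp add: \<A>0_def)
    moreover have "finite A" using A0 finite_subset[of A0 "{..<m * r}"] by (auto simp: \<A>0_def cverts_def)
    ultimately show "finite A \<and> card A = r + q + 1" by simp
  next
    fix \<psi> assume \<psi>: "\<psi> \<in> {\<psi> \<in> mixed g. cverts u \<subseteq> \<psi> ` {..<h}}"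
    then have x: "xe g \<in> T \<psi>" by (auto simp: mixed_def at_gadget_def)
    have "xe g \<subseteq> \<psi> ` {..<h} \<inter> {..<m * r}" using T_edge_in_image[OF x] xe_subset[OF assms(1)] by auto
    then obtain A0 where "xe g \<subseteq> A0" "A0 \<subseteq> \<psi> ` {..<h} \<inter> {..<m * r}" "card A0 = r + 1"
      using mixed_gadget_vertices[of \<psi> g] \<psi> assms(1) exists_subset_between[of "xe g" "r + 1" "\<psi> ` {..<h} \<inter> {..<m * r}"] card_xe[of g] r_ge_2
      by auto
    then have A: "A0 \<union> cverts u \<in> \<A>" "A0 \<union> cverts u \<subseteq> \<psi> ` {..<h}" using \<psi> by (auto simp: \<A>_def \<A>0_def)
    show "\<psi> \<in> embs h n \<and> (\<exists>A\<in>\<A>. A \<subseteq> \<psi> ` {..<h})"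
    proof
      show "\<psi> \<in> embs h n" using \<psi> by (auto simp: mixed_def at_gadget_def touching_def)
      show "\<exists>A\<in>\<A>. A \<subseteq> \<psi> ` {..<h}"
        by (rule bexI[where x = "A0 \<union> cverts u"]) (rule A)+
    qed
  qed (use fin0 in \<open>simp add: \<A>_def\<close>)
  also have "\<dots> \<le> real (m * r) ^ (r - 1) * (real h ^ h * real n ^ h / real n ^ (r + q + 1))"
    using cA by (intro mult_right_mono) (auto simp flip: of_nat_power of_nat_mult)
  finally show ?thesis using n_pos by (simp add: NS_def field_simps)
qed

text \<open>The r + 2 covered gadget vertices include the four ends of two edges \<open>xe g\<close>
  and \<open>xe g'\<close>: fewer than m^2 choices for the pair and (m r)^(r-2) for the rest. Two
  extra fixed vertices save n^2, and w^q counts the class vertices.\<close>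

lemma nonlinear_count:
  "real (card nonlinear) \<le> real h ^ h * NS * real (m * r) ^ r * real w ^ q / (real n)\<^sup>2"
proof -
  define \<A>0 where "\<A>0 = (\<Union>g<m. \<Union>g'\<in>{..<m} - {g}. {A. A \<subseteq> {..<m * r} \<and> card A = r + 2 \<and> xe g \<union> xe g' \<subseteq> A})"
  define \<A> where "\<A> = (\<lambda>(A, u). A \<union> cverts u) ` (\<A>0 \<times> classes)"
  have fin0: "finite \<A>0" by (rule finite_subset[of _ "Pow {..<m * r}"]) (auto simp: \<A>0_def)
  have "card \<A>0 \<le> (\<Sum>g<m. card (\<Union>g'\<in>{..<m} - {g}. {A. A \<subseteq> {..<m * r} \<and> card A = r + 2 \<and> xe g \<union> xe g' \<subseteq> A}))"
    unfolding \<A>0_def by (rule card_UN_le) simp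
  also have "\<dots> \<le> (\<Sum>g<m. \<Sum>g'\<in>{..<m} - {g}. card {A. A \<subseteq> {..<m * r} \<and> card A = r + 2 \<and> xe g \<union> xe g' \<subseteq> A})"
    by (intro sum_mono card_UN_le) simp
  also have "\<dots> \<le> (\<Sum>g<m. \<Sum>g'\<in>{..<m} - {g}. (m * r) ^ (r - 2))"
  proof (intro sum_mono)
    fix g g' assume g: "g \<in> {..<m}" "g' \<in> {..<m} - {g}"
    have "xe g \<inter> xe g' = {}" using g r_ge_2 gad_inj[of _ _ g g'] by (auto simp: xe_def)
    then have "card (xe g \<union> xe g') = 4" by (subst card_Un_disjoint) (auto simp: card_xe, auto simp: xe_def)
    then show "card {A. A \<subseteq> {..<m * r} \<and> card A = r + 2 \<and> xe g \<union> xe g' \<subseteq> A} \<le> (m * r) ^ (r - 2)"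
      using card_sets_containing[of "{..<m * r}" "xe g \<union> xe g'" "r + 2"] xe_subset[of g] xe_subset[of g'] r_ge_2 g
      by simp
  qed
  also have "\<dots> \<le> (\<Sum>g<m. m * (m * r) ^ (r - 2))"
    by (intro sum_mono) (auto intro!: mult_right_mono)
  also have "\<dots> = m * m * (m * r) ^ (r - 2)" by simp
  also have "\<dots> \<le> (m * r) * (m * r) * (m * r) ^ (r - 2)"
    using r_ge_2 by (intro mult_le_mono) auto
  also have "\<dots> = (m * r) ^ r"
  proof -
    have "(m * r) ^ r = (m * r) ^ (2 + (r - 2))" by (metis le_add_diff_inverse r_ge_2)
    then show ?thesis by (simp only: power_add power2_eq_square)
  qed
  finally have c0: "card \<A>0 \<le> (m * r) ^ r" .
  have "card \<A> \<le> card (\<A>0 \<times> classes)" unfolding \<A>_def using fin0 by (intro card_image_le) simp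
  also have "\<dots> = card \<A>0 * w ^ q" by (simp add: card_cartesian_product card_classes)
  also have "\<dots> \<le> (m * r) ^ r * w ^ q" using c0 by (intro mult_le_mono) auto
  finally have cA: "card \<A> \<le> (m * r) ^ r * w ^ q" .
  have "real (card nonlinear) \<le> real (card \<A>) * (real h ^ h * real n ^ h / real n ^ (r + q + 2))"
  proof (rule count_covering_family)
    fix A assume "A \<in> \<A>"
    then obtain A0 u where A0: "A0 \<in> \<A>0" "u \<in> classes" "A = A0 \<union> cverts u" by (auto simp: \<A>_def)
    then have s: "A0 \<subseteq> {..<m * r}" "card A0 = r + 2" by (auto simp: \<A>0_def)
    have "card A = r + 2 + q" using card_cverts_Un[OF A0(2) s(1)] A0 s by simp
    moreover have "finite A" using A0 s finite_subset[of A0 "{..<m * r}"] by (auto simp: cverts_def)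
    ultimately show "finite A \<and> card A = r + q + 2" by simp
  next
    fix \<psi> assume \<psi>: "\<psi> \<in> nonlinear"
    then obtain g g' where g: "g < m" "g' < m" "g \<noteq> g'" "xe g \<in> T \<psi>" "xe g' \<in> T \<psi>" "r + 2 \<le> card (\<psi> ` {..<h} \<inter> {..<m * r})"
      by (rule nonlinear_gadget_vertices)
    have sub: "xe g \<union> xe g' \<subseteq> \<psi> ` {..<h} \<inter> {..<m * r}"
      using T_edge_in_image[OF g(4)] T_edge_in_image[OF g(5)] xe_subset g by auto
    have "card (xe g \<union> xe g') \<le> r + 2" using card_Un_le[of "xe g" "xe g'"] r_ge_2 by (simp add: card_xe)
    then obtain A0 where "xe g \<union> xe g' \<subseteq> A0" "A0 \<subseteq> \<psi> ` {..<h} \<inter> {..<m * r}" "card A0 = r + 2"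
      using exists_subset_between[OF _ g(6) sub] by auto
    then have "A0 \<in> {A. A \<subseteq> {..<m * r} \<and> card A = r + 2 \<and> xe g \<union> xe g' \<subseteq> A}" and A0: "A0 \<subseteq> \<psi> ` {..<h}" by auto
    moreover have "g \<in> {..<m}" "g' \<in> {..<m} - {g}" using g by auto
    ultimately have "A0 \<in> \<A>0" unfolding \<A>0_def by blast
    note this A0
    moreover obtain u where "u \<in> classes" "cverts u \<subseteq> \<psi> ` {..<h}" using touching_classes[of \<psi>] \<psi> by (auto simp: nonlinear_def)
    ultimately have A: "A0 \<union> cverts u \<in> \<A>" "A0 \<union> cverts u \<subseteq> \<psi> ` {..<h}" by (auto simp: \<A>_def)
    show "\<psi> \<in> embs h n \<and> (\<exists>A\<in>\<A>. A \<subseteq> \<psi> ` {..<h})"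
    proof
      show "\<psi> \<in> embs h n" using \<psi> by (auto simp: nonlinear_def touching_def)
      show "\<exists>A\<in>\<A>. A \<subseteq> \<psi> ` {..<h}"
        by (rule bexI[where x = "A0 \<union> cverts u"]) (rule A)+
    qed
  qed (use fin0 in \<open>simp add: \<A>_def\<close>)
  also have "\<dots> \<le> (real (m * r) ^ r * real w ^ q) * (real h ^ h * real n ^ h / real n ^ (r + q + 2))"
    using cA by (intro mult_right_mono) (auto simp flip: of_nat_power of_nat_mult)
  finally show ?thesis using n_pos by (simp add: NS_def power2_eq_square field_simps)
qed

end

section \<open>Second moments of the gadget coefficients\<close>

lemma (in bernoulli) bexp_image:
  assumes "finite A" "inj_on f A"
  shows "bexp (f ` A) G = bexp A (\<lambda>S. G (f ` S))"
proof -
  have inj: "inj_on ((`) f) (Pow A)" using assms(2) by (rule inj_on_image_Pow)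
  have "bexp (f ` A) G = (\<Sum>S\<in>(`) f ` Pow A. (p ^ card S * (1 - p) ^ card (f ` A - S)) *\<^sub>R G S)"
    by (simp add: bexp_def image_Pow_surj[of f A "f ` A"])
  also have "\<dots> = bexp A (\<lambda>S. G (f ` S))"
    unfolding bexp_def sum.reindex[OF inj] o_def
  proof (rule sum.cong)
    fix S assume S: "S \<in> Pow A"
    then have "card (f ` S) = card S" using assms(2) by (intro card_image) (auto intro: inj_on_subset)
    moreover have "f ` A - f ` S = f ` (A - S)" using S assms(2) by (intro inj_on_image_set_diff[symmetric]) auto
    then have "card (f ` A - f ` S) = card (A - S)"
      using assms(2) by (simp only:) (rule card_image, auto intro: inj_on_subset)
    ultimately show "(p ^ card (f ` S) * (1 - p) ^ card (f ` A - f ` S)) *\<^sub>R G (f ` S)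
      = (p ^ card S * (1 - p) ^ card (A - S)) *\<^sub>R G (f ` S)" by simp
  qed simp
  finally show ?thesis .
qed

text \<open>A pair of independent random sets is encoded as one random set with labelled elements,
  so that \<open>pdeg\<close>, hypercontractivity and independence apply to functions of both
  copies.\<close>

lemma (in bernoulli) bexp_pair:
  assumes "finite A"
  shows "bexp A (\<lambda>Y. bexp A (\<lambda>Y'. F Y Y')) = bexp (A \<times> UNIV) (\<lambda>S. F {b. (b, True) \<in> S} {b. (b, False) \<in> S})"
proof -
  define c where "c = (\<lambda>(x :: bool) (b :: 'a). (b, x))"
  have U: "A \<times> (UNIV :: bool set) = c True ` A \<union> c False ` A"
    by (auto simp: c_def image_iff UNIV_bool)
  have inj: "inj_on (c x) A" for x by (auto simp: c_def inj_on_def)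
  define H where "H S = F {b. (b, True) \<in> S} {b. (b, False) \<in> S}" for S
  have "bexp (A \<times> UNIV) H = bexp (c True ` A) (\<lambda>S. bexp (c False ` A) (\<lambda>S'. H (S \<union> S')))"
    unfolding U using assms by (intro bexp_Un) (auto simp: c_def)
  also have "\<dots> = bexp A (\<lambda>Y. bexp A (\<lambda>Y'. H (c True ` Y \<union> c False ` Y')))"
    using assms by (simp only: bexp_image[OF _ inj])
  also have "\<dots> = bexp A (\<lambda>Y. bexp A (\<lambda>Y'. F Y Y'))"
    unfolding H_def by (intro bexp_cong arg_cong2[where f = F]) (auto simp: c_def)
  finally show ?thesis unfolding H_def by (rule sym)
qed

text \<open>Cauchy-Schwarz over the fibres of \<open>f\<close>.\<close>

lemma square_card_le_pairs:
  assumes "finite N" "finite V" "\<And>x. x \<in> N \<Longrightarrow> f x \<in> V"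
  shows "(real (card N))\<^sup>2 \<le> real (card V) * real (card {(x, y) \<in> N \<times> N. f x = f y})"
proof -
  define fib where "fib v = {x \<in> N. f x = v}" for v
  have fin: "finite (fib v)" for v using assms(1) by (simp add: fib_def)
  have "card N = (\<Sum>v\<in>V. card (fib v))"
  proof -
    have "f ` N \<subseteq> V" using assms(3) by auto
    from sum.group[OF assms(1,2) this, of "\<lambda>_. 1 :: nat"] show ?thesis by (simp add: fib_def)
  qed
  then have "(real (card N))\<^sup>2 = (\<Sum>v\<in>V. real (card (fib v)))\<^sup>2" by simp
  also have "\<dots> \<le> (\<Sum>v\<in>V. (real (card (fib v)))\<^sup>2) * real (card V)"
    by (rule sum_squared_le_sum_of_squares)
  also have "(\<Sum>v\<in>V. (real (card (fib v)))\<^sup>2) = real (\<Sum>v\<in>V. card (fib v \<times> fib v))"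
    by (simp add: card_cartesian_product power2_eq_square)
  also have "(\<Sum>v\<in>V. card (fib v \<times> fib v)) = card (\<Union>v\<in>V. fib v \<times> fib v)"
    using assms(2) fin by (intro card_UN_disjoint[symmetric]) (auto simp: fib_def)
  also have "(\<Union>v\<in>V. fib v \<times> fib v) = {(x, y) \<in> N \<times> N. f x = f y}"
    using assms(3) by (auto simp: fib_def)
  finally show ?thesis by (simp add: mult.commute)
qed

section \<open>Covariances of the decoupled monomials\<close>

context gadgets
begin

definition BT :: "(nat set \<times> bool) set" where "BT = BB \<times> UNIV"

lemma finite_BT [simp]: "finite BT" by (simp add: BT_def)

text \<open>The factor that \<open>decoupling\<close> produces at block i, the two copies being
  stored under True and False.\<close>

definition \<alpha>i :: "nat \<Rightarrow> (nat \<Rightarrow> nat) \<Rightarrow> (nat set \<times> bool) set \<Rightarrow> real" where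
  "\<alpha>i i \<psi> S = of_bool ((T \<psi> \<inter> block i) \<times> {True} \<subseteq> S) - of_bool ((T \<psi> \<inter> block i) \<times> {False} \<subseteq> S)"

definition \<alpha> :: "(nat \<Rightarrow> nat) \<Rightarrow> (nat set \<times> bool) set \<Rightarrow> real" where
  "\<alpha> \<psi> S = (\<Prod>i\<in>Ib. \<alpha>i i \<psi> S)"

lemma \<alpha>i_bound: "\<bar>\<alpha>i i \<psi> S\<bar> \<le> 1" by (simp add: \<alpha>i_def)

lemma \<alpha>_bound: "\<bar>\<alpha> \<psi> S\<bar> \<le> 1"
  unfolding \<alpha>_def abs_prod using \<alpha>i_bound by (intro prod_le_1) auto

lemma \<alpha>_not_touching: "\<psi> \<in> embs h n \<Longrightarrow> \<psi> \<notin> touching \<Longrightarrow> \<alpha> \<psi> S = 0"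
  by (auto simp: \<alpha>_def \<alpha>i_def touching_def intro!: prod_zero)

lemma pdeg_\<alpha>: "pdeg (card Ib * card E) (\<alpha> \<psi>)"
proof -
  have "card (T \<psi> \<inter> block i) \<le> card E" for i
    using card_mono[of "T \<psi>" "T \<psi> \<inter> block i"] card_T_le[of \<psi>] by simp
  then have "pdeg (card E) (\<alpha>i i \<psi>)" for i
    unfolding \<alpha>i_def by (intro pdeg_diff pdeg_ind) (auto simp: card_cartesian_product)
  then show ?thesis unfolding \<alpha>_def by (intro pdeg_prod) auto
qed

lemma block_subset_BB: "i \<in> Ib \<Longrightarrow> block i \<subseteq> BB" by (auto simp: BB_def)

text \<open>Each factor is a difference of two identically distributed monomials and has mean 0, so
  this is a covariance. Monomials from different copies are disjoint and give the subtracted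
  product.\<close>

lemma \<alpha>i_covariance:
  assumes "i \<in> Ib"
  shows "bexp BT (\<lambda>S. \<alpha>i i \<psi> S * \<alpha>i i \<psi>' S)
    = 2 * (p ^ card ((T \<psi> \<inter> block i) \<union> (T \<psi>' \<inter> block i)) - p ^ card (T \<psi> \<inter> block i) * p ^ card (T \<psi>' \<inter> block i))"
proof -
  define a where "a = T \<psi> \<inter> block i"
  define b where "b = T \<psi>' \<inter> block i"
  have ab: "a \<subseteq> BB" "b \<subseteq> BB" "finite a" "finite b" using block_subset_BB[OF assms] by (auto simp: a_def b_def)
  have ind: "bexp BT (\<lambda>S. of_bool (A \<subseteq> S)) = p ^ card A" if "A \<subseteq> BB \<times> UNIV" for A :: "(nat set \<times> bool) set"
    using that by (intro bexp_subset_indicator) (auto simp: BT_def)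
  have "bexp BT (\<lambda>S. \<alpha>i i \<psi> S * \<alpha>i i \<psi>' S) = bexp BT (\<lambda>S. of_bool ((a \<union> b) \<times> {True} \<subseteq> S) + of_bool ((a \<union> b) \<times> {False} \<subseteq> S)
     - of_bool (a \<times> {True} \<union> b \<times> {False} \<subseteq> S) - of_bool (a \<times> {False} \<union> b \<times> {True} \<subseteq> S))"
  proof (rule bexp_cong)
    fix S
    have e: "of_bool (A \<union> B \<subseteq> S) = (of_bool (A \<subseteq> S) * of_bool (B \<subseteq> S) :: real)" for A B :: "(nat set \<times> bool) set" by simp
    have d: "(a \<union> b) \<times> {x} = a \<times> {x} \<union> b \<times> {x}" for x :: bool by auto
    show "\<alpha>i i \<psi> S * \<alpha>i i \<psi>' S = of_bool ((a \<union> b) \<times> {True} \<subseteq> S) + of_bool ((a \<union> b) \<times> {False} \<subseteq> S)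
     - of_bool (a \<times> {True} \<union> b \<times> {False} \<subseteq> S) - of_bool (a \<times> {False} \<union> b \<times> {True} \<subseteq> S)"
      unfolding \<alpha>i_def a_def[symmetric] b_def[symmetric] d e by (simp only: algebra_simps)
  qed
  also have "\<dots> = p ^ card ((a \<union> b) \<times> {True}) + p ^ card ((a \<union> b) \<times> {False})
     - p ^ card (a \<times> {True} \<union> b \<times> {False}) - p ^ card (a \<times> {False} \<union> b \<times> {True})"
    unfolding bexp_diff bexp_add using ab by (subst (1 2 3 4) ind) auto
  also have "card (a \<times> {True} \<union> b \<times> {False}) = card a + card b"
    using ab by (subst card_Un_disjoint) (auto simp: card_cartesian_product)
  also have "card (a \<times> {False} \<union> b \<times> {True}) = card a + card b"
    using ab by (subst card_Un_disjoint) (auto simp: card_cartesian_product)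
  finally show ?thesis by (simp add: card_cartesian_product power_add a_def b_def)
qed

lemma \<alpha>_covariance:
  "bexp BT (\<lambda>S. \<alpha> \<psi> S * \<alpha> \<psi>' S)
    = (\<Prod>i\<in>Ib. 2 * (p ^ card ((T \<psi> \<inter> block i) \<union> (T \<psi>' \<inter> block i)) - p ^ card (T \<psi> \<inter> block i) * p ^ card (T \<psi>' \<inter> block i)))"
proof -
  have "bexp BT (\<lambda>S. \<alpha> \<psi> S * \<alpha> \<psi>' S) = bexp BT (\<lambda>S. \<Prod>i\<in>Ib. \<alpha>i i \<psi> S * \<alpha>i i \<psi>' S)"
    by (simp add: \<alpha>_def prod.distrib)
  also have "\<dots> = (\<Prod>i\<in>Ib. bexp BT (\<lambda>S. \<alpha>i i \<psi> S * \<alpha>i i \<psi>' S))"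
  proof (rule bexp_prod_indep[where A = "\<lambda>i. block i \<times> UNIV"])
    fix i j assume "i \<in> Ib" "j \<in> Ib" "i \<noteq> j"
    then have "block i \<inter> block j = {}" by (intro block_disjoint) (auto simp: Ib_def)
    then show "block i \<times> (UNIV :: bool set) \<inter> block j \<times> UNIV = {}" by auto
  next
    fix i S
    have "((T \<phi> \<inter> block i) \<times> {x} \<subseteq> S) = ((T \<phi> \<inter> block i) \<times> {x} \<subseteq> S \<inter> block i \<times> UNIV)" for \<phi> and x :: bool by auto
    then show "\<alpha>i i \<psi> S * \<alpha>i i \<psi>' S = \<alpha>i i \<psi> (S \<inter> block i \<times> UNIV) * \<alpha>i i \<psi>' (S \<inter> block i \<times> UNIV)"
      unfolding \<alpha>i_def by presburger
  qed (use block_subset_BB in \<open>auto simp: BT_def\<close>)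
  finally show ?thesis by (simp add: \<alpha>i_covariance)
qed

lemma covariance_factor_bounds:
  assumes "finite a" "finite b"
  shows "0 \<le> 2 * (p ^ card (a \<union> b) - p ^ card a * p ^ card b)"
    and "2 * (p ^ card (a \<union> b) - p ^ card a * p ^ card b) \<le> 2 * of_bool (a \<inter> b \<noteq> {})"
proof -
  have "p ^ (card a + card b) \<le> p ^ card (a \<union> b)"
    using p_pos p_less_1 by (intro power_decreasing card_Un_le) auto
  then show "0 \<le> 2 * (p ^ card (a \<union> b) - p ^ card a * p ^ card b)" by (simp add: power_add)
  show "2 * (p ^ card (a \<union> b) - p ^ card a * p ^ card b) \<le> 2 * of_bool (a \<inter> b \<noteq> {})"
  proof (cases "a \<inter> b = {}")
    case True
    then show ?thesis using assms by (simp add: card_Un_disjoint power_add)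
  next
    case False
    have "p ^ card (a \<union> b) \<le> 1" using p_pos p_less_1 by (intro power_le_one) auto
    moreover have "0 \<le> p ^ card a * p ^ card b" using p_pos by simp
    ultimately show ?thesis using False by simp
  qed
qed

text \<open>Nonnegativity, from the positive correlation of monomials, permits dropping terms in
  \<open>pure_second_moment_lower\<close>. The upper bound vanishes unless the two embeddings share
  an edge in every block, which keeps second moments small.\<close>

lemma \<alpha>_covariance_bounds:
  "0 \<le> bexp BT (\<lambda>S. \<alpha> \<psi> S * \<alpha> \<psi>' S)"
  "bexp BT (\<lambda>S. \<alpha> \<psi> S * \<alpha> \<psi>' S) \<le> 2 ^ card Ib * of_bool (\<forall>i\<in>Ib. T \<psi> \<inter> T \<psi>' \<inter> block i \<noteq> {})"
proof -
  show "0 \<le> bexp BT (\<lambda>S. \<alpha> \<psi> S * \<alpha> \<psi>' S)"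
    unfolding \<alpha>_covariance by (intro prod_nonneg covariance_factor_bounds) auto
  have "bexp BT (\<lambda>S. \<alpha> \<psi> S * \<alpha> \<psi>' S) \<le> (\<Prod>i\<in>Ib. 2 * of_bool ((T \<psi> \<inter> block i) \<inter> (T \<psi>' \<inter> block i) \<noteq> {}))"
    unfolding \<alpha>_covariance by (intro prod_mono conjI covariance_factor_bounds) auto
  also have "\<dots> = 2 ^ card Ib * (\<Prod>i\<in>Ib. of_bool (T \<psi> \<inter> T \<psi>' \<inter> block i \<noteq> {}))"
    by (simp add: prod.distrib Int_ac)
  also have "(\<Prod>i\<in>Ib. of_bool (T \<psi> \<inter> T \<psi>' \<inter> block i \<noteq> {}) :: real) = of_bool (\<forall>i\<in>Ib. T \<psi> \<inter> T \<psi>' \<inter> block i \<noteq> {})"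
    by (cases "\<forall>i\<in>Ib. T \<psi> \<inter> T \<psi>' \<inter> block i \<noteq> {}") (auto intro!: prod_zero)
  finally show "bexp BT (\<lambda>S. \<alpha> \<psi> S * \<alpha> \<psi>' S) \<le> 2 ^ card Ib * of_bool (\<forall>i\<in>Ib. T \<psi> \<inter> T \<psi>' \<inter> block i \<noteq> {})" .
qed

definition zsum :: "(nat \<Rightarrow> nat) set \<Rightarrow> nat set set \<Rightarrow> (nat set \<times> bool) set \<Rightarrow> real" where
  "zsum \<Psi> Z S = (\<Sum>\<psi>\<in>\<Psi>. \<alpha> \<psi> S * of_bool (T \<psi> \<inter> ZZ \<subseteq> Z))"

lemma pdeg_zsum: "pdeg (card Ib * card E) (zsum \<Psi> Z)"
  unfolding zsum_def by (rule pdeg_sum) (subst mult.commute, rule pdeg_cmult[OF pdeg_\<alpha>])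

lemma zsum_second_moment:
  "bexp BT (\<lambda>S. (zsum \<Psi> Z S)\<^sup>2) = (\<Sum>\<psi>\<in>\<Psi>. \<Sum>\<psi>'\<in>\<Psi>. of_bool (T \<psi> \<inter> ZZ \<subseteq> Z) * of_bool (T \<psi>' \<inter> ZZ \<subseteq> Z) * bexp BT (\<lambda>S. \<alpha> \<psi> S * \<alpha> \<psi>' S))"
proof -
  have "bexp BT (\<lambda>S. (zsum \<Psi> Z S)\<^sup>2) = bexp BT (\<lambda>S. \<Sum>\<psi>\<in>\<Psi>. \<Sum>\<psi>'\<in>\<Psi>. (of_bool (T \<psi> \<inter> ZZ \<subseteq> Z) * of_bool (T \<psi>' \<inter> ZZ \<subseteq> Z)) * (\<alpha> \<psi> S * \<alpha> \<psi>' S))"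
    by (simp only: zsum_def power2_eq_square sum_product mult_ac)
  then show ?thesis by (simp only: bexp_sum bexp_cmult)
qed

text \<open>Correlated embeddings share an edge of every class block and hence a vertex of every
  class, so the pairs are counted by the w^q choices of class vertices.\<close>

lemma zsum_second_moment_upper:
  assumes "finite \<Psi>" "\<And>u. u \<in> classes \<Longrightarrow> real (card {\<psi> \<in> \<Psi>. cverts u \<subseteq> \<psi> ` {..<h}}) \<le> b"
  shows "bexp BT (\<lambda>S. (zsum \<Psi> Z S)\<^sup>2) \<le> 2 ^ card Ib * (real w ^ q * b\<^sup>2)"
proof -
  have "bexp BT (\<lambda>S. (zsum \<Psi> Z S)\<^sup>2) \<le> (\<Sum>\<psi>\<in>\<Psi>. \<Sum>\<psi>'\<in>\<Psi>. 2 ^ card Ib * of_bool (\<forall>i\<in>Ib. T \<psi> \<inter> T \<psi>' \<inter> block i \<noteq> {}))"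
    unfolding zsum_second_moment
  proof (intro sum_mono)
    fix \<psi> \<psi>'
    have "of_bool (T \<psi> \<inter> ZZ \<subseteq> Z) * of_bool (T \<psi>' \<inter> ZZ \<subseteq> Z) * bexp BT (\<lambda>S. \<alpha> \<psi> S * \<alpha> \<psi>' S) \<le> 1 * bexp BT (\<lambda>S. \<alpha> \<psi> S * \<alpha> \<psi>' S)"
      by (intro mult_right_mono \<alpha>_covariance_bounds) auto
    then show "of_bool (T \<psi> \<inter> ZZ \<subseteq> Z) * of_bool (T \<psi>' \<inter> ZZ \<subseteq> Z) * bexp BT (\<lambda>S. \<alpha> \<psi> S * \<alpha> \<psi>' S)
      \<le> 2 ^ card Ib * of_bool (\<forall>i\<in>Ib. T \<psi> \<inter> T \<psi>' \<inter> block i \<noteq> {})"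
      using \<alpha>_covariance_bounds(2)[of \<psi> \<psi>'] by linarith
  qed
  also have "\<dots> = 2 ^ card Ib * (\<Sum>x\<in>\<Psi> \<times> \<Psi>. of_bool (\<forall>i\<in>Ib. T (fst x) \<inter> T (snd x) \<inter> block i \<noteq> {}))"
    by (simp add: sum_distrib_left[symmetric] sum.cartesian_product split_beta)
  also have "(\<Sum>x\<in>\<Psi> \<times> \<Psi>. of_bool (\<forall>i\<in>Ib. T (fst x) \<inter> T (snd x) \<inter> block i \<noteq> {}) :: real)
    = card {x \<in> \<Psi> \<times> \<Psi>. \<forall>i\<in>Ib. T (fst x) \<inter> T (snd x) \<inter> block i \<noteq> {}}"
    using assms(1) by (simp add: of_bool_def sum.If_cases Int_def)
  also have "{x \<in> \<Psi> \<times> \<Psi>. \<forall>i\<in>Ib. T (fst x) \<inter> T (snd x) \<inter> block i \<noteq> {}}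
    = {(\<psi>, \<psi>') \<in> \<Psi> \<times> \<Psi>. \<forall>i\<in>Ib. T \<psi> \<inter> T \<psi>' \<inter> block i \<noteq> {}}" by auto
  also have "real (card \<dots>) \<le> (\<Sum>u\<in>classes. b\<^sup>2)"
  proof (rule card_pairs_sharing[where P = "\<lambda>\<psi> u. cverts u \<subseteq> \<psi> ` {..<h}"])
    fix \<psi> \<psi>' assume sh: "\<forall>i\<in>Ib. T \<psi> \<inter> T \<psi>' \<inter> block i \<noteq> {}"
    have "\<forall>i\<in>{r..<r + q}. \<exists>u. u \<in> {lo i..<lo i + w} \<and> u \<in> \<psi> ` {..<h} \<and> u \<in> \<psi>' ` {..<h}"
    proof
      fix i assume i: "i \<in> {r..<r + q}"
      then have "i \<in> Ib" using r_ge_2 by (simp add: Ib_def)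
      then obtain e where e: "e \<in> T \<psi>" "e \<in> T \<psi>'" "e \<in> block i" using sh by blast
      then obtain g u where u: "u \<in> cand g i" "e = {gad g (\<pi> i), u}" by (auto simp: block_def gblock_def)
      then show "\<exists>u. u \<in> {lo i..<lo i + w} \<and> u \<in> \<psi> ` {..<h} \<and> u \<in> \<psi>' ` {..<h}"
        using i T_edge_in_image[OF e(1)] T_edge_in_image[OF e(2)] by (intro exI[of _ u]) (auto simp: cand_def len_def)
    qed
    then obtain u where u: "\<And>i. i \<in> {r..<r + q} \<Longrightarrow> u i \<in> {lo i..<lo i + w} \<and> u i \<in> \<psi> ` {..<h} \<and> u i \<in> \<psi>' ` {..<h}" by metis
    then have "restrict u {r..<r + q} \<in> classes" by (auto simp: classes_def)
    moreover have "cverts (restrict u {r..<r + q}) \<subseteq> \<psi> ` {..<h}" "cverts (restrict u {r..<r + q}) \<subseteq> \<psi>' ` {..<h}"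
      using u by (auto simp: cverts_def)
    ultimately show "\<exists>u\<in>classes. cverts u \<subseteq> \<psi> ` {..<h} \<and> cverts u \<subseteq> \<psi>' ` {..<h}" by blast
  qed (use assms in auto)
  finally show ?thesis by (simp add: card_classes)
qed

text \<open>Embeddings that send every role into its own candidate set: numerous enough for a lower
  bound, and with explicitly known block edges.\<close>

definition intended :: "nat \<Rightarrow> (nat \<Rightarrow> nat) set" where
  "intended g = Pi\<^sub>E {..<h} (cand g)"

lemma finite_intended [simp]: "finite (intended g)"
  unfolding intended_def by (intro finite_PiE) auto

lemma intended_mem: "\<psi> \<in> intended g \<Longrightarrow> i < h \<Longrightarrow> \<psi> i \<in> cand g i"
  by (auto simp: intended_def)

lemma intended_embs: "g < m \<Longrightarrow> intended g \<subseteq> embs h n"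
proof
  fix \<psi> assume g: "g < m" and \<psi>: "\<psi> \<in> intended g"
  have "\<psi> i < n" if "i < h" for i using intended_mem[OF \<psi> that] cand_subset[OF g that] by auto
  moreover have "inj_on \<psi> {..<h}"
  proof (rule inj_onI)
    fix i j assume ij: "i \<in> {..<h}" "j \<in> {..<h}" "\<psi> i = \<psi> j"
    then show "i = j" using intended_mem[OF \<psi>, of i] intended_mem[OF \<psi>, of j] cand_disjoint[OF g g, of i j] by auto
  qed
  ultimately show "\<psi> \<in> embs h n" using \<psi> by (auto simp: embs_def intended_def PiE_iff)
qed

text \<open>Candidate sets of different roles are disjoint even across gadgets, so a vertex reveals
  its role.\<close>

lemma intended_image:
  assumes "g < m" "g' < m" "\<psi> \<in> intended g" "v \<in> \<psi> ` {..<h}" "v \<in> cand g' i"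
  shows "v = \<psi> i"
proof -
  obtain j where j: "j < h" "v = \<psi> j" using assms by auto
  then have "v \<in> cand g j" using intended_mem assms by auto
  then have "i = j" using cand_disjoint[OF assms(1,2), of j i] assms(5) by auto
  then show ?thesis using j by simp
qed

lemma intended_block:
  assumes "g < m" "\<psi> \<in> intended g" "1 \<le> i" "i < r + q"
  shows "T \<psi> \<inter> block i = {{\<psi> i, gad g (\<pi> i)}}" and "\<psi> (\<pi> i) = gad g (\<pi> i)"
proof -
  have \<pi>: "\<pi> i < r" "\<pi> i < h" using parent_gadget[OF assms(3,4)] rq by auto
  have ih: "i < h" using assms rq by simp
  show p: "\<psi> (\<pi> i) = gad g (\<pi> i)" using intended_mem[OF assms(2) \<pi>(2)] \<pi> by (simp add: cand_def)
  show "T \<psi> \<inter> block i = {{\<psi> i, gad g (\<pi> i)}}"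
  proof (intro equalityI subsetI)
    fix e assume e: "e \<in> T \<psi> \<inter> block i"
    then obtain g' u where u: "g' < m" "u \<in> cand g' i" "e = {gad g' (\<pi> i), u}" by (auto simp: block_def gblock_def)
    have im: "u \<in> \<psi> ` {..<h}" "gad g' (\<pi> i) \<in> \<psi> ` {..<h}" using T_edge_in_image[of e \<psi>] e u by auto
    have "u = \<psi> i" using intended_image[OF assms(1) u(1) assms(2) im(1) u(2)] .
    moreover have "gad g' (\<pi> i) = \<psi> (\<pi> i)"
      using intended_image[OF assms(1) u(1) assms(2) im(2)] gad_in_cand[OF \<pi>(1)] by simp
    ultimately show "e \<in> {{\<psi> i, gad g (\<pi> i)}}" using u p by auto
  next
    fix e assume "e \<in> {{\<psi> i, gad g (\<pi> i)}}"
    then have e: "e = {\<psi> i, gad g (\<pi> i)}" by simp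
    have e2: "e = \<psi> ` {i, \<pi> i}" using e p by simp
    have "e \<in> T \<psi>" unfolding e2 image_edges_def by (intro imageI parent_edge assms)
    moreover have "e \<in> block i" using e assms(1) intended_mem[OF assms(2) ih]
      by (auto simp: block_def gblock_def insert_commute)
    ultimately show "e \<in> T \<psi> \<inter> block i" by simp
  qed
qed

lemma intended_pure:
  assumes "g < m"
  shows "intended g \<subseteq> pure g"
proof
  fix \<psi> assume \<psi>: "\<psi> \<in> intended g"
  have "T \<psi> \<inter> block i \<noteq> {}" if "i \<in> Ib" for i
    using intended_block(1)[OF assms \<psi>, of i] that by (auto simp: Ib_def)
  then have 1: "\<psi> \<in> touching" using \<psi> intended_embs[OF assms] by (auto simp: touching_def)
  have "\<psi> 1 = gad g 1" using intended_mem[OF \<psi>, of 1] r_ge_2 h_ge_2 by (simp add: cand_def)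
  then have 2: "T \<psi> \<inter> Xs = {xe g}"
    using intended_block(1)[OF assms \<psi>, of 1] r_ge_2 by (simp add: Xs_def xe_def parent_1 insert_commute)
  have "gverts \<psi> g' = {}" if g': "g' < m" "g' \<noteq> g" for g'
  proof (rule ccontr)
    assume "gverts \<psi> g' \<noteq> {}"
    then obtain i where i: "i < r" "gad g' i \<in> \<psi> ` {..<h}" by (auto simp: gverts_def)
    then have "gad g' i = \<psi> i" using intended_image[OF assms g'(1) \<psi> i(2), of i] by (simp add: gad_in_cand)
    moreover have "\<psi> i = gad g i" using intended_mem[OF \<psi>, of i] i rq by (simp add: cand_def)
    ultimately show False using gad_inj[of i i g' g] i g' by simp
  qed
  then show "\<psi> \<in> pure g" using 1 2 by (auto simp: pure_def at_gadget_def)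
qed

text \<open>As all covariances are nonnegative, it suffices to sum over intended embeddings. Two of
  them with the same class vertices have the same block edges and covariance (2 p (1 - p))^kb;
  Cauchy-Schwarz over the w^q class choices bounds the number of such pairs from below.\<close>

lemma pure_second_moment_lower:
  assumes "g < m"
  shows "(2 * (p * (1 - p))) ^ card Ib * (real (card {\<psi> \<in> intended g. T \<psi> \<inter> ZZ \<subseteq> Z}))\<^sup>2 / real w ^ q
    \<le> bexp BT (\<lambda>S. (zsum (pure g) Z S)\<^sup>2)"
proof -
  define N where "N = {\<psi> \<in> intended g. T \<psi> \<inter> ZZ \<subseteq> Z}"
  define f where "f \<psi> = restrict \<psi> {r..<r + q}" for \<psi> :: "nat \<Rightarrow> nat"
  define c where "c = (2 * (p * (1 - p))) ^ card Ib"
  have c: "0 \<le> c" using p_pos p_less_1 by (simp add: c_def)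
  have finN: "finite N" by (simp add: N_def)
  have Npure: "N \<subseteq> pure g" using intended_pure[OF assms] by (auto simp: N_def)
  have fcl: "f \<psi> \<in> classes" if "\<psi> \<in> N" for \<psi>
  proof -
    have "\<psi> i \<in> {lo i..<lo i + w}" if "i \<in> {r..<r + q}" for i
      using intended_mem[of \<psi> g i] \<open>\<psi> \<in> N\<close> that rq by (auto simp: N_def cand_def len_def)
    then show ?thesis by (auto simp: f_def classes_def)
  qed
  have cov: "c * of_bool (f \<psi> = f \<psi>') \<le> bexp BT (\<lambda>S. \<alpha> \<psi> S * \<alpha> \<psi>' S)" if \<psi>: "\<psi> \<in> N" "\<psi>' \<in> N" for \<psi> \<psi>'
  proof (cases "f \<psi> = f \<psi>'")
    case True
    have "\<psi> i = \<psi>' i" if "i \<in> Ib" for i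
    proof (cases "i < r")
      case True
      then show ?thesis using intended_mem[of \<psi> g i] intended_mem[of \<psi>' g i] \<psi> rq by (auto simp: N_def cand_def)
    next
      case False
      then have "i \<in> {r..<r + q}" using that by (auto simp: Ib_def)
      then show ?thesis using fun_cong[OF True, of i] by (simp add: f_def)
    qed
    then have "T \<psi> \<inter> block i = {{\<psi> i, gad g (\<pi> i)}}" "T \<psi>' \<inter> block i = {{\<psi> i, gad g (\<pi> i)}}" if "i \<in> Ib" for i
      using intended_block(1)[OF assms, of _ i] \<psi> that by (auto simp: N_def Ib_def)
    then have "bexp BT (\<lambda>S. \<alpha> \<psi> S * \<alpha> \<psi>' S) = (\<Prod>i\<in>Ib. 2 * (p ^ 1 - p ^ 1 * p ^ 1))"
      unfolding \<alpha>_covariance by (intro prod.cong) auto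
    then show ?thesis using True by (simp add: c_def right_diff_distrib)
  qed (simp add: \<alpha>_covariance_bounds)
  have "c * card {(x, y) \<in> N \<times> N. f x = f y} = (\<Sum>\<psi>\<in>N. \<Sum>\<psi>'\<in>N. c * of_bool (f \<psi> = f \<psi>'))"
  proof -
    have "{(x, y) \<in> N \<times> N. f x = f y} = {x \<in> N \<times> N. f (fst x) = f (snd x)}" by auto
    then have "real (card {(x, y) \<in> N \<times> N. f x = f y}) = (\<Sum>x\<in>N \<times> N. of_bool (f (fst x) = f (snd x)))"
      using finN by (simp add: of_bool_def sum.If_cases Int_def)
    then show ?thesis by (simp add: sum_distrib_left sum.cartesian_product split_beta)
  qed
  also have "\<dots> \<le> (\<Sum>\<psi>\<in>N. \<Sum>\<psi>'\<in>N. bexp BT (\<lambda>S. \<alpha> \<psi> S * \<alpha> \<psi>' S))" by (intro sum_mono cov)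
  also have "\<dots> = (\<Sum>x\<in>N \<times> N. bexp BT (\<lambda>S. \<alpha> (fst x) S * \<alpha> (snd x) S))"
    by (simp add: sum.cartesian_product split_beta)
  also have "\<dots> = (\<Sum>x\<in>N \<times> N. of_bool (T (fst x) \<inter> ZZ \<subseteq> Z) * of_bool (T (snd x) \<inter> ZZ \<subseteq> Z) * bexp BT (\<lambda>S. \<alpha> (fst x) S * \<alpha> (snd x) S))"
    by (intro sum.cong) (auto simp: N_def)
  also have "\<dots> \<le> (\<Sum>x\<in>pure g \<times> pure g. of_bool (T (fst x) \<inter> ZZ \<subseteq> Z) * of_bool (T (snd x) \<inter> ZZ \<subseteq> Z) * bexp BT (\<lambda>S. \<alpha> (fst x) S * \<alpha> (snd x) S))"
    using Npure by (intro sum_mono2 mult_nonneg_nonneg \<alpha>_covariance_bounds) auto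
  also have "\<dots> = bexp BT (\<lambda>S. (zsum (pure g) Z S)\<^sup>2)"
    unfolding zsum_second_moment by (simp add: sum.cartesian_product split_beta)
  finally have 1: "c * card {(x, y) \<in> N \<times> N. f x = f y} \<le> bexp BT (\<lambda>S. (zsum (pure g) Z S)\<^sup>2)" .
  have "(real (card N))\<^sup>2 \<le> real w ^ q * card {(x, y) \<in> N \<times> N. f x = f y}"
    using square_card_le_pairs[OF finN finite_classes fcl] by (simp add: card_classes)
  then have "(real (card N))\<^sup>2 / real w ^ q \<le> card {(x, y) \<in> N \<times> N. f x = f y}"
    using w_pos by (simp add: pos_divide_le_eq mult.commute)
  then have "c * ((real (card N))\<^sup>2 / real w ^ q) \<le> c * card {(x, y) \<in> N \<times> N. f x = f y}"
    using c by (rule mult_left_mono)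
  then show ?thesis using 1 by (simp add: c_def N_def)
qed

end

section \<open>Decay of the characteristic function\<close>

lemma one_minus_cos_le: "1 - cos y \<le> y\<^sup>2 / 2" for y :: real
proof -
  have "cos y = 1 - 2 * (sin (y / 2))\<^sup>2" using cos_double_sin[of "y / 2"] by simp
  moreover have "(sin (y / 2))\<^sup>2 \<le> \<bar>y / 2\<bar>\<^sup>2"
    using abs_sin_x_le_abs_x[of "y / 2"] by (simp add: abs_le_square_iff[symmetric])
  ultimately show ?thesis by (simp add: power_divide)
qed

text \<open>The square of y - y^3/6 <= sin y at y = |x|/2; for y^2 > 3 the lower bound is negative.
  The loss is a fourth power, which hypercontractivity controls.\<close>

lemma one_minus_cos_ge: "x\<^sup>2 / 2 - x ^ 4 / 24 \<le> 1 - cos x" for x :: real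
proof -
  define y where "y = \<bar>x / 2\<bar>"
  have y0: "0 \<le> y" by (simp add: y_def)
  have "y\<^sup>2 - y ^ 4 / 3 \<le> (sin y)\<^sup>2"
  proof (cases "y\<^sup>2 \<le> 3")
    case True
    have "\<bar>sin y - (\<Sum>m<3. sin_coeff m * y ^ m)\<bar> \<le> inverse (fact 3) * \<bar>y\<bar> ^ 3"
      by (rule Maclaurin_sin_bound)
    then have "\<bar>sin y - y\<bar> \<le> y ^ 3 / 6"
      using y0 by (simp add: eval_nat_numeral sin_coeff_def)
    then have s: "y - y ^ 3 / 6 \<le> sin y" by linarith
    have "y * y\<^sup>2 \<le> y * 3" using True y0 by (intro mult_left_mono) auto
    then have "0 \<le> y - y ^ 3 / 6" using y0 by (simp add: power3_eq_cube power2_eq_square)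
    then have "(y - y ^ 3 / 6)\<^sup>2 \<le> (sin y)\<^sup>2" using s by (intro power_mono) auto
    moreover have "(y - y ^ 3 / 6)\<^sup>2 = y\<^sup>2 - y ^ 4 / 3 + (y ^ 3 / 6)\<^sup>2"
      by (simp add: power2_eq_square power3_eq_cube power4_eq_xxxx algebra_simps)
    moreover have "0 \<le> (y ^ 3 / 6)\<^sup>2" by simp
    ultimately show ?thesis by linarith
  next
    case False
    have "y\<^sup>2 * 3 \<le> y\<^sup>2 * y\<^sup>2" using False by (intro mult_left_mono) auto
    then have "y\<^sup>2 - y ^ 4 / 3 \<le> 0" by (simp add: power4_eq_xxxx power2_eq_square)
    then show ?thesis by (rule order_trans) simp
  qed
  moreover have "(sin y)\<^sup>2 = (sin (x / 2))\<^sup>2" by (simp add: y_def abs_if)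
  moreover have "cos x = 1 - 2 * (sin (x / 2))\<^sup>2" using cos_double_sin[of "x / 2"] by simp
  moreover have "y\<^sup>2 = x\<^sup>2 / 4" "y ^ 4 = x ^ 4 / 16" by (auto simp: y_def power_divide)
  ultimately show ?thesis by linarith
qed

text \<open>The triangle inequality for |cis x - 1|, squared. It separates the pure part x of a
  coefficient from the mixed part y.\<close>

lemma one_minus_cos_add: "(1 - cos x) / 2 - (1 - cos y) \<le> 1 - cos (x + y)" for x y :: real
proof -
  have sq: "(norm (cis z - 1))\<^sup>2 = 2 * (1 - cos z)" for z
  proof -
    have "(norm (cis z - 1))\<^sup>2 = (cos z - 1)\<^sup>2 + (sin z)\<^sup>2" by (simp add: cmod_power2)
    also have "\<dots> = ((sin z)\<^sup>2 + (cos z)\<^sup>2) + 1 - 2 * cos z"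
      by (simp only: power2_eq_square) (simp add: algebra_simps)
    finally show ?thesis by (simp only: sin_cos_squared_add) simp
  qed
  have "cis x - 1 = (cis (x + y) - 1) - cis x * (cis y - 1)" by (simp add: cis_mult algebra_simps)
  then have "norm (cis x - 1) \<le> norm (cis (x + y) - 1) + norm (cis x * (cis y - 1))"
    by (metis norm_triangle_ineq4)
  then have "norm (cis x - 1) \<le> norm (cis (x + y) - 1) + norm (cis y - 1)" by (simp add: norm_mult)
  then have "(norm (cis x - 1))\<^sup>2 \<le> (norm (cis (x + y) - 1) + norm (cis y - 1))\<^sup>2"
    by (intro power_mono) auto
  also have "\<dots> \<le> 2 * (norm (cis (x + y) - 1))\<^sup>2 + 2 * (norm (cis y - 1))\<^sup>2"
    using sum_squares_bound[of "norm (cis (x + y) - 1)" "norm (cis y - 1)"]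
    by (simp only: power2_sum)
  finally have "2 * (1 - cos x) \<le> 2 * (2 * (1 - cos (x + y))) + 2 * (2 * (1 - cos y))" unfolding sq .
  then show ?thesis by (simp add: field_simps)
qed

lemma exp_minus_le_half: "exp (- y) \<le> 1 - y / 2" if "0 \<le> y" "y \<le> 1" for y :: real
proof -
  have "exp (- y) = inverse (exp y)" by (rule exp_minus)
  also have "\<dots> \<le> inverse (1 + y)" using that exp_ge_add_one_self[of y] by (intro le_imp_inverse_le) auto
  also have "\<dots> \<le> 1 - y / 2"
  proof -
    have "1 \<le> (1 - y / 2) * (1 + y)" using that mult_left_mono[of y 1 y] by (simp add: algebra_simps)
    then show ?thesis using that by (simp add: inverse_eq_divide pos_divide_le_eq)
  qed
  finally show ?thesis .
qed

section \<open>Reduction to independent gadgets\<close>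

context gadgets
begin

abbreviation dE :: nat where "dE \<equiv> card E"
abbreviation kb :: nat where "kb \<equiv> card Ib"

text \<open>The decay exponent up to the factor p (1 - p): by \<open>oscillation_bound\<close> every
  linear coefficient contributes 1 - cos of its phase.\<close>

definition defect :: "real \<Rightarrow> nat set set \<Rightarrow> (nat set \<times> bool) set \<Rightarrow> real" where
  "defect t Z S = (\<Sum>g<m. 1 - cos (t * zsum (at_gadget g) Z S))"

definition \<kappa> :: "real \<Rightarrow> real" where "\<kappa> t = 2 ^ dE * (\<bar>t\<bar> * real (card nonlinear))"

text \<open>Everything except the edges \<open>Xs\<close> is fixed here. Coefficients of embeddings
  outside \<open>touching\<close> vanish, so the nonlinear error involves \<open>nonlinear\<close>
  only. The minimum with 1 is the trivial bound, kept for exceptional choices of the fixed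
  edges.\<close>

lemma inner_bound:
  assumes Z: "Z \<subseteq> ZZ"
  shows "norm (bexp Xs (\<lambda>x. cis (t * (\<Sum>\<psi>\<in>embs h n. (\<alpha> \<psi> S * of_bool (T \<psi> \<inter> ZZ \<subseteq> Z)) * of_bool (T \<psi> \<inter> Xs \<subseteq> x)))))
    \<le> min 1 (exp (\<kappa> t - p * (1 - p) * defect t Z S))"
proof (rule min.boundedI)
  show "norm (bexp Xs (\<lambda>x. cis (t * (\<Sum>\<psi>\<in>embs h n. (\<alpha> \<psi> S * of_bool (T \<psi> \<inter> ZZ \<subseteq> Z)) * of_bool (T \<psi> \<inter> Xs \<subseteq> x))))) \<le> 1"
    by (rule order_trans[OF norm_bexp_le]) simp
  define b where "b \<psi> = \<alpha> \<psi> S * of_bool (T \<psi> \<inter> ZZ \<subseteq> Z)" for \<psi>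
  have b1: "\<bar>b \<psi>\<bar> \<le> 1" for \<psi> using \<alpha>_bound[of \<psi> S] by (simp add: b_def)
  have b0: "b \<psi> = 0" if "\<psi> \<in> embs h n" "\<psi> \<notin> touching" for \<psi>
    using \<alpha>_not_touching[OF that] by (simp add: b_def)
  have "norm (bexp Xs (\<lambda>x. cis (t * (\<Sum>\<psi>\<in>embs h n. b \<psi> * of_bool (T \<psi> \<inter> Xs \<subseteq> x)))))
    \<le> exp (2 ^ dE * (\<bar>t\<bar> * (\<Sum>\<psi> | \<psi> \<in> embs h n \<and> 2 \<le> card (T \<psi> \<inter> Xs). \<bar>b \<psi>\<bar>))
         - p * (1 - p) * (\<Sum>e\<in>Xs. 1 - cos (t * (\<Sum>\<psi> | \<psi> \<in> embs h n \<and> T \<psi> \<inter> Xs = {e}. b \<psi>))))"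
  proof (rule oscillation_bound)
    fix \<psi> show "card (T \<psi> \<inter> Xs) \<le> dE"
      using card_mono[of "T \<psi>" "T \<psi> \<inter> Xs"] card_T_le[of \<psi>] by simp
  qed auto
  also have "\<dots> \<le> exp (\<kappa> t - p * (1 - p) * defect t Z S)"
  proof -
    have "(\<Sum>\<psi> | \<psi> \<in> embs h n \<and> 2 \<le> card (T \<psi> \<inter> Xs). \<bar>b \<psi>\<bar>) = (\<Sum>\<psi>\<in>nonlinear. \<bar>b \<psi>\<bar>)"
      by (rule sum.mono_neutral_right) (auto simp: nonlinear_def touching_def intro!: b0)
    also have "\<dots> \<le> (\<Sum>\<psi>\<in>nonlinear. 1)" using b1 by (intro sum_mono) auto
    finally have 1: "2 ^ dE * (\<bar>t\<bar> * (\<Sum>\<psi> | \<psi> \<in> embs h n \<and> 2 \<le> card (T \<psi> \<inter> Xs). \<bar>b \<psi>\<bar>)) \<le> \<kappa> t"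
      unfolding \<kappa>_def by (intro mult_left_mono) auto
    have 2: "(\<Sum>\<psi> | \<psi> \<in> embs h n \<and> T \<psi> \<inter> Xs = {e}. b \<psi>) = (\<Sum>\<psi> | \<psi> \<in> touching \<and> T \<psi> \<inter> Xs = {e}. b \<psi>)" for e
      by (rule sum.mono_neutral_right) (auto simp: touching_def intro!: b0)
    have "(\<Sum>e\<in>Xs. 1 - cos (t * (\<Sum>\<psi> | \<psi> \<in> embs h n \<and> T \<psi> \<inter> Xs = {e}. b \<psi>))) = defect t Z S"
    proof -
      have R: "sum f Xs = (\<Sum>g<m. f (xe g))" for f :: "nat set \<Rightarrow> real"
        by (simp add: Xs_eq sum.reindex[OF xe_inj])
      have "(\<Sum>e\<in>Xs. 1 - cos (t * (\<Sum>\<psi> | \<psi> \<in> embs h n \<and> T \<psi> \<inter> Xs = {e}. b \<psi>)))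
        = (\<Sum>e\<in>Xs. 1 - cos (t * (\<Sum>\<psi> | \<psi> \<in> touching \<and> T \<psi> \<inter> Xs = {e}. b \<psi>)))" by (simp only: 2)
      also have "\<dots> = defect t Z S" unfolding R defect_def zsum_def at_gadget_def b_def by (rule refl)
      finally show ?thesis .
    qed
    then show ?thesis using 1 by simp
  qed
  finally show "norm (bexp Xs (\<lambda>x. cis (t * (\<Sum>\<psi>\<in>embs h n. (\<alpha> \<psi> S * of_bool (T \<psi> \<inter> ZZ \<subseteq> Z)) * of_bool (T \<psi> \<inter> Xs \<subseteq> x)))))
    \<le> exp (\<kappa> t - p * (1 - p) * defect t Z S)" by (simp only: b_def)
qed

text \<open>\<open>decoupling\<close> applied to the blocks in \<open>Ib\<close>. In the result the
  expectation over \<open>ZZ\<close> is outermost, since the second moments are later estimated for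
  fixed \<open>Z\<close>.\<close>

lemma fourier_bound:
  "norm (bexp (all_edges n) (\<lambda>S. cis (t * real (emb_count h E n S)))) ^ (2 ^ kb)
    \<le> bexp ZZ (\<lambda>Z. bexp BT (\<lambda>S. min 1 (exp (\<kappa> t - p * (1 - p) * defect t Z S))))"
proof -
  have split: "bexp (ZZ \<union> Xs) F = bexp ZZ (\<lambda>Z. bexp Xs (\<lambda>x. F (Z \<union> x)))" for F :: "nat set set \<Rightarrow> complex"
    by (rule bexp_Un) (auto simp: Xs_ZZ_disjoint)
  have "norm (bexp (all_edges n) (\<lambda>S. cis (t * real (emb_count h E n S)))) ^ (2 ^ kb)
    = norm (bexp ((ZZ \<union> Xs) \<union> \<Union> (block ` Ib)) (\<lambda>S. cis (t * (\<Sum>\<psi>\<in>embs h n. 1 * of_bool (T \<psi> \<subseteq> S))))) ^ (2 ^ kb)"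
    unfolding edges_split[symmetric] by (simp add: emb_count_eq_sum)
  also have "\<dots> \<le> bexp BB (\<lambda>Y. bexp BB (\<lambda>Y'. norm (bexp (ZZ \<union> Xs) (\<lambda>R. cis (t *
        (\<Sum>\<psi>\<in>embs h n. 1 * (\<Prod>i\<in>Ib. of_bool (T \<psi> \<inter> block i \<subseteq> Y) - of_bool (T \<psi> \<inter> block i \<subseteq> Y'))
          * of_bool (T \<psi> \<inter> (ZZ \<union> Xs) \<subseteq> R)))))))"
    unfolding BB_def
  proof (rule decoupling)
    fix \<psi> assume "\<psi> \<in> embs h n"
    then show "T \<psi> \<subseteq> (ZZ \<union> Xs) \<union> \<Union> (block ` Ib)" using T_subset_all_edges[of \<psi> n] by (simp only: edges_split[symmetric])
  next
    fix i j assume "i \<in> Ib" "j \<in> Ib" "i \<noteq> j"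
    then show "block i \<inter> block j = {}" by (intro block_disjoint) (auto simp: Ib_def)
  next
    fix i assume "i \<in> Ib"
    then show "block i \<inter> (ZZ \<union> Xs) = {}" using block_Xs_disjoint block_ZZ_disjoint by blast
  qed auto
  also have "\<dots> = bexp BT (\<lambda>S. norm (bexp (ZZ \<union> Xs) (\<lambda>R. cis (t *
        (\<Sum>\<psi>\<in>embs h n. \<alpha> \<psi> S * of_bool (T \<psi> \<inter> (ZZ \<union> Xs) \<subseteq> R))))))"
  proof -
    have s: "(A \<subseteq> {b. (b, x) \<in> S}) = (A \<times> {x} \<subseteq> S)" for A :: "nat set set" and x :: bool and S by auto
    show ?thesis unfolding bexp_pair[OF finite_sets(2)] BT_def[symmetric] s \<alpha>_def \<alpha>i_def by simp
  qed
  also have "\<dots> \<le> bexp BT (\<lambda>S. bexp ZZ (\<lambda>Z. min 1 (exp (\<kappa> t - p * (1 - p) * defect t Z S))))"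
  proof (rule bexp_mono)
    fix S
    have "bexp (ZZ \<union> Xs) (\<lambda>R. cis (t * (\<Sum>\<psi>\<in>embs h n. \<alpha> \<psi> S * of_bool (T \<psi> \<inter> (ZZ \<union> Xs) \<subseteq> R))))
      = bexp ZZ (\<lambda>Z. bexp Xs (\<lambda>x. cis (t * (\<Sum>\<psi>\<in>embs h n. (\<alpha> \<psi> S * of_bool (T \<psi> \<inter> ZZ \<subseteq> Z)) * of_bool (T \<psi> \<inter> Xs \<subseteq> x)))))"
      unfolding split
    proof (intro bexp_cong arg_cong[where f = cis] arg_cong[where f = "\<lambda>y. t * y"] sum.cong refl)
      fix Z x \<psi> assume "Z \<subseteq> ZZ" "x \<subseteq> Xs"
      then have "(T \<psi> \<inter> (ZZ \<union> Xs) \<subseteq> Z \<union> x) = (T \<psi> \<inter> ZZ \<subseteq> Z \<and> T \<psi> \<inter> Xs \<subseteq> x)"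
        using Xs_ZZ_disjoint by auto
      then show "\<alpha> \<psi> S * of_bool (T \<psi> \<inter> (ZZ \<union> Xs) \<subseteq> Z \<union> x) = (\<alpha> \<psi> S * of_bool (T \<psi> \<inter> ZZ \<subseteq> Z)) * of_bool (T \<psi> \<inter> Xs \<subseteq> x)"
        by simp
    qed
    then show "norm (bexp (ZZ \<union> Xs) (\<lambda>R. cis (t * (\<Sum>\<psi>\<in>embs h n. \<alpha> \<psi> S * of_bool (T \<psi> \<inter> (ZZ \<union> Xs) \<subseteq> R)))))
      \<le> bexp ZZ (\<lambda>Z. min 1 (exp (\<kappa> t - p * (1 - p) * defect t Z S)))"
      by (simp only:) (rule order_trans[OF norm_bexp_le bexp_mono[OF inner_bound]])
  qed
  also have "\<dots> = bexp ZZ (\<lambda>Z. bexp BT (\<lambda>S. min 1 (exp (\<kappa> t - p * (1 - p) * defect t Z S))))"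
    by (rule bexp_swap)
  finally show ?thesis .
qed

lemma zsum_at_gadget: "zsum (at_gadget g) Z S = zsum (pure g) Z S + zsum (mixed g) Z S"
proof -
  have "pure g \<subseteq> at_gadget g" by (auto simp: pure_def)
  then show ?thesis
    by (simp only: zsum_def mixed_def sum.subset_diff[OF _ finite_parts(1)] add.commute)
qed

lemma defect_ge:
  assumes "\<And>g. g < m \<Longrightarrow> \<bar>zsum (mixed g) Z S\<bar> < l"
  shows "(\<Sum>g<m. (1 - cos (t * zsum (pure g) Z S)) / 2) - real m * (t\<^sup>2 * l\<^sup>2 / 2) \<le> defect t Z S"
proof -
  have "(\<Sum>g<m. (1 - cos (t * zsum (pure g) Z S)) / 2 - t\<^sup>2 * l\<^sup>2 / 2) \<le> defect t Z S"
    unfolding defect_def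
  proof (rule sum_mono)
    fix g assume g: "g \<in> {..<m}"
    have "1 - cos (t * zsum (mixed g) Z S) \<le> (t * zsum (mixed g) Z S)\<^sup>2 / 2" by (rule one_minus_cos_le)
    also have "\<dots> = t\<^sup>2 * \<bar>zsum (mixed g) Z S\<bar>\<^sup>2 / 2" by (simp add: power_mult_distrib)
    also have "\<dots> \<le> t\<^sup>2 * l\<^sup>2 / 2"
      using assms[of g] g by (intro divide_right_mono mult_left_mono power_mono) auto
    finally show "(1 - cos (t * zsum (pure g) Z S)) / 2 - t\<^sup>2 * l\<^sup>2 / 2 \<le> 1 - cos (t * zsum (at_gadget g) Z S)"
      using one_minus_cos_add[of "t * zsum (pure g) Z S" "t * zsum (mixed g) Z S"]
      by (simp add: zsum_at_gadget distrib_left)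
  qed
  then show ?thesis by (simp add: sum_subtractf)
qed

text \<open>A block edge of another gadget would put its parent vertex, which lies in that gadget,
  into the image of a pure embedding.\<close>

lemma zsum_pure_local:
  assumes "g < m"
  shows "zsum (pure g) Z S = zsum (pure g) Z (S \<inter> (\<Union>i\<in>Ib. gblock g i) \<times> UNIV)"
  unfolding zsum_def
proof (rule sum.cong)
  fix \<psi> assume \<psi>: "\<psi> \<in> pure g"
  have sub: "T \<psi> \<inter> block i \<subseteq> (\<Union>i\<in>Ib. gblock g i)" if i: "i \<in> Ib" for i
  proof
    fix e assume e: "e \<in> T \<psi> \<inter> block i"
    then obtain g' where g': "g' < m" "e \<in> gblock g' i" by (auto simp: block_def)
    then have "gad g' (\<pi> i) \<in> \<psi> ` {..<h}" using e T_edge_in_image[of e \<psi>] by (auto simp: gblock_def)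
    then have "\<pi> i \<in> gverts \<psi> g'" using parent_gadget[of i] i by (auto simp: gverts_def Ib_def)
    then have "g' = g" using \<psi> g' by (auto simp: pure_def)
    then show "e \<in> (\<Union>i\<in>Ib. gblock g i)" using g' i by auto
  qed
  have "\<alpha>i i \<psi> S = \<alpha>i i \<psi> (S \<inter> (\<Union>i\<in>Ib. gblock g i) \<times> UNIV)" if "i \<in> Ib" for i
  proof -
    have "(T \<psi> \<inter> block i) \<times> {x} \<subseteq> (\<Union>i\<in>Ib. gblock g i) \<times> UNIV" for x :: bool using sub[OF that] by blast
    then show ?thesis by (simp add: \<alpha>i_def)
  qed
  then show "\<alpha> \<psi> S * of_bool (T \<psi> \<inter> ZZ \<subseteq> Z) = \<alpha> \<psi> (S \<inter> (\<Union>i\<in>Ib. gblock g i) \<times> UNIV) * of_bool (T \<psi> \<inter> ZZ \<subseteq> Z)"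
    by (simp add: \<alpha>_def)
qed simp

definition var :: "nat set set \<Rightarrow> nat \<Rightarrow> real" where
  "var Z g = bexp BT (\<lambda>S. (zsum (pure g) Z S)\<^sup>2)"

lemma var_nonneg: "0 \<le> var Z g"
  unfolding var_def by (rule bexp_nonneg) simp

text \<open>The mean of 1 - cos is at least half the second moment of the phase minus 1/24 of its
  fourth moment. Hypercontractivity and the bound 6 make the loss at most a quarter of the second
  moment, so a quarter remains.\<close>

lemma pure_oscillation:
  assumes "t\<^sup>2 * var Z g * hcK ^ (kb * dE) \<le> 6"
  shows "bexp BT (\<lambda>S. exp (- (p * (1 - p) / 2) * (1 - cos (t * zsum (pure g) Z S)))) \<le> exp (- (p * (1 - p) / 16) * (t\<^sup>2 * var Z g))"
proof -
  define V where "V S = 1 - cos (t * zsum (pure g) Z S)" for S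
  define a where "a = p * (1 - p) / 2"
  have pq: "p * (1 - p) \<le> 1 / 4" using zero_le_power2[of "p - 1/2"] by (simp add: power2_eq_square algebra_simps)
  have a: "0 \<le> a" "a \<le> 1/8" using pq p_pos p_less_1 by (auto simp: a_def)
  have V: "0 \<le> V S" "V S \<le> 2" for S by (auto simp: V_def)
  have "bexp BT (\<lambda>S. exp (- (a * V S))) \<le> bexp BT (\<lambda>S. 1 - a / 2 * V S)"
  proof (rule bexp_mono)
    fix S
    have "a * V S \<le> (1/8) * 2" using a V[of S] by (intro mult_mono) auto
    then have "exp (- (a * V S)) \<le> 1 - a * V S / 2" using a V[of S] by (intro exp_minus_le_half) auto
    then show "exp (- (a * V S)) \<le> 1 - a / 2 * V S" by simp
  qed
  also have "\<dots> = 1 - a / 2 * bexp BT V"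
    by (simp only: bexp_diff bexp_cmult bexp_const finite_BT)
  also have "\<dots> \<le> 1 - a / 2 * (t\<^sup>2 * var Z g / 4)"
  proof -
    have "t\<^sup>2 * var Z g / 4 \<le> t\<^sup>2 / 2 * var Z g - t ^ 4 / 24 * (hcK ^ (kb * dE) * (var Z g)\<^sup>2)"
    proof -
      have "(t\<^sup>2 * var Z g) * (t\<^sup>2 * var Z g * hcK ^ (kb * dE)) \<le> (t\<^sup>2 * var Z g) * 6"
        using assms var_nonneg by (intro mult_left_mono) auto
      then show ?thesis by (simp add: power4_eq_xxxx power2_eq_square algebra_simps)
    qed
    also have "\<dots> \<le> t\<^sup>2 / 2 * var Z g - t ^ 4 / 24 * bexp BT (\<lambda>S. zsum (pure g) Z S ^ 4)"
      using hypercontractivity[OF finite_BT pdeg_zsum, of "pure g" Z]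
      by (intro diff_left_mono mult_left_mono) (auto simp: var_def)
    also have "\<dots> = bexp BT (\<lambda>S. t\<^sup>2 / 2 * (zsum (pure g) Z S)\<^sup>2 - t ^ 4 / 24 * zsum (pure g) Z S ^ 4)"
      by (simp only: bexp_diff bexp_cmult var_def)
    also have "\<dots> \<le> bexp BT V"
    proof (rule bexp_mono)
      fix S show "t\<^sup>2 / 2 * (zsum (pure g) Z S)\<^sup>2 - t ^ 4 / 24 * zsum (pure g) Z S ^ 4 \<le> V S"
        using one_minus_cos_ge[of "t * zsum (pure g) Z S"] by (simp add: V_def power_mult_distrib)
    qed
    finally have "t\<^sup>2 * var Z g / 4 \<le> bexp BT V" .
    then have "a / 2 * (t\<^sup>2 * var Z g / 4) \<le> a / 2 * bexp BT V" using a by (intro mult_left_mono) auto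
    then show ?thesis by linarith
  qed
  also have "\<dots> \<le> exp (- (a / 2 * (t\<^sup>2 * var Z g / 4)))"
    using exp_ge_add_one_self[of "- (a / 2 * (t\<^sup>2 * var Z g / 4))"] by simp
  finally show ?thesis by (simp add: V_def a_def)
qed

text \<open>Either some mixed sum reaches the level \<open>l\<close>, which is handled by a union
  bound, or the mixed parts cost at most t^2 l^2 / 2 per gadget and the pure parts multiply by
  independence.\<close>

lemma fixed_Z_bound:
  assumes small: "\<And>g. g < m \<Longrightarrow> t\<^sup>2 * var Z g * hcK ^ (kb * dE) \<le> 6"
  shows "bexp BT (\<lambda>S. min 1 (exp (\<kappa> t - p * (1 - p) * defect t Z S)))
    \<le> (\<Sum>g<m. bexp BT (\<lambda>S. of_bool (l \<le> \<bar>zsum (mixed g) Z S\<bar>)))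
      + exp (\<kappa> t + p * (1 - p) * (real m * (t\<^sup>2 * l\<^sup>2 / 2)) - p * (1 - p) / 16 * (t\<^sup>2 * (\<Sum>g<m. var Z g)))"
proof -
  define c where "c = exp (\<kappa> t + p * (1 - p) * (real m * (t\<^sup>2 * l\<^sup>2 / 2)))"
  define F where "F g S = exp (- (p * (1 - p) / 2) * (1 - cos (t * zsum (pure g) Z S)))" for g S
  have pq: "0 \<le> p * (1 - p)" using p_pos p_less_1 by simp
  have "bexp BT (\<lambda>S. min 1 (exp (\<kappa> t - p * (1 - p) * defect t Z S)))
    \<le> bexp BT (\<lambda>S. (\<Sum>g<m. of_bool (l \<le> \<bar>zsum (mixed g) Z S\<bar>)) + c * (\<Prod>g<m. F g S))"
  proof (rule bexp_mono)
    fix S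
    have F0: "0 \<le> c * (\<Prod>g<m. F g S)" unfolding c_def F_def by (intro mult_nonneg_nonneg prod_nonneg) auto
    show "min 1 (exp (\<kappa> t - p * (1 - p) * defect t Z S)) \<le> (\<Sum>g<m. of_bool (l \<le> \<bar>zsum (mixed g) Z S\<bar>)) + c * (\<Prod>g<m. F g S)"
    proof (cases "\<exists>g<m. l \<le> \<bar>zsum (mixed g) Z S\<bar>")
      case True
      then obtain g where g: "g < m" "l \<le> \<bar>zsum (mixed g) Z S\<bar>" by auto
      then have "1 \<le> (of_bool (l \<le> \<bar>zsum (mixed g) Z S\<bar>) :: real)" by simp
      also have "\<dots> \<le> (\<Sum>g<m. of_bool (l \<le> \<bar>zsum (mixed g) Z S\<bar>))" using g by (intro member_le_sum) auto
      finally show ?thesis using F0 by linarith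
    next
      case False
      then have "(\<Sum>g<m. (1 - cos (t * zsum (pure g) Z S)) / 2) - real m * (t\<^sup>2 * l\<^sup>2 / 2) \<le> defect t Z S"
        by (intro defect_ge) auto
      from mult_left_mono[OF this pq]
      have "exp (\<kappa> t - p * (1 - p) * defect t Z S)
        \<le> exp ((\<kappa> t + p * (1 - p) * (real m * (t\<^sup>2 * l\<^sup>2 / 2))) + - (p * (1 - p)) * (\<Sum>g<m. (1 - cos (t * zsum (pure g) Z S)) / 2))"
        by (simp add: algebra_simps)
      also have "\<dots> = c * exp (\<Sum>g<m. - (p * (1 - p) / 2) * (1 - cos (t * zsum (pure g) Z S)))"
        unfolding exp_add c_def by (simp add: sum_distrib_left sum_negf)
      also have "\<dots> = c * (\<Prod>g<m. F g S)" by (simp add: exp_sum F_def)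
      finally show ?thesis by (intro order_trans[OF min.cobounded2] order_trans[OF _ add_increasing]) (auto intro: sum_nonneg)
    qed
  qed
  also have "\<dots> = (\<Sum>g<m. bexp BT (\<lambda>S. of_bool (l \<le> \<bar>zsum (mixed g) Z S\<bar>))) + c * bexp BT (\<lambda>S. \<Prod>g<m. F g S)"
    by (simp only: bexp_add bexp_sum bexp_cmult)
  also have "bexp BT (\<lambda>S. \<Prod>g<m. F g S) = (\<Prod>g<m. bexp BT (F g))"
  proof (rule bexp_prod_indep[where A = "\<lambda>g. (\<Union>i\<in>Ib. gblock g i) \<times> UNIV"])
    fix g assume "g \<in> {..<m}"
    then show "(\<Union>i\<in>Ib. gblock g i) \<times> (UNIV :: bool set) \<subseteq> BT" by (auto simp: BT_def BB_def block_def)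
  next
    fix g g' assume g: "g \<in> {..<m}" "g' \<in> {..<m}" "g \<noteq> g'"
    have "gblock g i \<inter> gblock g' j = {}" if "i \<in> Ib" "j \<in> Ib" for i j
      using g that by (intro gblock_disjoint) (auto simp: Ib_def)
    then show "(\<Union>i\<in>Ib. gblock g i) \<times> (UNIV :: bool set) \<inter> (\<Union>i\<in>Ib. gblock g' i) \<times> UNIV = {}" by blast
  next
    fix g S assume "g \<in> {..<m}"
    then have "g < m" by simp
    from zsum_pure_local[OF this, of Z S] show "F g S = F g (S \<inter> (\<Union>i\<in>Ib. gblock g i) \<times> UNIV)"
      unfolding F_def by presburger
  qed auto
  also have "(\<Prod>g<m. bexp BT (F g)) \<le> (\<Prod>g<m. exp (- (p * (1 - p) / 16) * (t\<^sup>2 * var Z g)))"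
    unfolding F_def using pure_oscillation[OF small] by (intro prod_mono conjI bexp_nonneg) auto
  also have "\<dots> = exp (- (p * (1 - p) / 16) * (t\<^sup>2 * (\<Sum>g<m. var Z g)))"
    by (simp add: exp_sum[symmetric] sum_distrib_left sum_negf)
  finally show ?thesis
    by (simp add: c_def exp_add[symmetric])
qed

section \<open>Concentration over the exposed edges\<close>

lemma fl_bounds: "1 \<le> fl" "real n / (4 * h) \<le> real fl"
proof -
  have "n = 2 * h * fl + n mod (2 * h)" "n mod (2 * h) < 2 * h" using h_ge_2 by (auto simp: fl_def)
  then have "n < 2 * h * fl + 2 * h" by linarith
  then have "real n < real (2 * h * fl + 2 * h)" by (simp only: of_nat_less_iff)
  then have 1: "real n < 2 * real h * real fl + 2 * real h" by simp
  have n: "4 * real h \<le> real n" using n_large by (metis of_nat_le_iff of_nat_mult of_nat_numeral)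
  have "2 * real h < 2 * real h * real fl" using 1 n by linarith
  then show "1 \<le> fl" by (cases fl) auto
  have "real n \<le> 4 * real h * real fl" using 1 n by linarith
  then show "real n / (4 * h) \<le> real fl" using h_ge_2 by (simp add: pos_divide_le_eq mult.commute)
qed

definition M0 :: nat where "M0 = (\<Prod>i<h. len i)"

lemma card_intended: "card (intended g) = M0"
  by (simp add: intended_def card_PiE card_cand M0_def)

lemma M0_eq: "M0 = w ^ q * fl ^ (h - (r + q))"
proof -
  have "M0 = (\<Prod>i\<in>{0..<r}. len i) * (\<Prod>i\<in>{r..<r + q}. len i) * (\<Prod>i\<in>{r + q..<h}. len i)"
    unfolding M0_def using rq by (simp add: prod.atLeastLessThan_concat atLeast0LessThan[symmetric])
  then show ?thesis by (simp add: len_def)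
qed

lemma len_pos: "0 < len i" using w_pos fl_bounds by (simp add: len_def)

text \<open>All gadgets are counted together: the embeddings of one gadget may share exposed edges
  inside it, so for a single gadget the count need not concentrate, whereas over many gadgets it
  does.\<close>

definition conf :: "(nat \<times> (nat \<Rightarrow> nat)) set" where "conf = (SIGMA g:{..<m}. intended g)"

lemma card_conf: "card conf = m * M0"
  by (simp add: conf_def card_intended)

text \<open>For i < r the vertex determines the gadget; for the other roles it fixes one of
  \<open>len i\<close> choices in every gadget.\<close>

lemma conf_through_vertex:
  assumes "i < h"
  shows "real (card {(g, \<psi>) \<in> conf. \<psi> i = v}) \<le> (if i < r then real M0 else real m * real M0 / real (len i))"
proof (cases "i < r")
  case True
  have mem: "\<psi> i = gad g i" if "\<psi> \<in> intended g" for \<psi> g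
    using intended_mem[OF that assms] \<open>i < r\<close> by (simp add: cand_def)
  show ?thesis
  proof (cases "\<exists>g<m. v = gad g i")
    case True
    then obtain g where g: "g < m" "v = gad g i" by auto
    have "{(g, \<psi>) \<in> conf. \<psi> i = v} \<subseteq> {g} \<times> intended g"
    proof (intro subsetI)
      fix c assume "c \<in> {(g, \<psi>) \<in> conf. \<psi> i = v}"
      then obtain g' \<psi> where c: "c = (g', \<psi>)" "\<psi> \<in> intended g'" "\<psi> i = v" by (auto simp: conf_def)
      then have "v = gad g' i" using mem by simp
      then show "c \<in> {g} \<times> intended g" using g c gad_inj[OF \<open>i < r\<close> \<open>i < r\<close>] by auto
    qed
    then have "card {(g, \<psi>) \<in> conf. \<psi> i = v} \<le> card ({g} \<times> intended g)" by (intro card_mono) auto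
    then show ?thesis using \<open>i < r\<close> by (simp add: card_cartesian_product card_intended)
  next
    case False
    then have "{(g, \<psi>) \<in> conf. \<psi> i = v} = {}" using mem by (auto simp: conf_def)
    then show ?thesis using \<open>i < r\<close> by (simp only: card.empty) simp
  qed
next
  case False
  have c: "card {\<psi> \<in> intended g. \<psi> i = v} * len i \<le> M0" for g
  proof -
    have "{\<psi> \<in> intended g. \<psi> i = v} \<subseteq> Pi\<^sub>E {..<h} ((cand g)(i := {v}))"
    proof (intro subsetI PiE_I)
      fix \<psi> j assume "\<psi> \<in> {\<psi> \<in> intended g. \<psi> i = v}" "j \<in> {..<h}"
      then show "\<psi> j \<in> ((cand g)(i := {v})) j" using intended_mem[of \<psi> g j] by simp
    next
      fix \<psi> j assume "\<psi> \<in> {\<psi> \<in> intended g. \<psi> i = v}" "j \<notin> {..<h}"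
      then show "\<psi> j = undefined" by (auto simp: intended_def intro: PiE_arb)
    qed
    then have "card {\<psi> \<in> intended g. \<psi> i = v} \<le> card (Pi\<^sub>E {..<h} ((cand g)(i := {v})))"
      by (intro card_mono finite_PiE) auto
    also have "\<dots> = (\<Prod>j<h. card (((cand g)(i := {v})) j))" by (simp add: card_PiE)
    also have "\<dots> = (\<Prod>j\<in>{..<h} - {i}. len j)"
      using assms by (subst prod.remove[of _ i]) (auto simp: card_cand intro!: prod.cong)
    finally have "card {\<psi> \<in> intended g. \<psi> i = v} * len i \<le> (\<Prod>j\<in>{..<h} - {i}. len j) * len i" by (rule mult_le_mono1)
    also have "\<dots> = M0" unfolding M0_def using assms by (subst prod.remove[of "{..<h}" i]) auto
    finally show ?thesis .
  qed
  have "{(g, \<psi>) \<in> conf. \<psi> i = v} = (SIGMA g:{..<m}. {\<psi> \<in> intended g. \<psi> i = v})" by (auto simp: conf_def)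
  then have "card {(g, \<psi>) \<in> conf. \<psi> i = v} * len i = (\<Sum>g<m. card {\<psi> \<in> intended g. \<psi> i = v} * len i)"
    by (simp add: sum_distrib_right)
  also have "\<dots> \<le> (\<Sum>g<m. M0)" by (intro sum_mono c)
  finally have "card {(g, \<psi>) \<in> conf. \<psi> i = v} * len i \<le> m * M0" by simp
  then have "real (card {(g, \<psi>) \<in> conf. \<psi> i = v}) * real (len i) \<le> real m * real M0"
    by (simp only: of_nat_mult[symmetric] of_nat_le_iff)
  then show ?thesis using False len_pos[of i] by (simp add: pos_le_divide_eq)
qed

text \<open>Proportion of pairs agreeing in a gadget vertex, a class vertex or a vertex of a
  linear-sized class, summed over the h roles; the last entry bounds 1 / fl.\<close>

definition \<theta> :: real where "\<theta> = real h * (1 / real m + 1 / real w + 4 * real h / real n)"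

text \<open>A shared exposed edge gives a shared vertex, and by disjointness of the candidate sets
  it has the same role in both embeddings.\<close>

lemma conf_pairs:
  "real (card {(c, c') \<in> conf \<times> conf. (T (snd c) \<inter> ZZ) \<inter> (T (snd c') \<inter> ZZ) \<noteq> {}}) \<le> \<theta> * real ((card conf)\<^sup>2)"
proof -
  define V where "V = (SIGMA i:{..<h}. (\<Union>g<m. cand g i))"
  define b where "b x = (if fst x < r then real M0 else real m * real M0 / real (len (fst x)))" for x :: "nat \<times> nat"
  have fin: "finite conf" by (simp add: conf_def)
  have "real (card {(c, c') \<in> conf \<times> conf. (T (snd c) \<inter> ZZ) \<inter> (T (snd c') \<inter> ZZ) \<noteq> {}}) \<le> (\<Sum>x\<in>V. (b x)\<^sup>2)"
  proof (rule card_pairs_sharing[where P = "\<lambda>c x. snd c (fst x) = snd x"])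
    fix x assume "x \<in> V"
    then have i: "fst x < h" by (auto simp: V_def)
    have "{c \<in> conf. snd c (fst x) = snd x} = {(g, \<psi>) \<in> conf. \<psi> (fst x) = snd x}" by auto
    then show "real (card {c \<in> conf. snd c (fst x) = snd x}) \<le> b x"
      using conf_through_vertex[OF i, of "snd x"] by (simp add: b_def)
  next
    fix c c' assume c: "c \<in> conf" "c' \<in> conf" "(T (snd c) \<inter> ZZ) \<inter> (T (snd c') \<inter> ZZ) \<noteq> {}"
    then obtain e where e: "e \<in> T (snd c)" "e \<in> T (snd c')" "e \<in> ZZ" by auto
    then have "card e = 2" by (auto simp: ZZ_def all_edges_def)
    then obtain v where "v \<in> e" by fastforce
    then have "v \<in> snd c ` {..<h}" "v \<in> snd c' ` {..<h}"
      using T_edge_in_image[OF e(1)] T_edge_in_image[OF e(2)] by auto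
    then obtain i j where ij: "i < h" "j < h" "v = snd c i" "v = snd c' j" by blast
    then have mem: "v \<in> cand (fst c) i" "v \<in> cand (fst c') j" "fst c < m" "fst c' < m"
    proof -
      have "snd c \<in> intended (fst c)" "snd c' \<in> intended (fst c')" "fst c < m" "fst c' < m"
        using c by (auto simp: conf_def)
      then show "v \<in> cand (fst c) i" "v \<in> cand (fst c') j" "fst c < m" "fst c' < m"
        using intended_mem[of "snd c" "fst c" i] intended_mem[of "snd c'" "fst c'" j] ij by auto
    qed
    then have "i = j" using cand_disjoint[OF mem(3,4), of i j] by auto
    then show "\<exists>x\<in>V. snd c (fst x) = snd x \<and> snd c' (fst x) = snd x"
      using ij mem by (intro bexI[of _ "(i, v)"]) (auto simp: V_def)
  qed (use fin in \<open>auto simp: V_def\<close>)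
  also have "\<dots> = (\<Sum>i<h. \<Sum>v\<in>(\<Union>g<m. cand g i). (b (i, v))\<^sup>2)"
    unfolding V_def by (subst sum.Sigma) (auto simp: split_beta)
  also have "\<dots> \<le> (\<Sum>i<h. (real m * real M0)\<^sup>2 * (1 / real m + 1 / real w + 1 / real fl))"
  proof (rule sum_mono)
    fix i assume "i \<in> {..<h}"
    define N where "N = card (\<Union>g<m. cand g i)"
    have "(\<Sum>v\<in>(\<Union>g<m. cand g i). (b (i, v))\<^sup>2) = real N * (if i < r then real M0 else real m * real M0 / real (len i))\<^sup>2"
      by (simp add: b_def N_def)
    also have "\<dots> \<le> (real m * real M0)\<^sup>2 * (if i < r then 1 / real m else 1 / real (len i))"
    proof (cases "i < r")
      case True
      have "N \<le> (\<Sum>g<m. card (cand g i))" unfolding N_def by (rule card_UN_le) simp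
      then have "N \<le> m" using True by (simp add: card_cand len_def)
      then have "real N * (real M0)\<^sup>2 \<le> real m * (real M0)\<^sup>2" by (intro mult_right_mono) auto
      also have "\<dots> = (real m * real M0)\<^sup>2 * (1 / real m)" using m_pos by (simp add: power2_eq_square)
      finally show ?thesis using True by simp
    next
      case False
      have "(\<Union>g<m. cand g i) = {lo i..<lo i + len i}" using False m_pos by (auto simp: cand_def lessThan_empty_iff)
      then have "real N = real (len i)" by (simp add: N_def)
      then show ?thesis using False len_pos[of i] by (simp add: power2_eq_square)
    qed
    also have "\<dots> \<le> (real m * real M0)\<^sup>2 * (1 / real m + 1 / real w + 1 / real fl)"
      by (intro mult_left_mono) (auto simp: len_def)
    finally show "(\<Sum>v\<in>(\<Union>g<m. cand g i). (b (i, v))\<^sup>2) \<le> (real m * real M0)\<^sup>2 * (1 / real m + 1 / real w + 1 / real fl)" .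
  qed
  also have "\<dots> = real h * (1 / real m + 1 / real w + 1 / real fl) * (real m * real M0)\<^sup>2" by simp
  also have "\<dots> \<le> \<theta> * (real m * real M0)\<^sup>2"
  proof (rule mult_right_mono)
    have "1 / real fl \<le> 1 / (real n / (4 * h))"
      using fl_bounds n_pos h_ge_2 by (intro divide_left_mono) auto
    then have "1 / real fl \<le> 4 * real h / real n" by simp
    then show "real h * (1 / real m + 1 / real w + 1 / real fl) \<le> \<theta>" unfolding \<theta>_def by (intro mult_left_mono) auto
  qed simp
  finally show ?thesis by (simp add: card_conf)
qed

lemma bad_Z_probability:
  "bexp ZZ (\<lambda>Z. of_bool (real (card {c \<in> conf. T (snd c) \<inter> ZZ \<subseteq> Z}) < p ^ dE * real (card conf) / 2))
    \<le> hcM dE j * (4 * \<theta> / (p ^ dE)\<^sup>2) ^ (2 ^ j)"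
proof (rule count_lower_tail[where T = "\<lambda>c. T (snd c) \<inter> ZZ", OF _ _ _ _ _ conf_pairs])
  show "0 \<le> \<theta>" by (simp add: \<theta>_def)
  fix c show "card (T (snd c) \<inter> ZZ) \<le> dE"
    using card_mono[of "T (snd c)" "T (snd c) \<inter> ZZ"] card_T_le[of "snd c"] by simp
qed (auto simp: conf_def)

text \<open>Origin of the factors: the covariance in \<open>pure_second_moment_lower\<close>, the
  square of p^dE / 2 from the lower tail, and fl >= n / (4h).\<close>

definition c1 :: real where "c1 = (2 * (p * (1 - p))) ^ kb * (p ^ dE)\<^sup>2 / (4 * (4 * real h) ^ (2 * h))"

lemma c1_pos: "0 < c1" using p_pos p_less_1 h_ge_2 by (simp add: c1_def)

lemma NS_eq: "NS = real n ^ (h - (r + q))"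
proof -
  have "real n ^ h = real n ^ (h - (r + q)) * real n ^ (r + q)" using rq by (simp add: power_add[symmetric])
  then show ?thesis using n_pos by (simp add: NS_def)
qed

text \<open>Cauchy-Schwarz over the gadgets: only the total count is known to be large, but this
  already bounds the sum of the squared counts from below.\<close>

lemma good_Z_variance:
  assumes "p ^ dE * real (card conf) / 2 \<le> real (card {c \<in> conf. T (snd c) \<inter> ZZ \<subseteq> Z})"
  shows "c1 * (real m * real w ^ q * NS\<^sup>2) \<le> (\<Sum>g<m. var Z g)"
proof -
  define N where "N g = real (card {\<psi> \<in> intended g. T \<psi> \<inter> ZZ \<subseteq> Z})" for g
  define c where "c = (2 * (p * (1 - p))) ^ kb"
  have c: "0 \<le> c" using p_pos p_less_1 by (simp add: c_def)
  have "{c \<in> conf. T (snd c) \<inter> ZZ \<subseteq> Z} = (SIGMA g:{..<m}. {\<psi> \<in> intended g. T \<psi> \<inter> ZZ \<subseteq> Z})"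
    by (auto simp: conf_def)
  then have S: "real (card {c \<in> conf. T (snd c) \<inter> ZZ \<subseteq> Z}) = (\<Sum>g<m. N g)" by (simp add: N_def)
  have "(p ^ dE * (real m * real M0) / 2)\<^sup>2 \<le> (\<Sum>g<m. N g)\<^sup>2"
    using assms p_pos unfolding S card_conf by (intro power_mono) auto
  also have "\<dots> \<le> (\<Sum>g<m. (N g)\<^sup>2) * real (card {..<m})" by (rule sum_squared_le_sum_of_squares)
  finally have 1: "(p ^ dE * (real m * real M0) / 2)\<^sup>2 / real m \<le> (\<Sum>g<m. (N g)\<^sup>2)"
    using m_pos by (simp add: pos_divide_le_eq)
  have "NS / (4 * real h) ^ h \<le> real fl ^ (h - (r + q))"
  proof -
    have "NS / (4 * real h) ^ h \<le> NS / (4 * real h) ^ (h - (r + q))"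
      using h_ge_2 by (intro divide_left_mono power_increasing) (auto simp: NS_def)
    also have "\<dots> = (real n / (4 * h)) ^ (h - (r + q))" by (simp add: NS_eq power_divide)
    also have "\<dots> \<le> real fl ^ (h - (r + q))" using fl_bounds by (intro power_mono) auto
    finally show ?thesis .
  qed
  then have "real w ^ q * (NS / (4 * real h) ^ h) \<le> real w ^ q * real fl ^ (h - (r + q))"
    by (rule mult_left_mono) simp
  then have "real w ^ q * (NS / (4 * real h) ^ h) \<le> real M0" by (simp only: M0_eq of_nat_mult of_nat_power)
  then have "p ^ dE * (real m * (real w ^ q * (NS / (4 * real h) ^ h))) / 2 \<le> p ^ dE * (real m * real M0) / 2"
    using p_pos by (intro divide_right_mono mult_left_mono) auto
  then have "(p ^ dE * (real m * (real w ^ q * (NS / (4 * real h) ^ h))) / 2)\<^sup>2 / real m \<le> (\<Sum>g<m. (N g)\<^sup>2)"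
    using p_pos by (intro order_trans[OF divide_right_mono[OF power_mono] 1]) (auto simp: NS_def)
  then have "c * ((p ^ dE * (real m * (real w ^ q * (NS / (4 * real h) ^ h))) / 2)\<^sup>2 / real m) / real w ^ q \<le> c * (\<Sum>g<m. (N g)\<^sup>2) / real w ^ q"
    using c by (intro divide_right_mono mult_left_mono) auto
  also have "\<dots> = (\<Sum>g<m. c * (N g)\<^sup>2 / real w ^ q)" by (simp add: sum_distrib_left sum_divide_distrib)
  also have "\<dots> \<le> (\<Sum>g<m. var Z g)"
    unfolding var_def c_def N_def by (intro sum_mono pure_second_moment_lower) auto
  also have "c * ((p ^ dE * (real m * (real w ^ q * (NS / (4 * real h) ^ h))) / 2)\<^sup>2 / real m) / real w ^ q = c1 * (real m * real w ^ q * NS\<^sup>2)"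
  proof -
    define H where "H = (4 * real h) ^ h"
    have H: "0 < H" using h_ge_2 by (simp add: H_def)
    have c1e: "c1 = c * (p ^ dE)\<^sup>2 / (4 * H\<^sup>2)"
      unfolding c1_def c_def H_def power_mult[symmetric] by (simp only: mult.commute)
    show ?thesis unfolding c1e H_def[symmetric] using m_pos w_pos H
      by (simp add: field_simps power2_eq_square)
  qed
  finally show ?thesis .
qed

text \<open>Chosen so that A <= c0 together with \<open>zsum_second_moment_upper\<close> and
  \<open>pure_count\<close> yields the hypothesis of \<open>pure_oscillation\<close>.\<close>

definition c0 :: real where "c0 = 6 / (hcK ^ (kb * dE) * 2 ^ kb * (real h ^ h)\<^sup>2)"

text \<open>Factor in the bound for the second moment of a mixed sum divided by the square of the
  level \<open>l\<close> of \<open>gadget_bound\<close>.\<close>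

definition c2 :: real where "c2 = 32 * 2 ^ kb * (real h ^ h)\<^sup>2 * (real r ^ (r - 1))\<^sup>2 / c1"

text \<open>The three error terms come from untypical exposed edges, from large mixed sums and from
  the product over the independent gadgets. A is the order of the squared phase of one pure
  coefficient: A <= c0 keeps the phase bounded, and m A governs the decay.\<close>

theorem gadget_bound:
  fixes t :: real
  defines "A \<equiv> t\<^sup>2 * (real w ^ q * NS\<^sup>2)"
  assumes A: "A \<le> c0"
    and \<kappa>: "2 ^ dE * (\<bar>t\<bar> * (real h ^ h * NS * real (m * r) ^ r * real w ^ q / (real n)\<^sup>2)) \<le> p * (1 - p) / 64 * c1 * (real m * A)"
  shows "norm (bexp (all_edges n) (\<lambda>S. cis (t * real (emb_count h E n S)))) ^ (2 ^ kb)
    \<le> hcM dE j * (4 * \<theta> / (p ^ dE)\<^sup>2) ^ (2 ^ j)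
      + real m * (hcM (kb * dE) j * (c2 * (real m ^ (r - 1) / real n)\<^sup>2) ^ (2 ^ j))
      + exp (- (p * (1 - p) / 32 * c1 * (real m * A)))"
proof -
  \<comment> \<open>The level is a small multiple of the typical size of a pure sum, chosen so that
    the mixed parts cost B/64 of the exponent.\<close>
  define l where "l = sqrt (c1 * (real w ^ q * NS\<^sup>2) / 32)"
  have NS: "0 < NS" using n_pos by (simp add: NS_def)
  have pq: "0 < p * (1 - p)" using p_pos p_less_1 by simp
  have wN: "0 < real w ^ q * NS\<^sup>2" using w_pos NS by simp
  have l: "0 < l" "l\<^sup>2 = c1 * (real w ^ q * NS\<^sup>2) / 32" using c1_pos wN by (auto simp: l_def)
  define P2 where "P2 = real m * (hcM (kb * dE) j * (c2 * (real m ^ (r - 1) / real n)\<^sup>2) ^ (2 ^ j))"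
  define P3 where "P3 = exp (- (p * (1 - p) / 32 * c1 * (real m * A)))"
  define good where "good Z \<longleftrightarrow> p ^ dE * real (card conf) / 2 \<le> real (card {c \<in> conf. T (snd c) \<inter> ZZ \<subseteq> Z})" for Z
  have P2: "0 \<le> P2" unfolding P2_def
    using hcM_pos[of "kb * dE" j] c1_pos by (intro mult_nonneg_nonneg zero_le_power) (auto simp: c2_def)
  have \<kappa>': "\<kappa> t \<le> p * (1 - p) / 64 * c1 * (real m * A)"
    unfolding \<kappa>_def by (rule order_trans[OF _ \<kappa>]) (intro mult_left_mono nonlinear_count; simp)
  have small: "t\<^sup>2 * var Z g * hcK ^ (kb * dE) \<le> 6" if "g < m" for Z g
  proof -
    have "var Z g \<le> 2 ^ kb * (real w ^ q * (real h ^ h * NS)\<^sup>2)"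
      unfolding var_def by (rule zsum_second_moment_upper) (use pure_count[OF that] in auto)
    then have "t\<^sup>2 * var Z g * hcK ^ (kb * dE) \<le> t\<^sup>2 * (2 ^ kb * (real w ^ q * (real h ^ h * NS)\<^sup>2)) * hcK ^ (kb * dE)"
      using hcK_bounds by (intro mult_right_mono mult_left_mono) auto
    also have "\<dots> = A * (hcK ^ (kb * dE) * 2 ^ kb * (real h ^ h)\<^sup>2)"
      by (simp add: A_def power_mult_distrib mult_ac)
    also have "\<dots> \<le> c0 * (hcK ^ (kb * dE) * 2 ^ kb * (real h ^ h)\<^sup>2)"
      using A hcK_bounds by (intro mult_right_mono) auto
    also have "\<dots> = 6" using hcK_bounds h_ge_2 by (simp add: c0_def)
    finally show ?thesis .
  qed
  have mixed: "bexp BT (\<lambda>S. of_bool (l \<le> \<bar>zsum (mixed g) Z S\<bar>)) \<le> hcM (kb * dE) j * (c2 * (real m ^ (r - 1) / real n)\<^sup>2) ^ (2 ^ j)"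
    if "g < m" for Z g
  proof -
    have "bexp BT (\<lambda>S. (zsum (mixed g) Z S)\<^sup>2) \<le> 2 ^ kb * (real w ^ q * (real h ^ h * NS * real (m * r) ^ (r - 1) / real n)\<^sup>2)"
      by (rule zsum_second_moment_upper) (use mixed_count[OF that] in auto)
    also have "\<dots> = c2 * (real m ^ (r - 1) / real n)\<^sup>2 * l\<^sup>2"
      unfolding l c2_def using c1_pos by (simp add: power_mult_distrib power_divide)
    finally have "bexp BT (\<lambda>S. (zsum (mixed g) Z S)\<^sup>2) / l\<^sup>2 \<le> c2 * (real m ^ (r - 1) / real n)\<^sup>2"
      by (simp only: pos_divide_le_eq[OF zero_less_power[OF l(1)]])
    then have "hcM (kb * dE) j * (bexp BT (\<lambda>S. (zsum (mixed g) Z S)\<^sup>2) / l\<^sup>2) ^ (2 ^ j) \<le> hcM (kb * dE) j * (c2 * (real m ^ (r - 1) / real n)\<^sup>2) ^ (2 ^ j)"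
      using hcM_pos[of "kb * dE" j] by (intro mult_left_mono power_mono divide_nonneg_nonneg bexp_nonneg) auto
    then show ?thesis using pdeg_tail[OF finite_BT pdeg_zsum l(1), of "mixed g" Z j] by linarith
  qed
  have Zb: "bexp BT (\<lambda>S. min 1 (exp (\<kappa> t - p * (1 - p) * defect t Z S))) \<le> of_bool (\<not> good Z) + (P2 + P3)" for Z
  proof (cases "good Z")
    case True
    have "bexp BT (\<lambda>S. min 1 (exp (\<kappa> t - p * (1 - p) * defect t Z S)))
      \<le> (\<Sum>g<m. bexp BT (\<lambda>S. of_bool (l \<le> \<bar>zsum (mixed g) Z S\<bar>)))
      + exp (\<kappa> t + p * (1 - p) * (real m * (t\<^sup>2 * l\<^sup>2 / 2)) - p * (1 - p) / 16 * (t\<^sup>2 * (\<Sum>g<m. var Z g)))"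
      by (rule fixed_Z_bound[OF small])
    also have "\<dots> \<le> P2 + P3"
    proof (rule add_mono)
      have "(\<Sum>g<m. bexp BT (\<lambda>S. of_bool (l \<le> \<bar>zsum (mixed g) Z S\<bar>))) \<le> (\<Sum>g<m. hcM (kb * dE) j * (c2 * (real m ^ (r - 1) / real n)\<^sup>2) ^ (2 ^ j))"
        by (intro sum_mono mixed) auto
      then show "(\<Sum>g<m. bexp BT (\<lambda>S. of_bool (l \<le> \<bar>zsum (mixed g) Z S\<bar>))) \<le> P2" by (simp add: P2_def)
      \<comment> \<open>The pure parts gain B/16; the mixed and the nonlinear parts lose B/64 each,
        so B/32 remains.\<close>
      define B where "B = p * (1 - p) * (c1 * (real m * A))"
      have "t\<^sup>2 * (c1 * (real m * real w ^ q * NS\<^sup>2)) \<le> t\<^sup>2 * (\<Sum>g<m. var Z g)"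
        using good_Z_variance[of Z] True by (intro mult_left_mono) (auto simp: good_def)
      then have "p * (1 - p) / 16 * (t\<^sup>2 * (c1 * (real m * real w ^ q * NS\<^sup>2))) \<le> p * (1 - p) / 16 * (t\<^sup>2 * (\<Sum>g<m. var Z g))"
        by (rule mult_left_mono) (use pq in simp)
      moreover have "p * (1 - p) / 16 * (t\<^sup>2 * (c1 * (real m * real w ^ q * NS\<^sup>2))) = B / 16"
        by (simp add: B_def A_def mult_ac)
      moreover have "p * (1 - p) * (real m * (t\<^sup>2 * l\<^sup>2 / 2)) = B / 64"
        unfolding l by (simp add: B_def A_def mult_ac)
      moreover have "\<kappa> t \<le> B / 64" using \<kappa>' by (simp add: B_def mult_ac)
      ultimately have "\<kappa> t + p * (1 - p) * (real m * (t\<^sup>2 * l\<^sup>2 / 2)) - p * (1 - p) / 16 * (t\<^sup>2 * (\<Sum>g<m. var Z g)) \<le> - (B / 32)"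
        by linarith
      then show "exp (\<kappa> t + p * (1 - p) * (real m * (t\<^sup>2 * l\<^sup>2 / 2)) - p * (1 - p) / 16 * (t\<^sup>2 * (\<Sum>g<m. var Z g))) \<le> P3"
        unfolding P3_def by (simp add: B_def mult_ac)
    qed
    finally show ?thesis using True by simp
  next
    case False
    have "bexp BT (\<lambda>S. min 1 (exp (\<kappa> t - p * (1 - p) * defect t Z S))) \<le> 1"
      by (rule bexp_le_const) auto
    moreover have "0 \<le> P3" by (simp add: P3_def)
    ultimately show ?thesis using False P2 by simp
  qed
  have "norm (bexp (all_edges n) (\<lambda>S. cis (t * real (emb_count h E n S)))) ^ (2 ^ kb)
    \<le> bexp ZZ (\<lambda>Z. bexp BT (\<lambda>S. min 1 (exp (\<kappa> t - p * (1 - p) * defect t Z S))))" by (rule fourier_bound)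
  also have "\<dots> \<le> bexp ZZ (\<lambda>Z. of_bool (\<not> good Z) + (P2 + P3))" by (intro bexp_mono Zb)
  also have "\<dots> = bexp ZZ (\<lambda>Z. of_bool (\<not> good Z)) + (P2 + P3)" by (simp add: bexp_add)
  also have "bexp ZZ (\<lambda>Z. of_bool (\<not> good Z)) \<le> hcM dE j * (4 * \<theta> / (p ^ dE)\<^sup>2) ^ (2 ^ j)"
    using bad_Z_probability[of j] by (simp add: good_def not_le)
  finally show ?thesis by (simp add: P2_def P3_def)
qed

end

section \<open>Subgraphs, embeddings and enumerations of connected graphs\<close>

text \<open>Invariant: a connected prefix with two spare vertices, each adjacent to the prefix. When
  one spare vertex moves into the prefix, connectedness supplies a replacement. The two spares at
  the end allow q = 2 classes with all parents in the gadget.\<close>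

lemma connected_enumeration:
  assumes "finite V" "1 \<le> r" "r + 2 \<le> card V"
    and sym: "\<And>x y. adj x y \<Longrightarrow> adj y x"
    and cut: "\<And>W. W \<subseteq> V \<Longrightarrow> W \<noteq> {} \<Longrightarrow> W \<noteq> V \<Longrightarrow> \<exists>x\<in>W. \<exists>y\<in>V - W. adj x y"
  shows "\<exists>L. distinct L \<and> set L = V \<and> (\<forall>i. 1 \<le> i \<longrightarrow> i < r + 2 \<longrightarrow> (\<exists>j<i. j < r \<and> adj (L ! i) (L ! j)))"
proof -
  define inv where "inv vs z z' \<longleftrightarrow> distinct (vs @ [z, z']) \<and> set (vs @ [z, z']) \<subseteq> V
    \<and> (\<forall>i. 1 \<le> i \<longrightarrow> i < length vs \<longrightarrow> (\<exists>j<i. adj (vs ! i) (vs ! j)))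
    \<and> (\<exists>x\<in>set vs. adj z x) \<and> (\<exists>x\<in>set vs. adj z' x)" for vs z z'
  have outside: "\<exists>x\<in>W. \<exists>y\<in>V - W. adj x y" if "W \<subseteq> V" "W \<noteq> {}" "card W < card V" for W
    using cut[OF that(1,2)] that(3) by auto
  have append: "\<forall>i. 1 \<le> i \<longrightarrow> i < length (vs @ [z]) \<longrightarrow> (\<exists>j<i. adj ((vs @ [z]) ! i) ((vs @ [z]) ! j))"
    if vs: "\<forall>i. 1 \<le> i \<longrightarrow> i < length vs \<longrightarrow> (\<exists>j<i. adj (vs ! i) (vs ! j))" and z: "\<exists>x\<in>set vs. adj z x" for vs z
  proof (intro allI impI)
    fix i assume i: "1 \<le> i" "i < length (vs @ [z])"
    show "\<exists>j<i. adj ((vs @ [z]) ! i) ((vs @ [z]) ! j)"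
    proof (cases "i < length vs")
      case True
      then obtain j where "j < i" "adj (vs ! i) (vs ! j)" using vs i by blast
      then show ?thesis using True by (intro exI[of _ j]) (simp add: nth_append)
    next
      case False
      then have "i = length vs" using i by simp
      moreover obtain j where "j < length vs" "adj z (vs ! j)" using z by (auto simp: in_set_conv_nth)
      ultimately show ?thesis by (intro exI[of _ j]) (simp add: nth_append)
    qed
  qed
  have "\<exists>vs z z'. length vs = r \<and> inv vs z z'"
    using assms(2,3)
  proof (induction r rule: nat_induct_at_least)
    case base
    then have "V \<noteq> {}" by auto
    then obtain a where a: "a \<in> V" by blast
    obtain b where b: "b \<in> V" "b \<noteq> a" "adj a b" using outside[of "{a}"] a base by auto
    have "card {a, b} < card V" using b(2) base by simp
    then obtain x y where xy: "x \<in> {a, b}" "y \<in> V - {a, b}" "adj x y" using outside[of "{a, b}"] a b by blast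
    \<comment> \<open>The three vertices form a path; its centre is the prefix and its ends are the
      spares.\<close>
    show ?case
    proof (cases "x = a")
      case True
      then have "inv [a] b y" using a b xy sym by (auto simp: inv_def)
      then show ?thesis by (intro exI[of _ "[a]"]) auto
    next
      case False
      then have "inv [b] a y" using a b xy sym by (auto simp: inv_def)
      then show ?thesis by (intro exI[of _ "[b]"]) auto
    qed
  next
    case (Suc r)
    then obtain vs z z' where I: "length vs = r" "inv vs z z'" by auto
    define W where "W = set (vs @ [z, z'])"
    have W: "W \<subseteq> V" "W \<noteq> {}" "card W = r + 2"
      using I distinct_card[of "vs @ [z, z']"] by (auto simp: W_def inv_def)
    then obtain x y where xy: "x \<in> W" "y \<in> V - W" "adj x y" using outside[of W] Suc by auto
    \<comment> \<open>The spare vertex to be moved is chosen so that the neighbour \<open>x\<close>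
      of the new vertex lies in the longer prefix; the other spare stays adjacent to it.\<close>
    show ?case
    proof (cases "x = z'")
      case True
      have "\<exists>x\<in>set (vs @ [z']). adj y x" using xy True sym by (intro bexI[of _ x]) auto
      then have "inv (vs @ [z']) z y" using I(2) xy(2) append[of vs z'] by (auto simp: inv_def W_def)
      then show ?thesis using I(1) by (intro exI[of _ "vs @ [z']"]) auto
    next
      case False
      have "\<exists>x\<in>set (vs @ [z]). adj y x" using xy False sym by (intro bexI[of _ x]) (auto simp: W_def)
      then have "inv (vs @ [z]) z' y" using I(2) xy(2) append[of vs z] by (auto simp: inv_def W_def)
      then show ?thesis using I(1) by (intro exI[of _ "vs @ [z]"]) auto
    qed
  qed
  then obtain vs z z' where I: "length vs = r" "inv vs z z'" by blast
  have "finite (V - set (vs @ [z, z']))" using assms(1) by simp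
  then obtain rest where rest: "set rest = V - set (vs @ [z, z'])" "distinct rest"
    using finite_distinct_list by blast
  define L where "L = vs @ [z, z'] @ rest"
  have L: "L ! i = vs ! i" if "i < r" for i using that I(1) by (simp add: L_def nth_append)
  have Lz: "L ! r = z" "L ! Suc r = z'" using I(1) by (auto simp: L_def nth_append)
  have "\<exists>j<i. j < r \<and> adj (L ! i) (L ! j)" if i: "1 \<le> i" "i < r + 2" for i
  proof -
    have ext: "\<exists>j<i. j < r \<and> adj (L ! i) (L ! j)" if "r \<le> i" "\<exists>x\<in>set vs. adj (L ! i) x"
      using that I(1) L by (force simp: in_set_conv_nth)
    consider "i < r" | "i = r" | "i = Suc r" using i by linarith
    then show ?thesis
    proof cases
      case 1
      then obtain j where "j < i" "adj (vs ! i) (vs ! j)" using I i by (auto simp: inv_def)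
      then show ?thesis using 1 by (intro exI[of _ j]) (simp add: L)
    qed (use I(2) ext Lz in \<open>auto simp: inv_def\<close>)
  qed
  moreover have "distinct L" "set L = V" using I(2) rest by (auto simp: L_def inv_def)
  ultimately show ?thesis by blast
qed

text \<open>Connectedness is reachability in the symmetric closure, which for a symmetric H is
  reachability in H; a walk that leaves \<open>W\<close> uses an arc of the cut.\<close>

lemma connected_cut:
  assumes "pair_graph H" "Digraph_Component.connected (with_proj H)"
    and "W \<subseteq> pverts H" "W \<noteq> {}" "W \<noteq> pverts H"
  shows "\<exists>x\<in>W. \<exists>y\<in>pverts H - W. (x, y) \<in> parcs H"
proof (rule ccontr)
  assume no: "\<not> ?thesis"
  interpret pair_graph H by fact
  obtain u v where uv: "u \<in> W" "v \<in> pverts H" "v \<notin> W" using assms(3-5) by blast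
  have "reachable (with_proj (mk_symmetric (with_proj H))) u v"
    using assms uv by (auto simp: Digraph_Component.connected_def strongly_connected_def mk_symmetric_def)
  then have "reachable (with_proj H) u v" using reachable_mk_symmetric_eq[OF pair_sym_arcs] by simp
  then have "(u, v) \<in> rtrancl_on (pverts H) (parcs H)" by (simp add: reachable_def)
  then have "v \<in> W"
  proof (induction rule: rtrancl_on_induct)
    case base
    show ?case by (rule uv(1))
  next
    case (step x y)
    then show ?case using no in_arcsD2[of x y] by blast
  qed
  then show False using uv by simp
qed

section \<open>Embeddings, automorphisms and copies\<close>

definition hom_set :: "'a pair_pre_digraph \<Rightarrow> nat \<Rightarrow> nat set set \<Rightarrow> ('a \<Rightarrow> nat) set" where
  "hom_set H n S = {\<phi> \<in> pverts H \<rightarrow>\<^sub>E {..<n}. inj_on \<phi> (pverts H) \<and> (\<forall>(a, b)\<in>parcs H. {\<phi> a, \<phi> b} \<in> S)}"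

definition aut_set :: "'a pair_pre_digraph \<Rightarrow> ('a \<Rightarrow> 'a) set" where
  "aut_set H = {\<sigma> \<in> pverts H \<rightarrow>\<^sub>E pverts H. inj_on \<sigma> (pverts H) \<and> map_prod \<sigma> \<sigma> ` parcs H = parcs H}"

definition host :: "nat \<Rightarrow> nat set set \<Rightarrow> nat pair_pre_digraph" where
  "host n S = \<lparr>pverts = {..<n}, parcs = {(u, v). {u, v} \<in> S}\<rparr>"

definition image_graph :: "'a pair_pre_digraph \<Rightarrow> ('a \<Rightarrow> 'b) \<Rightarrow> 'b pair_pre_digraph" where
  "image_graph H \<phi> = \<lparr>pverts = \<phi> ` pverts H, parcs = map_prod \<phi> \<phi> ` parcs H\<rparr>"

text \<open>For graphs whose arcs are pairs the arc map of an isomorphism is determined by its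
  vertex map, because tail and head are the projections.\<close>

lemma digraph_iso_iff_image_graph:
  fixes H :: "'a pair_pre_digraph" and H' :: "'b pair_pre_digraph"
  assumes "pair_wf_digraph H"
  shows "digraph_iso (with_proj H) (with_proj H') \<longleftrightarrow> (\<exists>\<phi>. inj_on \<phi> (pverts H) \<and> H' = image_graph H \<phi>)"
proof
  interpret pair_wf_digraph H by fact
  {
    assume "digraph_iso (with_proj H) (with_proj H')"
    then obtain f where f: "pre_digraph.digraph_isomorphism (with_proj H) f" "with_proj H' = app_iso f (with_proj H)"
      by (auto simp: digraph_iso_def)
    have g: "pverts H' = iso_verts f ` pverts H" "parcs H' = iso_arcs f ` parcs H" "iso_tail f = fst" "iso_head f = snd"
      using f(2) by (auto simp: with_proj_def app_iso_def)
    have "iso_arcs f a = map_prod (iso_verts f) (iso_verts f) a" if "a \<in> parcs H" for a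
      using f(1) that g(3,4) by (cases a) (auto simp: pre_digraph.digraph_isomorphism_def prod_eq_iff)
    then have "parcs H' = map_prod (iso_verts f) (iso_verts f) ` parcs H" unfolding g by (rule image_cong[OF refl])
    then have "H' = image_graph H (iso_verts f)" using g by (simp add: image_graph_def)
    moreover have "inj_on (iso_verts f) (pverts H)" using f(1) by (simp add: pre_digraph.digraph_isomorphism_def)
    ultimately show "\<exists>\<phi>. inj_on \<phi> (pverts H) \<and> H' = image_graph H \<phi>" by blast
  }
  {
    assume "\<exists>\<phi>. inj_on \<phi> (pverts H) \<and> H' = image_graph H \<phi>"
    then obtain \<phi> where \<phi>: "inj_on \<phi> (pverts H)" "H' = image_graph H \<phi>" by blast
    define f :: "('a, 'a \<times> 'a, 'b, 'b \<times> 'b) digraph_isomorphism" where "f = \<lparr>iso_verts = \<phi>, iso_arcs = map_prod \<phi> \<phi>, iso_head = snd, iso_tail = fst\<rparr>"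
    have "parcs H \<subseteq> pverts H \<times> pverts H" using in_arcsD1 in_arcsD2 by auto
    moreover have "inj_on (map_prod \<phi> \<phi>) (pverts H \<times> pverts H)" using \<phi>(1) by (rule map_prod_inj_on[OF _ \<phi>(1)])
    ultimately have "inj_on (map_prod \<phi> \<phi>) (parcs H)" by (rule inj_on_subset[rotated])
    then have "pre_digraph.digraph_isomorphism (with_proj H) f"
      using \<phi>(1) wf_digraph_axioms by (simp add: pre_digraph.digraph_isomorphism_def f_def)
    moreover have "with_proj H' = app_iso f (with_proj H)"
      by (simp add: with_proj_def app_iso_def f_def \<phi>(2) image_graph_def)
    ultimately show "digraph_iso (with_proj H) (with_proj H')" by (auto simp: digraph_iso_def)
  }
qed

lemma hom_setI:
  assumes "\<phi> \<in> extensional (pverts H)" "\<And>v. v \<in> pverts H \<Longrightarrow> \<phi> v < n" "inj_on \<phi> (pverts H)"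
    and "\<And>a b. (a, b) \<in> parcs H \<Longrightarrow> {\<phi> a, \<phi> b} \<in> S"
  shows "\<phi> \<in> hom_set H n S"
  using assms by (auto simp: hom_set_def PiE_def)

lemma host_wf: "S \<subseteq> all_edges n \<Longrightarrow> pair_wf_digraph (host n S)"
  by unfold_locales (auto simp: host_def all_edges_def)

lemma copies_eq:
  assumes "pair_graph H" "S \<subseteq> all_edges n"
  shows "{H'. subgraph (with_proj H') (with_proj (host n S)) \<and> digraph_iso (with_proj H) (with_proj H')} = image_graph H ` hom_set H n S"
proof (intro equalityI subsetI)
  interpret pair_graph H by fact
  have iso: "digraph_iso (with_proj H) (with_proj H') \<longleftrightarrow> (\<exists>\<phi>. inj_on \<phi> (pverts H) \<and> H' = image_graph H \<phi>)" for H' :: "nat pair_pre_digraph"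
    by (rule digraph_iso_iff_image_graph) unfold_locales
  {
    fix H' assume "H' \<in> {H'. subgraph (with_proj H') (with_proj (host n S)) \<and> digraph_iso (with_proj H) (with_proj H')}"
    then obtain \<phi> where \<phi>: "inj_on \<phi> (pverts H)" "H' = image_graph H \<phi>"
      and sub: "subgraph (with_proj H') (with_proj (host n S))" unfolding iso by blast
    define \<psi> where "\<psi> = restrict \<phi> (pverts H)"
    have "pverts H' = \<psi> ` pverts H" by (simp add: \<phi>(2) image_graph_def \<psi>_def)
    moreover have "parcs H' = map_prod \<psi> \<psi> ` parcs H"
      unfolding \<phi>(2) image_graph_def \<psi>_def using in_arcsD1 in_arcsD2 by (auto intro!: image_cong)
    ultimately have H': "H' = image_graph H \<psi>" by (simp add: image_graph_def)
    have s: "\<psi> ` pverts H \<subseteq> {..<n}" "map_prod \<psi> \<psi> ` parcs H \<subseteq> {(u, v). {u, v} \<in> S}"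
      using sub by (auto simp: subgraph_def H' host_def image_graph_def)
    have "{\<psi> a, \<psi> b} \<in> S" if "(a, b) \<in> parcs H" for a b using s(2) that by auto
    moreover have "inj_on \<psi> (pverts H)" using \<phi>(1) by (simp add: \<psi>_def inj_on_def)
    moreover have "\<psi> \<in> extensional (pverts H)" by (simp add: \<psi>_def)
    ultimately have "\<psi> \<in> hom_set H n S" using s(1) by (intro hom_setI) auto
    then show "H' \<in> image_graph H ` hom_set H n S" using H' by blast
  }
  {
    fix H' assume "H' \<in> image_graph H ` hom_set H n S"
    then obtain \<phi> where \<phi>: "\<phi> \<in> hom_set H n S" "H' = image_graph H \<phi>" by blast
    have "pair_wf_digraph H'"
      unfolding \<phi>(2) image_graph_def using in_arcsD1 in_arcsD2 by unfold_locales force+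
    moreover have "pverts H' \<subseteq> {..<n}" "parcs H' \<subseteq> {(u, v). {u, v} \<in> S}"
      using \<phi> by (auto simp: hom_set_def image_graph_def)
    ultimately have "subgraph (with_proj H') (with_proj (host n S))"
      using host_wf[OF assms(2)] by (auto simp: subgraph_def wf_digraph_wp_iff host_def)
    then show "H' \<in> {H'. subgraph (with_proj H') (with_proj (host n S)) \<and> digraph_iso (with_proj H) (with_proj H')}"
      using \<phi> unfolding iso by (auto simp: hom_set_def)
  }
qed

lemma finite_hom_set: "finite (pverts H) \<Longrightarrow> finite (hom_set H n S)"
  by (rule finite_subset[of _ "pverts H \<rightarrow>\<^sub>E {..<n}"]) (auto simp: hom_set_def intro: finite_PiE)

lemma aut_set_surj: "finite (pverts H) \<Longrightarrow> \<sigma> \<in> aut_set H \<Longrightarrow> \<sigma> ` pverts H = pverts H"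
  by (rule endo_inj_surj) (auto simp: aut_set_def)

text \<open>Embeddings with the same image differ by composition with an automorphism on the right;
  \<open>c\<close> inverts the reference embedding.\<close>

lemma card_fibre:
  assumes "pair_graph H" "\<phi>\<^sub>0 \<in> hom_set H n S"
  shows "card {\<phi> \<in> hom_set H n S. image_graph H \<phi> = image_graph H \<phi>\<^sub>0} = card (aut_set H)"
proof -
  interpret pair_graph H by fact
  let ?V = "pverts H" and ?A = "parcs H"
  have inj0: "inj_on \<phi>\<^sub>0 ?V" and im0: "\<And>v. v \<in> ?V \<Longrightarrow> \<phi>\<^sub>0 v < n" and edge0: "\<And>a b. (a, b) \<in> ?A \<Longrightarrow> {\<phi>\<^sub>0 a, \<phi>\<^sub>0 b} \<in> S"
    using assms(2) by (auto simp: hom_set_def)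
  have arcs_V: "a \<in> ?V" "b \<in> ?V" if "(a, b) \<in> ?A" for a b using that in_arcsD1 in_arcsD2 by auto
  define c where "c = inv_into ?V \<phi>\<^sub>0"
  have c: "c (\<phi>\<^sub>0 v) = v" if "v \<in> ?V" for v using that inj0 by (simp add: c_def)
  have "bij_betw (\<lambda>\<sigma>. restrict (\<phi>\<^sub>0 \<circ> \<sigma>) ?V) (aut_set H) {\<phi> \<in> hom_set H n S. image_graph H \<phi> = image_graph H \<phi>\<^sub>0}"
  proof (rule bij_betwI[where g = "\<lambda>\<phi>. restrict (c \<circ> \<phi>) ?V"])
    show "(\<lambda>\<sigma>. restrict (\<phi>\<^sub>0 \<circ> \<sigma>) ?V) \<in> aut_set H \<rightarrow> {\<phi> \<in> hom_set H n S. image_graph H \<phi> = image_graph H \<phi>\<^sub>0}"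
    proof
      fix \<sigma> assume \<sigma>: "\<sigma> \<in> aut_set H"
      have \<sigma>V: "\<sigma> v \<in> ?V" if "v \<in> ?V" for v using \<sigma> that by (auto simp: aut_set_def)
      have \<sigma>A: "(\<sigma> a, \<sigma> b) \<in> ?A" if "(a, b) \<in> ?A" for a b
      proof -
        have "map_prod \<sigma> \<sigma> (a, b) \<in> map_prod \<sigma> \<sigma> ` ?A" using that by (rule imageI)
        then show ?thesis using \<sigma> by (simp add: aut_set_def)
      qed
      define \<phi> where "\<phi> = restrict (\<phi>\<^sub>0 \<circ> \<sigma>) ?V"
      have "\<phi> ` ?V = \<phi>\<^sub>0 ` \<sigma> ` ?V" by (auto simp: \<phi>_def)
      also have "\<dots> = \<phi>\<^sub>0 ` ?V" by (simp only: aut_set_surj[OF pair_finite_verts \<sigma>])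
      finally have V: "\<phi> ` ?V = \<phi>\<^sub>0 ` ?V" .
      have "map_prod \<phi> \<phi> ` ?A = map_prod \<phi>\<^sub>0 \<phi>\<^sub>0 ` map_prod \<sigma> \<sigma> ` ?A"
        unfolding image_image by (rule image_cong) (auto simp: \<phi>_def dest: arcs_V)
      also have "\<dots> = map_prod \<phi>\<^sub>0 \<phi>\<^sub>0 ` ?A" using \<sigma> by (simp add: aut_set_def)
      finally have "image_graph H \<phi> = image_graph H \<phi>\<^sub>0" using V by (simp add: image_graph_def)
      moreover have "inj_on (\<phi>\<^sub>0 \<circ> \<sigma>) ?V"
        using \<sigma> by (intro comp_inj_on inj_on_subset[OF inj0]) (auto simp: aut_set_def)
      then have "inj_on \<phi> ?V" unfolding \<phi>_def by (simp add: inj_on_restrict_eq)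
      moreover have "{\<phi> a, \<phi> b} \<in> S" if "(a, b) \<in> ?A" for a b
        using edge0[OF \<sigma>A[OF that]] arcs_V[OF that] by (simp add: \<phi>_def)
      moreover have "\<phi> \<in> extensional ?V" "\<And>v. v \<in> ?V \<Longrightarrow> \<phi> v < n" using im0 \<sigma>V by (simp_all add: \<phi>_def)
      ultimately have "\<phi> \<in> {\<phi> \<in> hom_set H n S. image_graph H \<phi> = image_graph H \<phi>\<^sub>0}"
        by (intro CollectI conjI hom_setI)
      then show "restrict (\<phi>\<^sub>0 \<circ> \<sigma>) ?V \<in> {\<phi> \<in> hom_set H n S. image_graph H \<phi> = image_graph H \<phi>\<^sub>0}"
        by (simp only: \<phi>_def)
    qed
    show "(\<lambda>\<phi>. restrict (c \<circ> \<phi>) ?V) \<in> {\<phi> \<in> hom_set H n S. image_graph H \<phi> = image_graph H \<phi>\<^sub>0} \<rightarrow> aut_set H"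
    proof
      fix \<phi> assume "\<phi> \<in> {\<phi> \<in> hom_set H n S. image_graph H \<phi> = image_graph H \<phi>\<^sub>0}"
      then have \<phi>: "\<phi> \<in> hom_set H n S" "\<phi> ` ?V = \<phi>\<^sub>0 ` ?V" "map_prod \<phi> \<phi> ` ?A = map_prod \<phi>\<^sub>0 \<phi>\<^sub>0 ` ?A"
        by (auto simp: image_graph_def)
      define \<sigma> where "\<sigma> = restrict (c \<circ> \<phi>) ?V"
      have im: "\<phi> v \<in> \<phi>\<^sub>0 ` ?V" if "v \<in> ?V" for v unfolding \<phi>(2)[symmetric] using that by (rule imageI)
      have s: "\<sigma> v \<in> ?V" "\<phi>\<^sub>0 (\<sigma> v) = \<phi> v" if "v \<in> ?V" for v
        using im[OF that] that by (auto simp: \<sigma>_def c)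
      have "inj_on \<sigma> ?V"
      proof (rule inj_onI)
        fix x y assume "x \<in> ?V" "y \<in> ?V" "\<sigma> x = \<sigma> y"
        then have "\<phi> x = \<phi> y" using s(2)[of x] s(2)[of y] by simp
        then show "x = y" using \<phi>(1) \<open>x \<in> ?V\<close> \<open>y \<in> ?V\<close> by (auto simp: hom_set_def dest: inj_onD)
      qed
      moreover have "map_prod \<sigma> \<sigma> ` ?A = map_prod c c ` map_prod \<phi> \<phi> ` ?A"
        unfolding image_image by (rule image_cong) (auto simp: \<sigma>_def dest: arcs_V)
      then have "map_prod \<sigma> \<sigma> ` ?A = (\<lambda>x. map_prod c c (map_prod \<phi>\<^sub>0 \<phi>\<^sub>0 x)) ` ?A" by (simp only: \<phi>(3) image_image)
      then have "map_prod \<sigma> \<sigma> ` ?A = (\<lambda>x. x) ` ?A"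
      proof (simp only:, intro image_cong refl)
        fix x assume "x \<in> ?A"
        then show "map_prod c c (map_prod \<phi>\<^sub>0 \<phi>\<^sub>0 x) = x" using arcs_V[of "fst x" "snd x"] by (cases x) (simp add: c)
      qed
      ultimately have "\<sigma> \<in> aut_set H" using s(1) by (simp add: aut_set_def PiE_def \<sigma>_def)
      then show "restrict (c \<circ> \<phi>) ?V \<in> aut_set H" by (simp only: \<sigma>_def)
    qed
  next
    fix \<sigma> assume \<sigma>: "\<sigma> \<in> aut_set H"
    have "\<sigma> v \<in> ?V" if "v \<in> ?V" for v using \<sigma> that by (auto simp: aut_set_def)
    moreover have "\<sigma> v = undefined" if "v \<notin> ?V" for v using \<sigma> that by (auto simp: aut_set_def intro: PiE_arb)
    ultimately have "restrict (c \<circ> restrict (\<phi>\<^sub>0 \<circ> \<sigma>) ?V) ?V v = \<sigma> v" for v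
      by (cases "v \<in> ?V") (simp_all add: c)
    then show "restrict (c \<circ> restrict (\<phi>\<^sub>0 \<circ> \<sigma>) ?V) ?V = \<sigma>" by (rule ext)
  next
    fix \<phi> assume "\<phi> \<in> {\<phi> \<in> hom_set H n S. image_graph H \<phi> = image_graph H \<phi>\<^sub>0}"
    then have \<phi>: "\<phi> \<in> hom_set H n S" "\<phi> ` ?V = \<phi>\<^sub>0 ` ?V" by (auto simp: image_graph_def)
    have "\<phi>\<^sub>0 (c (\<phi> v)) = \<phi> v" if "v \<in> ?V" for v
    proof -
      have "\<phi> v \<in> \<phi>\<^sub>0 ` ?V" unfolding \<phi>(2)[symmetric] using that by (rule imageI)
      then show ?thesis by (auto simp: c)
    qed
    moreover have "\<phi> v = undefined" if "v \<notin> ?V" for v using \<phi>(1) that by (auto simp: hom_set_def intro: PiE_arb)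
    ultimately have "restrict (\<phi>\<^sub>0 \<circ> restrict (c \<circ> \<phi>) ?V) ?V v = \<phi> v" for v
      by (cases "v \<in> ?V") simp_all
    then show "restrict (\<phi>\<^sub>0 \<circ> restrict (c \<circ> \<phi>) ?V) ?V = \<phi>" by (rule ext)
  qed
  then show ?thesis by (rule bij_betw_same_card[symmetric])
qed

lemma card_hom_set:
  assumes "pair_graph H" "S \<subseteq> all_edges n"
  shows "card (hom_set H n S) = card (aut_set H) * subgraph_count H (host n S)"
proof -
  interpret pair_graph H by fact
  have "card (hom_set H n S) = (\<Sum>x\<in>hom_set H n S. 1)" by simp
  also have "\<dots> = (\<Sum>y\<in>image_graph H ` hom_set H n S. \<Sum>x | x \<in> hom_set H n S \<and> image_graph H x = y. 1)"
    by (rule sum.image_gen) (rule finite_hom_set[OF pair_finite_verts])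
  also have "\<dots> = (\<Sum>y\<in>image_graph H ` hom_set H n S. card (aut_set H))"
    by (rule sum.cong) (use card_fibre[OF assms(1)] in auto)
  finally show ?thesis by (simp add: subgraph_count_def copies_eq[OF assms])
qed

lemma card_aut_set_pos:
  assumes "pair_graph H"
  shows "0 < card (aut_set H)"
proof -
  interpret pair_graph H by fact
  have "finite (aut_set H)"
    by (rule finite_subset[of _ "pverts H \<rightarrow>\<^sub>E pverts H"]) (auto simp: aut_set_def intro: finite_PiE)
  moreover have "map_prod (restrict id (pverts H)) (restrict id (pverts H)) ` parcs H = (\<lambda>x. x) ` parcs H"
    by (rule image_cong) (auto dest: in_arcsD1 in_arcsD2)
  then have "restrict id (pverts H) \<in> aut_set H" by (auto simp: aut_set_def inj_on_def)
  ultimately show ?thesis by (auto simp: card_gt_0_iff)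
qed

lemma emb_count_eq_card_hom_set:
  assumes "pair_graph H" and b: "bij_betw b {..<h} (pverts H)"
    and E: "E = {{i, j} | i j. i < h \<and> j < h \<and> (b i, b j) \<in> parcs H}"
  shows "emb_count h E n S = card (hom_set H n S)"
proof -
  interpret pair_graph H by fact
  let ?V = "pverts H" and ?A = "parcs H"
  define c where "c = inv_into {..<h} b"
  have c: "c (b i) = i" if "i < h" for i using that b by (simp add: c_def bij_betw_def)
  have bV: "b i \<in> ?V" if "i < h" for i using b that by (auto simp: bij_betw_def)
  have cv: "c v < h" "b (c v) = v" if "v \<in> ?V" for v
  proof -
    have "v \<in> b ` {..<h}" using b that by (simp add: bij_betw_def)
    then show "c v < h" "b (c v) = v" using c by auto
  qed
  have arcs_V: "u \<in> ?V" "v \<in> ?V" if "(u, v) \<in> ?A" for u v using that in_arcsD1 in_arcsD2 by auto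
  have edges: "image_edges E \<psi> \<subseteq> S \<longleftrightarrow> (\<forall>i j. i < h \<longrightarrow> j < h \<longrightarrow> (b i, b j) \<in> ?A \<longrightarrow> {\<psi> i, \<psi> j} \<in> S)" for \<psi>
    unfolding image_edges_def E by fastforce
  have "bij_betw (\<lambda>\<phi>. restrict (\<phi> \<circ> b) {..<h}) (hom_set H n S) {\<psi> \<in> embs h n. image_edges E \<psi> \<subseteq> S}"
  proof (rule bij_betwI[where g = "\<lambda>\<psi>. restrict (\<psi> \<circ> c) ?V"])
    show "(\<lambda>\<phi>. restrict (\<phi> \<circ> b) {..<h}) \<in> hom_set H n S \<rightarrow> {\<psi> \<in> embs h n. image_edges E \<psi> \<subseteq> S}"
    proof
      fix \<phi> assume \<phi>: "\<phi> \<in> hom_set H n S"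
      have "inj_on (\<phi> \<circ> b) {..<h}" using \<phi> b by (intro comp_inj_on) (auto simp: hom_set_def bij_betw_def)
      then have "inj_on (restrict (\<phi> \<circ> b) {..<h}) {..<h}" by (simp add: inj_on_restrict_eq)
      then show "restrict (\<phi> \<circ> b) {..<h} \<in> {\<psi> \<in> embs h n. image_edges E \<psi> \<subseteq> S}"
        unfolding mem_Collect_eq edges using \<phi> bV by (auto simp: embs_def hom_set_def)
    qed
    show "(\<lambda>\<psi>. restrict (\<psi> \<circ> c) ?V) \<in> {\<psi> \<in> embs h n. image_edges E \<psi> \<subseteq> S} \<rightarrow> hom_set H n S"
    proof
      fix \<psi> assume "\<psi> \<in> {\<psi> \<in> embs h n. image_edges E \<psi> \<subseteq> S}"
      then have \<psi>: "\<psi> \<in> embs h n" "\<And>i j. i < h \<Longrightarrow> j < h \<Longrightarrow> (b i, b j) \<in> ?A \<Longrightarrow> {\<psi> i, \<psi> j} \<in> S"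
        unfolding mem_Collect_eq edges by auto
      have "inj_on c ?V" using cv(2) by (metis inj_onI)
      then have "inj_on (\<psi> \<circ> c) ?V"
      proof (rule comp_inj_on)
        have "inj_on \<psi> {..<h}" using \<psi>(1) by (simp add: embs_def)
        then show "inj_on \<psi> (c ` ?V)" by (rule inj_on_subset) (use cv(1) in auto)
      qed
      then have "inj_on (restrict (\<psi> \<circ> c) ?V) ?V" by (simp add: inj_on_restrict_eq)
      moreover have "{restrict (\<psi> \<circ> c) ?V u, restrict (\<psi> \<circ> c) ?V v} \<in> S" if "(u, v) \<in> ?A" for u v
        using \<psi>(2)[of "c u" "c v"] cv arcs_V[OF that] that by simp
      moreover have "restrict (\<psi> \<circ> c) ?V v < n" if "v \<in> ?V" for v
        using \<psi>(1) cv(1)[OF that] that by (auto simp: embs_def)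
      ultimately show "restrict (\<psi> \<circ> c) ?V \<in> hom_set H n S"
        by (intro hom_setI restrict_extensional)
    qed
  next
    fix \<phi> assume \<phi>: "\<phi> \<in> hom_set H n S"
    have "\<phi> v = undefined" if "v \<notin> ?V" for v using \<phi> that by (auto simp: hom_set_def intro: PiE_arb)
    then have "restrict (restrict (\<phi> \<circ> b) {..<h} \<circ> c) ?V v = \<phi> v" for v
      by (cases "v \<in> ?V") (simp_all add: cv)
    then show "restrict (restrict (\<phi> \<circ> b) {..<h} \<circ> c) ?V = \<phi>" by (rule ext)
  next
    fix \<psi> assume "\<psi> \<in> {\<psi> \<in> embs h n. image_edges E \<psi> \<subseteq> S}"
    then have "\<psi> v = undefined" if "\<not> v < h" for v using that by (auto simp: embs_def intro: PiE_arb)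
    then have "restrict (restrict (\<psi> \<circ> c) ?V \<circ> b) {..<h} v = \<psi> v" for v
      by (cases "v < h") (simp_all add: bV c)
    then show "restrict (restrict (\<psi> \<circ> c) ?V \<circ> b) {..<h} = \<psi>" by (rule ext)
  qed
  then show ?thesis unfolding emb_count_def by (rule bij_betw_same_card[symmetric])
qed

text \<open>Relabels H along an enumeration adapted to gadgets with prefix length r; the embedding
  counts do not depend on the labelling, so different r may be used for the same H.\<close>

lemma labelled_pattern:
  assumes H: "pair_graph H" "Digraph_Component.connected (with_proj H)" and h: "h = card (pverts H)"
    and r: "1 \<le> r" "r + 2 \<le> h"
  obtains E \<pi> where "\<And>e. e \<in> E \<Longrightarrow> e \<subseteq> {..<h} \<and> card e = 2"
    and "\<And>i. 1 \<le> i \<Longrightarrow> i < r + 2 \<Longrightarrow> \<pi> i < i \<and> \<pi> i < r \<and> {i, \<pi> i} \<in> E"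
    and "\<And>n S. emb_count h E n S = card (hom_set H n S)"
proof -
  interpret pair_graph H by fact
  have "\<exists>L. distinct L \<and> set L = pverts H \<and> (\<forall>i. 1 \<le> i \<longrightarrow> i < r + 2 \<longrightarrow> (\<exists>j<i. j < r \<and> (L ! i, L ! j) \<in> parcs H))"
  proof (rule connected_enumeration)
    fix x y assume "(x, y) \<in> parcs H"
    then show "(y, x) \<in> parcs H" using pair_sym_arcs by (auto simp: symmetric_def dest: symD)
  qed (use connected_cut[OF H] r h pair_finite_verts in auto)
  then obtain L where L: "distinct L" "set L = pverts H" "\<forall>i. 1 \<le> i \<longrightarrow> i < r + 2 \<longrightarrow> (\<exists>j<i. j < r \<and> (L ! i, L ! j) \<in> parcs H)"
    by blast
  have len: "length L = h" using L(1,2) h distinct_card by metis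
  have b: "bij_betw ((!) L) {..<h} (pverts H)" using bij_betw_nth[OF L(1), of "{..<h}" "pverts H"] L(2) len by simp
  define E where "E = {{i, j} | i j. i < h \<and> j < h \<and> (L ! i, L ! j) \<in> parcs H}"
  obtain \<pi> where \<pi>: "\<And>i. 1 \<le> i \<Longrightarrow> i < r + 2 \<Longrightarrow> \<pi> i < i \<and> \<pi> i < r \<and> (L ! i, L ! \<pi> i) \<in> parcs H"
    using L(3) by metis
  show ?thesis
  proof (rule that)
    fix e assume "e \<in> E"
    then obtain i j where ij: "e = {i, j}" "i < h" "j < h" "(L ! i, L ! j) \<in> parcs H" by (auto simp: E_def)
    then have "i \<noteq> j" using pair_no_loops[OF ij(4)] by auto
    then show "e \<subseteq> {..<h} \<and> card e = 2" using ij by simp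
  next
    fix i assume "1 \<le> i" "i < r + 2"
    then show "\<pi> i < i \<and> \<pi> i < r \<and> {i, \<pi> i} \<in> E" using \<pi>[of i] r(2) unfolding E_def by force
  next
    fix n S show "emb_count h E n S = card (hom_set H n S)"
      by (rule emb_count_eq_card_hom_set[OF H(1) b]) (rule E_def)
  qed
qed

text \<open>An arbitrary labelling, sufficient for the variance and for the interval estimate, and
  available for h = 2 as well.\<close>

lemma pattern_of_connected:
  assumes H: "pair_graph H" "Digraph_Component.connected (with_proj H)" and h: "h = card (pverts H)" "2 \<le> h"
  obtains E where "\<And>e. e \<in> E \<Longrightarrow> e \<subseteq> {..<h} \<and> card e = 2" "E \<noteq> {}"
    and "\<And>n S. emb_count h E n S = card (hom_set H n S)"
proof -
  interpret pair_graph H by fact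
  obtain b where b: "bij_betw b {..<h} (pverts H)"
    using ex_bij_betw_nat_finite[OF pair_finite_verts] h by (auto simp: atLeast0LessThan)
  define E where "E = {{i, j} | i j. i < h \<and> j < h \<and> (b i, b j) \<in> parcs H}"
  have "pverts H \<noteq> {}" using h by auto
  then obtain a where a: "a \<in> pverts H" by blast
  have "{a} \<noteq> pverts H"
  proof
    assume "{a} = pverts H"
    then have "card {a} = h" using h by simp
    then show False using h(2) by simp
  qed
  then obtain y where y: "(a, y) \<in> parcs H" using connected_cut[OF H, of "{a}"] a by auto
  then have "a \<in> b ` {..<h}" "y \<in> b ` {..<h}" using b in_arcsD1[OF y] in_arcsD2[OF y] by (auto simp: bij_betw_def)
  then obtain i j where "i < h" "j < h" "a = b i" "y = b j" by auto
  then have "{i, j} \<in> E" using y unfolding E_def by blast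
  show ?thesis
  proof (rule that)
    fix e assume "e \<in> E"
    then obtain i j where ij: "e = {i, j}" "i < h" "j < h" "(b i, b j) \<in> parcs H" by (auto simp: E_def)
    then have "i \<noteq> j" using pair_no_loops[OF ij(4)] by auto
    then show "e \<subseteq> {..<h} \<and> card e = 2" using ij by simp
  next
    show "E \<noteq> {}" using \<open>{i, j} \<in> E\<close> by auto
    fix n S show "emb_count h E n S = card (hom_set H n S)"
      by (rule emb_count_eq_card_hom_set[OF H(1) b]) (rule E_def)
  qed
qed

section \<open>From the random graph to random sets of edges\<close>

context bernoulli
begin

text \<open>Outcomes that are true somewhere outside \<open>all_edges n\<close> have probability 0;
  the others are the characteristic functions of its subsets.\<close>

lemma prob_eq_bexp:
  "measure_pmf.prob (binomial_random_graph n p) {G. Q G} = bexp (all_edges n) (\<lambda>S. of_bool (Q (host n S)) :: real)"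
proof -
  let ?P = "Pi_pmf (all_edges n) False (\<lambda>_. bernoulli_pmf p)"
  define g :: "nat set set \<Rightarrow> nat set \<Rightarrow> bool" where "g S = (\<lambda>e. e \<in> S)" for S
  define R where "R = g ` {S \<in> Pow (all_edges n). Q (host n S)}"
  have inj: "inj_on g X" for X by (auto simp: inj_on_def g_def fun_eq_iff)
  have fin: "finite R" by (simp add: R_def)
  have "measure_pmf.prob (binomial_random_graph n p) {G. Q G} = measure_pmf.prob ?P {f. Q \<lparr>pverts = {..<n}, parcs = {(u, v). f {u, v}}\<rparr>}"
    unfolding binomial_random_graph_def all_edges_def[symmetric] measure_map_pmf by (simp add: vimage_def)
  also have "\<dots> = measure_pmf.prob ?P R"
  proof (rule measure_prob_cong_0)
    fix f assume f: "f \<in> {f. Q \<lparr>pverts = {..<n}, parcs = {(u, v). f {u, v}}\<rparr>} - R"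
    show "pmf ?P f = 0"
    proof (cases "\<forall>e. e \<notin> all_edges n \<longrightarrow> \<not> f e")
      case True
      then have "f = g {e. f e}" "{e. f e} \<subseteq> all_edges n" by (auto simp: g_def)
      moreover have "Q (host n {e. f e})" using f by (simp add: host_def)
      ultimately have "f \<in> R" unfolding R_def by blast
      then show ?thesis using f by simp
    next
      case False
      then show ?thesis by (intro pmf_Pi_outside) auto
    qed
  next
    fix f assume f: "f \<in> R - {f. Q \<lparr>pverts = {..<n}, parcs = {(u, v). f {u, v}}\<rparr>}"
    then show "pmf ?P f = 0" by (auto simp: R_def g_def host_def)
  qed
  also have "\<dots> = (\<Sum>f\<in>R. pmf ?P f)" by (rule measure_measure_pmf_finite[OF fin])
  also have "\<dots> = (\<Sum>S | S \<in> Pow (all_edges n) \<and> Q (host n S). pmf ?P (g S))"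
    unfolding R_def by (rule sum.reindex_cong[OF inj]) auto
  also have "\<dots> = (\<Sum>S | S \<in> Pow (all_edges n) \<and> Q (host n S). p ^ card S * (1 - p) ^ card (all_edges n - S))"
  proof (rule sum.cong)
    fix S assume "S \<in> {S. S \<in> Pow (all_edges n) \<and> Q (host n S)}"
    then have S: "S \<subseteq> all_edges n" by simp
    have "pmf ?P (g S) = (\<Prod>e\<in>all_edges n. pmf (bernoulli_pmf p) (g S e))"
      using S by (intro pmf_Pi') (auto simp: g_def)
    also have "\<dots> = (\<Prod>e\<in>all_edges n. if e \<in> S then p else 1 - p)"
      using p_pos p_less_1 by (intro prod.cong) (auto simp: g_def)
    also have "\<dots> = p ^ card (all_edges n \<inter> S) * (1 - p) ^ card (all_edges n \<inter> - S)"
      by (simp add: prod.If_cases)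
    also have "all_edges n \<inter> S = S" using S by auto
    also have "all_edges n \<inter> - S = all_edges n - S" by auto
    finally show "pmf ?P (g S) = p ^ card S * (1 - p) ^ card (all_edges n - S)" .
  qed simp
  also have "\<dots> = bexp (all_edges n) (\<lambda>S. of_bool (Q (host n S)) :: real)"
    unfolding bexp_def by (rule sum.mono_neutral_cong_left) auto
  finally show ?thesis .
qed

end

section \<open>Choice of the parameters\<close>

lemma eventually_powr_ge:
  assumes "0 < a"
  shows "\<forall>\<^sub>F n in sequentially. C \<le> real n powr a"
proof (rule eventually_sequentiallyI[of "nat \<lceil>max C 1 powr (1 / a)\<rceil>"])
  fix n assume "nat \<lceil>max C 1 powr (1 / a)\<rceil> \<le> n"
  then have "max C 1 powr (1 / a) \<le> real n" by linarith
  then have "(max C 1 powr (1 / a)) powr a \<le> real n powr a" using assms by (intro powr_mono2) auto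
  moreover have "(max C 1 powr (1 / a)) powr a = max C 1" using assms by (simp add: powr_powr)
  ultimately show "C \<le> real n powr a" by linarith
qed

lemma eventually_exp_le_powr:
  fixes c \<delta> K :: real
  assumes "0 < c" "0 < \<delta>"
  shows "\<forall>\<^sub>F n in sequentially. exp (- (c * real n powr \<delta>)) \<le> real n powr (- K) / 2"
  using assms by real_asymp

lemma powr_power_nat: "0 < x \<Longrightarrow> (x powr a) ^ k = x powr (a * real k)" for x a :: real
  by (simp add: powr_realpow[symmetric] powr_powr)

context pattern
begin

text \<open>Here m is about n^\<mu> and w is as large as A <= C0 and the room permit. The first
  condition on x gives w >= n^\<delta>, the second gives m A >= n^\<delta> when w is limited by the
  room, and the third makes the nonlinear terms negligible. The bound on \<mu> (r - 1) keeps the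
  mixed embeddings rare.\<close>

theorem gadget_window:
  fixes r q :: nat and \<pi> :: "nat \<Rightarrow> nat" and \<mu> \<delta> K :: real
  defines "s \<equiv> real (h - (r + q))"
  assumes r: "2 \<le> r" "1 \<le> q" "r + q \<le> h"
    and \<pi>: "\<And>i. 1 \<le> i \<Longrightarrow> i < r + q \<Longrightarrow> \<pi> i < i \<and> \<pi> i < r \<and> {i, \<pi> i} \<in> E"
    and \<delta>: "0 < \<delta>" "2 * \<delta> \<le> \<mu>" "\<mu> * real (r - 1) \<le> 1 - \<delta>"
  shows "\<forall>\<^sub>F n in sequentially. \<forall>x. s + real q * \<delta> \<le> x \<longrightarrow> 2 * \<delta> + 2 * x \<le> \<mu> + real q + 2 * s \<longrightarrow>
    \<mu> * real (r - 1) + \<delta> + x \<le> 2 + s \<longrightarrow>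
    norm (bexp (all_edges n) (\<lambda>S. cis (real n powr (- x) * real (emb_count h E n S)))) \<le> real n powr (- K)"
proof -
  define k where "k = r + q - 2"
  define d where "d = card E"
  define C0 where "C0 = 6 / (hcK ^ (k * d) * 2 ^ k * (real h ^ h)\<^sup>2)"
  define C1 where "C1 = (2 * (p * (1 - p))) ^ k * (p ^ d)\<^sup>2 / (4 * (4 * real h) ^ (2 * h))"
  define C2 where "C2 = 32 * 2 ^ k * (real h ^ h)\<^sup>2 * (real r ^ (r - 1))\<^sup>2 / C1"
  have pq: "0 < p * (1 - p)" using p_pos p_less_1 by simp
  have C0: "0 < C0" using hcK_bounds h_ge_2 by (simp add: C0_def)
  have C1: "0 < C1" using p_pos p_less_1 h_ge_2 by (simp add: C1_def)
  have C2: "0 \<le> C2" using C1 by (simp add: C2_def)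
  \<comment> \<open>Compensates for the 2^k-th root that undoes the decoupling.\<close>
  define K' where "K' = K * 2 ^ k"
  \<comment> \<open>The polynomial errors are at most n (B1 + B2) n^(-\<delta> 2^j); the margin 2
    pays for the factor n and for the constants.\<close>
  obtain j where j: "(K' + 2) / \<delta> < 2 ^ j" using real_arch_pow[of 2 "(K' + 2) / \<delta>"] by auto
  then have j: "K' + 2 < \<delta> * 2 ^ j" using \<delta>(1) by (simp add: pos_divide_less_eq mult.commute)
  define B1 where "B1 = hcM d j * (4 * (real h * (2 + 4 * real h)) / (p ^ d)\<^sup>2) ^ (2 ^ j)"
  define B2 where "B2 = hcM (k * d) j * C2 ^ (2 ^ j)"
  define c3 where "c3 = min (1 / (4 * real q) ^ q) C0 / 2 ^ (q + 1)"
  define C4 where "C4 = 2 ^ d * (real h ^ h * real r ^ r) * 64 / (p * (1 - p) * C1)"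
  have c3: "0 < c3" using C0 r by (simp add: c3_def)
  have \<mu>: "\<mu> \<le> 1 - \<delta>"
  proof -
    have "\<mu> * 1 \<le> \<mu> * real (r - 1)" using r \<delta> by (intro mult_left_mono) auto
    then show ?thesis using \<delta>(3) by simp
  qed
  have ev: "\<forall>\<^sub>F n in sequentially. 4 * h \<le> n \<and> 4 * real r \<le> real n powr \<delta> \<and> 2 / (C0 powr (1 / real q)) \<le> real n powr \<delta>
     \<and> 8 * real q \<le> real n powr (1 - \<delta>) \<and> 2 \<le> real n powr (\<mu> - \<delta>) \<and> 1 / c3 \<le> real n powr \<delta> \<and> C4 \<le> real n powr \<delta>
     \<and> 2 * (B1 + B2) \<le> real n powr 1 \<and> exp (- (p * (1 - p) / 32 * C1 * real n powr \<delta>)) \<le> real n powr (- K') / 2"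
    using \<delta> \<mu> C1 p_pos p_less_1
    by (intro eventually_conj eventually_powr_ge eventually_ge_at_top eventually_exp_le_powr mult_pos_pos divide_pos_pos) auto
  then show ?thesis
  proof (rule eventually_mono, intro allI impI)
    fix n x
    assume n: "4 * h \<le> n \<and> 4 * real r \<le> real n powr \<delta> \<and> 2 / (C0 powr (1 / real q)) \<le> real n powr \<delta>
     \<and> 8 * real q \<le> real n powr (1 - \<delta>) \<and> 2 \<le> real n powr (\<mu> - \<delta>) \<and> 1 / c3 \<le> real n powr \<delta> \<and> C4 \<le> real n powr \<delta>
     \<and> 2 * (B1 + B2) \<le> real n powr 1 \<and> exp (- (p * (1 - p) / 32 * C1 * real n powr \<delta>)) \<le> real n powr (- K') / 2"
    and x: "s + real q * \<delta> \<le> x" "2 * \<delta> + 2 * x \<le> \<mu> + real q + 2 * s" "\<mu> * real (r - 1) + \<delta> + x \<le> 2 + s"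
    have n1: "1 \<le> real n" "0 < real n" using n h_ge_2 by auto
    define P where "P a = real n powr a" for a
    have Padd: "P (a + b) = P a * P b" for a b by (simp add: P_def powr_add)
    have Ppos: "0 < P a" for a using n1 by (simp add: P_def)
    have Pmono: "a \<le> b \<Longrightarrow> P a \<le> P b" for a b using n1 by (simp add: P_def powr_mono)
    have P1: "P 1 = real n" using n1 by (simp add: P_def)
    have Ppow: "P a ^ i = P (a * real i)" for a i using n1 by (simp add: P_def powr_power_nat)
    have Pge1: "0 \<le> a \<Longrightarrow> 1 \<le> P a" for a using Pmono[of 0 a] n1 by (simp add: P_def)
    \<comment> \<open>Equal to |t| times \<open>G.NS\<close>; the phase of a coefficient is of order
      \<tau> w^(q/2).\<close>
    define \<tau> where "\<tau> = P (s - x)"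
    have \<tau>: "0 < \<tau>" using Ppos by (simp add: \<tau>_def)
    \<comment> \<open>The second entry is the size at which \<tau>^2 w^q reaches C0; the first makes
      the q classes occupy at most a quarter of the vertices.\<close>
    define W where "W = min (real n / (4 * real q)) ((C0 / \<tau>\<^sup>2) powr (1 / real q))"
    define w where "w = nat \<lfloor>W\<rfloor>"
    define m where "m = nat \<lfloor>P \<mu>\<rfloor>"
    have W2: "2 * P \<delta> \<le> W"
    proof -
      have "8 * real q * P \<delta> \<le> P (1 - \<delta>) * P \<delta>" using n Ppos[of \<delta>] by (intro mult_right_mono) (auto simp: P_def)
      also have "\<dots> = real n" by (simp add: Padd[symmetric] P1)
      finally have 1: "2 * P \<delta> \<le> real n / (4 * real q)" using r by (simp add: pos_le_divide_eq mult_ac)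
      have t2: "1 / \<tau>\<^sup>2 = P (2 * (x - s))"
      proof -
        have "\<tau>\<^sup>2 * P (2 * (x - s)) = P 0" unfolding \<tau>_def Ppow by (simp add: Padd[symmetric])
        also have "P 0 = 1" using n1 by (simp add: P_def)
        finally show ?thesis using \<tau> by (simp add: field_simps)
      qed
      have "(C0 / \<tau>\<^sup>2) powr (1 / real q) = (C0 * P (2 * (x - s))) powr (1 / real q)"
        unfolding t2[symmetric] by simp
      also have "\<dots> = C0 powr (1 / real q) * P (2 * (x - s) * (1 / real q))"
        using C0 n1 by (simp add: powr_mult P_def powr_powr)
      also have "P (2 * (x - s) * (1 / real q)) \<ge> P (2 * \<delta>)"
        using x(1) r by (intro Pmono) (simp add: pos_le_divide_eq algebra_simps)
      then have "C0 powr (1 / real q) * P (2 * \<delta>) \<le> C0 powr (1 / real q) * P (2 * (x - s) * (1 / real q))"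
        by (rule mult_left_mono) simp
      also (xtrans) have "C0 powr (1 / real q) * P (2 * \<delta>) = (C0 powr (1 / real q) * P \<delta>) * P \<delta>"
        by (simp add: Padd[symmetric])
      also (xtrans) have "2 * P \<delta> \<le> (C0 powr (1 / real q) * P \<delta>) * P \<delta>"
      proof (rule mult_right_mono)
        show "2 \<le> C0 powr (1 / real q) * P \<delta>" using n C0 by (simp add: P_def pos_divide_le_eq mult.commute)
      qed (use Ppos[of \<delta>] in simp)
      finally have 2: "2 * P \<delta> \<le> (C0 / \<tau>\<^sup>2) powr (1 / real q)" .
      show ?thesis unfolding W_def using 1 2 by (rule min.boundedI)
    qed
    have P\<delta>: "1 \<le> P \<delta>" using Pge1 \<delta> by simp
    have w: "W / 2 \<le> real w" "real w \<le> W" "P \<delta> \<le> real w" using W2 P\<delta> unfolding w_def by linarith+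
    have P\<mu>: "2 * P \<delta> \<le> P \<mu>"
    proof -
      have "2 * P \<delta> \<le> P (\<mu> - \<delta>) * P \<delta>" using n Ppos[of \<delta>] by (intro mult_right_mono) (auto simp: P_def)
      then show ?thesis by (simp add: Padd[symmetric])
    qed
    have m: "P \<mu> / 2 \<le> real m" "real m \<le> P \<mu>" "P \<delta> \<le> real m" using P\<mu> P\<delta> unfolding m_def by linarith+
    have mw: "1 \<le> m" "1 \<le> w" using m(3) w(3) P\<delta> by linarith+
    have room: "2 * (m * r + q * w) \<le> n"
    proof -
      have "real m * (4 * real r) \<le> P \<mu> * P \<delta>" using m n Ppos[of \<mu>] by (intro mult_mono) (auto simp: P_def)
      also have "\<dots> \<le> P 1" unfolding Padd[symmetric] using \<mu> by (intro Pmono) simp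
      finally have 1: "4 * (real m * real r) \<le> real n" by (simp add: P1)
      have "real w \<le> real n / (4 * real q)" using w(2) by (simp add: W_def)
      then have "real w * (4 * real q) \<le> real n" using r by (simp add: pos_le_divide_eq)
      then have "2 * (real m * real r + real q * real w) \<le> real n" using 1 by (simp add: mult_ac)
      then have "real (2 * (m * r + q * w)) \<le> real n" by simp
      then show ?thesis by (simp only: of_nat_le_iff)
    qed
    interpret G: gadgets p h E r q \<pi> n m w
      by unfold_locales (use r \<pi> mw room n in auto)
    have kb: "card G.Ib = k" by (simp add: G.Ib_def k_def)
    have c: "G.c0 = C0" "G.c1 = C1" "G.c2 = C2"
      by (simp_all add: G.c0_def G.c1_def G.c2_def C0_def C1_def C2_def kb d_def)
    define t where "t = P (- x)"
    have NS: "G.NS = P s" unfolding G.NS_eq s_def P_def using n1 by (simp add: powr_realpow)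
    have tNS: "\<bar>t\<bar> * G.NS = \<tau>" unfolding NS t_def \<tau>_def using Ppos[of "- x"] by (simp add: Padd[symmetric])
    have t2: "t\<^sup>2 * G.NS\<^sup>2 = \<tau>\<^sup>2" unfolding tNS[symmetric] by (simp add: power_mult_distrib)
    define A where "A = t\<^sup>2 * (real w ^ q * G.NS\<^sup>2)"
    have A: "A = \<tau>\<^sup>2 * real w ^ q" unfolding A_def t2[symmetric] by (simp add: mult_ac)
    have root: "((C0 / \<tau>\<^sup>2) powr (1 / real q)) ^ q = C0 / \<tau>\<^sup>2"
      using C0 \<tau> r by (simp add: powr_power_nat)
    have W0: "0 < W" using W2 P\<delta> by linarith
    have AC: "A \<le> C0"
    proof -
      have "real w ^ q \<le> ((C0 / \<tau>\<^sup>2) powr (1 / real q)) ^ q" using w(2) by (intro power_mono) (auto simp: W_def)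
      then have "\<tau>\<^sup>2 * real w ^ q \<le> \<tau>\<^sup>2 * (C0 / \<tau>\<^sup>2)" unfolding root by (intro mult_left_mono) auto
      then show ?thesis using \<tau> by (simp add: A)
    qed
    have mA: "P \<delta> \<le> real m * A"
    proof -
      define M where "M = min (1 / (4 * real q) ^ q) C0"
      have "P \<mu> * (\<tau>\<^sup>2 * W ^ q) \<ge> M * P (2 * \<delta>)"
      \<comment> \<open>If the room limits w, the second condition on x gives the power of n;
        otherwise \<tau>^2 W^q equals C0 and m alone supplies it.\<close>
      proof (cases "real n / (4 * real q) \<le> (C0 / \<tau>\<^sup>2) powr (1 / real q)")
        case True
        have "M * P (2 * \<delta>) \<le> 1 / (4 * real q) ^ q * P (\<mu> + real q + 2 * (s - x))"
          using x(2) r Ppos[of "2 * \<delta>"] by (intro mult_mono Pmono) (auto simp: M_def)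
        also have "P (\<mu> + real q + 2 * (s - x)) = P \<mu> * (real n ^ q * \<tau>\<^sup>2)"
        proof -
          have "real n ^ q = P (real q)" using Ppow[of 1 q] by (simp add: P1)
          moreover have "\<tau>\<^sup>2 = P (2 * (s - x))" unfolding \<tau>_def Ppow by (simp add: mult.commute)
          ultimately show ?thesis by (simp add: Padd mult_ac)
        qed
        also have "1 / (4 * real q) ^ q * (P \<mu> * (real n ^ q * \<tau>\<^sup>2)) = P \<mu> * (\<tau>\<^sup>2 * W ^ q)"
          using True by (simp add: W_def power_divide min_def)
        finally show ?thesis .
      next
        case False
        then have "W = (C0 / \<tau>\<^sup>2) powr (1 / real q)" by (simp add: W_def min_def)
        then have "\<tau>\<^sup>2 * W ^ q = C0" using \<tau> by (simp only: root) simp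
        moreover have "P (2 * \<delta>) * M \<le> P \<mu> * C0" using \<delta> C0 Ppos[of \<mu>] r by (intro mult_mono Pmono) (auto simp: M_def)
        ultimately show ?thesis by (simp add: mult.commute)
      qed
      then have "M * P (2 * \<delta>) / 2 ^ (q + 1) \<le> P \<mu> * (\<tau>\<^sup>2 * W ^ q) / 2 ^ (q + 1)" by (rule divide_right_mono) simp
      also have "\<dots> = (P \<mu> / 2) * (\<tau>\<^sup>2 * (W / 2) ^ q)" by (simp add: power_divide)
      also have "\<dots> \<le> real m * (\<tau>\<^sup>2 * real w ^ q)"
        using m w W0 \<tau> by (intro mult_mono power_mono mult_nonneg_nonneg) auto
      finally have "M * P (2 * \<delta>) / 2 ^ (q + 1) \<le> real m * A" by (simp only: A)
      moreover have "M * P (2 * \<delta>) / 2 ^ (q + 1) = (c3 * P \<delta>) * P \<delta>"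
        by (simp add: c3_def M_def Padd[symmetric])
      moreover have "1 * P \<delta> \<le> (c3 * P \<delta>) * P \<delta>"
        using n c3 Ppos[of \<delta>] by (intro mult_right_mono) (auto simp: P_def pos_divide_le_eq mult.commute)
      ultimately show ?thesis by simp
    qed
    have mr: "real m ^ (r - 1) \<le> P (\<mu> * real (r - 1))" using power_mono[OF m(2), of "r - 1"] by (simp add: Ppow)
    have \<kappa>: "2 ^ d * (\<bar>t\<bar> * (real h ^ h * G.NS * real (m * r) ^ r * real w ^ q / (real n)\<^sup>2)) \<le> p * (1 - p) / 64 * C1 * (real m * A)"
    proof -
      have n2: "(real n)\<^sup>2 = P 2" using Ppow[of 1 2] by (simp add: P1)
      \<comment> \<open>The ratio of the nonlinear error to m A is a constant times m^(r-1) / (n^2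
        \<tau>), which the third condition on x controls.\<close>
      have "real m ^ (r - 1) * C4 \<le> P (\<mu> * real (r - 1)) * P \<delta>"
        using mr n Ppos[of "\<mu> * real (r - 1)"] pq C1 by (intro mult_mono) (auto simp: P_def C4_def)
      also have "\<dots> \<le> P (2 + (s - x))" unfolding Padd[symmetric] using x(3) by (intro Pmono) simp
      finally have 1: "real m ^ (r - 1) * C4 \<le> P 2 * \<tau>" by (simp only: Padd \<tau>_def)
      have "2 ^ d * (\<bar>t\<bar> * (real h ^ h * G.NS * real (m * r) ^ r * real w ^ q / (real n)\<^sup>2))
        = 2 ^ d * (real h ^ h * real r ^ r) * (\<bar>t\<bar> * G.NS) * (real m ^ r * real w ^ q) / P 2"
        unfolding n2 by (simp add: power_mult_distrib mult_ac)
      also have "real m ^ r = real m * real m ^ (r - 1)" using r by (cases r) auto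
      also have "2 ^ d * (real h ^ h * real r ^ r) * (\<bar>t\<bar> * G.NS) * (real m * real m ^ (r - 1) * real w ^ q) / P 2
        = p * (1 - p) / 64 * C1 * (real m * (\<tau> * real w ^ q)) * (real m ^ (r - 1) * C4 / P 2)"
        unfolding tNS C4_def using p_pos p_less_1 C1 by (simp add: mult_ac)
      also have "\<dots> \<le> p * (1 - p) / 64 * C1 * (real m * (\<tau> * real w ^ q)) * \<tau>"
      proof (rule mult_left_mono)
        show "real m ^ (r - 1) * C4 / P 2 \<le> \<tau>" using 1 Ppos[of 2] by (simp add: pos_divide_le_eq mult.commute)
        show "0 \<le> p * (1 - p) / 64 * C1 * (real m * (\<tau> * real w ^ q))"
          using pq C1 \<tau> by (intro mult_nonneg_nonneg) auto
      qed
      also have "\<dots> = p * (1 - p) / 64 * C1 * (real m * A)" by (simp add: A power2_eq_square mult_ac)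
      finally show ?thesis .
    qed
    define \<phi> where "\<phi> = norm (bexp (all_edges n) (\<lambda>S. cis (t * real (emb_count h E n S))))"
    have "\<phi> ^ (2 ^ k) \<le> hcM d j * (4 * G.\<theta> / (p ^ d)\<^sup>2) ^ (2 ^ j)
      + real m * (hcM (k * d) j * (C2 * (real m ^ (r - 1) / real n)\<^sup>2) ^ (2 ^ j))
      + exp (- (p * (1 - p) / 32 * C1 * (real m * A)))"
      using G.gadget_bound[of t j, unfolded kb c d_def[symmetric] A_def[symmetric], OF AC \<kappa>] unfolding \<phi>_def .
    also have "\<dots> \<le> B1 * P (- \<delta> * 2 ^ j) + real n * (B2 * P (- \<delta> * 2 ^ j)) + P (- K') / 2"
    proof (intro add_mono)
      have Pinv: "1 / y \<le> P (- \<delta>)" if "P \<delta> \<le> y" for y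
      proof -
        have "1 / y \<le> 1 / P \<delta>" using that Ppos[of \<delta>] by (intro divide_left_mono) auto
        then show ?thesis by (simp add: P_def powr_minus_divide)
      qed
      have "P \<delta> \<le> real n" using Pmono[of \<delta> 1] \<delta> \<mu> by (simp add: P1)
      then have "1 / real m + 1 / real w + 4 * real h / real n \<le> P (- \<delta>) + P (- \<delta>) + 4 * real h * P (- \<delta>)"
        using Pinv[OF m(3)] Pinv[OF w(3)] mult_left_mono[OF Pinv, of "real n" "4 * real h"] by simp
      also have "\<dots> = (2 + 4 * real h) * P (- \<delta>)" by (simp add: algebra_simps)
      finally have "real h * (1 / real m + 1 / real w + 4 * real h / real n) \<le> real h * ((2 + 4 * real h) * P (- \<delta>))" by (rule mult_left_mono) simp
      then have "4 * G.\<theta> \<le> 4 * (real h * ((2 + 4 * real h) * P (- \<delta>)))"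
        unfolding G.\<theta>_def by (rule mult_left_mono) simp
      then have "4 * G.\<theta> / (p ^ d)\<^sup>2 \<le> 4 * (real h * ((2 + 4 * real h) * P (- \<delta>))) / (p ^ d)\<^sup>2"
        by (rule divide_right_mono) simp
      moreover have "0 \<le> 4 * G.\<theta> / (p ^ d)\<^sup>2" by (simp add: G.\<theta>_def)
      ultimately have "hcM d j * (4 * G.\<theta> / (p ^ d)\<^sup>2) ^ (2 ^ j) \<le> hcM d j * (4 * (real h * ((2 + 4 * real h) * P (- \<delta>))) / (p ^ d)\<^sup>2) ^ (2 ^ j)"
        using hcM_pos[of d j] by (intro mult_left_mono power_mono) auto
      also have "4 * (real h * ((2 + 4 * real h) * P (- \<delta>))) / (p ^ d)\<^sup>2 = 4 * (real h * (2 + 4 * real h)) / (p ^ d)\<^sup>2 * P (- \<delta>)" by simp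
      also have "hcM d j * (4 * (real h * (2 + 4 * real h)) / (p ^ d)\<^sup>2 * P (- \<delta>)) ^ (2 ^ j) = B1 * P (- \<delta> * 2 ^ j)"
        unfolding power_mult_distrib Ppow B1_def by simp
      finally show "hcM d j * (4 * G.\<theta> / (p ^ d)\<^sup>2) ^ (2 ^ j) \<le> B1 * P (- \<delta> * 2 ^ j)" .
      have "real m ^ (r - 1) / real n \<le> P (1 - \<delta>) / P 1"
        unfolding P1 using order_trans[OF mr Pmono[OF \<delta>(3)]] n1 by (intro divide_right_mono) auto
      also have "\<dots> = P (- \<delta>)" using n1 by (simp add: P_def powr_diff powr_minus_divide)
      finally have "(real m ^ (r - 1) / real n)\<^sup>2 \<le> (P (- \<delta>))\<^sup>2" by (intro power_mono) auto
      also have "\<dots> \<le> P (- \<delta>)" unfolding Ppow using \<delta> by (intro Pmono) simp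
      finally have "C2 * (real m ^ (r - 1) / real n)\<^sup>2 \<le> C2 * P (- \<delta>)" using C2 by (rule mult_left_mono)
      then have "hcM (k * d) j * (C2 * (real m ^ (r - 1) / real n)\<^sup>2) ^ (2 ^ j) \<le> hcM (k * d) j * (C2 * P (- \<delta>)) ^ (2 ^ j)"
        using hcM_pos[of "k * d" j] C2
        by (intro mult_left_mono[OF power_mono[OF \<open>C2 * (real m ^ (r - 1) / real n)\<^sup>2 \<le> C2 * P (- \<delta>)\<close>]]) auto
      also have "hcM (k * d) j * (C2 * P (- \<delta>)) ^ (2 ^ j) = B2 * P (- \<delta> * 2 ^ j)"
        unfolding power_mult_distrib Ppow B2_def by simp
      finally have le: "hcM (k * d) j * (C2 * (real m ^ (r - 1) / real n)\<^sup>2) ^ (2 ^ j) \<le> B2 * P (- \<delta> * 2 ^ j)" .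
      have mn: "real m \<le> real n" using order_trans[OF m(2) Pmono[of \<mu> 1]] \<mu> \<delta> by (simp add: P1)
      have nn: "0 \<le> hcM (k * d) j * (C2 * (real m ^ (r - 1) / real n)\<^sup>2) ^ (2 ^ j)"
        using hcM_pos[of "k * d" j] C2 by (intro mult_nonneg_nonneg zero_le_power) auto
      show "real m * (hcM (k * d) j * (C2 * (real m ^ (r - 1) / real n)\<^sup>2) ^ (2 ^ j)) \<le> real n * (B2 * P (- \<delta> * 2 ^ j))"
        by (rule mult_mono[OF mn le _ nn]) simp
      have "0 \<le> p * (1 - p) / 32 * C1" using pq C1 by simp
      then have "p * (1 - p) / 32 * C1 * P \<delta> \<le> p * (1 - p) / 32 * C1 * (real m * A)"
        by (rule mult_left_mono[OF mA])
      then have "exp (- (p * (1 - p) / 32 * C1 * (real m * A))) \<le> exp (- (p * (1 - p) / 32 * C1 * P \<delta>))" by simp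
      also have "\<dots> \<le> P (- K') / 2" using n by (simp add: P_def)
      finally show "exp (- (p * (1 - p) / 32 * C1 * (real m * A))) \<le> P (- K') / 2" .
    qed
    also have "\<dots> \<le> P (- K')"
    proof -
      have B: "0 \<le> B1" "0 \<le> B2" using hcM_pos[of d j] hcM_pos[of "k * d" j] C2 by (auto simp: B1_def B2_def)
      have "B1 * P (- \<delta> * 2 ^ j) + real n * (B2 * P (- \<delta> * 2 ^ j)) \<le> real n * (B1 * P (- \<delta> * 2 ^ j)) + real n * (B2 * P (- \<delta> * 2 ^ j))"
        using mult_right_mono[of 1 "real n" "B1 * P (- \<delta> * 2 ^ j)"] n1 B Ppos[of "- \<delta> * 2 ^ j"] by simp
      also have "\<dots> = (B1 + B2) * (P 1 * P (- \<delta> * 2 ^ j))" by (simp add: P1 algebra_simps)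
      also have "\<dots> \<le> (B1 + B2) * P (- K' - 1)"
        unfolding Padd[symmetric] using B j by (intro mult_left_mono Pmono) auto
      also have "\<dots> \<le> P 1 / 2 * P (- K' - 1)"
        using n Ppos[of "- K' - 1"] by (intro mult_right_mono) (auto simp: P_def)
      also have "\<dots> = P (- K') / 2" by (simp add: Padd[symmetric])
      finally show ?thesis by simp
    qed
    also have "P (- K') = P (- K) ^ (2 ^ k)" by (simp add: Ppow K'_def)
    finally have "\<phi> ^ (2 ^ k) \<le> P (- K) ^ (2 ^ k)" .
    moreover have "0 \<le> \<phi>" by (simp add: \<phi>_def)
    ultimately have "\<phi> \<le> P (- K)" using Ppos[of "- K"] by (simp add: power_mono_iff)
    then show "norm (bexp (all_edges n) (\<lambda>S. cis (real n powr (- x) * real (emb_count h E n S)))) \<le> real n powr (- K)"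
      by (simp add: \<phi>_def t_def P_def)
  qed
qed

end

section \<open>The maximal point probability\<close>

lemma eventually_all_below:
  fixes N :: nat
  assumes "\<And>s. s < N \<Longrightarrow> eventually (P s) F"
  shows "eventually (\<lambda>n. \<forall>s<N. P s n) F"
  using assms by (simp add: eventually_ball_finite_distrib[of "{..<N}", simplified Ball_def, simplified])

context bernoulli
begin

text \<open>Finitely many windows cover the range of exponents: one with r = 2 and q = 1 for the top
  unit interval, and for each s < h - 3 one with q = 2 and r = h - 2 - s.\<close>

lemma fourier_decay:
  fixes H :: "'v pair_pre_digraph" and \<epsilon> K :: real
  assumes H: "pair_graph H" "Digraph_Component.connected (with_proj H)" and h: "h = card (pverts H)" "3 \<le> h"
    and \<epsilon>: "0 < \<epsilon>" "\<epsilon> * (8 * real h) \<le> 1"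
  shows "\<forall>\<^sub>F n in sequentially. \<forall>x. \<epsilon> \<le> x \<longrightarrow> x \<le> real h - 2 - \<epsilon> \<longrightarrow>
    norm (bexp (all_edges n) (\<lambda>S. cis (real n powr (- x) * real (card (hom_set H n S))))) \<le> real n powr (- K)"
proof -
  define ok where "ok n x \<longleftrightarrow> norm (bexp (all_edges n) (\<lambda>S. cis (real n powr (- x) * real (card (hom_set H n S))))) \<le> real n powr (- K)" for n x
  have "\<epsilon> * 24 \<le> \<epsilon> * (8 * real h)" using \<epsilon> h(2) by (intro mult_left_mono) auto
  then have \<epsilon>3: "\<epsilon> * 24 \<le> 1" using \<epsilon>(2) by linarith
  have A: "\<forall>\<^sub>F n in sequentially. \<forall>x. real h - 3 + \<epsilon> / 2 \<le> x \<longrightarrow> x \<le> real h - 2 - \<epsilon> \<longrightarrow> ok n x"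
  proof -
    \<comment> \<open>Prefix length 1 makes roles 1 and 2 both neighbours of role 0. This is
      possible already for h = 3, and role 1 then joins role 0 in the gadget while role 2 becomes
      the class.\<close>
    obtain E \<pi> where E: "\<And>e. e \<in> E \<Longrightarrow> e \<subseteq> {..<h} \<and> card e = 2"
      "\<And>i. 1 \<le> i \<Longrightarrow> i < 1 + 2 \<Longrightarrow> \<pi> i < i \<and> \<pi> i < 1 \<and> {i, \<pi> i} \<in> E"
      "\<And>n S. emb_count h E n S = card (hom_set H n S)"
      using labelled_pattern[OF H h(1), of 1] h(2) by auto
    interpret pattern p h E
      using E(1) E(2)[of 1] h by unfold_locales auto
    have s: "real (h - (2 + 1)) = real h - 3" using h by simp
    have "\<forall>\<^sub>F n in sequentially. \<forall>x. real (h - (2 + 1)) + real 1 * (\<epsilon> / 2) \<le> x \<longrightarrow> 2 * (\<epsilon> / 2) + 2 * x \<le> (1 - \<epsilon>) + real 1 + 2 * real (h - (2 + 1)) \<longrightarrow>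
      (1 - \<epsilon>) * real (2 - 1) + \<epsilon> / 2 + x \<le> 2 + real (h - (2 + 1)) \<longrightarrow>
      norm (bexp (all_edges n) (\<lambda>S. cis (real n powr (- x) * real (emb_count h E n S)))) \<le> real n powr (- K)"
    proof (rule gadget_window)
      fix i :: nat assume "1 \<le> i" "i < 2 + 1"
      then have "\<pi> i < i \<and> \<pi> i < 1 \<and> {i, \<pi> i} \<in> E" by (intro E(2)) auto
      then show "\<pi> i < i \<and> \<pi> i < 2 \<and> {i, \<pi> i} \<in> E" by linarith
    qed (use h \<epsilon> \<epsilon>3 in auto)
    then show ?thesis
      unfolding s ok_def E(3) by (rule eventually_mono) (use \<epsilon> in auto)
  qed
  \<comment> \<open>The small value of \<mu> satisfies the bound on mixed embeddings for every r at
    once, and 4 \<epsilon> <= \<mu> pushes the window past its unit interval, so it meets the next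
    one.\<close>
  have B: "\<forall>\<^sub>F n in sequentially. \<forall>x. real s + \<epsilon> \<le> x \<longrightarrow> x \<le> real s + 1 + \<epsilon> \<longrightarrow> ok n x" if s: "s < h - 3" for s
  proof -
    define r where "r = h - 2 - s"
    have r: "2 \<le> r" "r + 2 \<le> h" "r + 2 + s = h" using s by (auto simp: r_def)
    obtain E \<pi> where E: "\<And>e. e \<in> E \<Longrightarrow> e \<subseteq> {..<h} \<and> card e = 2"
      "\<And>i. 1 \<le> i \<Longrightarrow> i < r + 2 \<Longrightarrow> \<pi> i < i \<and> \<pi> i < r \<and> {i, \<pi> i} \<in> E"
      "\<And>n S. emb_count h E n S = card (hom_set H n S)"
      using labelled_pattern[OF H h(1), of r] r by auto
    interpret pattern p h E
      using E(1) E(2)[of 1] h by unfold_locales auto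
    define \<mu> where "\<mu> = 1 / (2 * real h)"
    have \<mu>: "4 * \<epsilon> \<le> \<mu>" "\<mu> * real (r - 1) \<le> 1 / 2"
    proof -
      show "4 * \<epsilon> \<le> \<mu>" using \<epsilon> h by (simp add: \<mu>_def pos_le_divide_eq mult_ac)
      have "real (r - 1) \<le> real h" using r by simp
      then show "\<mu> * real (r - 1) \<le> 1 / 2" using h by (simp add: \<mu>_def pos_divide_le_eq)
    qed
    have s': "real (h - (r + 2)) = real s" using r by simp
    have "\<forall>\<^sub>F n in sequentially. \<forall>x. real (h - (r + 2)) + real 2 * (\<epsilon> / 2) \<le> x \<longrightarrow> 2 * (\<epsilon> / 2) + 2 * x \<le> \<mu> + real 2 + 2 * real (h - (r + 2)) \<longrightarrow>
      \<mu> * real (r - 1) + \<epsilon> / 2 + x \<le> 2 + real (h - (r + 2)) \<longrightarrow>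
      norm (bexp (all_edges n) (\<lambda>S. cis (real n powr (- x) * real (emb_count h E n S)))) \<le> real n powr (- K)"
      by (rule gadget_window) (use E(2) r \<epsilon> \<epsilon>3 \<mu> in auto)
    then show ?thesis
      unfolding s' ok_def E(3)
    proof (rule eventually_mono, intro allI impI)
      fix n x
      assume "\<forall>x. real s + real 2 * (\<epsilon> / 2) \<le> x \<longrightarrow> 2 * (\<epsilon> / 2) + 2 * x \<le> \<mu> + real 2 + 2 * real s \<longrightarrow>
        \<mu> * real (r - 1) + \<epsilon> / 2 + x \<le> 2 + real s \<longrightarrow>
        norm (bexp (all_edges n) (\<lambda>S. cis (real n powr (- x) * real (card (hom_set H n S))))) \<le> real n powr (- K)"
        and "real s + \<epsilon> \<le> x" "x \<le> real s + 1 + \<epsilon>"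
      then show "norm (bexp (all_edges n) (\<lambda>S. cis (real n powr (- x) * real (card (hom_set H n S))))) \<le> real n powr (- K)"
        using \<mu> \<epsilon> \<epsilon>3 by (elim allE[of _ x] impE) auto
    qed
  qed
  have "\<forall>\<^sub>F n in sequentially. \<forall>s<h - 3. \<forall>x. real s + \<epsilon> \<le> x \<longrightarrow> x \<le> real s + 1 + \<epsilon> \<longrightarrow> ok n x"
    by (rule eventually_all_below) (rule B)
  with A show ?thesis
    unfolding ok_def[symmetric]
  proof eventually_elim
    case (elim n)
    show ?case
    proof (intro allI impI)
      fix x assume x: "\<epsilon> \<le> x" "x \<le> real h - 2 - \<epsilon>"
      show "ok n x"
      proof (cases "real h - 3 + \<epsilon> / 2 \<le> x")
        case True
        then show ?thesis using elim(1) x by blast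
      next
        case False
        define s where "s = nat \<lfloor>x - \<epsilon>\<rfloor>"
        have s: "real s \<le> x - \<epsilon>" "x - \<epsilon> < real s + 1" using x unfolding s_def by linarith+
        then have "real s < real h - 3" using False \<epsilon> by linarith
        then have "s < h - 3" using h by linarith
        then show ?thesis using elim(2) s by simp
      qed
    qed
  qed
qed

text \<open>Smoothing with N = 2 n^h, a about n^(2+\<epsilon>) and b about n^(h-\<epsilon>): the
  main term (a / b) / n has order n^(1-h+2\<epsilon>), and (a / b)^2 is no larger than
  n^(1-h+4\<epsilon>), up to constants, because h >= 3. The Fourier term is made n^(-h).\<close>

lemma point_probability_upper:
  fixes H :: "'v pair_pre_digraph"
  assumes H: "pair_graph H" "Digraph_Component.connected (with_proj H)" and h: "h = card (pverts H)" "2 \<le> h"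
    and \<eta>: "0 < \<eta>"
  shows "\<forall>\<^sub>F n in sequentially. \<forall>y. bexp (all_edges n) (\<lambda>S. of_bool (card (hom_set H n S) = y)) \<le> real n powr (1 - real h + \<eta>)"
proof -
  obtain E where E: "\<And>e. e \<in> E \<Longrightarrow> e \<subseteq> {..<h} \<and> card e = 2" "E \<noteq> {}"
    "\<And>n S. emb_count h E n S = card (hom_set H n S)"
    using pattern_of_connected[OF H h] by blast
  interpret pattern p h E using E h by unfold_locales auto
  obtain K0 where K0: "0 < K0" and small_ball: "\<And>n y. 6 * h \<le> n \<Longrightarrow>
    bexp (all_edges n) (\<lambda>S. of_bool (y \<le> real (emb_count h E n S) \<and> real (emb_count h E n S) < y + ball_width n)) \<le> K0 / real n"
    using emb_count_small_ball by blast
  show ?thesis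
  proof (cases "h = 2")
    \<comment> \<open>For h = 2 the interval length is bounded below by a positive constant, so the
      interval estimate by itself is the claim.\<close>
    case True
    have "\<forall>\<^sub>F n in sequentially. 6 * h \<le> n \<and> K0 \<le> real n powr \<eta>"
      using \<eta> by (intro eventually_conj eventually_ge_at_top eventually_powr_ge)
    then show ?thesis
    proof (rule eventually_mono, intro allI)
      fix n y assume n: "6 * h \<le> n \<and> K0 \<le> real n powr \<eta>"
      have n0: "0 < real n" using n h by simp
      have bw: "0 < ball_width n" unfolding ball_width_def using p_pos n0 h(2) by simp
      have "bexp (all_edges n) (\<lambda>S. of_bool (card (hom_set H n S) = y))
        \<le> bexp (all_edges n) (\<lambda>S. of_bool (real y \<le> real (emb_count h E n S) \<and> real (emb_count h E n S) < real y + ball_width n) :: real)"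
        using bw by (intro bexp_mono) (auto simp: E(3))
      also have "\<dots> \<le> K0 / real n" by (rule small_ball) (use n in simp)
      also have "\<dots> \<le> real n powr \<eta> / real n" using n n0 by (intro divide_right_mono) auto
      also have "\<dots> = real n powr (1 - real h + \<eta>)" using n0 True by (simp add: powr_diff)
      finally show "bexp (all_edges n) (\<lambda>S. of_bool (card (hom_set H n S) = y)) \<le> real n powr (1 - real h + \<eta>)" .
    qed
  next
    case False
    then have h3: "3 \<le> h" using h by simp
    define \<epsilon> where "\<epsilon> = min (\<eta> / 8) (1 / (8 * real h))"
    have \<epsilon>: "0 < \<epsilon>" "\<epsilon> \<le> \<eta> / 8" "\<epsilon> * (8 * real h) \<le> 1"
    proof -
      show "0 < \<epsilon>" "\<epsilon> \<le> \<eta> / 8" using \<eta> h by (auto simp: \<epsilon>_def)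
      have "\<epsilon> \<le> 1 / (8 * real h)" by (simp add: \<epsilon>_def)
      then show "\<epsilon> * (8 * real h) \<le> 1" using h by (simp add: pos_le_divide_eq)
    qed
    have "\<epsilon> * 24 \<le> \<epsilon> * (8 * real h)" using \<epsilon>(1) h3 by (intro mult_left_mono) auto
    then have \<epsilon>3: "\<epsilon> * 24 \<le> 1" using \<epsilon>(3) by linarith
    define cB where "cB = p ^ card E / (2 * real h) ^ (h - 2) / 2"
    have cB: "0 < cB" using p_pos h by (simp add: cB_def)
    \<comment> \<open>With a / b <= 24 n^(2-h+2\<epsilon>), 432 is 18 * 24 and 1730 is 3 * 24^2 +
      2.\<close>
    define C where "C = 432 * K0 + 1730"
    have "\<forall>\<^sub>F n in sequentially. (\<forall>x. \<epsilon> \<le> x \<longrightarrow> x \<le> real h - 2 - \<epsilon> \<longrightarrow>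
        norm (bexp (all_edges n) (\<lambda>S. cis (real n powr (- x) * real (card (hom_set H n S))))) \<le> real n powr (- real h))
      \<and> 6 * h \<le> n \<and> 1 / cB \<le> real n powr \<epsilon> \<and> 48 \<le> real n powr (1 / 2) \<and> C \<le> real n powr (4 * \<epsilon>)"
      using \<epsilon> by (intro eventually_conj fourier_decay[OF H h(1) h3] eventually_ge_at_top eventually_powr_ge) auto
    then show ?thesis
    proof (rule eventually_mono, intro allI)
      fix n y
      assume n: "(\<forall>x. \<epsilon> \<le> x \<longrightarrow> x \<le> real h - 2 - \<epsilon> \<longrightarrow>
        norm (bexp (all_edges n) (\<lambda>S. cis (real n powr (- x) * real (card (hom_set H n S))))) \<le> real n powr (- real h))
      \<and> 6 * h \<le> n \<and> 1 / cB \<le> real n powr \<epsilon> \<and> 48 \<le> real n powr (1 / 2) \<and> C \<le> real n powr (4 * \<epsilon>)"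
      have n1: "1 < real n" using n h by simp
      define P where "P a = real n powr a" for a
      have Padd: "P (a + b) = P a * P b" for a b by (simp add: P_def powr_add)
      have Ppos: "0 < P a" for a using n1 by (simp add: P_def)
      have Pmono: "a \<le> b \<Longrightarrow> P a \<le> P b" for a b using n1 by (simp add: P_def powr_mono)
      have P1: "P 1 = real n" using n1 by (simp add: P_def)
      have Pge1: "0 \<le> a \<Longrightarrow> 1 \<le> P a" for a using Pmono[of 0 a] n1 by (simp add: P_def)
      have Ph: "P (real k) = real n ^ k" for k using n1 by (simp add: P_def powr_realpow)
      have P48: "48 \<le> P b" if "1 / 2 \<le> b" for b using n Pmono[OF that] by (simp add: P_def)
      define N where "N = 2 * n ^ h"
      have N: "real N = 2 * P (real h)" by (simp add: N_def Ph)
      \<comment> \<open>With this choice and the next one, the frequencies 2 pi k / N with a < k < b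
        lie between n^(2+\<epsilon>-h) and n^(-\<epsilon>), and N / a is at most
        \<open>ball_width n\<close>.\<close>
      define a where "a = nat \<lceil>2 * P (2 + \<epsilon>)\<rceil>"
      define b where "b = nat \<lfloor>P (real h - \<epsilon>) / 4\<rfloor>"
      have a: "2 * P (2 + \<epsilon>) \<le> real a" "real a \<le> 3 * P (2 + \<epsilon>)"
        using Pge1[of "2 + \<epsilon>"] \<epsilon> unfolding a_def by linarith+
      have b: "P (real h - \<epsilon>) / 8 \<le> real b" "real b \<le> P (real h - \<epsilon>) / 4"
        using P48[of "real h - \<epsilon>"] \<epsilon>3 h3 unfolding b_def by linarith+
      have a0: "0 < real a" using a(1) Ppos[of "2 + \<epsilon>"] by linarith
      have b0: "0 < real b" using b(1) Ppos[of "real h - \<epsilon>"] by linarith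
      have ab: "2 * a \<le> b"
      proof -
        have "48 * P (2 + \<epsilon>) \<le> P (real h - 2 - 2 * \<epsilon>) * P (2 + \<epsilon>)"
          using h3 \<epsilon>3 Ppos[of "2 + \<epsilon>"] by (intro mult_right_mono P48) auto
        also have "\<dots> = P (real h - \<epsilon>)" by (simp add: Padd[symmetric])
        finally have "2 * real a \<le> real b" using a(2) b(1) by linarith
        then show ?thesis by linarith
      qed
      have "real N / real a \<le> 2 * P (real h) / (2 * P (2 + \<epsilon>))"
        unfolding N using a a0 Ppos[of "real h"] Ppos[of "2 + \<epsilon>"] by (intro divide_left_mono) auto
      also have "\<dots> = P (real h - 2) * P (- \<epsilon>)"
        unfolding Padd[symmetric] using n1 by (simp add: P_def powr_diff[symmetric] algebra_simps)
      also have "\<dots> \<le> P (real h - 2) * cB"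
      proof (rule mult_left_mono)
        have "1 \<le> P \<epsilon> * cB" using n cB by (simp add: P_def pos_divide_le_eq)
        then have "P (- \<epsilon>) * 1 \<le> P (- \<epsilon>) * (P \<epsilon> * cB)" using Ppos[of "- \<epsilon>"] by (intro mult_left_mono) auto
        also have "\<dots> = cB * P (- \<epsilon> + \<epsilon>)" by (simp only: Padd mult_ac)
        finally show "P (- \<epsilon>) \<le> cB" using n1 by (simp add: P_def)
      qed (use Ppos[of "real h - 2"] in simp)
      also have "\<dots> = ball_width n"
        using Ph[of "h - 2"] h(2) unfolding ball_width_def by (simp add: cB_def power_divide of_nat_diff)
      finally have Na: "real N / real a \<le> ball_width n" .
      have fourier: "norm (bexp (all_edges n) (\<lambda>S. cis (2 * pi * real k / real N * real (card (hom_set H n S))))) \<le> P (- real h)"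
        if k: "a < k" "k < b" for k
      proof -
        define t where "t = 2 * pi * real k / real N"
        have pi: "1 \<le> pi" "pi \<le> 4" using pi_gt3 pi_less_4 by linarith+
        have k0: "0 < real k" using k by simp
        have t0: "0 < t" using k0 Ppos[of "real h"] by (simp add: t_def N)
        have "P (2 + \<epsilon> - real h) = (2 * P (2 + \<epsilon>)) / real N"
          unfolding N using n1 by (simp add: P_def powr_diff[symmetric])
        also have "\<dots> \<le> real k / real N" using a k by (intro divide_right_mono) auto
        also have "\<dots> \<le> (2 * pi) * (real k / real N)" using pi mult_right_mono[of 1 "2 * pi" "real k / real N"] by simp
        finally have t1: "P (2 + \<epsilon> - real h) \<le> t" by (simp add: t_def)
        have "t \<le> 8 * real k / real N" unfolding t_def using pi by (intro divide_right_mono mult_right_mono) auto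
        also have "\<dots> \<le> 8 * (P (real h - \<epsilon>) / 4) / real N" using b k by (intro divide_right_mono mult_left_mono) auto
        also have "\<dots> = P (- \<epsilon>)" unfolding N using n1 by (simp add: P_def powr_diff powr_minus_divide)
        finally have t2: "t \<le> P (- \<epsilon>)" .
        define x where "x = - log (real n) t"
        have tx: "t = real n powr (- x)" using n1 t0 by (simp add: x_def)
        have "- x \<le> - \<epsilon>" "2 + \<epsilon> - real h \<le> - x"
          using t1 t2 n1 unfolding tx P_def by (simp_all only: powr_le_cancel_iff)
        then show ?thesis using n unfolding t_def[symmetric] tx P_def by simp
      qed
      have le: "card (hom_set H n S) \<le> n ^ h" for S unfolding E(3)[symmetric] by (rule emb_count_le)
      have "bexp (all_edges n) (\<lambda>S. of_bool (card (hom_set H n S) = y)) \<le> P (1 - real h + \<eta>)"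
      proof (cases "y \<le> n ^ h")
        case True
        have "bexp (all_edges n) (\<lambda>S. of_bool (card (hom_set H n S) = y))
          \<le> 18 * (real a / real b) * (K0 / real n) + 3 * (real a / real b)\<^sup>2 + 2 * P (- real h)"
        proof (rule point_probability_smoothing[where M = "n ^ h" and N = N])
          fix z
          have "bexp (all_edges n) (\<lambda>S. of_bool (z \<le> real (card (hom_set H n S)) \<and> real (card (hom_set H n S)) < z + real N / real a) :: real)
            \<le> bexp (all_edges n) (\<lambda>S. of_bool (z \<le> real (emb_count h E n S) \<and> real (emb_count h E n S) < z + ball_width n))"
            using Na by (intro bexp_mono) (auto simp: E(3))
          also have "\<dots> \<le> K0 / real n" by (rule small_ball) (use n in simp)
          finally show "bexp (all_edges n) (\<lambda>S. of_bool (z \<le> real (card (hom_set H n S)) \<and> real (card (hom_set H n S)) < z + real N / real a)) \<le> K0 / real n" .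
        next
          show "1 \<le> a" using a0 by linarith
          show "0 < N" using n1 by (simp add: N_def)
          show "0 \<le> P (- real h)" using Ppos[of "- real h"] by simp
        qed (use le True ab fourier in \<open>auto simp: N_def\<close>)
        also have "\<dots> \<le> 432 * K0 * P (1 - real h + 4 * \<epsilon>) + 1728 * P (1 - real h + 4 * \<epsilon>) + 2 * P (1 - real h + 4 * \<epsilon>)"
        proof -
          have "real a / real b \<le> 3 * P (2 + \<epsilon>) / (P (real h - \<epsilon>) / 8)"
            using a b a0 Ppos[of "real h - \<epsilon>"] by (intro frac_le) auto
          also have "\<dots> = 24 * (P (2 + \<epsilon>) / P (real h - \<epsilon>))" by simp
          also have "P (2 + \<epsilon>) / P (real h - \<epsilon>) = P (2 - real h + 2 * \<epsilon>)"
            unfolding P_def powr_diff[symmetric] by (rule arg_cong[where f = "(powr) (real n)"]) simp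
          finally have ab': "real a / real b \<le> 24 * P (2 - real h + 2 * \<epsilon>)" .
          have "18 * (real a / real b) * (K0 / real n) \<le> 18 * (24 * P (2 - real h + 2 * \<epsilon>)) * (K0 / real n)"
            using ab' K0 by (intro mult_right_mono mult_left_mono) auto
          also have "\<dots> = 432 * K0 * (P (2 - real h + 2 * \<epsilon>) / P 1)" by (simp add: P1)
          also have "P (2 - real h + 2 * \<epsilon>) / P 1 = P (1 - real h + 2 * \<epsilon>)"
            unfolding P_def powr_diff[symmetric] by (rule arg_cong[where f = "(powr) (real n)"]) simp
          also have "432 * K0 * P (1 - real h + 2 * \<epsilon>) \<le> 432 * K0 * P (1 - real h + 4 * \<epsilon>)"
            using K0 \<epsilon> by (intro mult_left_mono Pmono) auto
          finally have 1: "18 * (real a / real b) * (K0 / real n) \<le> 432 * K0 * P (1 - real h + 4 * \<epsilon>)" .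
          have "(real a / real b)\<^sup>2 \<le> (24 * P (2 - real h + 2 * \<epsilon>))\<^sup>2" using ab' by (intro power_mono) auto
          also have "\<dots> = 576 * P (2 - real h + 2 * \<epsilon> + (2 - real h + 2 * \<epsilon>))"
            unfolding Padd by (simp add: power2_eq_square)
          also have "\<dots> \<le> 576 * P (1 - real h + 4 * \<epsilon>)" using h3 by (intro mult_left_mono Pmono) auto
          finally have 2: "3 * (real a / real b)\<^sup>2 \<le> 1728 * P (1 - real h + 4 * \<epsilon>)" by simp
          have "P (- real h) \<le> P (1 - real h + 4 * \<epsilon>)" using \<epsilon> by (intro Pmono) simp
          then show ?thesis using 1 2 by linarith
        qed
        also have "\<dots> = C * P (1 - real h + 4 * \<epsilon>)" by (simp add: C_def algebra_simps)
        also have "\<dots> \<le> P (4 * \<epsilon>) * P (1 - real h + 4 * \<epsilon>)"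
          using n Ppos[of "1 - real h + 4 * \<epsilon>"] by (intro mult_right_mono) (auto simp: P_def)
        also have "\<dots> \<le> P (1 - real h + \<eta>)" unfolding Padd[symmetric] using \<epsilon>(2) by (intro Pmono) simp
        finally show ?thesis .
      next
        case False
        then have "card (hom_set H n S) \<noteq> y" for S using le[of S] by auto
        then show ?thesis using Ppos[of "1 - real h + \<eta>"] by simp
      qed
      then show "bexp (all_edges n) (\<lambda>S. of_bool (card (hom_set H n S) = y)) \<le> real n powr (1 - real h + \<eta>)"
        by (simp only: P_def)
    qed
  qed
qed

section \<open>Bounds for the maximum and its exponent\<close>

definition max_prob :: "'v pair_pre_digraph \<Rightarrow> nat \<Rightarrow> real" where
  "max_prob H n = Max (range (\<lambda>x :: int. measure_pmf.prob (binomial_random_graph n p) {G. int (subgraph_count H G) = x}))"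

lemma prob_le_max_prob: "measure_pmf.prob (binomial_random_graph n p) {G. int (subgraph_count H G) = x} \<le> max_prob H n"
  unfolding max_prob_def by (rule Max_ge[OF finite_range_point_probs]) blast

lemma max_prob_leI:
  "(\<And>x. measure_pmf.prob (binomial_random_graph n p) {G. int (subgraph_count H G) = x} \<le> B) \<Longrightarrow> max_prob H n \<le> B"
  unfolding max_prob_def by (rule Max.boundedI[OF finite_range_point_probs]) auto

text \<open>Serves the degenerate cases of a single-vertex H and of a host with one vertex, where
  the count is deterministic.\<close>

lemma max_prob_eq_1:
  assumes "\<And>S. S \<subseteq> all_edges n \<Longrightarrow> subgraph_count H (host n S) = c"
  shows "max_prob H n = 1"
proof (rule antisym)
  show "max_prob H n \<le> 1" by (rule max_prob_leI) simp
  have "bexp (all_edges n) (\<lambda>S. of_bool (int (subgraph_count H (host n S)) = int c) :: real) = bexp (all_edges n) (\<lambda>S. 1)"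
    by (rule bexp_cong) (simp add: assms)
  then have "measure_pmf.prob (binomial_random_graph n p) {G. int (subgraph_count H G) = int c} = 1"
    by (simp add: prob_eq_bexp)
  then show "1 \<le> max_prob H n" using prob_le_max_prob[of n H "int c"] by simp
qed

lemma max_prob_upper:
  fixes H :: "'v pair_pre_digraph"
  assumes H: "pair_graph H" "Digraph_Component.connected (with_proj H)" and h: "h = card (pverts H)" "2 \<le> h"
    and \<eta>: "0 < \<eta>"
  shows "\<forall>\<^sub>F n in sequentially. max_prob H n \<le> real n powr (1 - real h + \<eta>)"
  using point_probability_upper[OF assms]
proof eventually_elim
  case (elim n)
  show ?case
  proof (rule max_prob_leI)
    fix x
    have "measure_pmf.prob (binomial_random_graph n p) {G. int (subgraph_count H G) = x}
      = bexp (all_edges n) (\<lambda>S. of_bool (int (subgraph_count H (host n S)) = x) :: real)" by (rule prob_eq_bexp)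
    also have "\<dots> \<le> bexp (all_edges n) (\<lambda>S. of_bool (card (hom_set H n S) = card (aut_set H) * nat x))"
      by (intro bexp_mono) (auto simp: card_hom_set[OF H(1)])
    also have "\<dots> \<le> real n powr (1 - real h + \<eta>)" using elim by blast
    finally show "measure_pmf.prob (binomial_random_graph n p) {G. int (subgraph_count H G) = x} \<le> real n powr (1 - real h + \<eta>)" .
  qed
qed

text \<open>By Chebyshev's inequality O(n^(h-1)) integers carry probability at least 3/4. The
  explicit constant holds for every n >= 1, as positivity of the maximum is required for all
  n.\<close>

lemma max_prob_lower:
  fixes H :: "'v pair_pre_digraph"
  assumes H: "pair_graph H" "Digraph_Component.connected (with_proj H)" and h: "h = card (pverts H)" "2 \<le> h"
    and n: "1 \<le> n"
  shows "3 / (40 * real h ^ h) * real n powr (1 - real h) \<le> max_prob H n"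
proof -
  obtain E where E: "\<And>e. e \<in> E \<Longrightarrow> e \<subseteq> {..<h} \<and> card e = 2" "E \<noteq> {}"
    "\<And>n S. emb_count h E n S = card (hom_set H n S)"
    using pattern_of_connected[OF H h] by blast
  interpret pattern p h E using E h by unfold_locales auto
  define c where "c = real (card (aut_set H))"
  have c: "1 \<le> c" using card_aut_set_pos[OF H(1)] by (simp add: c_def)
  define X where "X S = real (subgraph_count H (host n S))" for S
  define M where "M = (\<Sum>\<psi>\<in>embs h n. p ^ card (image_edges E \<psi>))"
  \<comment> \<open>Twice the bound for the standard deviation, which gives the failure probability
    1/4.\<close>
  define l where "l = 2 * (real h ^ h * real n ^ (h - 1))"
  have l1: "1 \<le> l"
  proof -
    have "1 * 1 \<le> real h ^ h * real n ^ (h - 1)" using n h by (intro mult_mono one_le_power) auto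
    then show ?thesis by (simp add: l_def)
  qed
  have YX: "real (emb_count h E n S) = c * X S" if "S \<subseteq> all_edges n" for S
    using card_hom_set[OF H(1) that] by (simp add: E(3) c_def X_def)
  have var: "bexp (all_edges n) (\<lambda>S. (c * X S - M)\<^sup>2) \<le> l\<^sup>2 / 4"
  proof -
    have "bexp (all_edges n) (\<lambda>S. (c * X S - M)\<^sup>2) = bexp (all_edges n) (\<lambda>S. (real (emb_count h E n S) - M)\<^sup>2)"
      by (rule bexp_cong) (simp add: YX)
    also have "\<dots> \<le> real h ^ (2 * h) * real n ^ (2 * h - 2)" unfolding M_def by (rule emb_count_variance) (use n in simp)
    also have "\<dots> = (real h ^ h * real n ^ (h - 1))\<^sup>2"
      by (simp add: power_mult_distrib power_mult[symmetric] mult.commute diff_mult_distrib2)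
    also have "\<dots> = l\<^sup>2 / 4" by (simp add: l_def power_mult_distrib)
    finally show ?thesis .
  qed
  have far: "bexp (all_edges n) (\<lambda>S. of_bool (l\<^sup>2 \<le> (c * X S - M)\<^sup>2) :: real) \<le> 1 / 4"
  proof -
    have "bexp (all_edges n) (\<lambda>S. of_bool (l\<^sup>2 \<le> (c * X S - M)\<^sup>2) :: real) \<le> bexp (all_edges n) (\<lambda>S. (c * X S - M)\<^sup>2) / l\<^sup>2"
      using l1 by (intro bexp_markov) auto
    also have "\<dots> \<le> (l\<^sup>2 / 4) / l\<^sup>2" using var by (rule divide_right_mono) simp
    also have "\<dots> = 1 / 4" using l1 by simp
    finally show ?thesis .
  qed
  define J where "J = {\<lfloor>(M - l) / c\<rfloor>..\<lceil>(M + l) / c\<rceil>}"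
  have "1 - of_bool (l\<^sup>2 \<le> (c * X S - M)\<^sup>2) \<le> (\<Sum>x\<in>J. of_bool (int (subgraph_count H (host n S)) = x) :: real)" for S
  proof (cases "l\<^sup>2 \<le> (c * X S - M)\<^sup>2")
    case True
    then show ?thesis by (simp add: sum_nonneg)
  next
    case False
    then have "\<not> \<bar>l\<bar> \<le> \<bar>c * X S - M\<bar>" unfolding abs_le_square_iff .
    then have "\<bar>c * X S - M\<bar> < l" using l1 by linarith
    then have "(M - l) / c \<le> X S" "X S \<le> (M + l) / c" using c by (auto simp: pos_divide_le_eq pos_le_divide_eq mult.commute abs_less_iff)
    then have "\<lfloor>(M - l) / c\<rfloor> \<le> int (subgraph_count H (host n S))" "int (subgraph_count H (host n S)) \<le> \<lceil>(M + l) / c\<rceil>"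
      unfolding X_def by linarith+
    then have "int (subgraph_count H (host n S)) \<in> J" by (simp add: J_def)
    then show ?thesis using False by (simp add: J_def of_bool_def)
  qed
  then have "bexp (all_edges n) (\<lambda>S. 1 - of_bool (l\<^sup>2 \<le> (c * X S - M)\<^sup>2))
    \<le> bexp (all_edges n) (\<lambda>S. \<Sum>x\<in>J. of_bool (int (subgraph_count H (host n S)) = x) :: real)" by (rule bexp_mono)
  also have "\<dots> = (\<Sum>x\<in>J. measure_pmf.prob (binomial_random_graph n p) {G. int (subgraph_count H G) = x})"
    by (simp only: bexp_sum prob_eq_bexp)
  also have "\<dots> \<le> (\<Sum>x\<in>J. max_prob H n)" by (intro sum_mono prob_le_max_prob)
  also have "\<dots> = real (card J) * max_prob H n" by simp
  finally have "3 / 4 \<le> real (card J) * max_prob H n" using far by (simp add: bexp_diff)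
  also have "\<dots> \<le> 5 * l * max_prob H n"
  proof (rule mult_right_mono)
    \<comment> \<open>The interval has length at most 2 l, and rounding outward adds at most 3
      integers, hence 5 l because l >= 1.\<close>
    have "(M + l) / c - (M - l) / c = 2 * l / c" by (simp add: diff_divide_distrib[symmetric])
    also have "\<dots> \<le> 2 * l" using c l1 by (simp add: pos_divide_le_eq mult_left_le mult_le_cancel_left1)
    finally have "(M + l) / c - (M - l) / c \<le> 2 * l" .
    moreover have "real (card J) \<le> max 0 (real_of_int (\<lceil>(M + l) / c\<rceil> - \<lfloor>(M - l) / c\<rfloor> + 1))"
      unfolding J_def by simp
    ultimately show "real (card J) \<le> 5 * l" using l1 by linarith
    show "0 \<le> max_prob H n" by (rule order_trans[OF measure_nonneg prob_le_max_prob])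
  qed
  finally have "3 / 4 \<le> 5 * l * max_prob H n" .
  then have 1: "3 / (20 * l) \<le> max_prob H n" using l1 by (simp add: pos_divide_le_eq mult_ac)
  have "real n powr (1 - real h) = 1 / real n ^ (h - 1)"
  proof -
    have "real n powr (1 - real h) = real n powr (- real (h - 1))" using h by (simp add: of_nat_diff)
    then show ?thesis using n by (simp add: powr_minus_divide powr_realpow)
  qed
  then have "3 / (40 * real h ^ h) * real n powr (1 - real h) = 3 / (20 * l)" by (simp add: l_def)
  then show ?thesis using 1 by simp
qed

end

text \<open>The error exponent is read off as log_n (M n) - a; the lower bound makes M positive. At
  n = 1 powers carry no information, so the value there is an assumption of its own.\<close>

lemma powr_exponent_limit:
  fixes M :: "nat \<Rightarrow> real"
  assumes one: "M 1 = 1" and c: "0 < c" "\<And>n. 1 \<le> n \<Longrightarrow> c * real n powr a \<le> M n"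
    and upper: "\<And>\<eta>. 0 < \<eta> \<Longrightarrow> \<forall>\<^sub>F n in sequentially. M n \<le> real n powr (a + \<eta>)"
  shows "\<exists>\<epsilon>. \<epsilon> \<longlonglongrightarrow> 0 \<and> (\<forall>n\<ge>1. M n = real n powr (a + \<epsilon> n))"
proof -
  define \<epsilon> where "\<epsilon> n = log (real n) (M n) - a" for n
  have pos: "0 < M n" if "1 \<le> n" for n
  proof -
    have "0 < c * real n powr a" using c(1) that by simp
    then show ?thesis using c(2)[OF that] by linarith
  qed
  have "M n = real n powr (a + \<epsilon> n)" if "1 \<le> n" for n
  proof (cases "n = 1")
    case True
    then show ?thesis using one by simp
  next
    case False
    then show ?thesis using that pos[OF that] by (simp add: \<epsilon>_def)
  qed
  moreover have "\<epsilon> \<longlonglongrightarrow> 0"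
  proof (rule LIMSEQ_I)
    fix r :: real assume r: "0 < r"
    have "\<forall>\<^sub>F n in sequentially. M n \<le> real n powr (a + r / 2) \<and> 1 / c \<le> real n powr (r / 2) \<and> 2 \<le> n"
      using r by (intro eventually_conj upper eventually_powr_ge eventually_ge_at_top) auto
    then have "\<forall>\<^sub>F n in sequentially. norm (\<epsilon> n - 0) < r"
    proof eventually_elim
      case (elim n)
      have n: "1 < real n" using elim by simp
      have M: "0 < M n" using elim by (intro pos) simp
      have "log (real n) (M n) \<le> log (real n) (real n powr (a + r / 2))"
        using elim M n by (intro iffD2[OF log_le_cancel_iff]) auto
      then have 1: "\<epsilon> n \<le> r / 2" using n by (simp add: \<epsilon>_def)
      have "1 \<le> c * real n powr (r / 2)" using elim c by (simp add: pos_divide_le_eq mult.commute)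
      then have "real n powr (a - r / 2) * 1 \<le> real n powr (a - r / 2) * (c * real n powr (r / 2))"
        by (rule mult_left_mono) simp
      also have "\<dots> = c * (real n powr (a - r / 2) * real n powr (r / 2))" by (simp only: mult_ac)
      also have "\<dots> = c * real n powr a" by (simp add: powr_add[symmetric])
      also have "\<dots> \<le> M n" using elim by (intro c(2)) simp
      finally have "log (real n) (real n powr (a - r / 2)) \<le> log (real n) (M n)"
        using n M by (intro iffD2[OF log_le_cancel_iff]) auto
      then have "- (r / 2) \<le> \<epsilon> n" using n by (simp add: \<epsilon>_def)
      then show ?case using 1 r by simp
    qed
    then show "\<exists>no. \<forall>n\<ge>no. norm (\<epsilon> n - 0) < r" by (simp add: eventually_sequentially)
  qed
  ultimately show ?thesis by blast
qed

theorem theorem1p2: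
  fixes p :: real and H :: "'a pair_pre_digraph"
  assumes "0 < p" and "p < 1"
    and "pair_graph H" and "Digraph_Component.connected (with_proj H)"
  shows "\<exists>\<epsilon> :: nat \<Rightarrow> real. \<epsilon> \<longlonglongrightarrow> 0 \<and>
    (\<forall>n\<ge>1. Max (range (\<lambda>x :: int.
        measure_pmf.prob (binomial_random_graph n p) {G. int (subgraph_count H G) = x}))
      = real n powr (1 - real (card (pverts H)) + \<epsilon> n))"
proof -
  interpret bernoulli p using assms by unfold_locales
  interpret pair_graph H by fact
  let ?h = "card (pverts H)"
  have "pverts H \<noteq> {}" using assms(4) by (auto simp: Digraph_Component.connected_def strongly_connected_def mk_symmetric_def)
  then have h1: "1 \<le> ?h" using pair_finite_verts by (simp add: Suc_le_eq card_gt_0_iff)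
  show ?thesis
  proof (cases "?h = 1")
    \<comment> \<open>H is a single vertex: without edges the count depends on n only, and the error
      exponent is 0.\<close>
    case True
    then obtain v where v: "pverts H = {v}" by (auto simp: card_1_singleton_iff)
    have no: "parcs H = {}"
    proof (rule ccontr)
      assume "parcs H \<noteq> {}"
      then obtain a b where ab: "(a, b) \<in> parcs H" by auto
      then show False using in_arcsD1[OF ab] in_arcsD2[OF ab] pair_no_loops[OF ab] v by simp
    qed
    have "max_prob H n = 1" for n
    proof (rule max_prob_eq_1)
      fix S assume "S \<subseteq> all_edges n"
      then have "card (aut_set H) * subgraph_count H (host n S) = card (aut_set H) * subgraph_count H (host n {})"
        by (simp add: card_hom_set[OF assms(3), symmetric]) (simp add: hom_set_def no)
      then show "subgraph_count H (host n S) = subgraph_count H (host n {})"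
        using card_aut_set_pos[OF assms(3)] by simp
    qed
    then show ?thesis using True by (intro exI[of _ "\<lambda>_. 0"]) (simp add: max_prob_def)
  next
    case False
    then have h2: "2 \<le> ?h" using h1 by simp
    show ?thesis
      unfolding max_prob_def[symmetric]
    proof (rule powr_exponent_limit)
      \<comment> \<open>For n = 1 there is only one graph, which gives the value 1 demanded by
        \<open>powr_exponent_limit\<close>.\<close>
      have "all_edges (Suc 0) = {}"
      proof -
        have "card e \<noteq> 2" if "e \<subseteq> {..<Suc 0}" for e using card_mono[OF _ that] by auto
        then show ?thesis by (auto simp: all_edges_def)
      qed
      then show "max_prob H 1 = 1" by (intro max_prob_eq_1[where c = "subgraph_count H (host 1 {})"]) auto
      show "0 < 3 / (40 * real ?h ^ ?h)" using h2 by simp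
    qed (use max_prob_lower[OF assms(3,4) refl h2] max_prob_upper[OF assms(3,4) refl h2] in auto)
  qed
qed

end
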